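(* Under the hypotheses of the setup (types $A$–$D$ with arbitrary simple system, or distinguished $F(3|1)$, $G(3)$; arbitrary total order on $I$), let $\mathbf i,\mathbf j\in\mathsf L^+$ with $\mathbf i<\mathbf j$. Then $$\mathrm E_{\mathbf j}\star\mathrm E_{\mathbf i}=\sum_{\mathbf k\in\mathsf W^+,\ \mathbf i\mathbf j\le\mathbf k\le\mathbf j\mathbf i}c^{\mathbf k}_{\mathbf i,\mathbf j}\,\mathrm E_{\mathbf k}\qquad(c^{\mathbf k}_{\mathbf i,\mathbf j}\in\mathbb Q(q)).$$
   Context: Let $\mathfrak g$ be a basic Lie superalgebra of type $A(m,n)$, $B(m,n+1)$, $C(n+1)$ or $D(m,n+1)$ with an arbitrary simple system, or of type $F(3|1)$ (distinguished simple system: nodes $1,2,3$ even, $4$ isotropic odd, bonds $1$–$2$ single, $2$–$3$ double, $3$–$4$ single) or $G(3)$ (distinguished: $1$ isotropic odd, $2,3$ even, $1$–$2$ single, $2$–$3$ triple), with simple system $\Pi=\{\alpha_i\mid i\in I\}$, parity $p(i)$, $Q^+=\bigoplus\mathbb Z_{\ge0}\alpha_i$, parity $p(\sum c_i\alpha_i)=\sum c_ip(i)\bmod2$, $(\cdot,\cdot)$ the symmetric form with $(\alpha_i,\alpha_j)=d_ia_{ij}$. $\Phi^+$: positive roots of the reduced root system; an odd root $\beta$ is isotropic if $(\beta,\beta)=0$. $\pi:=-1$, $q$ an indeterminate; $U_q$ the positive half of the quantum supergroup. $\mathsf F$: free $\mathbb Q(q)$-algebra on $I$ with basis the words, weight $|\mathbf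 i|=\sum\alpha_{i_s}$, parity $\sum p(i_s)$. $\diamond_v$: $x\diamond_v\emptyset=\emptyset\diamond_vx=x$, $(xi)\diamond_v(yj)=(x\diamond_v(yj))i+\pi^{(p(x)+p(i))p(j)}v^{-(|x|+\alpha_i,\alpha_j)}((xi)\diamond_vy)j$; $\star:=\diamond_q$, $x\star_{q,q^{-1}}y:=x\diamond_qy-x\diamond_{q^{-1}}y$. $\Psi:U_q\to(\mathsf F,\star)$ injective algebra map with $\Psi(e_i)=i$, $\mathsf U=\Psi(U_q)$. Fix a total order on $I$; lexicographic order on words ($\mathbf i<\mathbf j$ if proper prefix, or smaller at first difference). Dominant: $\max(u)$ for some $u\in\mathsf U$ ($\mathsf W^+$); Lyndon: smaller than all proper right factors; $\mathsf L^+$ dominant Lyndon. Co-standard factorization of Lyndon $\mathbf i$: $\mathbf i=\mathbf i_1\mathbf i_2$ with $\mathbf i_1$ Lyndon of maximal length. Canonical factorization $\mathbf i=\mathbf i_1^{n_1}\cdots\mathbf i_d^{n_d}$, $\mathbf i_1>\cdots>\mathbf i_d$ Lyndon. Lyndon vectors: $r_i=i$, $r_{\mathbf i}=r_{\mathbf i_1}\star_{q,q^{-1}}r_{\mathbf i_2}$ ($\mathbf i\in\mathsf L^+$). Bar: $\mathbb Q$-linear, $\bar q=\pi q^{-1}$ in type $B(0,n+1)$ and $q^{-1}$ otherwise, $\overline{(i_1,\dots,i_d)}=\pi^{\sum_{s<t}p(i_s)p(i_t)}q^{-\sum_{s<t}(\alpha_{i_s},\alpha_{i_t})}(i_d,\dots,i_1)$;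 $\tau$ = word reversal; $\sigma(x)=\overline{\tau(x)}$. $q_i=q^{d_i}$; $[n]_i=\frac{q_i^n-q_i^{-n}}{q_i-q_i^{-1}}$ ($i$ even or isotropic), $[n]_i=\frac{\pi^nq_i^n-q_i^{-n}}{\pi q_i-q_i^{-1}}$ ($i$ odd non-isotropic), $\{n\}_i=\frac{\pi^nq_i^n-q_i^{-n}}{\pi q_i-q_i^{-1}}$; for $\beta\in\Phi^+$ with $(\beta,\beta)=(\alpha_i,\alpha_i)$: $[n]_\beta=[n]_i$ if $\beta$ even or isotropic odd, $\{n\}_i$ if odd non-isotropic; $[n]_\beta!=\prod_{k\le n}[k]_\beta$. $\kappa_i=1$ for letters; for $\mathbf i=\mathbf i_1\mathbf i_2$ co-standard, $\beta_k=|\mathbf i_k|$, $\kappa_{\mathbf i}=[p_{\mathbf i}+1]_{\beta_r}\kappa_{\mathbf i_1}\kappa_{\mathbf i_2}$ with $p_{\mathbf i}=\max\{p\ge0\mid\beta_1-p\beta_2\in\Phi^+\}$ and $\beta_r$ the one of $\beta_1,\beta_2$ with smaller $(\beta,\beta)$. $\mathrm E_{\mathbf i}=\kappa_{\mathbf i}^{-1}\sigma(r_{\mathbf i})$ ($\mathbf i\in\mathsf L^+$); $\mathrm E^{(n)}_{\mathbf j}=\mathrm E_{\mathbf j}^{\star n}/[n]_{|\mathbf j|}!$; for $\mathbf i\in\mathsf W^+$ with canonical factorization $\mathbf i_1^{n_1}\cdots\mathbf i_d^{n_d}$, $\mathrm E_{\mathbf i}=\mathrm E_{\mathbf i_d}^{(n_d)}\star\cdots\star\mathrm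 E_{\mathbf i_1}^{(n_1)}$. These $\mathrm E_{\mathbf i}$, $\mathbf i\in\mathsf W^+$, form a basis of $\mathsf U$. *)

theory Defs
  imports "HOL-Computational_Algebra.Computational_Algebra" "HOL-Computational_Algebra.Field_as_Ring"
begin

type_synonym K = "rat poly fract"
type_synonym word = "nat list"           (* letters are natural numbers; I = {0..<N} *)
type_synonym elt = "word \<Rightarrow> K"          (* element of F = finitely supported coefficient function *)
type_synonym vec = "nat \<Rightarrow> rat"          (* ambient (epsilon/delta) coordinates *)
type_synonym wgt = "nat \<Rightarrow> int"          (* element of the root lattice Q, coefficients w.r.t. simple roots *)

definition qq :: K where "qq = to_fract [:0, 1:]"

record datum =
  nn    :: nat                       (* number of simple roots, I = {0..<nn} *)
  amb   :: "vec \<Rightarrow> vec \<Rightarrow> rat"    (* ambient symmetric bilinear form *)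
  sr    :: "nat \<Rightarrow> vec"             (* simple roots alpha_i in ambient coordinates *)
  par   :: "nat \<Rightarrow> bool"            (* parity p(i): True = odd *)
  roots :: "vec set"                 (* all roots of the reduced root system, both signs *)
  bflag :: bool                      (* True iff type B(0,n+1) *)

definition ev :: "nat \<Rightarrow> vec" where "ev a = (\<lambda>c. if c = a then 1 else 0)"
definition vadd :: "vec \<Rightarrow> vec \<Rightarrow> vec" where "vadd x y = (\<lambda>c. x c + y c)"
definition vsub :: "vec \<Rightarrow> vec \<Rightarrow> vec" where "vsub x y = (\<lambda>c. x c - y c)"
definition vsc :: "rat \<Rightarrow> vec \<Rightarrow> vec" where "vsc r x = (\<lambda>c. r * x c)"

definition gform :: "nat \<Rightarrow> (nat \<Rightarrow> nat \<Rightarrow> rat) \<Rightarrow> vec \<Rightarrow> vec \<Rightarrow> rat" where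
  "gform M G x y = (\<Sum>a<M. \<Sum>b<M. G a b * x a * y b)"

definition sgns :: "rat set" where "sgns = {1, -1}"

(* A(m,n) = sl(m+1|n+1): eps_0..eps_m (coords 0..m), delta_0..delta_n (coords m+1..m+n+1);
   simple systems = { x_k - x_{k+1} } for x a permutation of the eps/delta basis *)
definition typeA :: "nat \<Rightarrow> nat \<Rightarrow> datum \<Rightarrow> bool" where
  "typeA m n D \<longleftrightarrow> (let M = m + n + 2 in
     \<exists>\<sigma>. bij_betw \<sigma> {..<M} {..<M} \<and>
       D = \<lparr> nn = M - 1,
             amb = gform M (\<lambda>a b. if a = b then (if a \<le> m then 1 else -1) else 0),
             sr = (\<lambda>k. vsub (ev (\<sigma> k)) (ev (\<sigma> (Suc k)))),
             par = (\<lambda>k. (m < \<sigma> k) \<noteq> (m < \<sigma> (Suc k))),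
             roots = {vsub (ev a) (ev b) | a b. a < M \<and> b < M \<and> a \<noteq> b},
             bflag = False \<rparr>)"

(* B(m,k) with k = n+1 >= 1 delta's, i.e. osp(2m+1|2k): eps_0..eps_{m-1} (coords < m),
   delta's (coords m..m+k-1).  Form scaled by 2.  Simple systems: x a signed permutation,
   simple roots x_j - x_{j+1} (j < M-1) and x_{M-1}.  Reduced root system: 2 delta excluded. *)
definition typeB :: "nat \<Rightarrow> nat \<Rightarrow> datum \<Rightarrow> bool" where
  "typeB m k D \<longleftrightarrow> (let M = m + k; isD = (\<lambda>c. m \<le> c) in
     \<exists>\<sigma> sg. bij_betw \<sigma> {..<M} {..<M} \<and> (\<forall>j<M. sg j \<in> sgns) \<and>
       (let x = (\<lambda>j. vsc (sg j) (ev (\<sigma> j))) in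
       D = \<lparr> nn = M,
             amb = gform M (\<lambda>a b. if a = b then (if a < m then 2 else -2) else 0),
             sr = (\<lambda>j. if Suc j < M then vsub (x j) (x (Suc j)) else x j),
             par = (\<lambda>j. if Suc j < M then isD (\<sigma> j) \<noteq> isD (\<sigma> (Suc j)) else isD (\<sigma> j)),
             roots = {vadd (vsc s1 (ev a)) (vsc s2 (ev b)) | a b s1 s2.
                        a < M \<and> b < M \<and> a \<noteq> b \<and> s1 \<in> sgns \<and> s2 \<in> sgns}
                     \<union> {vsc s (ev a) | a s. a < M \<and> s \<in> sgns},
             bflag = (m = 0) \<rparr>))"

(* osp(2m|2k), m >= 1, k >= 1: C(n+1) is m = 1, k = n; D(m,n+1) is m >= 2, k = n+1.
   Simple roots x_j - x_{j+1} (j < M-1) and, at the end, 2 x_{M-1} if x_{M-1} is a delta,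
   x_{M-2} + x_{M-1} if x_{M-1} is an eps. *)
definition typeDC :: "nat \<Rightarrow> nat \<Rightarrow> datum \<Rightarrow> bool" where
  "typeDC m k D \<longleftrightarrow> (let M = m + k; isD = (\<lambda>c. m \<le> c) in
     \<exists>\<sigma> sg. bij_betw \<sigma> {..<M} {..<M} \<and> (\<forall>j<M. sg j \<in> sgns) \<and>
       (let x = (\<lambda>j. vsc (sg j) (ev (\<sigma> j))) in
       D = \<lparr> nn = M,
             amb = gform M (\<lambda>a b. if a = b then (if a < m then 1 else -1) else 0),
             sr = (\<lambda>j. if Suc j < M then vsub (x j) (x (Suc j))
                       else if isD (\<sigma> j) then vsc 2 (x j) else vadd (x (j - 1)) (x j)),
             par = (\<lambda>j. if Suc j < M then isD (\<sigma> j) \<noteq> isD (\<sigma> (Suc j))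
                        else (\<not> isD (\<sigma> j) \<and> isD (\<sigma> (j - 1)))),
             roots = {vadd (vsc s1 (ev a)) (vsc s2 (ev b)) | a b s1 s2.
                        a < M \<and> b < M \<and> a \<noteq> b \<and> s1 \<in> sgns \<and> s2 \<in> sgns}
                     \<union> {vsc (2 * s) (ev a) | a s. m \<le> a \<and> a < M \<and> s \<in> sgns},
             bflag = False \<rparr>))"

(* F(3|1), distinguished: coords eps1,eps2,eps3 (0,1,2), delta (3); (eps,eps)=2, (delta,delta)=-6.
   nodes 1,2,3,4 = indices 0,1,2,3: eps1-eps2, eps2-eps3, eps3, (delta-eps1-eps2-eps3)/2 *)
definition typeF :: datum where
  "typeF = \<lparr> nn = 4,
     amb = gform 4 (\<lambda>a b. if a = b then (if a < 3 then 2 else -6) else 0),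
     sr = (\<lambda>j. if j = 0 then vsub (ev 0) (ev 1) else if j = 1 then vsub (ev 1) (ev 2)
              else if j = 2 then ev 2
              else vsc (1/2) (vsub (vsub (vsub (ev 3) (ev 0)) (ev 1)) (ev 2))),
     par = (\<lambda>j. j = 3),
     roots = {vadd (vsc s1 (ev a)) (vsc s2 (ev b)) | a b s1 s2.
                a < 3 \<and> b < 3 \<and> a \<noteq> b \<and> s1 \<in> sgns \<and> s2 \<in> sgns}
             \<union> {vsc s (ev a) | a s. a < 4 \<and> s \<in> sgns}
             \<union> {vsc (1/2) (vadd (vadd (vsc s0 (ev 0)) (vsc s1 (ev 1))) (vadd (vsc s2 (ev 2)) (vsc s3 (ev 3))))
                 | s0 s1 s2 s3. s0 \<in> sgns \<and> s1 \<in> sgns \<and> s2 \<in> sgns \<and> s3 \<in> sgns},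
     bflag = False \<rparr>"

(* G(3), distinguished: coords eps1 (0), eps2 (1), delta (2), eps3 = -eps1-eps2;
   (eps_i,eps_i)=2, (eps_i,eps_j)=-1, (delta,delta)=-2.
   nodes 1,2,3 = indices 0,1,2: delta+eps3, eps1, eps2-eps1.  Reduced: 2 delta excluded. *)
definition gEps :: "vec set" where
  "gEps = {ev 0, ev 1, vsc (-1) (vadd (ev 0) (ev 1))}"

definition typeG :: datum where
  "typeG = \<lparr> nn = 3,
     amb = gform 3 (\<lambda>a b. if a = 2 \<and> b = 2 then -2 else if a < 2 \<and> b < 2 then (if a = b then 2 else -1) else 0),
     sr = (\<lambda>j. if j = 0 then vadd (ev 2) (vsc (-1) (vadd (ev 0) (ev 1)))
              else if j = 1 then ev 0 else vsub (ev 1) (ev 0)),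
     par = (\<lambda>j. j = 0),
     roots = {vsc s v | s v. s \<in> sgns \<and> v \<in> gEps}
             \<union> {vsub v w | v w. v \<in> gEps \<and> w \<in> gEps \<and> v \<noteq> w}
             \<union> {vsc s (ev 2) | s. s \<in> sgns}
             \<union> {vadd (vsc s1 v) (vsc s2 (ev 2)) | s1 s2 v. s1 \<in> sgns \<and> s2 \<in> sgns \<and> v \<in> gEps},
     bflag = False \<rparr>"

definition basic_datum :: "datum \<Rightarrow> bool" where
  "basic_datum D \<longleftrightarrow>
     (\<exists>m n. typeA m n D)
   \<or> (\<exists>m k. 1 \<le> k \<and> typeB m k D)
   \<or> (\<exists>k. 1 \<le> k \<and> typeDC 1 k D)
   \<or> (\<exists>m k. 2 \<le> m \<and> 1 \<le> k \<and> typeDC m k D)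
   \<or> D = typeF \<or> D = typeG"

(* (alpha_i, alpha_j); integer-valued in all the above data *)
definition Bf :: "datum \<Rightarrow> nat \<Rightarrow> nat \<Rightarrow> int" where
  "Bf D i j = \<lfloor>amb D (sr D i) (sr D j)\<rfloor>"

definition wt :: "word \<Rightarrow> wgt" where "wt w = (\<lambda>i. int (count_list w i))"

definition bfw :: "datum \<Rightarrow> wgt \<Rightarrow> wgt \<Rightarrow> int" where
  "bfw D \<beta> \<gamma> = (\<Sum>i<nn D. \<Sum>j<nn D. \<beta> i * \<gamma> j * Bf D i j)"

definition parw :: "datum \<Rightarrow> word \<Rightarrow> bool" where
  "parw D w \<longleftrightarrow> odd (length (filter (par D) w))"

definition paru :: "datum \<Rightarrow> wgt \<Rightarrow> bool" where
  "paru D \<beta> \<longleftrightarrow> odd (\<Sum>i\<in>{i. i < nn D \<and> par D i}. \<beta> i)"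

definition posroots :: "datum \<Rightarrow> wgt set" where
  "posroots D = {\<beta>. (\<forall>i. 0 \<le> \<beta> i) \<and> (\<forall>i. nn D \<le> i \<longrightarrow> \<beta> i = 0) \<and>
                    (\<lambda>c. \<Sum>i<nn D. of_int (\<beta> i) * sr D i c) \<in> roots D}"

definition basis :: "word \<Rightarrow> elt" where "basis w = (\<lambda>u. if u = w then 1 else 0)"
definition supp :: "elt \<Rightarrow> word set" where "supp x = {u. x u \<noteq> 0}"
definition app_letter :: "nat \<Rightarrow> elt \<Rightarrow> elt" where
  "app_letter i x = (\<lambda>u. if u \<noteq> [] \<and> last u = i then x (butlast u) else 0)"

(* shuffle of basis words, arguments given reversed (last letter first) *)
fun shr :: "datum \<Rightarrow> K \<Rightarrow> word \<Rightarrow> word \<Rightarrow> elt" where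
  "shr D v [] y = basis (rev y)"
| "shr D v x [] = basis (rev x)"
| "shr D v (i # x) (j # y) =
     (\<lambda>u. app_letter i (shr D v x (j # y)) u
         + (-1) ^ (if parw D (i # x) \<and> par D j then 1 else 0)
           * v powi (- bfw D (wt (i # x)) (wt [j]))
           * app_letter j (shr D v (i # x) y) u)"

definition shuffle :: "datum \<Rightarrow> K \<Rightarrow> word \<Rightarrow> word \<Rightarrow> elt" where
  "shuffle D v u w = shr D v (rev u) (rev w)"

definition diamond :: "datum \<Rightarrow> K \<Rightarrow> elt \<Rightarrow> elt \<Rightarrow> elt" where
  "diamond D v x y = (\<lambda>w. \<Sum>u\<in>supp x. \<Sum>u'\<in>supp y. x u * y u' * shuffle D v u u' w)"

definition star :: "datum \<Rightarrow> elt \<Rightarrow> elt \<Rightarrow> elt" where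
  "star D = diamond D qq"

definition starqq :: "datum \<Rightarrow> elt \<Rightarrow> elt \<Rightarrow> elt" where
  "starqq D x y = (\<lambda>w. diamond D qq x y w - diamond D (inverse qq) x y w)"

(* U = Psi(U_q): the Q(q)-subalgebra of (F, star) generated by the letters *)
inductive_set UU :: "datum \<Rightarrow> elt set" for D where
  one:  "basis [] \<in> UU D"
| gen:  "i < nn D \<Longrightarrow> basis [i] \<in> UU D"
| add:  "x \<in> UU D \<Longrightarrow> y \<in> UU D \<Longrightarrow> (\<lambda>w. x w + y w) \<in> UU D"
| smul: "x \<in> UU D \<Longrightarrow> (\<lambda>w. c * x w) \<in> UU D"
| mult: "x \<in> UU D \<Longrightarrow> y \<in> UU D \<Longrightarrow> star D x y \<in> UU D"

(* the total order on I is given by an injective rank function rk on I *)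
definition lexless :: "(nat \<Rightarrow> nat) \<Rightarrow> word \<Rightarrow> word \<Rightarrow> bool" where
  "lexless rk u v \<longleftrightarrow> (\<exists>w. w \<noteq> [] \<and> v = u @ w)
     \<or> (\<exists>p a b s t. u = p @ a # s \<and> v = p @ b # t \<and> rk a < rk b)"

definition lexle :: "(nat \<Rightarrow> nat) \<Rightarrow> word \<Rightarrow> word \<Rightarrow> bool" where
  "lexle rk u v \<longleftrightarrow> u = v \<or> lexless rk u v"

definition is_max :: "(nat \<Rightarrow> nat) \<Rightarrow> elt \<Rightarrow> word \<Rightarrow> bool" where
  "is_max rk x w \<longleftrightarrow> x w \<noteq> 0 \<and> (\<forall>u. x u \<noteq> 0 \<longrightarrow> lexle rk u w)"

definition dominant :: "datum \<Rightarrow> (nat \<Rightarrow> nat) \<Rightarrow> word \<Rightarrow> bool" where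
  "dominant D rk w \<longleftrightarrow> (\<exists>x\<in>UU D. is_max rk x w)"

definition lyndon :: "(nat \<Rightarrow> nat) \<Rightarrow> word \<Rightarrow> bool" where
  "lyndon rk w \<longleftrightarrow> w \<noteq> [] \<and> (\<forall>k. 0 < k \<and> k < length w \<longrightarrow> lexless rk w (drop k w))"

definition Lplus :: "datum \<Rightarrow> (nat \<Rightarrow> nat) \<Rightarrow> word \<Rightarrow> bool" where
  "Lplus D rk w \<longleftrightarrow> dominant D rk w \<and> lyndon rk w"

definition cs_len :: "(nat \<Rightarrow> nat) \<Rightarrow> word \<Rightarrow> nat" where
  "cs_len rk w = (GREATEST k. 0 < k \<and> k < length w \<and> lyndon rk (take k w))"

primrec r_aux :: "datum \<Rightarrow> (nat \<Rightarrow> nat) \<Rightarrow> nat \<Rightarrow> word \<Rightarrow> elt" where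
  "r_aux D rk 0 w = basis w"
| "r_aux D rk (Suc n) w =
     (if length w \<le> 1 then basis w
      else starqq D (r_aux D rk n (take (cs_len rk w) w)) (r_aux D rk n (drop (cs_len rk w) w)))"

definition rvec :: "datum \<Rightarrow> (nat \<Rightarrow> nat) \<Rightarrow> word \<Rightarrow> elt" where
  "rvec D rk w = r_aux D rk (length w) w"

definition barq :: "datum \<Rightarrow> K" where
  "barq D = (if bflag D then - inverse qq else inverse qq)"

definition evalK :: "rat poly \<Rightarrow> K \<Rightarrow> K" where
  "evalK p x = poly (map_poly (\<lambda>c. to_fract [:c:]) p) x"

definition barK :: "datum \<Rightarrow> K \<Rightarrow> K" where
  "barK D f = evalK (fst (quot_of_fract f)) (barq D) / evalK (snd (quot_of_fract f)) (barq D)"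

definition pcount :: "datum \<Rightarrow> word \<Rightarrow> nat" where
  "pcount D u = card {(s, t). s < t \<and> t < length u \<and> par D (u ! s) \<and> par D (u ! t)}"

definition Ssum :: "datum \<Rightarrow> word \<Rightarrow> int" where
  "Ssum D u = (\<Sum>t<length u. \<Sum>s<t. Bf D (u ! s) (u ! t))"

(* bar(x) : Q-linear, q \<mapsto> bar q, (i_1..i_d) \<mapsto> pi^.. q^-.. (i_d..i_1) *)
definition barE :: "datum \<Rightarrow> elt \<Rightarrow> elt" where
  "barE D x = (\<lambda>w. barK D (x (rev w)) * (-1) ^ pcount D (rev w) * qq powi (- Ssum D (rev w)))"

definition tau :: "elt \<Rightarrow> elt" where "tau x = (\<lambda>w. x (rev w))"

definition sigma :: "datum \<Rightarrow> elt \<Rightarrow> elt" where "sigma D x = barE D (tau x)"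

definition qnum :: "datum \<Rightarrow> wgt \<Rightarrow> nat \<Rightarrow> K" where
  "qnum D \<beta> n = (let b = bfw D \<beta> \<beta>; d = (if b = 0 then 1 else b div 2); qd = qq powi d in
     if paru D \<beta> \<and> b \<noteq> 0
     then ((-1) ^ n * qd ^ n - inverse qd ^ n) / (- qd - inverse qd)
     else (qd ^ n - inverse qd ^ n) / (qd - inverse qd))"

definition qfact :: "datum \<Rightarrow> wgt \<Rightarrow> nat \<Rightarrow> K" where
  "qfact D \<beta> n = (\<Prod>k\<in>{1..n}. qnum D \<beta> k)"

primrec kappa_aux :: "datum \<Rightarrow> (nat \<Rightarrow> nat) \<Rightarrow> nat \<Rightarrow> word \<Rightarrow> K" where
  "kappa_aux D rk 0 w = 1"
| "kappa_aux D rk (Suc n) w =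
     (if length w \<le> 1 then 1
      else (let k = cs_len rk w; b1 = wt (take k w); b2 = wt (drop k w);
                p = (GREATEST p::nat. (\<lambda>i. b1 i - int p * b2 i) \<in> posroots D);
                br = (if \<bar>bfw D b2 b2\<bar> \<le> \<bar>bfw D b1 b1\<bar> then b2 else b1)
            in qnum D br (Suc p) * kappa_aux D rk n (take k w) * kappa_aux D rk n (drop k w)))"

definition kappa :: "datum \<Rightarrow> (nat \<Rightarrow> nat) \<Rightarrow> word \<Rightarrow> K" where
  "kappa D rk w = kappa_aux D rk (length w) w"

definition EL :: "datum \<Rightarrow> (nat \<Rightarrow> nat) \<Rightarrow> word \<Rightarrow> elt" where
  "EL D rk w = (\<lambda>u. inverse (kappa D rk w) * sigma D (rvec D rk w) u)"

primrec starpow :: "datum \<Rightarrow> elt \<Rightarrow> nat \<Rightarrow> elt" where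
  "starpow D x 0 = basis []"
| "starpow D x (Suc n) = star D x (starpow D x n)"

definition Edp :: "datum \<Rightarrow> (nat \<Rightarrow> nat) \<Rightarrow> word \<Rightarrow> nat \<Rightarrow> elt" where
  "Edp D rk l n = (\<lambda>u. inverse (qfact D (wt l) n) * starpow D (EL D rk l) n u)"

definition lynfact :: "(nat \<Rightarrow> nat) \<Rightarrow> word \<Rightarrow> word list" where
  "lynfact rk w = (THE ls. concat ls = w \<and> (\<forall>l\<in>set ls. lyndon rk l)
                        \<and> sorted_wrt (\<lambda>a b. lexle rk b a) ls)"

fun rle :: "'a list \<Rightarrow> ('a \<times> nat) list" where
  "rle [] = []"
| "rle (x # xs) = (case rle xs of
                      [] \<Rightarrow> [(x, 1)]
                    | (y, n) # r \<Rightarrow> (if x = y then (y, Suc n) # r else (x, 1) # (y, n) # r))"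

definition EW :: "datum \<Rightarrow> (nat \<Rightarrow> nat) \<Rightarrow> word \<Rightarrow> elt" where
  "EW D rk w = foldr (\<lambda>(l, n) acc. star D (Edp D rk l n) acc) (rev (rle (lynfact rk w))) (basis [])"

end

theory Submission
  imports Defs "HOL-Library.List_Lexorder" "HOL-Library.Function_Algebras" "HOL-Library.Sublist"
begin

text \<open>
  The bar-reversal map \<open>\<sigma>\<close> is a semilinear anti-automorphism of the quantum shuffle algebra and carries the
  products \<open>r\<^sub>1 \<star> \<dots> \<star> r\<^sub>d\<close> of Lyndon vectors along a canonical factorization to nonzero multiples of the
  \<open>E\<^sub>k\<close>. So it suffices to expand \<open>r\<^sub>i \<star> r\<^sub>j\<close> in these products and to bound the words that occur. The
  lower bound \<open>ij\<close> is a leading term argument: \<open>r\<^sub>i\<close> is the product of the letters of \<open>i\<close> plus products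
  belonging to larger words. The upper bound \<open>ji\<close> holds because a shuffle of two words is at most the
  decreasing arrangement of their Lyndon factors, once one knows that the maximal word of \<open>r\<^sub>l\<close> is \<open>l\<close>.

  If the maximal word \<open>m\<close> of \<open>r\<^sub>l\<close> were larger, then all Lyndon factors of \<open>m\<close> would be larger than \<open>l\<close>,
  and \<open>|l|\<close> would be the sum of their weights. This contradicts convexity of the order on dominant Lyndon
  words, which is proved without the classification of Lyndon words: the elements all of whose words have
  Lyndon factors below a bound form a right coideal subalgebra, and a flag of such subalgebras is
  transported by the reflection maps of the Weyl groupoid until the weight in question becomes simple. The
  only input about the root system is a finite set of roots and a family of simple systems in it which is
  closed under (odd and even) reflections.
\<close>

subsection \<open>Lyndon words and shuffles\<close>

text \<open>Sign and power of q are merged into one symmetric bicharacter \<open>X\<close> on a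
  group of weights, and a reflection needs of it only that certain quantum numbers vanish or do not;
  so even, odd non-isotropic and isotropic roots are treated alike. All weights live in one fixed
  group: a reflection replaces the family \<open>x\<close> of simple roots but never changes the
  weight of an element. A weight can therefore become negative, while every weight that still occurs
  in a reflected subalgebra is a nonnegative combination of the new simple roots; the contradiction
  in the convexity argument rests on this. The danger is circularity: expanding in products of
  Lyndon vectors is useful only once their maximal words are known, and these are what one wants to
  find. Two things break the circle. Convexity uses maximal words of arbitrary elements of the
  algebra, never of Lyndon vectors. And the coefficients obtained by stripping a prefix from
  \<open>r l\<close> have shorter words, so that induction on length makes the expansion triangular
  for them. A step of the flag survives a reflection because the reflection map is injective, which
  is the hardest property of that map.\<close>

lemma append_less_iff [simp]: "(a @ u < a @ v) = (u < (v :: 'a::linorder list))"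
  by (induction a) auto

lemma append_le_iff [simp]: "(a @ u \<le> a @ v) = (u \<le> (v :: 'a::linorder list))"
  by (induction a) auto

lemma le_append [simp]: "u \<le> u @ (t :: 'a::linorder list)"
  by (induction u) auto

lemma less_not_prefix_append:
  fixes u :: "'a::linorder list"
  shows "u < v \<Longrightarrow> \<not> prefix u v \<Longrightarrow> u @ x < v @ y"
proof (induction u arbitrary: v)
  case Nil then show ?case by simp
next
  case (Cons a u) then show ?case by (cases v) auto
qed

lemma less_same_length_append:
  fixes u :: "'a::linorder list"
  assumes "u < v" "length v \<le> length u" shows "u @ x < v @ y"
proof (rule less_not_prefix_append[OF assms(1)])
  show "\<not> prefix u v"
  proof
    assume "prefix u v"
    with assms(2) have "u = v" by (metis prefix_length_le prefix_order.order_eq_iff prefix_length_prefix)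
    with assms(1) show False by simp
  qed
qed

lemma le_same_length_append:
  fixes u :: "'a::linorder list"
  assumes "u \<le> v" "length u = length v" "x \<le> y" shows "u @ x \<le> v @ y"
  using assms less_same_length_append[of u v x y] by (cases "u = v") (auto simp: order.order_iff_strict)

text \<open>Words over \<open>I\<close> enter through \<open>map rk\<close>, which is injective on
  the letters, so that the combinatorics can use the library order on lists;
  \<open>lyndon_key\<close> is the bridge to \<open>lyndon\<close>.\<close>

definition lyn :: "'a::linorder list \<Rightarrow> bool" where
  "lyn w \<longleftrightarrow> w \<noteq> [] \<and> (\<forall>p s. w = p @ s \<longrightarrow> p \<noteq> [] \<longrightarrow> s \<noteq> [] \<longrightarrow> w < s)"

lemma lyn_suffix: "lyn (p @ s) \<Longrightarrow> p \<noteq> [] \<Longrightarrow> s \<noteq> [] \<Longrightarrow> p @ s < s"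
  by (auto simp: lyn_def)

lemma lyn_suffix_le: "lyn (p @ s) \<Longrightarrow> s \<noteq> [] \<Longrightarrow> p @ s \<le> s"
  using lyn_suffix[of p s] by (cases "p = []") auto

lemma lyn_Nil [simp]: "\<not> lyn []" by (simp add: lyn_def)

lemma lyn_single [simp]: "lyn [a]"
  by (simp add: lyn_def) (metis append_is_Nil_conv butlast_append butlast.simps(2) append_self_conv2)

text \<open>Formulated for all suffixes s of l so that a prefix can be stripped: since
  \<open>m < l \<le> s\<close>, either m and s differ at a letter and the comparison is settled, or
  m is a proper prefix of s and the rest of s is again a suffix of l.\<close>

lemma concat_less_lyn_suffix:
  assumes "lyn (l :: 'a::linorder list)" "\<forall>m\<in>set ms. m < l" "l = p @ s" "s \<noteq> []"
  shows "concat ms < s"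
  using assms(2-4)
proof (induction ms arbitrary: p s)
  case Nil then show ?case by (cases s) auto
next
  case (Cons m ms)
  have "l \<le> s" using lyn_suffix_le[of p s] assms(1) Cons.prems by auto
  then have ms: "m < s" using Cons.prems by auto
  show ?case
  proof (cases "prefix m s")
    case True
    then obtain s' where s': "s = m @ s'" by (auto simp: prefix_def)
    with ms have "s' \<noteq> []" by auto
    then have "concat ms < s'" using Cons.IH[of "p @ m" s'] Cons.prems s' by auto
    then show ?thesis using s' by simp
  next
    case False
    then show ?thesis using less_not_prefix_append[OF ms False, of "concat ms" "[]"] by simp
  qed
qed

lemma concat_less_lyn:
  "lyn (l :: 'a::linorder list) \<Longrightarrow> \<forall>m\<in>set ms. m < l \<Longrightarrow> concat ms < l"
  using concat_less_lyn_suffix[of l ms "[]" l] by (metis append_Nil lyn_Nil)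

text \<open>The point is \<open>u @ v < v\<close>. If \<open>v = u @ v'\<close>, then
  \<open>v < v'\<close> because v is Lyndon; otherwise u and v already differ at a letter.\<close>

lemma lyn_append:
  assumes "lyn (u :: 'a::linorder list)" "lyn v" "u < v" shows "lyn (u @ v)"
proof -
  have uv: "u @ v < v"
  proof (cases "prefix u v")
    case True
    then obtain v' where v': "v = u @ v'" by (auto simp: prefix_def)
    with assms have "u \<noteq> []" "v' \<noteq> []" by auto
    then have "v < v'" using lyn_suffix[of u v'] assms(2) v' by auto
    then show ?thesis using v' by (metis append_less_iff)
  next
    case False
    then show ?thesis using less_not_prefix_append[OF assms(3) False, of v "[]"] by simp
  qed
  show ?thesis unfolding lyn_def
  proof (intro conjI allI impI)
    show "u @ v \<noteq> []" using assms by auto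
    fix p s assume a: "u @ v = p @ s" "p \<noteq> []" "s \<noteq> []"
    then consider t where "p = u @ t" "v = t @ s" | t where "u = p @ t" "s = t @ v" "t \<noteq> []"
      by (auto simp: append_eq_append_conv2 split: list.splits) (metis append_Nil append_Nil2)
    then show "u @ v < s"
    proof cases
      case 1
      then have "v \<le> s" using lyn_suffix_le[of t s] assms a by auto
      then show ?thesis using uv by simp
    next
      case 2
      then have lt: "u < t" using lyn_suffix[of p t] assms a by auto
      have "\<not> prefix u t" using 2 a by (auto dest!: prefix_length_le)
      then show ?thesis using less_not_prefix_append[OF lt] 2 by auto
    qed
  qed
qed

section \<open>Factorization into a weakly decreasing sequence of Lyndon words\<close>

definition dsc :: "'a::linorder list list \<Rightarrow> bool" where
  "dsc ls \<longleftrightarrow> (\<forall>l\<in>set ls. lyn l) \<and> sorted_wrt (\<lambda>a b. b \<le> a) ls"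

lemma dsc_Nil [simp]: "dsc []" by (simp add: dsc_def)

lemma dsc_Cons: "dsc (l # ls) \<longleftrightarrow> lyn l \<and> dsc ls \<and> (\<forall>m\<in>set ls. m \<le> l)"
  by (auto simp: dsc_def)

lemma dsc_append: "dsc (ls @ ms) \<longleftrightarrow> dsc ls \<and> dsc ms \<and> (\<forall>l\<in>set ls. \<forall>m\<in>set ms. m \<le> l)"
  by (auto simp: dsc_def sorted_wrt_append)

text \<open>A factor l placed before a larger m fuses with it to the Lyndon word
  \<open>l @ m\<close>, which shortens the list. Existence of factorizations follows by adding one
  letter at a time.\<close>

lemma dsc_insert: "lyn l \<Longrightarrow> dsc ls \<Longrightarrow> \<exists>ms. dsc ms \<and> concat ms = l @ concat ls"
proof (induction ls arbitrary: l)
  case Nil then show ?case by (intro exI[of _ "[l]"]) (auto simp: dsc_Cons)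
next
  case (Cons m ls)
  show ?case
  proof (cases "m \<le> l")
    case True
    then show ?thesis using Cons.prems by (intro exI[of _ "l # m # ls"]) (auto simp: dsc_Cons)
  next
    case False
    then have "lyn (l @ m)" using lyn_append[of l m] Cons.prems by (auto simp: dsc_Cons)
    then show ?thesis using Cons.IH[of "l @ m"] Cons.prems by (auto simp: dsc_Cons)
  qed
qed

lemma dsc_exists: "\<exists>ls. dsc ls \<and> concat ls = w"
proof (induction w)
  case Nil then show ?case by (intro exI[of _ "[]"]) auto
next
  case (Cons a w) then show ?case using dsc_insert[of "[a]"] by fastforce
qed

text \<open>Otherwise all factors of \<open>ms\<close> lie below the first factor l of
  \<open>ls\<close>, and \<open>concat_less_lyn\<close> gives
  \<open>concat ms < l \<le> concat ls\<close>. Used in both directions it yields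
  uniqueness.\<close>

lemma dsc_hd_mono:
  assumes "dsc ls" "dsc ms" "concat ls \<le> concat ms" "ls \<noteq> []"
  shows "ms \<noteq> [] \<and> hd ls \<le> hd ms"
proof (rule ccontr)
  assume a: "\<not> ?thesis"
  obtain l ls' where ls: "ls = l # ls'" using assms by (cases ls) auto
  have l: "lyn l" "l \<le> concat ls" using assms ls by (auto simp: dsc_Cons)
  have "\<forall>m\<in>set ms. m < l" using a assms ls by (cases ms) (auto simp: dsc_Cons)
  then have "concat ms < l" using concat_less_lyn l by blast
  then show False using l assms by auto
qed

lemma dsc_unique: "dsc ls \<Longrightarrow> dsc ms \<Longrightarrow> concat ls = concat ms \<Longrightarrow> ls = ms"
proof (induction ls arbitrary: ms)
  case Nil
  then show ?case using dsc_hd_mono[of ms "[]"] by auto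
next
  case (Cons l ls)
  then have ne: "ms \<noteq> []" and "l \<le> hd ms" using dsc_hd_mono[of "l # ls" ms] by auto
  moreover have "hd ms \<le> l" using dsc_hd_mono[of ms "l # ls"] Cons.prems ne by auto
  ultimately obtain ms' where "ms = l # ms'" by (cases ms) auto
  then show ?case using Cons by (auto simp: dsc_Cons)
qed

definition fac :: "'a::linorder list \<Rightarrow> 'a list list" where
  "fac w = (THE ls. dsc ls \<and> concat ls = w)"

lemma fac: "dsc (fac w)" "concat (fac w) = w"
proof -
  have "\<exists>!ls. dsc ls \<and> concat ls = w" using dsc_exists dsc_unique by blast
  then have "dsc (fac w) \<and> concat (fac w) = w" unfolding fac_def by (rule theI')
  then show "dsc (fac w)" "concat (fac w) = w" by auto
qed

lemma fac_eqI: "dsc ls \<Longrightarrow> concat ls = w \<Longrightarrow> fac w = ls"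
  using fac dsc_unique by blast

lemma fac_Nil [simp]: "fac [] = []" by (rule fac_eqI) auto

lemma fac_lyn: "lyn l \<Longrightarrow> fac l = [l]" by (rule fac_eqI) (auto simp: dsc_Cons)

lemma lyn_fac: "x \<in> set (fac w) \<Longrightarrow> lyn x" using fac(1)[of w] by (auto simp: dsc_def)

text \<open>The last factor of s is a proper suffix of the Lyndon word, hence larger than it, and it
  is the smallest of the factors.\<close>

lemma fac_proper_suffix_greater:
  assumes "lyn (p @ s)" "p \<noteq> []" "x \<in> set (fac s)" shows "p @ s < x"
proof -
  have ne: "fac s \<noteq> []" using assms by auto
  then obtain ls y where ls: "fac s = ls @ [y]" by (metis rev_exhaust)
  have d: "dsc (ls @ [y])" "concat (ls @ [y]) = s" using fac[of s] ls by auto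
  have "y \<noteq> []" using d by (auto simp: dsc_append dsc_Cons)
  moreover have "p @ s = (p @ concat ls) @ y" using d by auto
  ultimately have "p @ s < y" using lyn_suffix[of "p @ concat ls" y] assms by auto
  moreover have "y \<le> x" using d assms(3) ls by (auto simp: dsc_append dsc_Cons)
  ultimately show ?thesis by simp
qed

text \<open>Here \<open>mx\<close> is the maximality of \<open>l1\<close> in the co-standard
  factorization. If \<open>l2\<close> had a first factor f and further ones, then f would exceed the
  whole word and so \<open>l1\<close>, and \<open>l1 @ f\<close> would be a longer Lyndon
  prefix.\<close>

lemma lyn_costandard:
  assumes "lyn (l1 @ l2)" "lyn l1" "l2 \<noteq> []"
    and mx: "\<And>p q. l2 = p @ q \<Longrightarrow> p \<noteq> [] \<Longrightarrow> q \<noteq> [] \<Longrightarrow> \<not> lyn (l1 @ p)"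
  shows "lyn l2"
proof -
  obtain f fs where f: "fac l2 = f # fs" using assms fac(2)[of l2] by (cases "fac l2") auto
  have d: "dsc (f # fs)" "f @ concat fs = l2" using fac[of l2] f by auto
  have lf: "lyn f" and ff: "\<forall>x\<in>set fs. x \<le> f" using d by (auto simp: dsc_Cons)
  show ?thesis
  proof (cases "fs = []")
    case True then show ?thesis using d by (auto simp: dsc_Cons)
  next
    case False
    have "f < l1 @ l2 \<or> \<not> l1 < f"
    proof (rule ccontr)
      assume "\<not> ?thesis"
      then have "lyn (l1 @ f)" using lyn_append assms lf by blast
      moreover have "concat fs \<noteq> []" using False d by (cases fs) (auto simp: dsc_Cons)
      moreover have "f \<noteq> []" using lf by auto
      ultimately show False using mx[of f "concat fs"] d by auto
    qed
    moreover have gt: "l1 @ l2 < f" using fac_proper_suffix_greater[of l1 l2 f] assms(1,2) f by (cases "l1 = []") auto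
    moreover have "l1 < f" by (rule order_le_less_trans[OF le_append gt])
    ultimately show ?thesis by auto
  qed
qed

section \<open>The decreasing arrangement of Lyndon factors bounds all shuffles\<close>

definition mg :: "'a::linorder list list \<Rightarrow> 'a list" where
  "mg ls = concat (rev (sort ls))"

lemma mg_mset: "mset ls = mset ms \<Longrightarrow> mg ls = mg ms"
  unfolding mg_def by (metis properties_for_sort mset_sort sorted_sort)

lemma sorted_desc_mg: "sorted_wrt (\<lambda>a b. b \<le> a) ls \<Longrightarrow> mg ls = concat ls"
proof -
  assume "sorted_wrt (\<lambda>a b. b \<le> a) ls"
  then have "sorted (rev ls)" by (simp add: sorted_wrt_rev)
  then have "sort ls = rev ls" by (metis mset_rev properties_for_sort)
  then show ?thesis by (simp add: mg_def)
qed

lemma mg_dsc: "dsc ls \<Longrightarrow> mg ls = concat ls"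
  using sorted_desc_mg by (auto simp: dsc_def)

lemma mg_append:
  assumes "\<forall>a\<in>set ls. \<forall>b\<in>set ms. b \<le> a" shows "mg (ls @ ms) = mg ls @ mg ms"
proof -
  have "sort (ls @ ms) = sort ms @ sort ls"
    by (rule properties_for_sort) (use assms in \<open>auto simp: sorted_append\<close>)
  then show ?thesis by (simp add: mg_def)
qed

lemma mg_Cons: "\<forall>b\<in>set ms. b \<le> a \<Longrightarrow> mg (a # ms) = a @ mg ms"
  using mg_append[of "[a]" ms] by (simp add: mg_def del: sort_key_simps) (simp add: mg_def)

text \<open>Either \<open>f = x @ f'\<close>, where \<open>f < f'\<close> because f is Lyndon, or x
  and f differ at a letter and x is the smaller one.\<close>

lemma prefix_commute_less:
  fixes f :: "'a::linorder list"
  assumes "prefix x l" "l < f" "lyn f" "x \<noteq> []" shows "x @ f < f @ x"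
proof -
  have xl: "x \<le> l" using assms by (auto simp: prefix_def)
  then have xf: "x < f" using assms by auto
  show ?thesis
  proof (cases "prefix x f")
    case True
    then obtain f' where f': "f = x @ f'" by (auto simp: prefix_def)
    then have "f' \<noteq> []" using xf by auto
    then have ff': "f < f'" using lyn_suffix[of x f'] assms f' by auto
    then have "f < f' @ x" by (rule order_less_le_trans) simp
    then show ?thesis using f' by auto
  next
    case False then show ?thesis using less_not_prefix_append[OF xf False] by blast
  qed
qed

text \<open>Cutting the first letter d off l leaves the factors \<open>ss\<close>, all above l. If
  no factor in V exceeds l, both sides agree. Otherwise let f be the largest one: on the right it
  comes first, on the left it follows d and those factors of \<open>ss\<close> that are at least f.
  These together form a prefix of l, so \<open>prefix_commute_less\<close> compares the two
  positions of f, and f is then removed from V.\<close>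

lemma Cons_mg_le:
  assumes "lyn l" "l = d # concat ss" "dsc ss" "\<forall>s\<in>set ss. l < s" "\<forall>v\<in>set V. lyn v"
  shows "d # mg (ss @ V) \<le> mg (l # V)"
  using assms(5)
proof (induction V rule: length_induct)
  case (1 V)
  show ?case
  proof (cases "\<forall>v\<in>set V. v \<le> l")
    case True
    have "mg (ss @ V) = concat ss @ mg V"
      using True assms by (subst mg_append) (auto simp: mg_dsc, fastforce)
    moreover have "mg (l # V) = l @ mg V"
      using True by (rule mg_Cons)
    ultimately show ?thesis using assms by auto
  next
    case False
    define f where "f = Max (set V)"
    have "set V \<noteq> {}" using False by auto
    then have fV: "f \<in> set V" and fmax: "\<forall>v\<in>set V. v \<le> f" unfolding f_def using Max_in Max_ge by blast+
    have lf: "l < f" using False fmax by force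
    have lynf: "lyn f" using fV 1 by auto
    define V' where "V' = remove1 f V"
    have mV: "mset V = mset (f # V')" using fV by (simp add: V'_def)
    have V'V: "set V' \<subseteq> set V" unfolding V'_def by (rule set_remove1_subset)
    have "length V = length (f # V')" using mV by (rule mset_eq_length)
    then have "length V' < length V" by simp
    then have IH: "d # mg (ss @ V') \<le> mg (l # V')" using 1 V'V by blast
    have "mg (l # V) = mg (f # l # V')" by (rule mg_mset) (use mV in auto)
    also have "\<dots> = f @ mg (l # V')"
      by (rule mg_Cons) (use fmax V'V lf in auto)
    finally have e1: "mg (l # V) = f @ mg (l # V')" .
    define A where "A = takeWhile (\<lambda>s. f \<le> s) ss"
    define B where "B = dropWhile (\<lambda>s. f \<le> s) ss"
    have AB: "ss = A @ B" by (simp add: A_def B_def)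
    have Af: "\<forall>a\<in>set A. f \<le> a" unfolding A_def by (meson set_takeWhileD)
    have Bf: "\<forall>b\<in>set B. b \<le> f"
    proof (cases B)
      case (Cons b B')
      then have "\<not> f \<le> b" unfolding B_def by (metis dropWhile_eq_Cons_conv)
      then show ?thesis using assms(3) AB Cons by (auto simp: dsc_append dsc_Cons)
    qed auto
    have dA: "dsc A" using assms AB by (auto simp: dsc_append)
    have "mg (ss @ V) = mg (A @ f # B @ V')" by (rule mg_mset) (use mV AB in auto)
    also have "\<dots> = mg A @ mg (f # B @ V')"
      using Af Bf fmax V'V by (intro mg_append) (auto, (meson order_trans subsetD)+)
    also have "mg (f # B @ V') = f @ mg (B @ V')"
      by (rule mg_Cons) (use Bf fmax V'V in auto)
    finally have e2: "mg (ss @ V) = concat A @ f @ mg (B @ V')" using dA by (simp add: mg_dsc)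
    have "mg (ss @ V') = mg A @ mg (B @ V')"
      unfolding AB append_assoc
      using Af Bf fmax V'V by (intro mg_append) (auto, (meson order_trans subsetD)+)
    then have e3: "mg (ss @ V') = concat A @ mg (B @ V')" using dA by (simp add: mg_dsc)
    have "(d # concat A) @ f < f @ (d # concat A)"
      by (rule prefix_commute_less[of _ l]) (use assms AB lf lynf in auto)
    then have "((d # concat A) @ f) @ mg (B @ V') < (f @ (d # concat A)) @ mg (B @ V')"
      by (rule less_same_length_append) auto
    then have "d # mg (ss @ V) < f @ (d # mg (ss @ V'))" unfolding e2 e3 by simp
    also have "\<dots> \<le> f @ mg (l # V')" using IH by simp
    finally show ?thesis unfolding e1 by simp
  qed
qed

text \<open>Removing the first letter breaks up only the first Lyndon factor; its pieces exceed that
  factor and hence stay in front of the remaining ones.\<close>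

lemma Cons_mg_fac_le:
  assumes "\<forall>v\<in>set V. lyn v" shows "d # mg (fac u @ V) \<le> mg (fac (d # u) @ V)"
proof -
  obtain l ls where l: "fac (d # u) = l # ls" using fac(2)[of "d # u"] by (cases "fac (d # u)") auto
  have dl: "dsc (l # ls)" "l @ concat ls = d # u" using fac[of "d # u"] l by auto
  then obtain l' where l': "l = d # l'" by (cases l) (auto simp: dsc_Cons)
  have lynl: "lyn l" using dl by (simp add: dsc_Cons)
  have gr: "\<forall>s\<in>set (fac l'). l < s"
    using fac_proper_suffix_greater[of "[d]" l'] lynl l' by auto
  have "fac u = fac l' @ ls"
  proof (rule fac_eqI)
    have "m \<le> s" if "s \<in> set (fac l')" "m \<in> set ls" for m s
      using gr that dl(1) by (force simp: dsc_Cons)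
    then show "dsc (fac l' @ ls)" using fac(1)[of l'] dl by (auto simp: dsc_append dsc_Cons)
    show "concat (fac l' @ ls) = u" using dl l' by (simp add: fac(2))
  qed
  moreover have "\<forall>v\<in>set (ls @ V). lyn v" using dl assms by (auto simp: dsc_def)
  ultimately show ?thesis using Cons_mg_le[of l d "fac l'" "ls @ V"] lynl l' gr
    by (simp add: l fac)
qed

lemma shuffles_le_mg: "z \<in> shuffles u v \<Longrightarrow> z \<le> mg (fac u @ fac v)"
proof (induction z arbitrary: u v)
  case Nil then show ?case by simp
next
  case (Cons d z)
  have lv: "\<forall>x\<in>set (fac w). lyn x" for w :: "'a list" using lyn_fac by blast
  from Cons.prems consider u' where "u = d # u'" "z \<in> shuffles u' v" | v' where "v = d # v'" "z \<in> shuffles u v'"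
    by (auto simp: Cons_in_shuffles_iff) (metis list.exhaust_sel)+
  then show ?case
  proof cases
    case 1
    then have "d # z \<le> d # mg (fac u' @ fac v)" using Cons.IH by auto
    also have "\<dots> \<le> mg (fac (d # u') @ fac v)" by (rule Cons_mg_fac_le[OF lv])
    finally show ?thesis using 1 by simp
  next
    case 2
    then have "z \<le> mg (fac v' @ fac u)" using Cons.IH[of u v'] mg_mset[of "fac v' @ fac u" "fac u @ fac v'"] by auto
    then have "d # z \<le> d # mg (fac v' @ fac u)" by auto
    also have "\<dots> \<le> mg (fac (d # v') @ fac u)" by (rule Cons_mg_fac_le[OF lv])
    also have "\<dots> = mg (fac u @ fac (d # v'))" by (rule mg_mset) auto
    finally show ?thesis using 2 by simp
  qed
qed

lemma append_in_shuffles: "u @ v \<in> shuffles u v"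
  by (induction u) (auto intro: Cons_in_shuffles_leftI)

text \<open>As long as the letters agree, the shuffle of the larger words is built in parallel. At
  the first letter d that meets a larger e, any shuffle that continues with e wins.\<close>

lemma shuffles_mono:
  "z \<in> shuffles u v \<Longrightarrow> length u = length k \<Longrightarrow> u \<le> k \<Longrightarrow> length v = length m \<Longrightarrow> v \<le> m
    \<Longrightarrow> \<exists>z'\<in>shuffles k m. z \<le> (z' :: 'a::linorder list)"
proof (induction z arbitrary: u v k m)
  case Nil then show ?case by auto
next
  case (Cons d z)
  from Cons.prems(1) consider u' where "u = d # u'" "z \<in> shuffles u' v" | v' where "v = d # v'" "z \<in> shuffles u v'"
    by (auto simp: Cons_in_shuffles_iff) (metis list.exhaust_sel)+
  then show ?case
  proof cases
    case 1
    then obtain e k' where k: "k = e # k'" using Cons.prems by (cases k) auto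
    show ?thesis
    proof (cases "d = e")
      case True
      then obtain z' where "z' \<in> shuffles k' m" "z \<le> z'" using Cons.IH[of u' v k' m] Cons.prems 1 k by auto
      then show ?thesis using True k by (intro bexI[of _ "e # z'"]) (auto simp: Cons_in_shuffles_iff)
    next
      case False
      have "e # k' @ m \<in> shuffles k m" using k append_in_shuffles[of k m] by auto
      then show ?thesis using False Cons.prems 1 k by (intro bexI[of _ "e # k' @ m"]) auto
    qed
  next
    case 2
    then obtain e m' where m: "m = e # m'" using Cons.prems by (cases m) auto
    show ?thesis
    proof (cases "d = e")
      case True
      then obtain z' where "z' \<in> shuffles k m'" "z \<le> z'" using Cons.IH[of u v' k m'] Cons.prems 2 m by auto
      then show ?thesis using True m by (intro bexI[of _ "e # z'"]) (auto simp: Cons_in_shuffles_iff)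
    next
      case False
      have "k @ m' \<in> shuffles k m'" by (rule append_in_shuffles)
      then have "e # k @ m' \<in> shuffles k m" using m by (auto simp: Cons_in_shuffles_iff)
      then show ?thesis using False Cons.prems 2 m by (intro bexI[of _ "e # k @ m'"]) auto
    qed
  qed
qed

lemma shuffles_le_mg_mono:
  assumes "z \<in> shuffles u v" "length u = length k" "u \<le> k" "length v = length m" "v \<le> (m :: 'a::linorder list)"
  shows "z \<le> mg (fac k @ fac m)"
proof -
  obtain z' where "z' \<in> shuffles k m" "z \<le> z'" using shuffles_mono[OF assms] by blast
  then show ?thesis using shuffles_le_mg[of z' k m] by simp
qed

text \<open>Q describes a lower set. If some factor of w violated Q, so would the first factor l;
  then every factor of \<open>ls\<close> is below l and \<open>concat ls < l \<le> w\<close>. This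
  is what turns a bound on Lyndon factors into a condition stable under products
  (\<open>fac_shuffles_downclosed\<close>) and under cutting off last letters
  (\<open>fac_prefix_downclosed\<close>).\<close>

lemma fac_downclosed:
  assumes "w \<le> concat ls" "\<forall>x\<in>set ls. Q x" "x \<in> set (fac w)"
    and Q: "\<And>x y. Q y \<Longrightarrow> x \<le> y \<Longrightarrow> Q x"
  shows "Q (x :: 'a::linorder list)"
proof (rule ccontr)
  assume nq: "\<not> Q x"
  obtain l ms where f: "fac w = l # ms" using assms by (cases "fac w") auto
  have d: "dsc (l # ms)" "l @ concat ms = w" using fac[of w] f by auto
  have "x \<le> l" using d(1) assms(3) f by (auto simp: dsc_Cons)
  then have "\<not> Q l" using nq Q by blast
  then have "\<forall>m\<in>set ls. m < l" using assms(2) Q by (meson not_le)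
  then have "concat ls < l" using concat_less_lyn d by (auto simp: dsc_Cons)
  moreover have "l \<le> w" using d by auto
  ultimately show False using assms(1) by simp
qed

lemma fac_shuffles_downclosed:
  assumes "z \<in> shuffles u v" "\<forall>x\<in>set (fac u). Q x" "\<forall>x\<in>set (fac v). Q x"
    and Q: "\<And>x y. Q y \<Longrightarrow> x \<le> y \<Longrightarrow> Q x"
  shows "\<forall>x\<in>set (fac z). Q (x :: 'a::linorder list)"
proof
  fix x assume x: "x \<in> set (fac z)"
  have le: "z \<le> concat (rev (sort (fac u @ fac v)))" using shuffles_le_mg[OF assms(1)] by (simp add: mg_def)
  show "Q x" by (rule fac_downclosed[OF le _ x Q]) (use assms(2,3) in auto)
qed

lemma fac_prefix_downclosed:
  assumes "\<forall>x\<in>set (fac (z @ t)). Q x" and Q: "\<And>x y. Q y \<Longrightarrow> x \<le> y \<Longrightarrow> Q x"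
  shows "\<forall>x\<in>set (fac z). Q (x :: 'a::linorder list)"
proof
  fix x assume x: "x \<in> set (fac z)"
  have le: "z \<le> concat (fac (z @ t))" by (simp add: fac)
  show "Q x" by (rule fac_downclosed[OF le _ x Q]) (use assms(1) in auto)
qed

subsection \<open>The quantum shuffle algebra of a bicharacter\<close>

text \<open>Stripping a first or last letter. With respect to the shuffle product these are the left
  and right skew derivations, see \<open>Dl_mul\<close> and \<open>Dr_mul\<close>.\<close>

definition Dl :: "nat \<Rightarrow> (nat list \<Rightarrow> 'k) \<Rightarrow> nat list \<Rightarrow> 'k" where
  "Dl j f = (\<lambda>w. f (j # w))"

definition Dr :: "nat \<Rightarrow> (nat list \<Rightarrow> 'k) \<Rightarrow> nat list \<Rightarrow> 'k" where
  "Dr j f = (\<lambda>w. f (w @ [j]))"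

definition sc :: "'k::times \<Rightarrow> (nat list \<Rightarrow> 'k) \<Rightarrow> nat list \<Rightarrow> 'k" where
  "sc c f = (\<lambda>w. c * f w)"

definition bas :: "nat list \<Rightarrow> nat list \<Rightarrow> 'k::zero_neq_one" where
  "bas w = (\<lambda>u. if u = w then 1 else 0)"

lemma Dl_simps [simp]:
  "Dl j (f + g) = Dl j f + Dl j g" "Dl j (sc c h) = sc c (Dl j h)" "Dl j 0 = 0"
  by (auto simp: Dl_def sc_def fun_eq_iff)

lemma Dr_simps [simp]:
  "Dr j (f + g) = Dr j f + Dr j g" "Dr j (sc c h) = sc c (Dr j h)" "Dr j 0 = 0"
  by (auto simp: Dr_def sc_def fun_eq_iff)

lemma sc_apply: "sc c f w = c * f w" by (simp add: sc_def)

lemma sc_simps [simp]: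
  fixes c :: "'k::comm_ring_1"
  shows "sc c (f + g) = sc c f + sc c g" "sc c 0 = 0" "sc 0 f = 0" "sc 1 f = f" "sc c (sc d f) = sc (c * d) f"
  by (auto simp: sc_def fun_eq_iff algebra_simps)

lemma sc_left_distrib: "sc (c + d) f = sc c f + sc d (f :: _ \<Rightarrow> 'k::comm_ring_1)"
  by (auto simp: sc_def fun_eq_iff algebra_simps)

lemma sc_minus: "sc (- c) f = - sc c (f :: _ \<Rightarrow> 'k::comm_ring_1)" "sc c (- f) = - sc c f"
   "sc c (f - g) = sc c f - sc c g"
  by (auto simp: sc_def fun_eq_iff algebra_simps)

lemma bas_Nil [simp]: "Dl j (bas []) = 0" "Dr j (bas []) = 0"
  by (auto simp: Dl_def Dr_def bas_def fun_eq_iff)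

lemma Dl_bas: "Dl j (bas (i # w)) = (if i = j then bas w else 0)"
  by (auto simp: Dl_def bas_def fun_eq_iff)

lemma Dr_bas: "Dr j (bas (w @ [i])) = (if i = j then bas w else 0)"
  by (auto simp: Dr_def bas_def fun_eq_iff)

lemma Dr_bas1: "Dr j (bas [i]) = (if i = j then bas [] else 0)"
  using Dr_bas[of j "[]" i] by simp

text \<open>The weights of the letters are a parameter, since the same letters are used for all
  simple systems that arise by reflection.\<close>

definition wv :: "(nat \<Rightarrow> 'v::ab_group_add) \<Rightarrow> nat list \<Rightarrow> 'v" where
  "wv x w = sum_list (map x w)"

lemma wv_simps [simp]: "wv x [] = 0" "wv x (j # w) = x j + wv x w" "wv x (u @ w) = wv x u + wv x w"
  by (auto simp: wv_def)

lemma wv_mset: "mset u = mset w \<Longrightarrow> wv x u = wv x w"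
  unfolding wv_def by (metis mset_map sum_mset_sum_list)

definition hom :: "(nat \<Rightarrow> 'v::ab_group_add) \<Rightarrow> 'v \<Rightarrow> (nat list \<Rightarrow> 'k::zero) \<Rightarrow> bool" where
  "hom x \<mu> f \<longleftrightarrow> (\<forall>w. f w \<noteq> 0 \<longrightarrow> wv x w = \<mu>)"

lemma hom_zero [simp]: "hom x \<mu> 0" by (simp add: hom_def)

lemma hom_add: "hom x \<mu> f \<Longrightarrow> hom x \<mu> g \<Longrightarrow> hom x \<mu> (f + g :: _ \<Rightarrow> 'k::comm_ring_1)"
  by (auto simp: hom_def) (metis add_0)

lemma hom_sc: "hom x \<mu> f \<Longrightarrow> hom x \<mu> (sc c (f :: _ \<Rightarrow> 'k::comm_ring_1))"
  by (auto simp: hom_def sc_def) (metis mult_zero_right)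

lemma hom_diff: "hom x \<mu> f \<Longrightarrow> hom x \<mu> g \<Longrightarrow> hom x \<mu> (f - g :: _ \<Rightarrow> 'k::comm_ring_1)"
  by (auto simp: hom_def) (metis diff_zero)

lemma hom_Dr: "hom x \<mu> f \<Longrightarrow> hom x (\<mu> - x j) (Dr j f)"
  by (auto simp: hom_def Dr_def algebra_simps)

lemma hom_Dl: "hom x \<mu> f \<Longrightarrow> hom x (\<mu> - x j) (Dl j f)"
  by (auto simp: hom_def Dl_def algebra_simps)

lemma hom_bas: "hom x (wv x w) (bas w)" by (auto simp: hom_def bas_def split: if_splits)

lemma hom_unique: "hom x \<mu> f \<Longrightarrow> hom x \<nu> f \<Longrightarrow> f \<noteq> 0 \<Longrightarrow> \<mu> = \<nu>"
  by (force simp: hom_def fun_eq_iff)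

text \<open>The instance in mind is \<open>X a b\<close> = (-1)^(p(a)p(b)) q^(-(a,b)), see
  \<open>lattice_form.X\<close>.\<close>

locale bichar =
  fixes X :: "'v::ab_group_add \<Rightarrow> 'v \<Rightarrow> 'k::field"
  assumes X_add_left: "X (a + b) c = X a c * X b c"
    and X_sym: "X a b = X b a"
    and X_nz [simp]: "X a b \<noteq> 0"
begin

lemma X_add_right: "X c (a + b) = X c a * X c b" by (metis X_add_left X_sym)

lemma X_zero [simp]: "X 0 c = 1" "X c 0 = 1"
proof -
  have "X 0 c * X 0 c = X 0 c * 1" using X_add_left[of 0 0 c] by simp
  then show "X 0 c = 1" using X_nz[of 0 c] by (simp del: X_nz mult_1_right)
  then show "X c 0 = 1" by (simp add: X_sym)
qed

lemma X_uminus: "X (- a) c = inverse (X a c)" "X c (- a) = inverse (X c a)"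
proof -
  have "X (- a) c * X a c = 1" using X_add_left[of "- a" a c] by simp
  then show "X (- a) c = inverse (X a c)" by (metis inverse_unique mult.commute)
  then show "X c (- a) = inverse (X c a)" by (simp add: X_sym)
qed

lemma X_diff: "X (a - b) c = X a c / X b c" "X c (a - b) = X c a / X c b"
  using X_add_left[of a "- b" c] X_add_right[of c a "- b"] by (simp_all add: X_uminus field_simps)

text \<open>The factor collected when a letter of weight v passes an element; it is the twist in the
  skew Leibniz rules.\<close>

definition tw :: "(nat \<Rightarrow> 'v) \<Rightarrow> 'v \<Rightarrow> (nat list \<Rightarrow> 'k) \<Rightarrow> nat list \<Rightarrow> 'k" where
  "tw x v f = (\<lambda>w. X v (wv x w) * f w)"

lemma tw_simps [simp]:
  "tw x v (f + g) = tw x v f + tw x v g" "tw x v (sc c h) = sc c (tw x v h)" "tw x v 0 = 0"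
  "tw x v (bas w) = sc (X v (wv x w)) (bas w)" "tw x 0 f = f"
  "tw x v (tw x u f) = tw x (v + u) f"
  by (auto simp: tw_def sc_def fun_eq_iff algebra_simps bas_def X_add_left)

lemma Dl_tw: "Dl j (tw x v f) = sc (X v (x j)) (tw x v (Dl j f))"
  by (auto simp: Dl_def tw_def sc_def fun_eq_iff X_add_right)

lemma Dr_tw: "Dr j (tw x v f) = sc (X v (x j)) (tw x v (Dr j f))"
  by (auto simp: Dr_def tw_def sc_def fun_eq_iff X_add_right)

lemma tw_hom: "hom x \<mu> f \<Longrightarrow> tw x v f = sc (X v \<mu>) f"
  by (auto simp: tw_def sc_def fun_eq_iff hom_def)

lemma hom_tw: "hom x \<mu> f \<Longrightarrow> hom x \<mu> (tw x v f)"
  by (simp add: tw_hom hom_sc)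

primrec mulw :: "(nat \<Rightarrow> 'v) \<Rightarrow> nat list \<Rightarrow> (nat list \<Rightarrow> 'k) \<Rightarrow> (nat list \<Rightarrow> 'k) \<Rightarrow> 'k" where
  "mulw x [] f g = f [] * g []"
| "mulw x (j # w) f g = mulw x w (Dl j f) (tw x (x j) g) + mulw x w f (Dl j g)"

text \<open>The value at \<open>w\<close> is the sum over all ways to split \<open>w\<close> into complementary subwords
  \<open>u\<close>, \<open>v\<close> of \<open>f u * g v\<close>, weighted by the factors \<open>X\<close> of the pairs in which a letter
  of \<open>u\<close> precedes a letter of \<open>v\<close>; no finiteness of supports is needed.\<close>

definition mul :: "(nat list \<Rightarrow> 'k) \<Rightarrow> (nat \<Rightarrow> 'v) \<Rightarrow> (nat list \<Rightarrow> 'k) \<Rightarrow> nat list \<Rightarrow> 'k"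
    ("(_ \<odot>\<^bsub>_\<^esub>/ _)" [71, 0, 70] 70) where
  "f \<odot>\<^bsub>x\<^esub> g = (\<lambda>w. mulw x w f g)"

lemma mul_Nil [simp]: "(f \<odot>\<^bsub>x\<^esub> g) [] = f [] * g []" by (simp add: mul_def)

lemma Dl_mul: "Dl j (f \<odot>\<^bsub>x\<^esub> g) = (Dl j f \<odot>\<^bsub>x\<^esub> tw x (x j) g) + (f \<odot>\<^bsub>x\<^esub> Dl j g)"
proof
  show "Dl j (f \<odot>\<^bsub>x\<^esub> g) w = ((Dl j f \<odot>\<^bsub>x\<^esub> tw x (x j) g) + (f \<odot>\<^bsub>x\<^esub> Dl j g)) w" for w
    by (simp add: Dl_def[of j "mul f x g"]) (simp add: mul_def)
qed

lemma ext_Dl: "f [] = g [] \<Longrightarrow> (\<And>j w. Dl j f w = Dl j g w) \<Longrightarrow> f = g"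
proof (rule ext)
  fix w assume "f [] = g []" "\<And>j w. Dl j f w = Dl j g w"
  then show "f w = g w" by (cases w) (auto simp: Dl_def)
qed

lemma mul_add_left: "(f + f') \<odot>\<^bsub>x\<^esub> g = (f \<odot>\<^bsub>x\<^esub> g) + (f' \<odot>\<^bsub>x\<^esub> g)"
proof
  fix w show "((f + f') \<odot>\<^bsub>x\<^esub> g) w = ((f \<odot>\<^bsub>x\<^esub> g) + (f' \<odot>\<^bsub>x\<^esub> g)) w"
    unfolding mul_def by (induction w arbitrary: f f' g) (auto simp: algebra_simps)
qed

lemma mul_add_right: "f \<odot>\<^bsub>x\<^esub> (g + g') = (f \<odot>\<^bsub>x\<^esub> g) + (f \<odot>\<^bsub>x\<^esub> g')"
proof
  fix w show "(f \<odot>\<^bsub>x\<^esub> (g + g')) w = ((f \<odot>\<^bsub>x\<^esub> g) + (f \<odot>\<^bsub>x\<^esub> g')) w"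
    unfolding mul_def by (induction w arbitrary: f g g') (auto simp: algebra_simps)
qed

lemma mul_sc_left [simp]: "sc c f \<odot>\<^bsub>x\<^esub> g = sc c (f \<odot>\<^bsub>x\<^esub> g)"
proof
  fix w show "(sc c f \<odot>\<^bsub>x\<^esub> g) w = sc c (f \<odot>\<^bsub>x\<^esub> g) w"
    unfolding mul_def by (induction w arbitrary: f g) (auto simp: algebra_simps sc_apply)
qed

lemma mul_sc_right [simp]: "f \<odot>\<^bsub>x\<^esub> sc c g = sc c (f \<odot>\<^bsub>x\<^esub> g)"
proof
  fix w show "(f \<odot>\<^bsub>x\<^esub> sc c g) w = sc c (f \<odot>\<^bsub>x\<^esub> g) w"
    unfolding mul_def by (induction w arbitrary: f g) (auto simp: algebra_simps sc_apply)
qed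

lemma mul_zero [simp]: "0 \<odot>\<^bsub>x\<^esub> g = 0" "f \<odot>\<^bsub>x\<^esub> 0 = 0"
  using mul_sc_left[of 0 0 x g] mul_sc_right[of f x 0 0] by simp_all

lemma mul_minus: "(- f) \<odot>\<^bsub>x\<^esub> g = - (f \<odot>\<^bsub>x\<^esub> g)" "f \<odot>\<^bsub>x\<^esub> (- g) = - (f \<odot>\<^bsub>x\<^esub> g)"
  using mul_sc_left[of "-1" f x g] mul_sc_right[of f x "-1" g] by (simp_all add: sc_minus)

lemma mul_diff: "(f - f') \<odot>\<^bsub>x\<^esub> g = (f \<odot>\<^bsub>x\<^esub> g) - (f' \<odot>\<^bsub>x\<^esub> g)" "f \<odot>\<^bsub>x\<^esub> (g - g') = (f \<odot>\<^bsub>x\<^esub> g) - (f \<odot>\<^bsub>x\<^esub> g')"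
  using mul_add_left[of f "- f'" x g] mul_add_right[of f x g "- g'"] by (simp_all add: mul_minus)

lemma mul_one_left [simp]: "bas [] \<odot>\<^bsub>x\<^esub> f = f"
proof
  fix w show "(bas [] \<odot>\<^bsub>x\<^esub> f) w = f w"
    unfolding mul_def
  proof (induction w arbitrary: f)
    case (Cons j w)
    have "mulw x w 0 g = 0" for g using mul_zero(1)[of x g] by (simp add: mul_def fun_eq_iff)
    then show ?case using Cons by simp (simp add: Dl_def)
  qed (simp add: bas_def)
qed

lemma mul_one_right [simp]: "f \<odot>\<^bsub>x\<^esub> bas [] = f"
proof
  fix w show "(f \<odot>\<^bsub>x\<^esub> bas []) w = f w"
    unfolding mul_def
  proof (induction w arbitrary: f)
    case (Cons j w)
    have "mulw x w g 0 = 0" for g using mul_zero(2)[of g x] by (simp add: mul_def fun_eq_iff)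
    then show ?case using Cons by simp (simp add: Dl_def)
  qed (simp add: bas_def)
qed

lemma tw_mul: "tw x v (f \<odot>\<^bsub>x\<^esub> g) = tw x v f \<odot>\<^bsub>x\<^esub> tw x v g"
proof
  fix w show "tw x v (f \<odot>\<^bsub>x\<^esub> g) w = (tw x v f \<odot>\<^bsub>x\<^esub> tw x v g) w"
  proof (induction w arbitrary: f g)
    case Nil then show ?case by (simp add: tw_def)
  next
    case (Cons j w)
    have "tw x v (f \<odot>\<^bsub>x\<^esub> g) (j # w) = X v (x j) * tw x v (Dl j (f \<odot>\<^bsub>x\<^esub> g)) w"
      by (simp add: tw_def Dl_def X_add_right)
    also have "\<dots> = X v (x j) * ((tw x v (Dl j f) \<odot>\<^bsub>x\<^esub> tw x v (tw x (x j) g)) w + (tw x v f \<odot>\<^bsub>x\<^esub> tw x v (Dl j g)) w)"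
      by (simp only: Dl_mul tw_simps(1) plus_fun_apply Cons.IH)
    also have "\<dots> = Dl j (tw x v f \<odot>\<^bsub>x\<^esub> tw x v g) w"
      unfolding Dl_mul by (simp add: Dl_tw sc_apply algebra_simps)
    finally show ?case by (simp add: Dl_def)
  qed
qed

lemma mul_assoc: "(f \<odot>\<^bsub>x\<^esub> g) \<odot>\<^bsub>x\<^esub> h = f \<odot>\<^bsub>x\<^esub> (g \<odot>\<^bsub>x\<^esub> h)"
proof
  fix w show "((f \<odot>\<^bsub>x\<^esub> g) \<odot>\<^bsub>x\<^esub> h) w = (f \<odot>\<^bsub>x\<^esub> (g \<odot>\<^bsub>x\<^esub> h)) w"
  proof (induction w arbitrary: f g h)
    case Nil then show ?case by simp
  next
    case (Cons j w)
    have "Dl j ((f \<odot>\<^bsub>x\<^esub> g) \<odot>\<^bsub>x\<^esub> h) w = Dl j (f \<odot>\<^bsub>x\<^esub> (g \<odot>\<^bsub>x\<^esub> h)) w"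
      by (simp add: Dl_mul mul_add_left mul_add_right Cons.IH tw_mul)
    then show ?case by (simp add: Dl_def)
  qed
qed

text \<open>Left and right derivations commute, so the rule can be checked after applying some
  \<open>Dl i\<close>. In contrast to \<open>Dl_mul\<close> the twist falls on the left
  factor.\<close>

lemma Dr_mul: "Dr j (f \<odot>\<^bsub>x\<^esub> g) = (Dr j f \<odot>\<^bsub>x\<^esub> g) + (tw x (x j) f \<odot>\<^bsub>x\<^esub> Dr j g)"
proof
  have comm: "Dr j (Dl i f) = Dl i (Dr j f)" for i and f :: "nat list \<Rightarrow> 'k"
    by (simp add: Dr_def Dl_def)
  fix w show "Dr j (f \<odot>\<^bsub>x\<^esub> g) w = ((Dr j f \<odot>\<^bsub>x\<^esub> g) + (tw x (x j) f \<odot>\<^bsub>x\<^esub> Dr j g)) w"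
  proof (induction w arbitrary: f g)
    case Nil
    have "Dr j (f \<odot>\<^bsub>x\<^esub> g) [] = Dl j (f \<odot>\<^bsub>x\<^esub> g) []" by (simp add: Dr_def Dl_def)
    then show ?case by (simp add: Dl_mul) (simp add: Dr_def Dl_def tw_def)
  next
    case (Cons i w)
    have "Dr j (f \<odot>\<^bsub>x\<^esub> g) (i # w) = Dr j (Dl i (f \<odot>\<^bsub>x\<^esub> g)) w" by (simp add: Dr_def Dl_def)
    also have "\<dots> = Dl i ((Dr j f \<odot>\<^bsub>x\<^esub> g) + (tw x (x j) f \<odot>\<^bsub>x\<^esub> Dr j g)) w"
      by (simp add: Dl_mul Cons.IH comm Dr_tw Dl_tw X_sym[of "x i" "x j"] add.commute[of "x i" "x j"])
        (simp add: sc_apply algebra_simps)?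
    finally show ?case by (simp add: Dl_def)
  qed
qed

lemma hom_mul:
  assumes "hom x \<mu> f" "hom x \<nu> g" shows "hom x (\<mu> + \<nu>) (f \<odot>\<^bsub>x\<^esub> g)"
proof -
  have "(f \<odot>\<^bsub>x\<^esub> g) w \<noteq> 0 \<Longrightarrow> wv x w = \<mu> + \<nu>" for w
    using assms
  proof (induction w arbitrary: f g \<mu> \<nu>)
    case Nil then show ?case by (auto simp: hom_def) force
  next
    case (Cons j w)
    then have "Dl j (f \<odot>\<^bsub>x\<^esub> g) w \<noteq> 0" by (simp add: Dl_def)
    then consider "(Dl j f \<odot>\<^bsub>x\<^esub> tw x (x j) g) w \<noteq> 0" | "(f \<odot>\<^bsub>x\<^esub> Dl j g) w \<noteq> 0"
      unfolding Dl_mul by force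
    then show ?case
    proof cases
      case 1
      then have "wv x w = \<mu> - x j + \<nu>" using Cons.IH[OF 1] Cons.prems hom_Dl hom_tw by blast
      then show ?thesis by simp
    next
      case 2
      then have "wv x w = \<mu> + (\<nu> - x j)" using Cons.IH[OF 2] Cons.prems hom_Dl by blast
      then show ?thesis by simp
    qed
  qed
  then show ?thesis by (auto simp: hom_def)
qed

lemma mul_support:
  "(f \<odot>\<^bsub>x\<^esub> g) w \<noteq> 0 \<Longrightarrow> \<exists>u v. w \<in> shuffles u v \<and> f u \<noteq> 0 \<and> g v \<noteq> 0"
proof (induction w arbitrary: f g)
  case Nil then show ?case by (intro exI[of _ "[]"]) auto
next
  case (Cons j w)
  then have "Dl j (f \<odot>\<^bsub>x\<^esub> g) w \<noteq> 0" by (simp add: Dl_def)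
  then consider "(Dl j f \<odot>\<^bsub>x\<^esub> tw x (x j) g) w \<noteq> 0" | "(f \<odot>\<^bsub>x\<^esub> Dl j g) w \<noteq> 0"
    unfolding Dl_mul by force
  then show ?case
  proof cases
    case 1
    from Cons.IH[OF 1] obtain u v where "w \<in> shuffles u v" "Dl j f u \<noteq> 0" "tw x (x j) g v \<noteq> 0" by blast
    then show ?thesis
      by (intro exI[of _ "j # u"] exI[of _ v]) (auto simp: Dl_def tw_def Cons_in_shuffles_leftI)
  next
    case 2
    from Cons.IH[OF 2] obtain u v where "w \<in> shuffles u v" "f u \<noteq> 0" "Dl j g v \<noteq> 0" by blast
    then show ?thesis
      by (intro exI[of _ u] exI[of _ "j # v"]) (auto simp: Dl_def Cons_in_shuffles_rightI)
  qed
qed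

text \<open>The image of the monomial with word w in the generators of the positive half.\<close>

primrec Xi :: "(nat \<Rightarrow> 'v) \<Rightarrow> nat list \<Rightarrow> nat list \<Rightarrow> 'k" where
  "Xi x [] = bas []"
| "Xi x (j # w) = bas [j] \<odot>\<^bsub>x\<^esub> Xi x w"

lemma Xi_append: "Xi x (u @ w) = Xi x u \<odot>\<^bsub>x\<^esub> Xi x w"
  by (induction u) (auto simp: mul_assoc)

lemma hom_Xi: "hom x (wv x w) (Xi x w)"
proof (induction w)
  case Nil then show ?case using hom_bas[of x "[]"] by simp
next
  case (Cons j w) then show ?case using hom_mul[OF hom_bas[of x "[j]"]] by fastforce
qed

lemma Xi_support: "Xi x w u \<noteq> 0 \<Longrightarrow> mset u = mset w"
proof (induction w arbitrary: u)
  case Nil then show ?case by (auto simp: bas_def split: if_splits)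
next
  case (Cons j w)
  then obtain a b where "u \<in> shuffles a b" "bas [j] a \<noteq> (0::'k)" "Xi x w b \<noteq> 0"
    using mul_support by force
  moreover have "z \<in> shuffles p q \<Longrightarrow> mset z = mset p + mset q" for z p q :: "nat list"
    by (induction p q arbitrary: z rule: shuffles.induct) auto
  ultimately show ?case using Cons.IH[of b] by (auto simp: bas_def split: if_splits)
qed

text \<open>Removing the first letter on the left of the word, or on the index side, yields the same
  recursion; hence the matrix of the elements \<open>Xi\<close> is symmetric.\<close>

lemma Dl_bas_mul: "Dl j (bas [i] \<odot>\<^bsub>x\<^esub> f) = (if i = j then tw x (x j) f else 0) + (bas [i] \<odot>\<^bsub>x\<^esub> Dl j f)"
  by (simp add: Dl_mul Dl_bas)

lemma Xi_bas_sum: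
  "(bas [i] \<odot>\<^bsub>x\<^esub> f) v = (\<Sum>k<length v. if v ! k = i then X (x i) (wv x (drop (Suc k) v)) * f (take k v @ drop (Suc k) v) else 0)"
proof (induction v arbitrary: f)
  case Nil then show ?case by (simp add: bas_def)
next
  case (Cons j v)
  have "(bas [i] \<odot>\<^bsub>x\<^esub> f) (j # v) = Dl j (bas [i] \<odot>\<^bsub>x\<^esub> f) v" by (simp add: Dl_def)
  also have "\<dots> = (if j = i then X (x i) (wv x v) * f v else 0) + (bas [i] \<odot>\<^bsub>x\<^esub> Dl j f) v"
    by (simp add: Dl_bas_mul tw_def)
  also have "\<dots> = (\<Sum>k<length (j # v). if (j # v) ! k = i then X (x i) (wv x (drop (Suc k) (j # v))) * f (take k (j # v) @ drop (Suc k) (j # v)) else 0)"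
    unfolding Cons.IH length_Cons sum.lessThan_Suc_shift by (simp add: Dl_def cong: if_cong)
  finally show ?case .
qed

lemma Dl_Xi:
  "Dl j (Xi x w) v = (\<Sum>k<length w. if w ! k = j then X (x j) (wv x (drop (Suc k) w)) * Xi x (take k w @ drop (Suc k) w) v else 0)"
proof (induction w arbitrary: v)
  case Nil then show ?case by simp
next
  case (Cons i w)
  have "(bas [i] \<odot>\<^bsub>x\<^esub> Dl j (Xi x w)) v =
    (\<Sum>k<length w. if w ! k = j then X (x j) (wv x (drop (Suc k) w)) * (bas [i] \<odot>\<^bsub>x\<^esub> Xi x (take k w @ drop (Suc k) w)) v else 0)"
  proof -
    have "(bas [i] \<odot>\<^bsub>x\<^esub> Dl j (Xi x w)) v = (\<Sum>n<length v. if v ! n = i then X (x i) (wv x (drop (Suc n) v)) *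
      (\<Sum>k<length w. if w ! k = j then X (x j) (wv x (drop (Suc k) w)) * Xi x (take k w @ drop (Suc k) w) (take n v @ drop (Suc n) v) else 0) else 0)"
      by (simp only: Xi_bas_sum Cons.IH)
    also have "\<dots> = (\<Sum>n<length v. (\<Sum>k<length w. if w ! k = j then X (x j) (wv x (drop (Suc k) w)) *
       (if v ! n = i then X (x i) (wv x (drop (Suc n) v)) * Xi x (take k w @ drop (Suc k) w) (take n v @ drop (Suc n) v) else 0) else 0))"
    proof (intro sum.cong refl)
      fix n
      have r: "(if P then A * (\<Sum>k<length w. if Q k then B k * C k else 0) else 0) =
         (\<Sum>k<length w. if Q k then B k * (if P then A * C k else 0) else 0)" for P Q A and B C :: "nat \<Rightarrow> 'k"
        by (cases P) (auto simp: sum_distrib_left intro!: sum.cong sum.neutral)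
      show "(if v ! n = i then X (x i) (wv x (drop (Suc n) v)) *
      (\<Sum>k<length w. if w ! k = j then X (x j) (wv x (drop (Suc k) w)) * Xi x (take k w @ drop (Suc k) w) (take n v @ drop (Suc n) v) else 0) else 0) =
       (\<Sum>k<length w. if w ! k = j then X (x j) (wv x (drop (Suc k) w)) *
       (if v ! n = i then X (x i) (wv x (drop (Suc n) v)) * Xi x (take k w @ drop (Suc k) w) (take n v @ drop (Suc n) v) else 0) else 0)"
        by (rule r)
    qed
    also have "\<dots> = (\<Sum>k<length w. (\<Sum>n<length v. if w ! k = j then X (x j) (wv x (drop (Suc k) w)) *
       (if v ! n = i then X (x i) (wv x (drop (Suc n) v)) * Xi x (take k w @ drop (Suc k) w) (take n v @ drop (Suc n) v) else 0) else 0))"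
      by (rule sum.swap)
    also have "\<dots> = (\<Sum>k<length w. if w ! k = j then X (x j) (wv x (drop (Suc k) w)) * (bas [i] \<odot>\<^bsub>x\<^esub> Xi x (take k w @ drop (Suc k) w)) v else 0)"
      by (intro sum.cong refl) (auto simp: Xi_bas_sum sum_distrib_left)
    finally show ?thesis .
  qed
  then show ?case unfolding length_Cons sum.lessThan_Suc_shift
    by (simp add: Dl_bas_mul cong: if_cong) (auto simp: tw_hom[OF hom_Xi] sc_apply)
qed

lemma Xi_sym: "Xi x w v = Xi x v w"
proof (induction "length v" arbitrary: v w)
  case 0
  show ?case
  proof (cases w)
    case (Cons a w')
    then have "Xi x w [] = 0" using Xi_support[of x w "[]"] by fastforce
    then show ?thesis using 0 Cons by (simp add: bas_def)
  qed (use 0 in simp)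
next
  case (Suc n)
  then obtain j v' where v: "v = j # v'" by (cases v) auto
  have "Xi x w v = Dl j (Xi x w) v'" by (simp add: Dl_def v)
  also have "\<dots> = (\<Sum>k<length w. if w ! k = j then X (x j) (wv x (drop (Suc k) w)) * Xi x v' (take k w @ drop (Suc k) w) else 0)"
    unfolding Dl_Xi using Suc v by (intro sum.cong refl) auto
  also have "\<dots> = Xi x v w" unfolding v Xi.simps Xi_bas_sum ..
  finally show ?case .
qed

end

subsection \<open>Spans\<close>

definition lspan :: "(nat list \<Rightarrow> 'k::comm_ring_1) set \<Rightarrow> (nat list \<Rightarrow> 'k) set" where
  "lspan A = {sum_list (map (\<lambda>(c, a). sc c a) ps) |ps. snd ` set ps \<subseteq> A}"

lemma lspan_zero [simp]: "0 \<in> lspan A"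
  unfolding lspan_def by (intro CollectI exI[of _ "[]"]) simp

lemma lspan_add_base: "a \<in> A \<Longrightarrow> f \<in> lspan A \<Longrightarrow> sc c a + f \<in> lspan A"
  unfolding lspan_def by clarify (rule_tac x = "(c, a) # ps" in exI, auto)

lemma lspan_induct [consumes 1, case_names zero add, induct set: lspan]:
  assumes "f \<in> lspan A" "P 0" "\<And>a f c. a \<in> A \<Longrightarrow> f \<in> lspan A \<Longrightarrow> P f \<Longrightarrow> P (sc c a + f)"
  shows "P f"
proof -
  have "snd ` set ps \<subseteq> A \<Longrightarrow> P (sum_list (map (\<lambda>(c, a). sc c a) ps))" for ps
  proof (induction ps)
    case (Cons p ps)
    obtain c a where p: "p = (c, a)" by (cases p)
    have "sum_list (map (\<lambda>(c, a). sc c a) ps) \<in> lspan A" using Cons.prems by (auto simp: lspan_def)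
    moreover have "a \<in> A" "P (sum_list (map (\<lambda>(c, a). sc c a) ps))" using Cons p by auto
    ultimately have "P (sc c a + sum_list (map (\<lambda>(c, a). sc c a) ps))" by (intro assms(3))
    then show ?case by (simp only: p list.map sum_list.Cons prod.case)
  qed (use assms(2) in simp)
  then show ?thesis using assms(1) by (auto simp: lspan_def)
qed

lemma lspan_base: "a \<in> A \<Longrightarrow> a \<in> lspan A"
  using lspan_add_base[of a A 0 1, OF _ lspan_zero] by (simp only: sc_simps add_0_right)

lemma lspan_add: "f \<in> lspan A \<Longrightarrow> g \<in> lspan A \<Longrightarrow> f + g \<in> lspan A"
  by (induction rule: lspan_induct) (simp_all only: add.assoc add_0 lspan_add_base)

lemma lspan_sc: "f \<in> lspan A \<Longrightarrow> sc c f \<in> lspan A"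
  by (induction rule: lspan_induct) (simp_all only: sc_simps lspan_zero lspan_add_base)

lemma lspan_diff: "f \<in> lspan A \<Longrightarrow> g \<in> lspan A \<Longrightarrow> f - g \<in> lspan A"
  using lspan_add[of f A "sc (-1) g"] lspan_sc[of g A "-1"] by (simp add: sc_minus)

lemma lspan_sum: "(\<And>i. i \<in> I \<Longrightarrow> f i \<in> lspan A) \<Longrightarrow> sum f I \<in> lspan A"
  by (induction I rule: infinite_finite_induct) (simp_all add: lspan_add del: plus_fun_apply)

lemma lspan_subset: "(\<And>a. a \<in> A \<Longrightarrow> a \<in> lspan B) \<Longrightarrow> f \<in> lspan A \<Longrightarrow> f \<in> lspan B"
proof (rotate_tac, induction rule: lspan_induct)
  case (add a f c) then show ?case by (intro lspan_add lspan_sc) auto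
qed simp

lemma lspan_mono: "A \<subseteq> B \<Longrightarrow> f \<in> lspan A \<Longrightarrow> f \<in> lspan B"
  using lspan_subset lspan_base by blast

lemma lspan_linear:
  assumes "f \<in> lspan A" "F 0 = 0" "\<And>g h. F (g + h) = F g + F h" "\<And>c g. F (sc c g) = sc c (F g)"
    and "\<And>a. a \<in> A \<Longrightarrow> F a \<in> lspan B"
  shows "F f \<in> lspan B"
  using assms(1)
proof induction
  case (add a f c)
  show ?case unfolding assms(3,4) by (rule lspan_add[OF lspan_sc[OF assms(5)[OF add(1)]] add(3)])
qed (simp only: assms(2) lspan_zero)

lemma lspan_vanish:
  assumes "f \<in> lspan A" "\<And>a. a \<in> A \<Longrightarrow> a w = 0" shows "f w = 0"
  using assms(1) by induction (auto simp: assms sc_apply)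

lemma lspan_finite_sum:
  assumes "f \<in> lspan (r ` A)"
  shows "\<exists>S c. finite S \<and> S \<subseteq> A \<and> f = (\<Sum>k\<in>S. sc (c k) (r k))"
  using assms
proof induction
  case zero then show ?case by (intro exI[of _ "{}"]) auto
next
  case (add a f c)
  then obtain S d k where S: "finite S" "S \<subseteq> A" "f = (\<Sum>k\<in>S. sc (d k) (r k))" "a = r k" "k \<in> A" by auto
  define d' where "d' = (\<lambda>l. (if l \<in> S then d l else 0) + (if l = k then c else 0))"
  have "(\<Sum>l\<in>insert k S. sc (d' l) (r l)) =
    (\<Sum>l\<in>insert k S. sc (if l \<in> S then d l else 0) (r l)) + (\<Sum>l\<in>insert k S. sc (if l = k then c else 0) (r l))"
    by (simp add: d'_def sc_left_distrib sum.distrib)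
  also have "(\<Sum>l\<in>insert k S. sc (if l \<in> S then d l else 0) (r l)) = (\<Sum>l\<in>S. sc (d l) (r l))"
    using S by (intro sum.mono_neutral_cong_right) auto
  also have "(\<Sum>l\<in>insert k S. sc (if l = k then c else 0) (r l)) = (\<Sum>l\<in>{k}. sc c (r l))"
    using S by (intro sum.mono_neutral_cong_right) auto
  finally have "sc c a + f = (\<Sum>l\<in>insert k S. sc (d' l) (r l))" by (simp only: S(3,4) add.commute sum.insert finite.emptyI sum.empty empty_iff not_False_eq_True add_0_left add_0_right)
  then show ?case unfolding S(3,4) using S(1,2,5)
    by (intro exI[of _ "insert k S"] exI[of _ d'] conjI) (simp_all only: finite_insert insert_subset)
qed

text \<open>S may have infinite dimension; only the finitely many coordinates in A matter. Induction
  on A: if some g in S vanishes on A but not at b, the coordinate at b enters with coefficient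
  \<open>\<phi> g / g b\<close>; otherwise it is redundant on S and gets 0.\<close>

lemma functional_span:
  fixes \<phi> :: "(nat list \<Rightarrow> 'k::field) \<Rightarrow> 'k"
  assumes "finite A"
    and S: "\<And>f g. f \<in> S \<Longrightarrow> g \<in> S \<Longrightarrow> f + g \<in> S" "\<And>c f. f \<in> S \<Longrightarrow> sc c f \<in> S"
    and "\<And>f. f \<in> S \<Longrightarrow> (\<And>a. a \<in> A \<Longrightarrow> f a = 0) \<Longrightarrow> \<phi> f = 0"
    and "\<And>f g. \<phi> (f + g) = \<phi> f + \<phi> g" "\<And>c f. \<phi> (sc c f) = c * \<phi> f"
  shows "\<exists>c. \<forall>f\<in>S. \<phi> f = (\<Sum>a\<in>A. c a * f a)"
  using assms(1,4-)
proof (induction A arbitrary: \<phi>)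
  case empty then show ?case by simp
next
  case (insert b A)
  show ?case
  proof (cases "\<exists>g\<in>S. (\<forall>a\<in>A. g a = 0) \<and> g b \<noteq> 0")
    case True
    then obtain g where g: "g \<in> S" "\<forall>a\<in>A. g a = 0" "g b \<noteq> 0" by blast
    define d where "d = \<phi> g / g b"
    define \<psi> where "\<psi> = (\<lambda>f. \<phi> f - d * f b)"
    have "\<exists>c. \<forall>f\<in>S. \<psi> f = (\<Sum>a\<in>A. c a * f a)"
    proof (rule insert.IH)
      fix f assume f: "f \<in> S" "\<And>a. a \<in> A \<Longrightarrow> f a = 0"
      let ?h = "f + sc (- (f b / g b)) g"
      have "?h \<in> S" using f g S by blast
      moreover have "?h a = 0" if "a \<in> insert b A" for a
        using that f(2)[of a] g(2,3) by (auto simp: sc_apply)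
      ultimately have "\<phi> ?h = 0" by (rule insert.prems(1))
      moreover have "\<phi> ?h = \<phi> f + (- (f b / g b)) * \<phi> g" by (simp only: insert.prems(2,3))
      ultimately show "\<psi> f = 0" by (simp add: \<psi>_def d_def)
    qed (use insert.prems in \<open>auto simp: \<psi>_def algebra_simps sc_apply\<close>)
    then obtain c where c: "\<forall>f\<in>S. \<psi> f = (\<Sum>a\<in>A. c a * f a)" by blast
    have "\<phi> f = (\<Sum>a\<in>insert b A. (c(b := d)) a * f a)" if "f \<in> S" for f
    proof -
      have "(\<Sum>a\<in>A. (c(b := d)) a * f a) = (\<Sum>a\<in>A. c a * f a)" using insert.hyps by (intro sum.cong) auto
      then show ?thesis using c that insert.hyps by (simp add: \<psi>_def algebra_simps)
    qed
    then show ?thesis by blast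
  next
    case False
    have "\<exists>c. \<forall>f\<in>S. \<phi> f = (\<Sum>a\<in>A. c a * f a)"
    proof (rule insert.IH)
      fix f assume f: "f \<in> S" "\<And>a. a \<in> A \<Longrightarrow> f a = 0"
      then have "f a = 0" if "a \<in> insert b A" for a using that False by auto
      then show "\<phi> f = 0" using insert.prems(1) f(1) by blast
    qed (fact insert.prems)+
    then obtain c where c: "\<forall>f\<in>S. \<phi> f = (\<Sum>a\<in>A. c a * f a)" by blast
    have "\<phi> f = (\<Sum>a\<in>insert b A. (c(b := 0)) a * f a)" if "f \<in> S" for f
    proof -
      have "(\<Sum>a\<in>A. (c(b := 0)) a * f a) = (\<Sum>a\<in>A. c a * f a)" using insert.hyps by (intro sum.cong) auto
      then show ?thesis using c that insert.hyps by simp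
    qed
    then show ?thesis by blast
  qed
qed

text \<open>As simp rules these are applied below equations between functions and eta-expand them.\<close>

declare plus_fun_apply [simp del] zero_fun_apply [simp del] minus_apply [simp del]

lemmas fun_pw = plus_fun_apply zero_fun_apply minus_apply sc_apply

lemma ext_Dr:
  assumes "f [] = g []" "\<And>j. Dr j f = Dr j g" shows "f = g"
proof
  fix w show "f w = g w"
    using assms(1) fun_cong[OF assms(2)] by (cases w rule: rev_cases) (auto simp: Dr_def)
qed

lemma Dr_pow_zero [simp]: "(Dr i ^^ t) 0 = (0 :: nat list \<Rightarrow> 'k::comm_ring_1)"
  by (induction t) auto

lemma Dr_pow_add: "(Dr i ^^ t) (f + g) = (Dr i ^^ t) f + (Dr i ^^ t) (g :: nat list \<Rightarrow> 'k::comm_ring_1)"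
  by (induction t) auto

lemma Dr_pow_sc: "(Dr i ^^ t) (sc c f) = sc c ((Dr i ^^ t) (f :: nat list \<Rightarrow> 'k::comm_ring_1))"
  by (induction t) auto

lemma Dr_diff: "Dr j (f - g) = Dr j f - (Dr j g :: nat list \<Rightarrow> 'k::comm_ring_1)"
  by (auto simp: Dr_def fun_eq_iff fun_pw)

lemma Dr_pow_apply: "(Dr i ^^ t) f w = f (w @ replicate t i)"
proof (induction t arbitrary: w)
  case (Suc t) then show ?case by (simp add: Dr_def replicate_append_same)
qed simp

lemma Dr_sum: "Dr j (sum F I) = (\<Sum>k\<in>I. Dr j (F k :: nat list \<Rightarrow> 'k::comm_ring_1))"
  by (induction I rule: infinite_finite_induct) simp_all

lemma Dr_pow_sum: "(Dr j ^^ t) (sum F I) = (\<Sum>k\<in>I. (Dr j ^^ t) (F k :: nat list \<Rightarrow> 'k::comm_ring_1))"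
  by (induction t) (simp_all add: Dr_sum)

section \<open>Quantum integers and the subalgebra generated by the letters\<close>

definition qn :: "'k::field \<Rightarrow> nat \<Rightarrow> 'k" where "qn Q t = (\<Sum>r<t. Q ^ r)"

lemma qn_simps [simp]: "qn Q 0 = 0" "qn Q (Suc 0) = 1"
  by (auto simp: qn_def)

lemma qn_Suc: "qn Q (Suc t) = qn Q t + Q ^ t" by (simp add: qn_def)

lemma qn_Suc': "qn Q (Suc t) = 1 + Q * qn Q t"
  by (simp add: qn_def sum.lessThan_Suc_shift sum_distrib_left del: sum.lessThan_Suc)

lemma qn_inverse: "Q \<noteq> 0 \<Longrightarrow> (\<Sum>r<Suc t. inverse Q ^ r) = inverse Q ^ t * qn Q (Suc t)"
proof (induction t)
  case (Suc t)
  have "(\<Sum>r<Suc (Suc t). inverse Q ^ r) = inverse Q ^ t * qn Q (Suc t) + inverse Q ^ Suc t"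
    using Suc by simp
  also have "\<dots> = inverse Q ^ Suc t * (Q * qn Q (Suc t) + 1)" using Suc(2) by (simp add: field_simps)
  also have "\<dots> = inverse Q ^ Suc t * qn Q (Suc (Suc t))" by (simp only: qn_Suc'[of Q "Suc t"] add.commute)
  finally show ?case .
qed simp

context bichar
begin

lemma tw_diff: "tw x v (f - g) = tw x v f - tw x v g"
  by (auto simp: tw_def fun_eq_iff fun_pw algebra_simps)

text \<open>For the simple system of a datum this is the image of the positive half;
  \<open>UU_V\<close> identifies it with \<open>UU D\<close>.\<close>

definition U :: "nat \<Rightarrow> (nat \<Rightarrow> 'v) \<Rightarrow> (nat list \<Rightarrow> 'k) set" where
  "U n x = lspan (Xi x ` lists {..<n})"

lemma Xi_U: "set w \<subseteq> {..<n} \<Longrightarrow> Xi x w \<in> U n x"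
  unfolding U_def by (intro lspan_base) auto

lemma bas_U: "j < n \<Longrightarrow> bas [j] \<in> U n x" using Xi_U[of "[j]" n x] by simp

lemma one_U: "bas [] \<in> U n x" using Xi_U[of "[]" n x] by simp

lemma U_add: "f \<in> U n x \<Longrightarrow> g \<in> U n x \<Longrightarrow> f + g \<in> U n x" unfolding U_def by (rule lspan_add)
lemma U_sc: "f \<in> U n x \<Longrightarrow> sc c f \<in> U n x" unfolding U_def by (rule lspan_sc)
lemma U_diff: "f \<in> U n x \<Longrightarrow> g \<in> U n x \<Longrightarrow> f - g \<in> U n x" unfolding U_def by (rule lspan_diff)
lemma U_zero: "0 \<in> U n x" by (simp add: U_def)

lemma lspan_mul:
  assumes "f \<in> lspan A" "g \<in> lspan B" "\<And>a b. a \<in> A \<Longrightarrow> b \<in> B \<Longrightarrow> a \<odot>\<^bsub>x\<^esub> b \<in> lspan C"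
  shows "f \<odot>\<^bsub>x\<^esub> g \<in> lspan C"
proof (rule lspan_linear[OF assms(1), where F = "\<lambda>f. f \<odot>\<^bsub>x\<^esub> g"])
  fix a assume a: "a \<in> A"
  show "a \<odot>\<^bsub>x\<^esub> g \<in> lspan C"
    by (rule lspan_linear[OF assms(2), where F = "\<lambda>g. a \<odot>\<^bsub>x\<^esub> g"]) (auto simp: mul_add_right intro: assms(3) a)
qed (simp_all add: mul_add_left)

lemma U_mul: "f \<in> U n x \<Longrightarrow> g \<in> U n x \<Longrightarrow> f \<odot>\<^bsub>x\<^esub> g \<in> U n x"
  unfolding U_def by (erule lspan_mul, assumption) (force simp: Xi_append[symmetric] intro: lspan_base)

lemma U_tw:
  assumes "f \<in> U n x" shows "tw x v f \<in> U n x"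
  unfolding U_def
  by (rule lspan_linear[OF assms[unfolded U_def], where F = "tw x v"])
     (force simp: tw_hom[OF hom_Xi] intro: lspan_sc lspan_base)+

lemma U_Dr:
  assumes "f \<in> U n x" shows "Dr j f \<in> U n x"
  unfolding U_def
proof (rule lspan_linear[OF assms[unfolded U_def], where F = "Dr j"])
  have "set w \<subseteq> {..<n} \<Longrightarrow> Dr j (Xi x w) \<in> U n x" for w
  proof (induction w)
    case Nil then show ?case by (simp add: U_zero)
  next
    case (Cons k w)
    have "Dr j (Xi x (k # w)) = (if k = j then Xi x w else 0) + sc (X (x j) (x k)) (bas [k] \<odot>\<^bsub>x\<^esub> Dr j (Xi x w))"
      by (simp add: Dr_mul Dr_bas1)
    moreover have "(if k = j then Xi x w else 0) \<in> U n x" using Cons.prems by (auto intro: Xi_U U_zero)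
    moreover have "sc (X (x j) (x k)) (bas [k] \<odot>\<^bsub>x\<^esub> Dr j (Xi x w)) \<in> U n x"
      using Cons by (intro U_sc U_mul bas_U) auto
    ultimately show ?case by (simp only: U_add)
  qed
  then show "\<And>a. a \<in> Xi x ` lists {..<n} \<Longrightarrow> Dr j a \<in> lspan (Xi x ` lists {..<n})"
    by (auto simp: U_def)
qed simp_all

lemma U_letters: "f \<in> U n x \<Longrightarrow> f w \<noteq> 0 \<Longrightarrow> set w \<subseteq> {..<n}"
proof (rule ccontr)
  assume f: "f \<in> U n x" "f w \<noteq> 0" and n: "\<not> set w \<subseteq> {..<n}"
  have "f w = 0" using f(1) unfolding U_def
  proof (rule lspan_vanish)
    fix a assume "a \<in> Xi x ` lists {..<n}"
    then obtain u where u: "a = Xi x u" "set u \<subseteq> {..<n}" by auto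
    show "a w = 0" using Xi_support[of x u w] u n by (metis set_mset_mset)
  qed
  then show False using f by simp
qed

lemma U_bounded: "f \<in> U n x \<Longrightarrow> \<exists>N. \<forall>w. f w \<noteq> 0 \<longrightarrow> length w \<le> N"
  unfolding U_def
proof (induction rule: lspan_induct)
  case zero then show ?case by (simp add: fun_pw)
next
  case (add a f c)
  then obtain N u where N: "\<forall>w. f w \<noteq> 0 \<longrightarrow> length w \<le> N" "a = Xi x u" by auto
  have "length w \<le> max N (length u)" if "(sc c a + f) w \<noteq> 0" for w
  proof (cases "a w = 0")
    case True then show ?thesis using that N by (force simp: fun_pw)
  next
    case False
    then have "mset w = mset u" using Xi_support N by blast
    then have "length w = length u" by (rule mset_eq_length)
    then show ?thesis by simp
  qed
  then show ?case by blast
qed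

lemma U_Dr_ge: "f \<in> U n x \<Longrightarrow> \<not> j < n \<Longrightarrow> Dr j f = 0"
  using U_letters[of f n x] by (fastforce simp: Dr_def fun_eq_iff fun_pw)

abbreviation pw :: "(nat \<Rightarrow> 'v) \<Rightarrow> nat \<Rightarrow> nat \<Rightarrow> nat list \<Rightarrow> 'k" where
  "pw x i k \<equiv> Xi x (replicate k i)"

lemma pw_commute: "bas [i] \<odot>\<^bsub>x\<^esub> pw x i k = pw x i (Suc k)" "pw x i k \<odot>\<^bsub>x\<^esub> bas [i] = pw x i (Suc k)"
  using Xi_append[of x "replicate k i" "[i]"] by (simp_all add: replicate_append_same)

lemma Dr_pw_ne: "j \<noteq> i \<Longrightarrow> Dr j (pw x i k) = 0"
  by (induction k) (simp_all add: Dr_mul Dr_bas1)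

lemma Dr_pw: "Dr i (pw x i k) = sc (qn (X (x i) (x i)) k) (pw x i (k - 1))"
proof (induction k)
  case (Suc k)
  have "Dr i (pw x i (Suc k)) = pw x i k + sc (X (x i) (x i)) (bas [i] \<odot>\<^bsub>x\<^esub> Dr i (pw x i k))"
    by (simp add: Dr_mul Dr_bas1)
  also have "sc (X (x i) (x i)) (bas [i] \<odot>\<^bsub>x\<^esub> Dr i (pw x i k)) = sc (X (x i) (x i) * qn (X (x i) (x i)) k) (pw x i k)"
    unfolding Suc by (cases k) (simp_all add: pw_commute del: Xi.simps replicate.simps)
  finally show ?case by (simp add: qn_Suc' sc_left_distrib del: Xi.simps replicate.simps)
qed simp

text \<open>Constant words are thus divided powers, and a power of i vanishes exactly when one of
  its quantum integers does; for isotropic i this happens from the square on.\<close>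

lemma pw_eq: "pw x i k = sc (\<Prod>r=1..k. qn (X (x i) (x i)) r) (bas (replicate k i))"
proof (induction k)
  case (Suc k)
  show ?case
  proof (rule ext_Dr)
    have "(pw x i (Suc k)) [] = 0" by (simp add: bas_def)
    then show "(pw x i (Suc k)) [] = sc (\<Prod>r=1..Suc k. qn (X (x i) (x i)) r) (bas (replicate (Suc k) i)) []"
      by (simp add: sc_apply bas_def)
    fix j
    have r: "replicate (Suc k) i = replicate k i @ [i]" by (simp add: replicate_append_same)
    show "Dr j (pw x i (Suc k)) = Dr j (sc (\<Prod>r=1..Suc k. qn (X (x i) (x i)) r) (bas (replicate (Suc k) i)))"
    proof (cases "j = i")
      case True
      have "Dr i (pw x i (Suc k)) = sc (qn (X (x i) (x i)) (Suc k)) (pw x i k)" by (simp only: Dr_pw diff_Suc_1)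
      then show ?thesis unfolding True Suc r Dr_simps Dr_bas by (simp add: mult.commute)
    next
      case False
      have "Dr j (sc c (bas (replicate (Suc k) i))) = 0" for c :: 'k
        using False unfolding r Dr_simps Dr_bas by simp
      then show ?thesis unfolding Dr_pw_ne[OF False] by simp
    qed
  qed
qed simp

end

text \<open>The conditions on \<open>m j\<close> say that it is the largest \<open>k\<close> for which the \<open>k\<close>-fold bracket of \<open>i\<close> with
  \<open>j\<close> is nonzero, that is, the Cartan integer (with \<open>0\<close> or \<open>1\<close> in case \<open>x i\<close> is isotropic).\<close>

locale refl = bichar X for X :: "'v::ab_group_add \<Rightarrow> 'v \<Rightarrow> 'k::field" +
  fixes x :: "nat \<Rightarrow> 'v" and n i :: nat and m :: "nat \<Rightarrow> nat"
  assumes i_less: "i < n"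
    and Q_cases: "X (x i) (x i) = - 1 \<or> (\<forall>t>0. qn (X (x i) (x i)) t \<noteq> 0)"
    and m_below: "\<And>j t. j < n \<Longrightarrow> j \<noteq> i \<Longrightarrow> t < m j \<Longrightarrow> qn (X (x i) (x i)) (Suc t) \<noteq> 0 \<and> X (x i) (x i) ^ t * X (x i) (x j) ^ 2 \<noteq> 1"
    and m_top: "\<And>j. j < n \<Longrightarrow> j \<noteq> i \<Longrightarrow> qn (X (x i) (x i)) (Suc (m j)) = 0 \<or> X (x i) (x i) ^ m j * X (x i) (x j) ^ 2 = 1"
    and m_above: "\<And>j t. j < n \<Longrightarrow> j \<noteq> i \<Longrightarrow> t < m j \<Longrightarrow> X (x i) (x i) ^ (2 * m j - t) * X (x i) (x j) ^ 2 \<noteq> 1"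
begin

abbreviation Q where "Q \<equiv> X (x i) (x i)"
abbreviation ioi where "ioi \<equiv> bas [i] :: nat list \<Rightarrow> 'k"
abbreviation mul_x (infixl "\<odot>" 70) where "f \<odot> g \<equiv> f \<odot>\<^bsub>x\<^esub> g"

text \<open>For y of weight \<mu> this is the braided commutator of i and y with coefficient
  \<open>X (x i) \<mu>\<close> inverted. With this choice the two copies of y in
  \<open>Dr i (ad y)\<close> cancel, so that \<open>ad\<close> preserves the kernel of
  \<open>Dr i\<close>.\<close>

definition ad :: "(nat list \<Rightarrow> 'k) \<Rightarrow> nat list \<Rightarrow> 'k" where
  "ad y = (ioi \<odot> y) - (tw x (- x i) y \<odot> ioi)"

text \<open>The reflected simple system in the same weight group; for isotropic \<open>x i\<close>
  it is the odd reflection.\<close>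

definition x' :: "nat \<Rightarrow> 'v" where
  "x' j = (if j = i then - x i else x j + wv x (replicate (m j) i))"

definition Op :: "nat \<Rightarrow> (nat list \<Rightarrow> 'k) \<Rightarrow> nat list \<Rightarrow> 'k" where
  "Op j y = (if j = i then ad y else (Dr i ^^ m j) (Dr j y))"

text \<open>The reflection map: the coefficient of a word is obtained by applying the operators of its letters,
  which are the right derivations of the reflected system.\<close>

definition Th :: "(nat list \<Rightarrow> 'k) \<Rightarrow> nat list \<Rightarrow> 'k" where
  "Th y = (\<lambda>w. foldr Op w y [])"

lemma X_wv_replicate: "X (wv x (replicate k i)) c = X (x i) c ^ k" "X c (wv x (replicate k i)) = X c (x i) ^ k"
  by (induction k) (auto simp: X_add_left X_add_right)

lemma ad_add: "ad (f + g) = ad f + ad g" by (simp add: ad_def mul_add_left mul_add_right)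
lemma ad_sc: "ad (sc c f) = sc c (ad f)" by (simp add: ad_def sc_minus)
lemma ad_zero [simp]: "ad 0 = 0" by (simp add: ad_def)
lemma ad_one [simp]: "ad (bas []) = 0" by (simp add: ad_def)
lemma ad_Nil [simp]: "ad f [] = 0" by (simp add: ad_def fun_pw) (simp add: bas_def)

lemma Dr_ad_i: "Dr i (ad y) = sc Q (ioi \<odot> Dr i y) - sc (inverse Q) (tw x (- x i) (Dr i y) \<odot> ioi)"
  by (simp add: ad_def Dr_diff Dr_mul Dr_bas1 Dr_tw X_uminus)

lemma Dr_ad: "j \<noteq> i \<Longrightarrow> Dr j (ad y) = sc (X (x i) (x j)) (ioi \<odot> Dr j y) - sc (inverse (X (x i) (x j))) (tw x (- x i) (Dr j y) \<odot> ioi)"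
  by (simp add: ad_def Dr_diff Dr_mul Dr_bas1 Dr_tw X_uminus X_sym[of "x j"])

lemma ad_mul: "ad (y \<odot> z) = (ad y \<odot> z) + (tw x (- x i) y \<odot> ad z)"
  by (simp add: ad_def tw_mul mul_diff mul_assoc)

lemma ad_tw: "ad (tw x v y) = sc (inverse (X v (x i))) (tw x v (ad y))"
proof -
  have "tw x v (ad y) = sc (X v (x i)) (ad (tw x v y))"
    by (simp add: ad_def tw_diff sc_minus tw_mul add.commute)
  then show ?thesis by simp
qed

end

context refl
begin

lemma Op_i: "Op i = ad" by (simp add: Op_def fun_eq_iff)
lemma Op_ne: "j \<noteq> i \<Longrightarrow> Op j y = (Dr i ^^ m j) (Dr j y)" by (simp add: Op_def)

lemma Op_add: "Op j (f + g) = Op j f + Op j g"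
  by (cases "j = i") (simp_all add: Op_i ad_add Op_ne Dr_pow_add)

lemma Op_sc: "Op j (sc c f) = sc c (Op j f)"
  by (cases "j = i") (simp_all add: Op_i ad_sc Op_ne Dr_pow_sc)

lemma Op_zero [simp]: "Op j 0 = 0"
  by (cases "j = i") (simp_all add: Op_i Op_ne)

lemma Op_one [simp]: "Op j (bas []) = 0"
  by (cases "j = i") (simp_all add: Op_i Op_ne)

lemma Dr_pow_tw: "(Dr i ^^ t) (tw x v f) = sc (X v (wv x (replicate t i))) (tw x v ((Dr i ^^ t) f))"
  by (induction t) (simp_all add: Dr_tw X_add_right mult.commute)

lemma x'_i [simp]: "x' i = - x i" and x'_ne: "j \<noteq> i \<Longrightarrow> x' j = x j + wv x (replicate (m j) i)"
  by (simp_all add: x'_def)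

lemma Op_tw: "Op j (tw x v f) = sc (X v (x' j)) (tw x v (Op j f))"
  by (cases "j = i") (simp_all add: Op_i ad_tw X_uminus Op_ne Dr_tw Dr_pow_sc Dr_pow_tw x'_ne X_add_right)

lemma Th_Nil: "Th y [] = y []" by (simp add: Th_def)

lemma Dr_Th: "Dr j (Th y) = Th (Op j y)"
  by (simp add: Dr_def Th_def fun_eq_iff)

lemma Th_zero [simp]: "Th 0 = 0"
proof -
  have "foldr Op w 0 = 0" for w by (induction w) simp_all
  then show ?thesis by (simp add: Th_def fun_pw fun_eq_iff)
qed

lemma Th_add: "Th (f + g) = Th f + Th g"
proof
  fix w show "Th (f + g) w = (Th f + Th g) w"
    by (induction w arbitrary: f g rule: rev_induct) (auto simp: Th_def fun_pw Op_add)
qed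

lemma Th_sc: "Th (sc c f) = sc c (Th f)"
proof
  fix w show "Th (sc c f) w = sc c (Th f) w"
    by (induction w arbitrary: f rule: rev_induct) (auto simp: Th_def fun_pw Op_sc)
qed

lemma Th_diff: "Th (f - g) = Th f - Th g"
proof -
  have "f - g = f + sc (- 1) g" by (simp add: sc_minus)
  then show ?thesis by (simp only: Th_add Th_sc) (simp add: sc_minus)
qed

lemma Th_one [simp]: "Th (bas []) = bas []"
  by (rule ext_Dr) (simp_all add: Th_Nil Dr_Th)

lemma Th_tw: "Th (tw x v f) = tw x' v (Th f)"
proof
  fix w show "Th (tw x v f) w = tw x' v (Th f) w"
  proof (induction w arbitrary: f rule: rev_induct)
    case Nil then show ?case by (simp add: Th_Nil tw_def)
  next
    case (snoc j w)
    have "Th (tw x v f) (w @ [j]) = Th (Op j (tw x v f)) w" by (simp add: Dr_Th[symmetric] Dr_def)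
    also have "\<dots> = X v (x' j) * tw x' v (Th (Op j f)) w" by (simp add: Op_tw Th_sc fun_pw snoc.IH)
    also have "\<dots> = tw x' v (Th f) (w @ [j])"
      by (simp add: tw_def Dr_Th[symmetric] Dr_def X_add_right)
    finally show ?case .
  qed
qed

lemma hom_ad: "hom x \<mu> f \<Longrightarrow> hom x (\<mu> + x i) (ad f)"
  unfolding ad_def
  using hom_mul[OF hom_bas[of x "[i]"], of \<mu> f] hom_mul[OF hom_tw hom_bas[of x "[i]"], of \<mu> f "- x i"]
  by (auto intro!: hom_diff simp: add.commute)

lemma hom_Dr_pow: "hom x \<mu> f \<Longrightarrow> hom x (\<mu> - wv x (replicate t i)) ((Dr i ^^ t) f)"
proof (induction t)
  case (Suc t)
  then show ?case using hom_Dr[of x "\<mu> - wv x (replicate t i)" "(Dr i ^^ t) f" i] by (simp add: algebra_simps)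
qed simp

lemma hom_Op: "hom x \<mu> f \<Longrightarrow> hom x (\<mu> - x' j) (Op j f)"
proof (cases "j = i")
  case False
  assume "hom x \<mu> f"
  from hom_Dr_pow[OF hom_Dr[OF this, of j], of "m j"] False show ?thesis
    by (simp add: Op_ne x'_ne algebra_simps)
qed (use hom_ad in \<open>simp add: Op_i\<close>)

text \<open>Each \<open>Op j\<close> lowers weights by exactly \<open>x' j\<close>. So the weight
  stays the same element of the group; only the simple roots by which words are measured are
  exchanged.\<close>

lemma hom_Th: "hom x \<mu> f \<Longrightarrow> hom x' \<mu> (Th f)"
proof -
  have "hom x \<mu> f \<Longrightarrow> Th f w \<noteq> 0 \<Longrightarrow> wv x' w = \<mu>" for w
  proof (induction w arbitrary: f \<mu> rule: rev_induct)
    case Nil then show ?case by (auto simp: Th_Nil hom_def)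
  next
    case (snoc j w)
    have "Th (Op j f) w \<noteq> 0" using snoc.prems by (simp add: Dr_Th[symmetric] Dr_def)
    then have "wv x' w = \<mu> - x' j" using snoc.IH hom_Op snoc.prems by blast
    then show ?case by simp
  qed
  then show "hom x \<mu> f \<Longrightarrow> hom x' \<mu> (Th f)" by (auto simp: hom_def)
qed

subsubsection \<open>The kernel of the right derivation\<close>

definition xk :: "nat \<Rightarrow> nat \<Rightarrow> nat list \<Rightarrow> 'k" where "xk j k = (ad ^^ k) (bas [j])"

lemma xk_simps [simp]: "xk j 0 = bas [j]" "ad (xk j k) = xk j (Suc k)" by (simp_all add: xk_def)

lemma Dr_i_xk: "j \<noteq> i \<Longrightarrow> Dr i (xk j k) = 0"
proof (induction k)
  case (Suc k) then show ?case by (simp add: Dr_ad_i flip: xk_simps(2))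
qed (simp add: Dr_bas1)

lemma Dr_xk_ne: "j \<noteq> i \<Longrightarrow> l \<noteq> i \<Longrightarrow> l \<noteq> j \<Longrightarrow> Dr l (xk j k) = 0"
proof (induction k)
  case (Suc k) then show ?case by (simp add: Dr_ad flip: xk_simps(2))
qed (simp add: Dr_bas1)

definition ck :: "nat \<Rightarrow> nat \<Rightarrow> 'k" where
  "ck j k = (\<Prod>r<k. X (x i) (x j) - inverse (X (x i) (x j)) * inverse Q ^ r)"

lemma Dr_xk: "j \<noteq> i \<Longrightarrow> Dr j (xk j k) = sc (ck j k) (pw x i k)"
proof (induction k)
  case (Suc k)
  have "Dr j (xk j (Suc k)) = sc (X (x i) (x j)) (ioi \<odot> sc (ck j k) (pw x i k)) -
     sc (inverse (X (x i) (x j))) (tw x (- x i) (sc (ck j k) (pw x i k)) \<odot> ioi)"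
    using Suc by (simp add: Dr_ad flip: xk_simps(2))
  also have "\<dots> = sc (X (x i) (x j) * ck j k) (pw x i (Suc k)) - sc (inverse (X (x i) (x j)) * (ck j k * inverse Q ^ k)) (pw x i (Suc k))"
  proof -
    have "tw x (- x i) (pw x i k) = sc (inverse Q ^ k) (pw x i k)"
      by (simp add: tw_hom[OF hom_Xi] X_wv_replicate X_uminus power_inverse)
    then show ?thesis by (simp add: pw_commute del: Xi.simps(2) replicate.simps(2))
  qed
  also have "\<dots> = sc (ck j (Suc k)) (pw x i (Suc k))"
    by (simp add: ck_def sc_def fun_eq_iff fun_pw algebra_simps del: Xi.simps(2) replicate.simps(2))
  finally show ?case .
qed (simp add: ck_def Dr_bas1)

lemma xk_Nil [simp]: "xk j k [] = 0"
  by (cases k) (simp_all add: bas_def flip: xk_simps(2))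

lemma pw_zero: "qn Q (Suc r) = 0 \<Longrightarrow> r < k \<Longrightarrow> pw x i k = 0"
  unfolding pw_eq by (subst prod_zero) (auto intro!: bexI[of _ "Suc r"])

text \<open>The two alternatives of \<open>m_top\<close>: either the power of i is zero already, or
  the factor of \<open>ck\<close> with \<open>r = m j\<close> is.\<close>

lemma ck_pw_zero:
  assumes "j < n" "j \<noteq> i" "m j < k" shows "sc (ck j k) (pw x i k) = 0"
  using m_top[OF assms(1,2)]
proof
  assume "qn Q (Suc (m j)) = 0" then show ?thesis using pw_zero assms(3) by simp
next
  assume a: "Q ^ m j * (X (x i) (x j))\<^sup>2 = 1"
  have "X (x i) (x j) - inverse (X (x i) (x j)) * inverse Q ^ m j = 0"
    using a by (simp add: field_simps power2_eq_square power_inverse)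
  then have "ck j k = 0" unfolding ck_def using assms(3) by (intro prod_zero) auto
  then show ?thesis by simp
qed

text \<open>The quantum Serre relation. It need not be imposed: in the shuffle algebra an element
  without constant term is zero as soon as all its right derivatives vanish.\<close>

lemma xk_zero: assumes "j < n" "j \<noteq> i" "m j < k" shows "xk j k = 0"
proof (rule ext_Dr)
  fix l show "Dr l (xk j k) = Dr l 0"
    using Dr_i_xk[of j k] Dr_xk_ne[of j l k] Dr_xk[of j k] ck_pw_zero[OF assms] assms
    by (cases "l = i"; cases "l = j") auto
qed (simp add: fun_pw)

lemma Dr_pow_pw: "(Dr i ^^ t) (pw x i k) = sc (\<Prod>r<t. qn Q (k - r)) (pw x i (k - t))"
  by (induction t) (simp_all add: Dr_pw mult.commute)

lemma Dr_pow_pw_zero: "k < t \<Longrightarrow> (Dr i ^^ t) (pw x i k) = 0"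
proof -
  assume "k < t"
  then have "(\<Prod>r<t. qn Q (k - r)) = 0" by (intro prod_zero) (auto intro!: bexI[of _ k])
  then show ?thesis unfolding Dr_pow_pw by (simp only: sc_simps)
qed

lemma Dr_pow_mul:
  assumes "Dr i y = 0" shows "(Dr i ^^ t) (y \<odot> z) = tw x (wv x (replicate t i)) y \<odot> (Dr i ^^ t) z"
proof (induction t)
  case (Suc t)
  have "Dr i (tw x v y) = 0" for v using assms by (simp add: Dr_tw)
  then show ?case using Suc by (simp add: Dr_mul add.commute)
qed simp

text \<open>Once \<open>Dr i\<close> kills both factors it acts only on the parts produced by
  \<open>Dr j\<close>, so no mixed terms appear. Hence the reflected derivations are again skew
  derivations on the kernel of \<open>Dr i\<close>.\<close>

lemma Dr_pow_Dr_mul: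
  assumes "Dr i y = 0" "Dr i z = 0"
  shows "(Dr i ^^ t) (Dr j (y \<odot> z)) = ((Dr i ^^ t) (Dr j y) \<odot> z) + (tw x (x j + wv x (replicate t i)) y \<odot> (Dr i ^^ t) (Dr j z))"
proof -
  have tw0: "Dr i (tw x v y) = 0" for v using assms by (simp add: Dr_tw)
  have "(Dr i ^^ t) (u \<odot> z) = (Dr i ^^ t) u \<odot> z" for u
    by (induction t) (simp_all add: Dr_mul assms)
  then show ?thesis by (simp add: Dr_mul Dr_pow_add Dr_pow_mul[OF tw0] add.commute)
qed

lemma Op_mul:
  assumes "Dr i y = 0" "Dr i z = 0"
  shows "Op j (y \<odot> z) = (Op j y \<odot> z) + (tw x (x' j) y \<odot> Op j z)"
proof (cases "j = i")
  case True then show ?thesis by (simp add: Op_i ad_mul)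
next
  case False then show ?thesis using Dr_pow_Dr_mul[OF assms] by (simp add: Op_ne x'_ne)
qed

definition mon :: "(nat \<times> nat) list \<Rightarrow> nat list \<Rightarrow> 'k" where
  "mon ps = foldr (\<lambda>p acc. xk (fst p) (snd p) \<odot> acc) ps (bas [])"

lemma mon_simps [simp]: "mon [] = bas []" "mon (p # ps) = xk (fst p) (snd p) \<odot> mon ps"
  by (simp_all add: mon_def)

lemma mon_append: "mon (ps @ qs) = mon ps \<odot> mon qs"
  by (induction ps) (simp_all add: mul_assoc)

text \<open>The subalgebra generated by the iterated brackets of i with the other letters;
  \<open>Kg_iff\<close> identifies it with the kernel of \<open>Dr i\<close> in
  \<open>U\<close>.\<close>

definition Kg :: "(nat list \<Rightarrow> 'k) set" where
  "Kg = lspan (mon ` {ps. \<forall>p\<in>set ps. fst p < n \<and> fst p \<noteq> i})"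

lemma Kg_mon: "\<forall>p\<in>set ps. fst p < n \<and> fst p \<noteq> i \<Longrightarrow> mon ps \<in> Kg"
  unfolding Kg_def by (intro lspan_base) auto

lemma Kg_xk: "j < n \<Longrightarrow> j \<noteq> i \<Longrightarrow> xk j k \<in> Kg" using Kg_mon[of "[(j, k)]"] by simp
lemma Kg_one: "bas [] \<in> Kg" using Kg_mon[of "[]"] by simp
lemma Kg_zero: "0 \<in> Kg" by (simp add: Kg_def)
lemma Kg_add: "f \<in> Kg \<Longrightarrow> g \<in> Kg \<Longrightarrow> f + g \<in> Kg" unfolding Kg_def by (rule lspan_add)
lemma Kg_sc: "f \<in> Kg \<Longrightarrow> sc c f \<in> Kg" unfolding Kg_def by (rule lspan_sc)

lemma Kg_mul: "f \<in> Kg \<Longrightarrow> g \<in> Kg \<Longrightarrow> f \<odot> g \<in> Kg"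
  unfolding Kg_def by (erule lspan_mul, assumption) (force simp: mon_append[symmetric] intro: lspan_base)

lemma Kg_induct [consumes 1, case_names one zero gen mul add]:
  assumes "f \<in> Kg" "P (bas [])" "P 0" "\<And>j k. j < n \<Longrightarrow> j \<noteq> i \<Longrightarrow> P (xk j k)"
    "\<And>f g. P f \<Longrightarrow> P g \<Longrightarrow> f \<in> Kg \<Longrightarrow> g \<in> Kg \<Longrightarrow> P (f \<odot> g)"
    "\<And>f g c. P f \<Longrightarrow> P g \<Longrightarrow> f \<in> Kg \<Longrightarrow> g \<in> Kg \<Longrightarrow> P (sc c f + g)"
  shows "P f"
  using assms(1) unfolding Kg_def
proof (induction rule: lspan_induct)
  case zero then show ?case by (rule assms(3))
next
  case (add a f c)
  have "\<forall>p\<in>set ps. fst p < n \<and> fst p \<noteq> i \<Longrightarrow> P (mon ps)" for ps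
  proof (induction ps)
    case Nil then show ?case by (simp add: assms(2))
  next
    case (Cons p ps) then show ?case by (auto intro!: assms(4,5) Kg_xk Kg_mon)
  qed
  then have "P a" "a \<in> Kg" using add(1) Kg_mon by auto
  then show ?case using add by (intro assms(6)) (auto simp: Kg_def)
qed

lemma hom_xk: "hom x (x j + wv x (replicate k i)) (xk j k)"
proof (induction k)
  case 0 then show ?case using hom_bas[of x "[j]"] by simp
next
  case (Suc k) then show ?case using hom_ad[OF Suc] by (simp add: algebra_simps)
qed

lemma Kg_tw: "f \<in> Kg \<Longrightarrow> tw x v f \<in> Kg"
proof (induction rule: Kg_induct)
  case (gen j k) then show ?case by (simp add: tw_hom[OF hom_xk] Kg_sc Kg_xk)
qed (auto simp: tw_mul intro: Kg_mul Kg_add Kg_sc Kg_one Kg_zero)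

lemma Kg_ad: "f \<in> Kg \<Longrightarrow> ad f \<in> Kg"
proof (induction rule: Kg_induct)
  case (gen j k) then show ?case by (simp add: Kg_xk)
qed (auto simp: ad_mul ad_add ad_sc intro: Kg_mul Kg_add Kg_sc Kg_zero Kg_tw)

lemma U_ad: "f \<in> U n x \<Longrightarrow> ad f \<in> U n x"
  unfolding ad_def by (intro U_diff U_mul U_tw bas_U i_less)

lemma Kg_U: "f \<in> Kg \<Longrightarrow> f \<in> U n x"
proof (induction rule: Kg_induct)
  case (gen j k)
  then show ?case by (induction k) (simp_all add: bas_U U_ad flip: xk_simps(2))
qed (auto intro: U_mul U_add U_sc one_U U_zero)

lemma Kg_Dr: "f \<in> Kg \<Longrightarrow> Dr i f = 0"
  by (induction rule: Kg_induct) (auto simp: Dr_mul Dr_i_xk)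

text \<open>On a generator the derivatives fall on a power of i with exponent at most
  \<open>m j\<close> and exhaust it; \<open>Dr_pow_Dr_mul\<close> passes this to products.\<close>

lemma Kg_serre: "f \<in> Kg \<Longrightarrow> j < n \<Longrightarrow> j \<noteq> i \<Longrightarrow> (Dr i ^^ Suc (m j)) (Dr j f) = 0"
proof (induction rule: Kg_induct)
  case (gen l k)
  show ?case
  proof (cases "l = j")
    case True
    show ?thesis
    proof (cases "m j < k")
      case True then show ?thesis using gen \<open>l = j\<close> by (simp add: xk_zero)
    next
      case False
      then show ?thesis using gen \<open>l = j\<close> Dr_pow_pw_zero[of k "Suc (m j)"]
        by (simp only: Dr_xk Dr_pow_sc) simp
    qed
  qed (use gen in \<open>simp add: Dr_xk_ne\<close>)
next
  case (mul f g)
  then show ?case by (subst Dr_pow_Dr_mul) (auto simp: Kg_Dr)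
next
  case (add f g c)
  then have "(Dr i ^^ Suc (m j)) (Dr j f) = 0" "(Dr i ^^ Suc (m j)) (Dr j g) = 0" by auto
  then show ?case by (simp only: Dr_simps Dr_pow_add Dr_pow_sc sc_simps add_0_left)
qed (simp_all only: Dr_simps bas_Nil Dr_pow_zero)

text \<open>Triangular decomposition: kernel elements to the left of powers of i. By
  \<open>U_KI\<close> these products span all of \<open>U\<close>.\<close>

definition KI :: "(nat list \<Rightarrow> 'k) set" where
  "KI = lspan {y \<odot> pw x i k |y k. y \<in> Kg}"

lemma KI_base: "y \<in> Kg \<Longrightarrow> y \<odot> pw x i k \<in> KI"
  unfolding KI_def by (rule lspan_base) auto

lemma KI_mul_letter:
  assumes f: "f \<in> KI" and j: "j < n" shows "bas [j] \<odot> f \<in> KI"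
  unfolding KI_def
proof (rule lspan_linear[OF f[unfolded KI_def], where F = "\<lambda>f. bas [j] \<odot> f"])
  fix a assume "a \<in> {y \<odot> pw x i k |y k. y \<in> Kg}"
  then obtain y k where a: "a = y \<odot> pw x i k" and y: "y \<in> Kg" by blast
  have "bas [j] \<odot> a \<in> KI"
  proof (cases "j = i")
    case False
    then have "bas [j] \<odot> y \<in> Kg" using Kg_mul[OF Kg_xk[of j 0] y] j by simp
    then show ?thesis using KI_base[of "bas [j] \<odot> y" k] by (simp add: a mul_assoc)
  next
    case True
    \<comment> \<open>Moving i to the right of y costs only \<open>ad y\<close>, which lies in
      \<open>Kg\<close> again.\<close>
    have "ioi \<odot> y = ad y + (tw x (- x i) y \<odot> ioi)" by (simp add: ad_def)
    then have "ioi \<odot> a = (ad y \<odot> pw x i k) + (tw x (- x i) y \<odot> pw x i (Suc k))"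
      unfolding a by (metis mul_add_left mul_assoc pw_commute(1))
    then show ?thesis unfolding True KI_def
      by (simp only:) (intro lspan_add KI_base[unfolded KI_def] Kg_ad Kg_tw y)
  qed
  then show "bas [j] \<odot> a \<in> lspan {y \<odot> pw x i k |y k. y \<in> Kg}" by (simp add: KI_def)
qed (simp_all add: mul_add_right)

lemma U_KI: "f \<in> U n x \<Longrightarrow> f \<in> KI"
proof -
  have "set w \<subseteq> {..<n} \<Longrightarrow> Xi x w \<in> KI" for w
  proof (induction w)
    case Nil then show ?case using KI_base[OF Kg_one, of 0] by simp
  next
    case (Cons j w) then show ?case by (auto intro: KI_mul_letter)
  qed
  then show "f \<in> U n x \<Longrightarrow> f \<in> KI" unfolding U_def KI_def
    by (erule_tac lspan_subset[rotated]) auto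
qed

lemma KI_sum: "f \<in> KI \<Longrightarrow> \<exists>N y. (\<forall>k. y k \<in> Kg) \<and> f = (\<Sum>k<N. y k \<odot> pw x i k)"
  unfolding KI_def
proof (induction rule: lspan_induct)
  case zero then show ?case by (intro exI[of _ 0] exI[of _ "\<lambda>_. 0"]) (simp add: Kg_zero)
next
  case (add a f c)
  then obtain N y z l where *: "\<forall>k. y k \<in> Kg" "f = (\<Sum>k<N. y k \<odot> pw x i k)" "a = z \<odot> pw x i l" "z \<in> Kg" by blast
  define y' where "y' = (\<lambda>k. (if k = l then sc c z else 0) + (if k < N then y k else 0))"
  have "(\<Sum>k<max N (Suc l). y' k \<odot> pw x i k) =
     (\<Sum>k<max N (Suc l). (if k = l then sc c z else 0) \<odot> pw x i k) + (\<Sum>k<max N (Suc l). (if k < N then y k else 0) \<odot> pw x i k)"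
    by (simp add: y'_def mul_add_left sum.distrib)
  also have "(\<Sum>k<max N (Suc l). (if k = l then sc c z else 0) \<odot> pw x i k) = (\<Sum>k\<in>{l}. sc c z \<odot> pw x i k)"
    by (rule sum.mono_neutral_cong_right) auto
  also have "(\<Sum>k<max N (Suc l). (if k < N then y k else 0) \<odot> pw x i k) = f"
    unfolding * by (rule sum.mono_neutral_cong_right) auto
  finally have "sc c a + f = (\<Sum>k<max N (Suc l). y' k \<odot> pw x i k)" unfolding * by simp
  moreover have "\<forall>k. y' k \<in> Kg" using * by (auto simp: y'_def intro!: Kg_add Kg_sc Kg_zero)
  ultimately show ?case by blast
qed

text \<open>Write f as a sum of \<open>y k \<odot> pw x i k\<close> with \<open>y k\<close> in
  \<open>Kg\<close> and \<open>k \<le> N\<close>. Applying \<open>Dr i\<close> N times kills f and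
  every term with \<open>k < N\<close>, so the top coefficient vanishes; then descend.\<close>

lemma kernel_Kg:
  assumes "f \<in> U n x" "Dr i f = 0" shows "f \<in> Kg"
proof -
  have "\<forall>k. y k \<in> Kg \<Longrightarrow> f = (\<Sum>k<N. y k \<odot> pw x i k) \<Longrightarrow> f \<in> Kg" for N y
  proof (induction N)
    case 0 then show ?case by (simp add: Kg_zero)
  next
    case (Suc N)
    show ?case
    \<comment> \<open>For \<open>N = 0\<close> the sum is \<open>y 0\<close> alone, and a vanishing
      power contributes nothing. Otherwise none of the quantum integers 1,...,N vanishes, which
      permits the division below.\<close>
    proof (cases "N = 0 \<or> pw x i N = 0")
      case True
      then show ?thesis using Suc by auto
    next
      case False
      then have "Dr i f = 0 \<and> N > 0" using assms by simp
      then obtain N' where "N = Suc N'" "Dr i f = 0" by (cases N) auto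
      then have "(Dr i ^^ N) f = 0" by (simp only: funpow_Suc_right o_apply Dr_pow_zero)
      moreover have "(Dr i ^^ N) f = (\<Sum>k<Suc N. tw x (wv x (replicate N i)) (y k) \<odot> (Dr i ^^ N) (pw x i k))"
        unfolding Suc.prems(2) using Suc.prems(1) by (simp only: Dr_pow_sum Dr_pow_mul Kg_Dr)
      moreover have "(\<Sum>k<N. tw x (wv x (replicate N i)) (y k) \<odot> (Dr i ^^ N) (pw x i k)) = 0"
        by (rule sum.neutral) (simp add: Dr_pow_pw_zero)
      ultimately have "sc (\<Prod>r<N. qn Q (N - r)) (tw x (wv x (replicate N i)) (y N)) = 0"
        by (simp add: Dr_pow_pw)
      moreover have "(\<Prod>r<N. qn Q (N - r)) \<noteq> 0"
      proof -
        have "qn Q t \<noteq> 0" if tN: "0 < t" "t \<le> N" for t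
        proof
          assume z: "qn Q t = 0"
          obtain r where t: "t = Suc r" using tN by (cases t) auto
          with pw_zero[of r N] z tN False show False by auto
        qed
        then show ?thesis by auto
      qed
      ultimately have "tw x (wv x (replicate N i)) (y N) = 0"
        by (metis (no_types, lifting) left_inverse sc_simps(2,4,5))
      then have "y N = 0" by (auto simp: tw_def fun_eq_iff fun_pw)
      then show ?thesis using Suc by simp
    qed
  qed
  then show ?thesis using KI_sum[OF U_KI[OF assms(1)]] by blast
qed

end

context bichar
begin

lemma bas_mul_pow:
  "bas [i] \<odot>\<^bsub>x\<^esub> bas (replicate t i) = sc (qn (X (x i) (x i)) (Suc t)) (bas (replicate (Suc t) i))"
  "bas (replicate t i) \<odot>\<^bsub>x\<^esub> bas [i] = sc (qn (X (x i) (x i)) (Suc t)) (bas (replicate (Suc t) i))"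
proof (induction t)
  case (Suc t)
  have e: "f = g" if "f [] = g []" "\<And>j. Dl j f = Dl j g" for f g :: "nat list \<Rightarrow> 'k"
    using ext_Dl[of f g] that by auto
  show "bas [i] \<odot>\<^bsub>x\<^esub> bas (replicate (Suc t) i) = sc (qn (X (x i) (x i)) (Suc (Suc t))) (bas (replicate (Suc (Suc t)) i))"
  proof (rule e)
    fix j
    show "Dl j (bas [i] \<odot>\<^bsub>x\<^esub> bas (replicate (Suc t) i)) = Dl j (sc (qn (X (x i) (x i)) (Suc (Suc t))) (bas (replicate (Suc (Suc t)) i)))"
    proof (cases "i = j")
      case True
      have "X (x i) (wv x (replicate (Suc t) i)) = X (x i) (x i) ^ Suc t"
        by (induction t) (simp_all add: X_add_right)
      then show ?thesis using True Suc(1)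
        by (simp add: Dl_mul Dl_bas qn_Suc[of _ "Suc t"] sc_left_distrib add.commute)
    qed (simp add: Dl_mul Dl_bas)
  qed (simp add: sc_apply, simp add: bas_def)
  show "bas (replicate (Suc t) i) \<odot>\<^bsub>x\<^esub> bas [i] = sc (qn (X (x i) (x i)) (Suc (Suc t))) (bas (replicate (Suc (Suc t)) i))"
  proof (rule e)
    fix j
    show "Dl j (bas (replicate (Suc t) i) \<odot>\<^bsub>x\<^esub> bas [i]) = Dl j (sc (qn (X (x i) (x i)) (Suc (Suc t))) (bas (replicate (Suc (Suc t)) i)))"
      using Suc(2) by (cases "i = j")
        (simp_all add: Dl_mul Dl_bas qn_Suc'[of _ "Suc t"] sc_left_distrib add.commute)
  qed (simp add: sc_apply, simp add: bas_def)
qed simp_all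

end

context refl
begin

lemma Kg_iff: "f \<in> Kg \<longleftrightarrow> f \<in> U n x \<and> Dr i f = 0"
  using Kg_U Kg_Dr kernel_Kg by blast

lemma Op_Kg: assumes "f \<in> Kg" shows "Op j f \<in> Kg"
proof -
  consider "j = i" | "j \<noteq> i" "j < n" | "j \<noteq> i" "\<not> j < n" by blast
  then show ?thesis
  proof cases
    case 1 then show ?thesis using Kg_ad[OF assms] by (simp add: Op_i)
  next
    case 2
    have "(Dr i ^^ t) (Dr j f) \<in> U n x" for t
      by (induction t) (simp_all add: U_Dr Kg_U assms)
    moreover have "Dr i ((Dr i ^^ m j) (Dr j f)) = 0" using Kg_serre[OF assms] 2 by simp
    ultimately show ?thesis using 2 by (auto simp: Op_ne intro: kernel_Kg)
  next
    case 3 then show ?thesis using U_Dr_ge[OF Kg_U[OF assms]] by (simp add: Op_ne Kg_zero)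
  qed
qed

abbreviation mul_x' (infixl "\<odot>''" 70) where "f \<odot>' g \<equiv> f \<odot>\<^bsub>x'\<^esub> g"

text \<open>On the kernel the operators \<open>Op j\<close> obey the skew Leibniz rule that
  \<open>Dr j\<close> obeys in the shuffle algebra of \<open>x'\<close>, by
  \<open>Op_mul\<close>.\<close>

lemma Th_mul: "y \<in> Kg \<Longrightarrow> z \<in> Kg \<Longrightarrow> Th (y \<odot> z) = Th y \<odot>' Th z"
proof
  fix w show "y \<in> Kg \<Longrightarrow> z \<in> Kg \<Longrightarrow> Th (y \<odot> z) w = (Th y \<odot>' Th z) w"
  proof (induction w arbitrary: y z rule: rev_induct)
    case Nil then show ?case by (simp add: Th_Nil)
  next
    case (snoc j w)
    have "Th (y \<odot> z) (w @ [j]) = Th (Op j (y \<odot> z)) w" by (simp add: Dr_Th[symmetric] Dr_def)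
    also have "\<dots> = (Th (Op j y \<odot> z) + Th (tw x (x' j) y \<odot> Op j z)) w"
      by (simp only: Op_mul[OF Kg_Dr Kg_Dr] snoc.prems Th_add)
    also have "\<dots> = ((Th (Op j y) \<odot>' Th z) + (tw x' (x' j) (Th y) \<odot>' Th (Op j z))) w"
      using snoc by (simp add: fun_pw Op_Kg Kg_tw Th_tw)
    also have "\<dots> = Dr j (Th y \<odot>' Th z) w" by (simp add: Dr_mul Dr_Th)
    finally show ?case by (simp add: Dr_def)
  qed
qed

lemma Th_xk_zero: "j < n \<Longrightarrow> j \<noteq> i \<Longrightarrow> m j < k \<Longrightarrow> Th (xk j k) = 0" by (simp add: xk_zero)

text \<open>The weights match: \<open>x j\<close> plus k times \<open>x i\<close> equals
  \<open>x' j\<close> plus \<open>m j - k\<close> times \<open>x' i\<close>.\<close>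

lemma Th_xk:
  assumes "j < n" "j \<noteq> i" "k \<le> m j"
  shows "\<exists>c. Th (xk j k) = sc c (bas (j # replicate (m j - k) i))"
proof -
  \<comment> \<open>The scalar of the top bracket \<open>k = m j\<close> serves for all k, because
    going from k to \<open>Suc k\<close> by \<open>ad\<close> corresponds exactly to removing one
    last letter i.\<close>
  obtain c where c: "(Dr i ^^ m j) (Dr j (xk j (m j))) = sc c (bas [])"
    using assms by (simp add: Dr_xk Dr_pow_sc Dr_pow_pw)
  have "Th (xk j k) = sc c (bas (j # replicate (m j - k) i))"
    using assms(3)
  proof (induction "m j - k" arbitrary: k)
    case 0
    then have k: "k = m j" by simp
    show ?case
    proof (rule ext_Dr)
      fix l
      consider "l = i" | "l \<noteq> i" "l = j" | "l \<noteq> i" "l \<noteq> j" by blast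
      then show "Dr l (Th (xk j k)) = Dr l (sc c (bas (j # replicate (m j - k) i)))"
      proof cases
        case 1 then show ?thesis using assms k by (simp add: Dr_Th Op_i xk_zero Dr_bas1)
      next
        case 2 then show ?thesis using c k by (simp add: Dr_Th Op_ne Dr_bas1 Th_sc)
      next
        case 3 then show ?thesis using assms k by (simp add: Dr_Th Op_ne Dr_xk_ne Dr_bas1)
      qed
    qed (simp add: Th_Nil sc_apply, simp add: bas_def)
  next
    case (Suc d)
    then have IH: "Th (xk j (Suc k)) = sc c (bas (j # replicate (m j - Suc k) i))" by simp
    have r: "j # replicate (m j - k) i = (j # replicate (m j - Suc k) i) @ [i]"
      using Suc(2) by (simp add: replicate_append_same Suc_diff_Suc flip: replicate_Suc)
    show ?case
    proof (rule ext_Dr)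
      fix l
      consider "l = i" | "l \<noteq> i" "l = j" | "l \<noteq> i" "l \<noteq> j" by blast
      then show "Dr l (Th (xk j k)) = Dr l (sc c (bas (j # replicate (m j - k) i)))"
      proof cases
        case 1 then show ?thesis unfolding r Dr_simps Dr_bas by (simp add: Dr_Th Op_i IH)
      next
        case 2
        have "(Dr i ^^ m j) (pw x i k) = 0" using Suc(2) by (intro Dr_pow_pw_zero) simp
        then show ?thesis using 2 assms unfolding r Dr_simps Dr_bas
          by (simp add: Dr_Th Op_ne Dr_xk Dr_pow_sc)
      next
        case 3 then show ?thesis using assms unfolding r Dr_simps Dr_bas by (simp add: Dr_Th Op_ne Dr_xk_ne)
      qed
    qed (simp add: Th_Nil sc_apply, simp add: bas_def)
  qed
  then show ?thesis by blast
qed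

text \<open>These words are the images of the generators of \<open>Kg\<close>. Each is obtained from
  the shorter one by a braided commutator with i in the reflected algebra, provided that the
  coefficient e there is nonzero.\<close>

lemma word_U':
  assumes j: "j < n" "j \<noteq> i" "t \<le> m j"
  shows "bas (j # replicate t i) \<in> U n x'"
  using j(3)
proof (induction t)
  case 0 then show ?case using j by (simp add: bas_U)
next
  case (Suc t)
  let ?b = "\<lambda>t. bas (j # replicate t i) :: nat list \<Rightarrow> 'k"
  let ?\<chi> = "X (x' i) (x' j)"
  \<comment> \<open>With \<open>?\<chi>\<close> the inverse of
    \<open>X (x i) (x j) * Q ^ m j\<close>, the bracket in e vanishes only if
    \<open>Q ^ (2 * m j - t) * X (x i) (x j) ^ 2 = 1\<close>, which \<open>m_above\<close> excludes;
    the quantum integer is nonzero by \<open>m_below\<close>.\<close>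
  define e where "e = (?\<chi> - inverse (X (x' i) (wv x' (j # replicate t i)))) * qn Q (Suc t)"
  have w: "X (x' i) (wv x' (j # replicate t i)) = ?\<chi> * Q ^ t"
    by (induction t) (simp_all add: X_add_right X_uminus X_diff field_simps)
  have "(?b t \<odot>' ioi) - (ioi \<odot>' tw x' (- x' i) (?b t)) = sc e (?b (Suc t))"
  proof -
    have ee: "f = g" if "f [] = g []" "\<And>j. Dl j f = Dl j g" for f g :: "nat list \<Rightarrow> 'k"
      using ext_Dl[of f g] that by auto
    have Dld: "Dl l (f - g) = Dl l f - Dl l g" for l and f g :: "nat list \<Rightarrow> 'k"
      by (simp add: Dl_def fun_eq_iff fun_pw)
    have QQ: "X (x' i) (x' i) = Q" by (simp add: X_uminus)
    show ?thesis
    proof (rule ee)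
      fix l
      consider "l = i" | "l \<noteq> i" "l = j" | "l \<noteq> i" "l \<noteq> j" by blast
      then show "Dl l ((?b t \<odot>' ioi) - (ioi \<odot>' tw x' (- x' i) (?b t))) = Dl l (sc e (?b (Suc t)))"
      proof cases
        case 1 then show ?thesis using j by (simp add: Dld Dl_mul Dl_bas Dl_tw X_uminus)
      next
        case 2
        have "X (- x' i) (wv x' (j # replicate t i)) = inverse (X (x' i) (wv x' (j # replicate t i)))"
          by (simp only: X_uminus)
        moreover have "wv x' [i] = x' i" by (simp only: wv_simps add_0_right)
        ultimately have "Dl l ((?b t \<odot>' ioi) - (ioi \<odot>' tw x' (- x' i) (?b t))) =
           sc (?\<chi> * qn Q (Suc t)) (bas (replicate (Suc t) i)) - sc (inverse (X (x' i) (wv x' (j # replicate t i))) * qn Q (Suc t)) (bas (replicate (Suc t) i))"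
          using j 2 by (simp add: Dld Dl_mul Dl_bas bas_mul_pow[where x = x' and i = i, unfolded QQ] X_sym[of "x' j"]
             del: wv_simps(2) x'_i replicate.simps(2))
        also have "\<dots> = sc e (bas (replicate (Suc t) i))"
          by (simp add: e_def sc_def fun_eq_iff fun_pw algebra_simps)
        finally show ?thesis using 2 j by (simp add: Dl_bas)
      next
        case 3 then show ?thesis by (simp add: Dld Dl_mul Dl_bas)
      qed
    qed (simp add: fun_pw, simp add: bas_def)
  qed
  moreover have "(?b t \<odot>' ioi) - (ioi \<odot>' tw x' (- x' i) (?b t)) \<in> U n x'"
    using Suc i_less by (intro U_diff U_mul U_tw bas_U) auto
  ultimately have *: "sc e (?b (Suc t)) \<in> U n x'" by simp
  have "e \<noteq> 0"
  proof
    assume "e = 0"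
    then have "?\<chi> = inverse (?\<chi> * Q ^ t)" using m_below[OF j(1,2), of t] Suc.prems unfolding e_def w by simp
    then have 1: "?\<chi> ^ 2 * Q ^ t = 1" by (simp add: field_simps power2_eq_square)
    have "?\<chi> = inverse (X (x i) (x j) * Q ^ m j)" using j by (simp add: x'_ne X_uminus X_add_right X_wv_replicate power_inverse)
    then have c1: "?\<chi> * (X (x i) (x j) * Q ^ m j) = 1" by (simp only: left_inverse X_nz mult_eq_0_iff power_eq_0_iff simp_thms)
    have "Q ^ t = Q ^ t * (?\<chi> * (X (x i) (x j) * Q ^ m j)) ^ 2" by (simp only: c1) simp
    also have "\<dots> = (?\<chi> ^ 2 * Q ^ t) * (X (x i) (x j) * Q ^ m j) ^ 2" by (simp only: power_mult_distrib mult_ac)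
    also have "\<dots> = (X (x i) (x j))\<^sup>2 * Q ^ (2 * m j)" by (simp only: 1 mult_1_left power_mult_distrib mult.commute[of 2] power_mult)
    finally have "Q ^ t = (X (x i) (x j))\<^sup>2 * Q ^ (2 * m j)" .
    moreover have "Q ^ (2 * m j) = Q ^ t * Q ^ (2 * m j - t)" using Suc.prems by (simp flip: power_add)
    ultimately have "Q ^ (2 * m j - t) * (X (x i) (x j))\<^sup>2 = 1" by (simp add: mult.commute)
    then show False using m_above[OF j(1,2), of t] Suc.prems by simp
  qed
  then show ?case using U_sc[OF *, of "inverse e"] by simp
qed

lemma Th_U: "f \<in> Kg \<Longrightarrow> Th f \<in> U n x'"
proof (induction rule: Kg_induct)
  case (gen j k)
  show ?case
  proof (cases "k \<le> m j")
    case True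
    then obtain c where "Th (xk j k) = sc c (bas (j # replicate (m j - k) i))" using Th_xk gen by blast
    then show ?thesis using word_U'[of j "m j - k"] gen by (simp add: U_sc)
  next
    case False then show ?thesis using Th_xk_zero gen by (simp add: U_zero)
  qed
qed (auto simp: Th_mul Th_add Th_sc intro: U_mul U_add U_sc one_U U_zero)

section \<open>Injectivity of the reflection map\<close>

lemma ad_pow_add: "(ad ^^ M) (f + g) = (ad ^^ M) f + (ad ^^ M) g" by (induction M) (simp_all add: ad_add)
lemma ad_pow_sc: "(ad ^^ M) (sc c f) = sc c ((ad ^^ M) f)" by (induction M) (simp_all add: ad_sc)
lemma ad_pow_zero [simp]: "(ad ^^ M) 0 = 0" by (induction M) simp_all

lemma ad_pow_mono: "(ad ^^ a) f = 0 \<Longrightarrow> a \<le> b \<Longrightarrow> (ad ^^ b) f = 0"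
proof -
  assume "(ad ^^ a) f = 0" "a \<le> b"
  moreover have "(ad ^^ b) f = (ad ^^ (b - a)) ((ad ^^ a) f)"
    using funpow_add[of "b - a" a ad] \<open>a \<le> b\<close> by (simp add: o_def)
  ultimately show ?thesis by simp
qed

lemma ad_pow_tw: "(ad ^^ a) f = 0 \<Longrightarrow> (ad ^^ a) (tw x v f) = 0"
proof -
  have "\<exists>c. (ad ^^ a) (tw x v f) = sc c (tw x v ((ad ^^ a) f))"
  proof (induction a)
    case 0 show ?case by (intro exI[of _ 1]) simp
  next
    case (Suc a)
    then obtain c where "(ad ^^ a) (tw x v f) = sc c (tw x v ((ad ^^ a) f))" by blast
    then show ?case by (auto simp: ad_sc ad_tw)
  qed
  then show "(ad ^^ a) f = 0 \<Longrightarrow> (ad ^^ a) (tw x v f) = 0" by auto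
qed

lemma ad_pow_mul: "(ad ^^ a) f = 0 \<Longrightarrow> (ad ^^ b) g = 0 \<Longrightarrow> (ad ^^ (a + b)) (f \<odot> g) = 0"
proof (induction "a + b" arbitrary: a b f g)
  case 0 then show ?case by simp
next
  case (Suc s)
  show ?case
  proof (cases "a = 0 \<or> b = 0")
    case True then show ?thesis using Suc.prems by auto
  next
    case False
    then obtain a' b' where ab: "a = Suc a'" "b = Suc b'" by (cases a; cases b) auto
    have "(ad ^^ (a' + b)) (ad f \<odot> g) = 0"
      using Suc.hyps(1)[of a' b "ad f" g] Suc.hyps(2) Suc.prems ab by (simp add: funpow_swap1)
    moreover have "(ad ^^ (a + b')) (tw x (- x i) f \<odot> ad g) = 0"
      using Suc.hyps(1)[of a b' "tw x (- x i) f" "ad g"] Suc.hyps(2) Suc.prems ab ad_pow_tw[of a f]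
      by (simp add: funpow_swap1)
    moreover have "(ad ^^ (a + b)) (f \<odot> g) = (ad ^^ (a' + b)) (ad (f \<odot> g))"
      using ab by (simp add: funpow_swap1)
    moreover have "a' + b = a + b'" using ab by simp
    ultimately show ?thesis by (simp only: ad_mul ad_pow_add add_0_left)
  qed
qed

text \<open>On generators this is the Serre relation \<open>xk_zero\<close>; the skew Leibniz rule
  for \<open>ad\<close> carries nilpotency over to products.\<close>

lemma ad_nilpotent: "f \<in> Kg \<Longrightarrow> \<exists>M. (ad ^^ M) f = 0"
proof (induction rule: Kg_induct)
  case one show ?case by (intro exI[of _ 1]) simp
next
  case zero show ?case by (intro exI[of _ 0]) simp
next
  case (gen j k)
  have "(ad ^^ Suc (m j)) (xk j k) = 0"
    using xk_zero[of j "Suc (m j) + k"] gen unfolding xk_def by (simp add: funpow_add)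
  then show ?case by blast
next
  case (mul f g) then show ?case using ad_pow_mul by blast
next
  case (add f g c)
  then obtain a b where "(ad ^^ a) f = 0" "(ad ^^ b) g = 0" by blast
  then have "(ad ^^ max a b) f = 0" "(ad ^^ max a b) g = 0"
    using ad_pow_mono[of a f "max a b"] ad_pow_mono[of b g "max a b"] by simp_all
  then have "(ad ^^ max a b) (sc c f + g) = 0" by (simp add: ad_pow_add ad_pow_sc)
  then show ?case by blast
qed

text \<open>The coefficient that accumulates when \<open>Dr i\<close> is applied t times to the
  relation \<open>ad v = 0\<close>, see E in \<open>faithful\<close>. It factors into the two
  quantities that \<open>m_below\<close> keeps from vanishing.\<close>

definition sq :: "nat \<Rightarrow> nat \<Rightarrow> 'k" where
  "sq j t = (\<Sum>r<t. Q ^ r - inverse ((X (x i) (x j))\<^sup>2) * inverse Q ^ r)"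

lemma sq_nz:
  assumes "j < n" "j \<noteq> i" "t < m j" shows "sq j (Suc t) \<noteq> 0"
proof -
  have "sq j (Suc t) = qn Q (Suc t) - inverse ((X (x i) (x j))\<^sup>2) * (\<Sum>r<Suc t. inverse Q ^ r)"
    by (simp only: sq_def sum_subtractf qn_def sum_distrib_left)
  also have "\<dots> = qn Q (Suc t) * (1 - inverse ((X (x i) (x j))\<^sup>2 * Q ^ t))"
    by (simp only: qn_inverse[OF X_nz]) (simp add: field_simps power_inverse)
  finally have "sq j (Suc t) = qn Q (Suc t) * (1 - inverse ((X (x i) (x j))\<^sup>2 * Q ^ t))" .
  moreover have "inverse ((X (x i) (x j))\<^sup>2 * Q ^ t) \<noteq> 1"
    using m_below[OF assms] unfolding inverse_eq_1_iff by (simp only: mult.commute not_False_eq_True)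
  ultimately show ?thesis using m_below[OF assms] by simp
qed

text \<open>An argument as for sl2 modules: applying \<open>Dr j\<close> and then t times
  \<open>Dr i\<close> to \<open>ad v = 0\<close> expresses \<open>sq j t\<close> times the (t-1)-st
  derivative of \<open>Dr j v\<close> by the t-th one. Since these factors are nonzero up to
  \<open>m j\<close>, vanishing descends from the top derivative to \<open>Dr j v\<close>.\<close>

lemma faithful:
  assumes j: "j < n" "j \<noteq> i" and ad: "ad v = 0" and top: "(Dr i ^^ m j) (Dr j v) = 0"
  shows "Dr j v = 0"
proof -
  define Y where "Y = inverse ((X (x i) (x j))\<^sup>2)"
  define u where "u = (\<lambda>t. (Dr i ^^ t) (Dr j v))"
  \<comment> \<open>At \<open>t = 0\<close> the index \<open>t - 1\<close> is 0 again, but its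
    coefficient \<open>sq j 0\<close> is zero.\<close>
  have E: "sc (Q ^ t) (ioi \<odot> u t) - sc (Y * inverse Q ^ t) (tw x (- x i) (u t) \<odot> ioi) + sc (sq j t) (u (t - 1)) = 0" for t
  proof (induction t)
    case 0
    have "sc (X (x i) (x j)) (ioi \<odot> Dr j v) - sc (inverse (X (x i) (x j))) (tw x (- x i) (Dr j v) \<odot> ioi) = 0"
      using Dr_ad[OF j(2), of v] ad by simp
    then have "sc (inverse (X (x i) (x j))) (sc (X (x i) (x j)) (ioi \<odot> Dr j v) - sc (inverse (X (x i) (x j))) (tw x (- x i) (Dr j v) \<odot> ioi)) = 0"
      by simp
    then show ?case by (simp add: sc_minus sq_def u_def Y_def power2_eq_square)
  next
    case (Suc t)
    have "Dr i (sc (Q ^ t) (ioi \<odot> u t) - sc (Y * inverse Q ^ t) (tw x (- x i) (u t) \<odot> ioi) + sc (sq j t) (u (t - 1))) = 0"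
      unfolding Suc by simp
    then have "sc (Q ^ t) (u t + sc Q (ioi \<odot> u (Suc t))) - sc (Y * inverse Q ^ t) (sc (inverse Q) (tw x (- x i) (u (Suc t)) \<odot> ioi) + u t)
       + sc (sq j t) (Dr i (u (t - 1))) = 0"
      by (simp add: Dr_diff Dr_mul Dr_bas1 Dr_tw X_uminus u_def)
    moreover have "sc (sq j t) (Dr i (u (t - 1))) = sc (sq j t) (u t)"
      by (cases t) (simp_all add: sq_def u_def)
    ultimately have *: "sc (Q ^ t) (u t + sc Q (ioi \<odot> u (Suc t))) - sc (Y * inverse Q ^ t) (sc (inverse Q) (tw x (- x i) (u (Suc t)) \<odot> ioi) + u t)
       + sc (sq j t) (u t) = 0" by simp
    have s: "sq j (Suc t) = sq j t + Q ^ t - Y * inverse Q ^ t" by (simp add: sq_def Y_def)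
    have "sc (Q ^ Suc t) (ioi \<odot> u (Suc t)) - sc (Y * inverse Q ^ Suc t) (tw x (- x i) (u (Suc t)) \<odot> ioi) + sc (sq j (Suc t)) (u t)
       = sc (Q ^ t) (u t + sc Q (ioi \<odot> u (Suc t))) - sc (Y * inverse Q ^ t) (sc (inverse Q) (tw x (- x i) (u (Suc t)) \<odot> ioi) + u t)
       + sc (sq j t) (u t)"
      unfolding s by (simp add: fun_eq_iff fun_pw algebra_simps)
    also have "\<dots> = 0" by (rule *)
    finally show ?case by simp
  qed
  have "t \<le> m j \<Longrightarrow> u (m j - t) = 0" for t
  proof (induction t)
    case 0 then show ?case using top by (simp add: u_def)
  next
    case (Suc t)
    define r where "r = m j - Suc t"
    have r: "m j - t = Suc r" "r < m j" using Suc by (auto simp: r_def)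
    have "sc (sq j (Suc r)) (u r) = 0" using E[of "Suc r"] Suc r by simp
    then have "sc (inverse (sq j (Suc r))) (sc (sq j (Suc r)) (u r)) = 0" by simp
    then show ?case using sq_nz[OF j r(2)] by (simp add: r_def)
  qed
  from this[of "m j"] show ?thesis by (simp add: u_def)
qed

text \<open>Induction on the number of letters other than i, which \<open>ad\<close> does not
  increase and every other \<open>Op l\<close> lowers. The kernel of \<open>Th\<close> is stable
  under all \<open>Op l\<close>.\<close>

lemma Th_inj:
  assumes "y \<in> Kg" "Th y = 0" shows "y = 0"
proof -
  define c where "c = (\<lambda>w. length (filter (\<lambda>l. l \<noteq> i) w))"
  have Xi_c: "c u = c w" if "mset u = mset w" for u w
  proof -
    have "mset (filter (\<lambda>l. l \<noteq> i) u) = mset (filter (\<lambda>l. l \<noteq> i) w)" using that by simp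
    then show ?thesis unfolding c_def by (rule mset_eq_length)
  qed
  have mulc: "\<forall>w. (f \<odot> g) w \<noteq> 0 \<longrightarrow> c w \<le> N" if "\<forall>w. f w \<noteq> 0 \<longrightarrow> c w \<le> a" "\<forall>w. g w \<noteq> 0 \<longrightarrow> c w \<le> b" "a + b \<le> N" for f g a b N
  proof (intro allI impI)
    fix w assume "(f \<odot> g) w \<noteq> 0"
    then obtain u v where uv: "w \<in> shuffles u v" "f u \<noteq> 0" "g v \<noteq> 0" using mul_support by blast
    have "filter (\<lambda>l. l \<noteq> i) w \<in> shuffles (filter (\<lambda>l. l \<noteq> i) u) (filter (\<lambda>l. l \<noteq> i) v)"
      using filter_shuffles uv(1) by blast
    then have "c w = c u + c v" unfolding c_def by (rule length_shuffles)
    then show "c w \<le> N" using that uv by (metis add_mono le_trans)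
  qed
  have adc: "\<forall>w. ad f w \<noteq> 0 \<longrightarrow> c w \<le> N" if f: "\<forall>w. f w \<noteq> 0 \<longrightarrow> c w \<le> N" for f N
  proof -
    have "\<forall>w. (ioi \<odot> f) w \<noteq> 0 \<longrightarrow> c w \<le> N"
      by (rule mulc[where a = 0 and b = N]) (use f in \<open>auto simp: bas_def c_def\<close>)
    moreover have "\<forall>w. (tw x (- x i) f \<odot> ioi) w \<noteq> 0 \<longrightarrow> c w \<le> N"
      by (rule mulc[where a = N and b = 0]) (use f in \<open>auto simp: bas_def c_def tw_def\<close>)
    ultimately show ?thesis unfolding ad_def by (metis fun_pw(3) diff_zero)
  qed
  have "y = 0" if "y \<in> Kg" "Th y = 0" "\<forall>w. y w \<noteq> 0 \<longrightarrow> c w \<le> N" for y N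
    using that
  proof (induction N arbitrary: y)
    case 0
    show ?case
    proof
      fix w
      show "y w = 0 w"
      proof (cases w rule: rev_cases)
        case Nil
        have "Th y [] = 0" using 0 by (simp add: fun_pw)
        then show ?thesis using Nil by (simp add: Th_Nil fun_pw)
      next
        case (snoc v l)
        show ?thesis
        proof (cases "l = i")
          case True
          then have "y w = Dr i y v" by (simp add: Dr_def snoc)
          then show ?thesis using Kg_Dr[OF 0(1)] by (simp add: fun_pw)
        next
          case False
          then have "c w \<noteq> 0" by (simp add: snoc c_def)
          then show ?thesis using 0 by (auto simp: fun_pw)
        qed
      qed
    qed
  next
    case (Suc N)
    have ad_pw: "(ad ^^ k) y \<in> Kg \<and> Th ((ad ^^ k) y) = 0 \<and> (\<forall>w. (ad ^^ k) y w \<noteq> 0 \<longrightarrow> c w \<le> Suc N)" for k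
    proof (induction k)
      case 0 then show ?case using Suc.prems by simp
    next
      case (Suc k)
      then have "Th (ad ((ad ^^ k) y)) = 0" using Dr_Th[of i "(ad ^^ k) y"] by (simp add: Op_i)
      then show ?case using Suc adc[of "(ad ^^ k) y" "Suc N"] by (auto intro: Kg_ad)
    qed
    \<comment> \<open>For z with \<open>ad z = 0\<close> the induction hypothesis kills
      \<open>Op l z\<close>, and \<open>faithful\<close> then gives
      \<open>Dr l z = 0\<close>.\<close>
    have step: "z = 0" if z: "z \<in> Kg" "Th z = 0" "\<forall>w. z w \<noteq> 0 \<longrightarrow> c w \<le> Suc N" "ad z = 0" for z
    proof (rule ext_Dr)
      have "Th z [] = 0" using z by (simp add: fun_pw)
      then show "z [] = 0 []" by (simp add: Th_Nil fun_pw)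
      fix l
      consider "l = i" | "l \<noteq> i" "l < n" | "\<not> l < n" by blast
      then have "Dr l z = 0"
      proof cases
        case 1 then show ?thesis using Kg_Dr z by simp
      next
        case 3 then show ?thesis using U_Dr_ge[OF Kg_U[OF z(1)]] by simp
      next
        case 2
        have "(Dr i ^^ m l) (Dr l z) = 0"
        proof (rule Suc.IH)
          show "(Dr i ^^ m l) (Dr l z) \<in> Kg" using Op_Kg[OF z(1), of l] 2 by (simp add: Op_ne)
          show "Th ((Dr i ^^ m l) (Dr l z)) = 0" using Dr_Th[of l z] z 2 by (simp add: Op_ne)
          show "\<forall>w. (Dr i ^^ m l) (Dr l z) w \<noteq> 0 \<longrightarrow> c w \<le> N"
          proof (intro allI impI)
            fix w assume "(Dr i ^^ m l) (Dr l z) w \<noteq> 0"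
            then have "c (w @ replicate (m l) i @ [l]) \<le> Suc N" using z by (simp add: Dr_pow_apply Dr_def)
            then show "c w \<le> N" using 2 by (simp add: c_def)
          qed
        qed
        then show ?thesis using faithful[of l z] 2 z by simp
      qed
      then show "Dr l z = Dr l 0" by simp
    qed
    \<comment> \<open>By local nilpotency some power of \<open>ad\<close> kills y. Each lower power
      is then annihilated by \<open>ad\<close> and falls under \<open>step\<close>, down to y
      itself.\<close>
    obtain M where M: "(ad ^^ M) y = 0" using ad_nilpotent Suc.prems by blast
    have "k \<le> M \<Longrightarrow> (ad ^^ (M - k)) y = 0" for k
    proof (induction k)
      case (Suc k)
      then have "ad ((ad ^^ (M - Suc k)) y) = 0" by (metis Suc_diff_Suc Suc_le_lessD Suc_leD funpow.simps(2) o_apply)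
      then show ?case using ad_pw[of "M - Suc k"] step by blast
    qed (use M in simp)
    from this[of M] show ?case by simp
  qed
  moreover obtain N where "\<forall>w. y w \<noteq> 0 \<longrightarrow> c w \<le> N"
  proof -
    obtain N where N: "\<forall>w. y w \<noteq> 0 \<longrightarrow> length w \<le> N" using U_bounded[OF Kg_U[OF assms(1)]] by blast
    have "c w \<le> length w" for w unfolding c_def by (rule length_filter_le)
    then show thesis using N that le_trans by blast
  qed
  ultimately show ?thesis using assms by blast
qed

end

subsection \<open>Right coideal subalgebras and convexity\<close>

text \<open>Linear independence, restricted to nonnegative combinations: the weight of a word
  determines its letters up to order.\<close>

definition indep :: "nat \<Rightarrow> (nat \<Rightarrow> 'v::ab_group_add) \<Rightarrow> bool" where
  "indep n x \<longleftrightarrow> (\<forall>u w. set u \<subseteq> {..<n} \<longrightarrow> set w \<subseteq> {..<n} \<longrightarrow> wv x u = wv x w \<longrightarrow> mset u = mset w)"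

text \<open>Below and at the height of \<theta> the two members of the flag differ only in the
  weight \<theta>; larger heights are left free. The functional h is fixed and does not change under
  reflections.\<close>

definition gap :: "('v \<Rightarrow> int) \<Rightarrow> (nat \<Rightarrow> 'v::ab_group_add) \<Rightarrow> (nat list \<Rightarrow> 'k::field) set \<Rightarrow> (nat list \<Rightarrow> 'k) set \<Rightarrow> 'v \<Rightarrow> bool" where
  "gap h x C1 C2 \<theta> \<longleftrightarrow> C1 \<subseteq> C2 \<and> (\<forall>y \<mu>. y \<in> C2 \<longrightarrow> y \<noteq> 0 \<longrightarrow> hom x \<mu> y \<longrightarrow> h \<mu> \<le> h \<theta> \<longrightarrow> \<mu> \<noteq> \<theta> \<longrightarrow> y \<in> C1)
     \<and> (\<exists>e\<in>C2. hom x \<theta> e \<and> e \<notin> C1)"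

definition hpos :: "('v \<Rightarrow> int) \<Rightarrow> (nat \<Rightarrow> 'v::ab_group_add) \<Rightarrow> (nat list \<Rightarrow> 'k::field) set \<Rightarrow> bool" where
  "hpos h x C \<longleftrightarrow> (\<forall>y\<in>C. \<forall>\<mu>. y \<noteq> 0 \<longrightarrow> hom x \<mu> y \<longrightarrow> \<mu> = 0 \<or> 0 < h \<mu>)"

context bichar
begin

text \<open>A graded right coideal subalgebra, represented by its homogeneous elements only; this is
  why sums are taken within one weight. Stability under the right derivations is the coideal
  property.\<close>

definition rcs :: "nat \<Rightarrow> (nat \<Rightarrow> 'v) \<Rightarrow> (nat list \<Rightarrow> 'k) set \<Rightarrow> bool" where
  "rcs n x C \<longleftrightarrow> (\<forall>y\<in>C. y \<in> U n x \<and> (\<exists>\<mu>. hom x \<mu> y)) \<and> bas [] \<in> C \<and> (\<forall>c. \<forall>y\<in>C. sc c y \<in> C)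
     \<and> (\<forall>y\<in>C. \<forall>z\<in>C. \<forall>\<mu>. hom x \<mu> y \<longrightarrow> hom x \<mu> z \<longrightarrow> y + z \<in> C)
     \<and> (\<forall>y\<in>C. \<forall>z\<in>C. y \<odot>\<^bsub>x\<^esub> z \<in> C) \<and> (\<forall>y\<in>C. \<forall>j<n. Dr j y \<in> C)"

lemma rcsD:
  assumes "rcs n x C"
  shows "y \<in> C \<Longrightarrow> y \<in> U n x" "y \<in> C \<Longrightarrow> \<exists>\<mu>. hom x \<mu> y" "bas [] \<in> C" "y \<in> C \<Longrightarrow> sc c y \<in> C"
    "y \<in> C \<Longrightarrow> z \<in> C \<Longrightarrow> hom x \<mu> y \<Longrightarrow> hom x \<mu> z \<Longrightarrow> y + z \<in> C"
    "y \<in> C \<Longrightarrow> z \<in> C \<Longrightarrow> y \<odot>\<^bsub>x\<^esub> z \<in> C" "y \<in> C \<Longrightarrow> j < n \<Longrightarrow> Dr j y \<in> C"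
  using assms unfolding rcs_def by blast+

lemma rcs_zero: "rcs n x C \<Longrightarrow> 0 \<in> C"
  using rcsD(4)[of n x C "bas []" 0] rcsD(3) by fastforce

lemma rcs_diff: "rcs n x C \<Longrightarrow> y \<in> C \<Longrightarrow> z \<in> C \<Longrightarrow> hom x \<mu> y \<Longrightarrow> hom x \<mu> z \<Longrightarrow> y - z \<in> C"
  using rcsD(5)[of n x C y "sc (- 1) z" \<mu>] rcsD(4)[of n x C z "- 1"] hom_sc[of x \<mu> z "- 1"]
  by (simp add: sc_minus)

lemma rcs_tw: "rcs n x C \<Longrightarrow> y \<in> C \<Longrightarrow> tw x v y \<in> C"
  using rcsD(2)[of n x C y] rcsD(4) tw_hom by metis

lemma rcs_Dr_pow: "rcs n x C \<Longrightarrow> y \<in> C \<Longrightarrow> j < n \<Longrightarrow> (Dr j ^^ t) y \<in> C"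
  by (induction t) (auto intro: rcsD)

lemma rcs_pow: "rcs n x C \<Longrightarrow> bas [j] \<in> C \<Longrightarrow> pw x j k \<in> C"
  by (induction k) (auto intro: rcsD)

lemma rcs_sum:
  assumes "rcs n x C" shows "(\<And>k. k \<in> I \<Longrightarrow> F k \<in> C \<and> hom x \<mu> (F k)) \<Longrightarrow> sum F I \<in> C \<and> hom x \<mu> (sum F I)"
  by (induction I rule: infinite_finite_induct) (auto simp: rcs_zero[OF assms] intro: rcsD(5)[OF assms] hom_add)

lemma rcs_suffix:
  assumes "rcs n x C" shows "y \<in> C \<Longrightarrow> set w \<subseteq> {..<n} \<Longrightarrow> (\<lambda>v. y (v @ w)) \<in> C"
proof (induction w)
  case (Cons l w)
  then have "Dr l (\<lambda>v. y (v @ w)) \<in> C" by (intro rcsD(7)[OF assms]) auto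
  then show ?case by (simp add: Dr_def)
qed simp

text \<open>Strip all letters but the first from the right end of a word of y. The result has the
  weight of one letter j, so by independence \<open>[j]\<close> is the only word in it.\<close>

lemma rcs_letter:
  assumes C: "rcs n x C" and x: "indep n x" and y: "y \<in> C" "y w \<noteq> 0" "w \<noteq> []"
  shows "\<exists>j<n. bas [j] \<in> C"
proof -
  obtain j w' where w: "w = j # w'" using y by (cases w) auto
  have n: "set w \<subseteq> {..<n}" using U_letters[OF rcsD(1)[OF C y(1)] y(2)] .
  define z where "z = (\<lambda>v. y (v @ w'))"
  have zC: "z \<in> C" unfolding z_def using rcs_suffix[OF C y(1)] n w by auto
  have zj: "z [j] \<noteq> 0" using y w by (simp add: z_def)
  obtain \<nu> where \<nu>: "hom x \<nu> z" using rcsD(2)[OF C zC] by blast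
  have "v = [j]" if "z v \<noteq> 0" for v
  proof -
    have "wv x v = wv x [j]" using \<nu> zj that unfolding hom_def by metis
    moreover have "set v \<subseteq> {..<n}" "set [j] \<subseteq> {..<n}" using U_letters[OF rcsD(1)[OF C zC] that] n w by auto
    ultimately have "mset v = mset [j]" using x unfolding indep_def by blast
    then show "v = [j]" by simp
  qed
  then have "z = sc (z [j]) (bas [j])" by (auto simp: fun_eq_iff sc_apply bas_def)
  then have "bas [j] = sc (inverse (z [j])) z" using zj by (metis left_inverse sc_simps(4,5))
  then show ?thesis using rcsD(4)[OF C zC] n w by (intro exI[of _ j]) auto
qed

definition scalars :: "(nat list \<Rightarrow> 'k) set" where "scalars = range (\<lambda>c. sc c (bas []))"

lemma rcs_scalars: "rcs n x scalars"
  unfolding rcs_def scalars_def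
proof (intro conjI ballI allI impI)
  fix y :: "nat list \<Rightarrow> 'k" assume y: "y \<in> range (\<lambda>c. sc c (bas []))"
  then show "y \<in> U n x" by (auto intro: U_sc one_U)
  show "\<exists>\<mu>. hom x \<mu> y" using y by (auto intro!: exI[of _ 0] simp: hom_def bas_def sc_def split: if_splits)
  show "sc c y \<in> range (\<lambda>c. sc c (bas []))" for c using y by auto
  show "Dr j y \<in> range (\<lambda>c. sc c (bas []))" for j using y by (auto intro!: image_eqI[of _ _ 0])
  fix z :: "nat list \<Rightarrow> 'k" assume z: "z \<in> range (\<lambda>c. sc c (bas []))"
  show "y + z \<in> range (\<lambda>c. sc c (bas []))" using y z by (auto simp flip: sc_left_distrib)
  show "y \<odot>\<^bsub>x\<^esub> z \<in> range (\<lambda>c. sc c (bas []))" using y z by auto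
qed (auto intro: image_eqI[of _ _ 1])

lemma rcs_no_letter:
  assumes "rcs n x C" "indep n x" "\<not> (\<exists>j<n. bas [j] \<in> C)" shows "C = scalars"
proof
  show "C \<subseteq> scalars"
  proof
    fix y assume "y \<in> C"
    then have "y w = 0" if "w \<noteq> []" for w using rcs_letter assms that by blast
    then have "y = sc (y []) (bas [])" by (auto simp: fun_eq_iff sc_apply bas_def)
    then show "y \<in> scalars" by (auto simp: scalars_def)
  qed
  show "scalars \<subseteq> C" using assms by (auto simp: scalars_def intro: rcsD)
qed

end

section \<open>Reflecting right coideal subalgebras\<close>

context refl
begin

text \<open>Only the kernel of \<open>Dr i\<close> is transported. The letter i itself is left
  behind, since its weight becomes negative.\<close>

definition red :: "(nat list \<Rightarrow> 'k) set \<Rightarrow> (nat list \<Rightarrow> 'k) set" where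
  "red C = Th ` {y \<in> C. Dr i y = 0}"

lemma rcs_Kg: "rcs n x C \<Longrightarrow> y \<in> C \<Longrightarrow> Dr i y = 0 \<Longrightarrow> y \<in> Kg"
  using rcsD(1) Kg_iff by blast

lemma rcs_Op:
  assumes "rcs n x C" "ioi \<in> C" "y \<in> C" "Dr i y = 0" "j < n"
  shows "Op j y \<in> C"
proof (cases "j = i")
  case True
  obtain \<mu> where \<mu>: "hom x \<mu> y" using rcsD(2)[OF assms(1,3)] by blast
  have "ad y \<in> C" unfolding ad_def
  proof (rule rcs_diff[OF assms(1), of _ _ "x i + \<mu>"])
    show "hom x (x i + \<mu>) (ioi \<odot> y)" using hom_mul[OF hom_bas[of x "[i]"] \<mu>] by simp
    show "hom x (x i + \<mu>) (tw x (- x i) y \<odot> ioi)"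
      using hom_mul[OF hom_tw[OF \<mu>] hom_bas[of x "[i]"]] by (simp add: add.commute)
  qed (use assms rcsD(6) rcs_tw in blast)+
  then show ?thesis using True by (simp add: Op_i)
next
  case False
  then show ?thesis using rcs_Dr_pow[OF assms(1) rcsD(7)[OF assms(1,3,5)] i_less] by (simp add: Op_ne)
qed

lemma red_rcs:
  assumes C: "rcs n x C" "ioi \<in> C" shows "rcs n x' (red C)"
  unfolding rcs_def red_def
proof (intro conjI ballI allI impI)
  let ?C = "{y \<in> C. Dr i y = 0}"
  show "bas [] \<in> Th ` ?C" by (rule image_eqI[of _ _ "bas []"]) (auto intro: rcsD[OF C(1)])
  fix y' assume "y' \<in> Th ` ?C"
  then obtain y where y: "y' = Th y" "y \<in> C" "Dr i y = 0" by blast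
  note yK = rcs_Kg[OF C(1) y(2,3)]
  show "y' \<in> U n x'" using Th_U[OF yK] y by simp
  obtain \<mu>y where \<mu>y: "hom x \<mu>y y" using rcsD(2)[OF C(1) y(2)] by blast
  show "\<exists>\<mu>. hom x' \<mu> y'" using hom_Th[OF \<mu>y] y by blast
  show "sc c y' \<in> Th ` ?C" for c
    by (rule image_eqI[of _ _ "sc c y"]) (use y rcsD[OF C(1)] in \<open>auto simp: Th_sc\<close>)
  show "Dr j y' \<in> Th ` ?C" if "j < n" for j
    by (rule image_eqI[of _ _ "Op j y"])
       (use y that rcs_Op[OF C y(2,3)] Op_Kg[OF yK, of j] Kg_Dr in \<open>auto simp: Dr_Th\<close>)
  fix z' assume "z' \<in> Th ` ?C"
  then obtain z where z: "z' = Th z" "z \<in> C" "Dr i z = 0" by blast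
  note zK = rcs_Kg[OF C(1) z(2,3)]
  show "y' \<odot>' z' \<in> Th ` ?C"
    by (rule image_eqI[of _ _ "y \<odot> z"]) (use y z yK zK rcsD(6)[OF C(1)] in \<open>auto simp: Th_mul Dr_mul\<close>)
  fix \<mu> assume h: "hom x' \<mu> y'" "hom x' \<mu> z'"
  show "y' + z' \<in> Th ` ?C"
  proof (cases "y' = 0 \<or> z' = 0")
    case True then show ?thesis using \<open>y' \<in> Th ` ?C\<close> \<open>z' \<in> Th ` ?C\<close> by auto
  next
    case False
    obtain \<mu>z where \<mu>z: "hom x \<mu>z z" using rcsD(2)[OF C(1) z(2)] by blast
    have "\<mu>y = \<mu>" "\<mu>z = \<mu>" using hom_unique[OF hom_Th[OF \<mu>y], of \<mu>] hom_unique[OF hom_Th[OF \<mu>z], of \<mu>] h False y z by auto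
    then have "y + z \<in> C" using rcsD(5)[OF C(1) y(2) z(2)] \<mu>y \<mu>z by blast
    then show ?thesis by (intro image_eqI[of _ _ "y + z"]) (use y z in \<open>auto simp: Th_add\<close>)
  qed
qed

lemma red_homD:
  assumes "rcs n x C" "y' \<in> red C" "y' \<noteq> 0" "hom x' \<mu> y'"
  shows "\<exists>y\<in>C. Dr i y = 0 \<and> y' = Th y \<and> y \<noteq> 0 \<and> hom x \<mu> y"
proof -
  obtain y where y: "y \<in> C" "Dr i y = 0" "y' = Th y" using assms by (auto simp: red_def)
  obtain \<nu> where \<nu>: "hom x \<nu> y" using rcsD(2)[OF assms(1) y(1)] by blast
  have "\<nu> = \<mu>" using hom_unique[OF hom_Th[OF \<nu>], of \<mu>] y assms by auto
  moreover have "y \<noteq> 0" using y assms by auto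
  ultimately show ?thesis using y \<nu> by blast
qed

lemma Dr_Dr_zero:
  assumes "Q = - 1" "f \<in> U n x" shows "Dr i (Dr i f) = 0"
  using assms(2) unfolding U_def
proof (induction rule: lspan_induct)
  case (add a f c)
  have "Dr i (Dr i (Xi x w)) = 0" for w
  proof (induction w)
    case (Cons k w)
    show ?case
    proof (cases "k = i")
      case True
      have "Dr i (Dr i (ioi \<odot> Xi x w)) = sc (1 + Q) (Dr i (Xi x w)) + sc (Q * Q) (ioi \<odot> Dr i (Dr i (Xi x w)))"
        by (simp add: Dr_mul Dr_bas1 sc_left_distrib add.assoc)
      then show ?thesis using True Cons assms(1) by simp
    qed (use Cons in \<open>simp add: Dr_mul Dr_bas1\<close>)
  qed simp
  then show ?case using add by auto
qed simp

text \<open>The triangular decomposition inside C: divide the highest nonzero derivative z of e by a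
  scalar, put the power of i behind it, subtract, and continue with a lower order. All terms stay in
  C because i lies in C.\<close>

lemma decomp:
  assumes C: "rcs n x C" "ioi \<in> C"
  shows "e \<in> C \<Longrightarrow> hom x \<theta> e \<Longrightarrow> (Dr i ^^ N) e = 0 \<Longrightarrow>
    \<exists>y. (\<forall>k<N. y k \<in> C \<and> Dr i (y k) = 0 \<and> hom x (\<theta> - wv x (replicate k i)) (y k)) \<and> e = (\<Sum>k<N. y k \<odot> pw x i k)"
proof (induction N arbitrary: e)
  case 0 then show ?case by simp
next
  case (Suc N)
  define z where "z = (Dr i ^^ N) e"
  let ?\<mu> = "\<theta> - wv x (replicate N i)"
  have z: "z \<in> C" "hom x ?\<mu> z" "Dr i z = 0"
    using rcs_Dr_pow[OF C(1) Suc.prems(1) i_less] hom_Dr_pow[OF Suc.prems(2)] Suc.prems(3) by (auto simp: z_def)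
  show ?case
  proof (cases "z = 0")
    case True
    then obtain y where y: "\<forall>k<N. y k \<in> C \<and> Dr i (y k) = 0 \<and> hom x (\<theta> - wv x (replicate k i)) (y k)" "e = (\<Sum>k<N. y k \<odot> pw x i k)"
      using Suc.IH[of e] Suc.prems by (auto simp: z_def)
    have "(\<Sum>k<N. (y(N := 0)) k \<odot> pw x i k) = (\<Sum>k<N. y k \<odot> pw x i k)" by (rule sum.cong) auto
    then show ?thesis using y rcs_zero[OF C(1)] by (intro exI[of _ "y(N := 0)"]) (auto simp: less_Suc_eq)
  next
    case False
    \<comment> \<open>The scalar that the N-fold derivation produces on
      \<open>yN \<odot> pw x i N\<close>: the quantum factorial and the twist of weight
      \<open>?\<mu>\<close>.\<close>
    define d where "d = (\<Prod>r<N. qn Q (N - r)) * X (wv x (replicate N i)) ?\<mu>"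
    have "(\<Prod>r<N. qn Q (N - r)) \<noteq> 0"
      using Q_cases
    proof
      \<comment> \<open>Here \<open>Dr i\<close> squares to zero on \<open>U\<close>, so that a
        nonzero z forces \<open>N < 2\<close>, before a vanishing quantum integer can occur.\<close>
      assume Q: "Q = - 1"
      have "N < 2"
      proof (rule ccontr)
        assume "\<not> N < 2"
        then obtain N' where "N = N' + 2" by (metis add.commute le_add_diff_inverse not_less)
        then have "z = (Dr i ^^ N') ((Dr i ^^ 2) e)" unfolding z_def by (simp only: funpow_add o_apply)
        then have "z = (Dr i ^^ N') (Dr i (Dr i e))" by (simp add: numeral_2_eq_2)
        then show False using False Dr_Dr_zero[OF Q rcsD(1)[OF C(1) Suc.prems(1)]] by simp
      qed
      then show ?thesis by (cases N) auto
    qed auto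
    then have d: "d \<noteq> 0" by (simp add: d_def)
    define yN where "yN = sc (inverse d) z"
    have yN: "yN \<in> C" "hom x ?\<mu> yN" "Dr i yN = 0" using z rcsD(4)[OF C(1)] hom_sc by (auto simp: yN_def)
    have hy: "hom x \<theta> (yN \<odot> pw x i N)" using hom_mul[OF yN(2) hom_Xi[of x "replicate N i"]] by simp
    define e' where "e' = e - (yN \<odot> pw x i N)"
    have "(Dr i ^^ N) (yN \<odot> pw x i N) = sc (\<Prod>r<N. qn Q (N - r)) (tw x (wv x (replicate N i)) yN)"
      by (simp add: Dr_pow_mul[OF yN(3)] Dr_pow_pw)
    also have "\<dots> = sc (d * inverse d) z" unfolding tw_hom[OF yN(2)] unfolding yN_def sc_simps d_def by (simp only: mult.assoc)
    also have "\<dots> = z" using d by simp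
    finally have p: "(Dr i ^^ N) (yN \<odot> pw x i N) = z" .
    have "e = e' + (yN \<odot> pw x i N)" by (simp add: e'_def)
    then have "z = (Dr i ^^ N) e' + z" unfolding z_def by (metis Dr_pow_add p z_def)
    then have e'0: "(Dr i ^^ N) e' = 0" by simp
    have "e' \<in> C" unfolding e'_def
      using rcs_diff[OF C(1) Suc.prems(1) rcsD(6)[OF C(1) yN(1) rcs_pow[OF C]] Suc.prems(2) hy] .
    moreover have "hom x \<theta> e'" unfolding e'_def by (intro hom_diff hy Suc.prems)
    ultimately obtain y where y: "\<forall>k<N. y k \<in> C \<and> Dr i (y k) = 0 \<and> hom x (\<theta> - wv x (replicate k i)) (y k)" "e' = (\<Sum>k<N. y k \<odot> pw x i k)"
      using Suc.IH[of e'] e'0 by auto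
    have "(\<Sum>k<N. (y(N := yN)) k \<odot> pw x i k) = (\<Sum>k<N. y k \<odot> pw x i k)" by (rule sum.cong) auto
    then have "e = (\<Sum>k<Suc N. (y(N := yN)) k \<odot> pw x i k)" using y(2) \<open>e = e' + _\<close> by simp
    then show ?thesis using y(1) yN by (intro exI[of _ "y(N := yN)"]) (auto simp: less_Suc_eq)
  qed
qed

lemma decomp':
  assumes C: "rcs n x C" "ioi \<in> C" and e: "e \<in> C" "hom x \<theta> e"
  shows "\<exists>N y. (\<forall>k<Suc N. y k \<in> C \<and> Dr i (y k) = 0 \<and> hom x (\<theta> - wv x (replicate k i)) (y k)) \<and> e = (\<Sum>k<Suc N. y k \<odot> pw x i k)"
proof -
  obtain N where N: "\<forall>w. e w \<noteq> 0 \<longrightarrow> length w \<le> N" using U_bounded[OF rcsD(1)[OF C(1) e(1)]] by blast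
  have "(Dr i ^^ Suc N) e = 0"
  proof
    fix w show "(Dr i ^^ Suc N) e w = 0 w"
      using N[rule_format, of "w @ replicate (Suc N) i"] by (simp only: Dr_pow_apply fun_pw) fastforce
  qed
  then show ?thesis using decomp[OF C e, of "Suc N"] by blast
qed

text \<open>By P all terms of the decomposition of e with a positive power of i lie in
  \<open>C1\<close>. So the remaining term \<open>y 0\<close>, which lies in the kernel, is outside
  \<open>C1\<close>, and injectivity of \<open>Th\<close> keeps its image outside
  \<open>red C1\<close>.\<close>

lemma gap_red:
  assumes C1: "rcs n x C1" and C2: "rcs n x C2" "ioi \<in> C2" and g: "gap h x C1 C2 \<theta>"
    and P: "\<And>k y. y \<in> C2 \<Longrightarrow> hom x (\<theta> - wv x (replicate (Suc k) i)) y \<Longrightarrow> y \<odot> pw x i (Suc k) \<in> C1"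
  shows "gap h x' (red C1) (red C2) \<theta>"
  unfolding gap_def
proof (intro conjI allI impI)
  have C12: "C1 \<subseteq> C2" using g by (simp add: gap_def)
  then show "red C1 \<subseteq> red C2" by (auto simp: red_def)
  fix y' \<mu> assume y': "y' \<in> red C2" "y' \<noteq> 0" "hom x' \<mu> y'" and \<mu>: "h \<mu> \<le> h \<theta>" "\<mu> \<noteq> \<theta>"
  obtain y where "y \<in> C2" "Dr i y = 0" "y' = Th y" "y \<noteq> 0" "hom x \<mu> y" using red_homD[OF C2(1) y'] by blast
  then show "y' \<in> red C1" using g \<mu> unfolding gap_def red_def by blast
next
  obtain e where e: "e \<in> C2" "hom x \<theta> e" "e \<notin> C1" using g by (auto simp: gap_def)
  obtain N y where y: "\<forall>k<Suc N. y k \<in> C2 \<and> Dr i (y k) = 0 \<and> hom x (\<theta> - wv x (replicate k i)) (y k)" "e = (\<Sum>k<Suc N. y k \<odot> pw x i k)"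
    using decomp'[OF C2 e(1,2)] by blast
  define r where "r = (\<Sum>k<N. y (Suc k) \<odot> pw x i (Suc k))"
  have er: "e = y 0 + r" unfolding y(2) r_def sum.lessThan_Suc_shift by simp
  have "y (Suc k) \<odot> pw x i (Suc k) \<in> C1 \<and> hom x \<theta> (y (Suc k) \<odot> pw x i (Suc k))" if "k < N" for k
  proof
    have k: "y (Suc k) \<in> C2" "hom x (\<theta> - wv x (replicate (Suc k) i)) (y (Suc k))" using y(1) that by auto
    then show "y (Suc k) \<odot> pw x i (Suc k) \<in> C1" by (rule P)
    show "hom x \<theta> (y (Suc k) \<odot> pw x i (Suc k))"
      using hom_mul[OF k(2) hom_Xi[of x "replicate (Suc k) i"]] by (simp only: diff_add_cancel)
  qed
  then have "r \<in> C1 \<and> hom x \<theta> r" unfolding r_def by (intro rcs_sum[OF C1]) (simp only: lessThan_iff)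
  then have r: "r \<in> C1" "hom x \<theta> r" by blast+
  have y0: "y 0 \<in> C2" "Dr i (y 0) = 0" "hom x \<theta> (y 0)" using y(1) by force+
  have "y 0 \<notin> C1" using rcsD(5)[OF C1 _ r(1) y0(3) r(2)] er e by auto
  moreover have "y 0 = z" if "Th (y 0) = Th z" "z \<in> C1" "Dr i z = 0" for z
  proof -
    have zK: "z \<in> Kg" "y 0 \<in> Kg" using rcs_Kg[OF C1 that(2,3)] rcs_Kg[OF C2(1) y0(1,2)] by auto
    have "y 0 - z \<in> Kg" using Kg_add[OF zK(2) Kg_sc[OF zK(1), of "-1"]] by (simp add: sc_minus)
    moreover have "Th (y 0 - z) = 0" using that by (simp add: Th_diff)
    ultimately have "y 0 - z = 0" by (rule Th_inj)
    then show ?thesis by simp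
  qed
  ultimately have "Th (y 0) \<notin> red C1" by (auto simp: red_def)
  moreover have "Th (y 0) \<in> red C2" "hom x' \<theta> (Th (y 0))" using y0 hom_Th by (auto simp: red_def)
  ultimately show "\<exists>e\<in>red C2. hom x' \<theta> e \<and> e \<notin> red C1" by blast
qed

lemma hpos_red: "rcs n x C \<Longrightarrow> hpos h x C \<Longrightarrow> hpos h x' (red C)"
  unfolding hpos_def using red_homD by blast

lemma red_mono: "C \<subseteq> E \<Longrightarrow> red C \<subseteq> red E" by (auto simp: red_def)

lemma red_scalars: "red scalars = scalars"
  by (auto simp: red_def scalars_def Th_sc intro!: image_eqI[of _ Th])

lemma indep_x': assumes "indep n x" shows "indep n x'"
  unfolding indep_def
proof (intro allI impI)
  fix u w assume u: "set u \<subseteq> {..<n}" and w: "set w \<subseteq> {..<n}" and uw: "wv x' u = wv x' w"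
  \<comment> \<open>Replacing each \<open>j \<noteq> i\<close> by j followed by \<open>m j\<close>
    copies of i rewrites reflected weights as old ones, up to as many \<open>x i\<close> as there
    are letters i. The i's are moved to the other side to stay with nonnegative
    combinations.\<close>
  define g where "g = (\<lambda>u. concat (map (\<lambda>j. if j = i then [] else j # replicate (m j) i) u))"
  have g: "wv x' u = wv x (g u) - wv x (replicate (count (mset u) i) i)" for u
    by (induction u) (simp_all add: g_def x'_def algebra_simps)
  have gs: "set u \<subseteq> {..<n} \<Longrightarrow> set (g u) \<subseteq> {..<n}" for u
    using i_less by (auto simp: g_def split: if_splits)
  have "wv x (g u @ replicate (count (mset w) i) i) = wv x (g w @ replicate (count (mset u) i) i)"
    using uw unfolding g by (simp add: algebra_simps)
  moreover have "set (g u @ replicate (count (mset w) i) i) \<subseteq> {..<n}" "set (g w @ replicate (count (mset u) i) i) \<subseteq> {..<n}"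
    using gs[OF u] gs[OF w] i_less by auto
  ultimately have ms: "mset (g u @ replicate (count (mset w) i) i) = mset (g w @ replicate (count (mset u) i) i)"
    using assms unfolding indep_def by blast
  have cj: "j \<noteq> i \<Longrightarrow> count (mset (g u)) j = count (mset u) j" for j u
    by (induction u) (auto simp: g_def)
  have fg: "filter (\<lambda>j. j \<noteq> i) (g u) = filter (\<lambda>j. j \<noteq> i) u" for u
    by (induction u) (auto simp: g_def)
  have eqj: "count (mset u) j = count (mset w) j" if "j \<noteq> i" for j
    using arg_cong[OF ms, of "\<lambda>M. count M j"] that by (simp add: cj)
  have ci: "count (mset (g u)) i = (\<Sum>j\<in>#filter_mset (\<lambda>j. j \<noteq> i) (mset u). m j)" for u
    by (induction u) (auto simp: g_def)
  have "filter_mset (\<lambda>j. j \<noteq> i) (mset u) = filter_mset (\<lambda>j. j \<noteq> i) (mset w)"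
    by (rule multiset_eqI) (auto simp: eqj)
  then have "count (mset (g u)) i = count (mset (g w)) i" by (simp add: ci)
  then have "count (mset u) i = count (mset w) i" using arg_cong[OF ms, of "\<lambda>M. count M i"] by simp
  then show "mset u = mset w" using eqj by (intro multiset_eqI) metis
qed

end

text \<open>\<open>Phi\<close> serves termination: a finite set that contains the simple roots of
  all systems in \<open>XX\<close>.\<close>

locale root_sys = bichar X for X :: "'v::ab_group_add \<Rightarrow> 'v \<Rightarrow> 'k::field" +
  fixes n :: nat and XX :: "(nat \<Rightarrow> 'v) set" and Phi :: "'v set" and h :: "'v \<Rightarrow> int"
  assumes fin: "finite Phi"
    and simple: "\<And>x i. x \<in> XX \<Longrightarrow> i < n \<Longrightarrow> x i \<in> Phi"
    and reflect: "\<And>x i. x \<in> XX \<Longrightarrow> i < n \<Longrightarrow> \<exists>m. refl X x n i m \<and> refl.x' x i m \<in> XX"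
    and h_add: "\<And>a b. h (a + b) = h a + h b"
begin

lemma h_diff: "h (a - b) = h a - h b" using h_add[of "a - b" b] by simp
lemma h_zero: "h 0 = 0" using h_add[of 0 0] by simp
lemma h_wv: "h (wv x (replicate k i)) = int k * h (x i)"
  by (induction k) (simp_all add: h_zero h_add algebra_simps)

text \<open>The subalgebras in the flag are reflected simultaneously, each time at a letter of the
  smallest nontrivial member. When \<open>\<theta>\<close> itself has become a simple root and is reflected, it turns
  negative, while all the \<open>\<theta>' t\<close> stay positive.\<close>

lemma convexity:
  "\<lbrakk>x \<in> XX; indep n x; rcs n x C1; rcs n x C2; gap h x C1 C2 \<theta>; hpos h x C2; finite T; T \<noteq> {};
    \<And>t. t \<in> T \<Longrightarrow> rcs n x (E1 t) \<and> rcs n x (E2 t) \<and> C2 \<subseteq> E1 t \<and> gap h x (E1 t) (E2 t) (\<theta>' t) \<and> hpos h x (E2 t)\<rbrakk>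
   \<Longrightarrow> \<theta> \<noteq> (\<Sum>t\<in>T. \<theta>' t)"
proof (induction "card {\<beta>\<in>Phi. \<exists>y\<in>C2. y \<noteq> 0 \<and> hom x \<beta> y}" arbitrary: x C1 C2 E1 E2 rule: less_induct)
  case less
  note xX = less.prems(1) and ix = less.prems(2) and C1 = less.prems(3) and C2 = less.prems(4)
    and gC = less.prems(5) and hC = less.prems(6) and T = less.prems(7,8) and E = less.prems(9)
  obtain e where e: "e \<in> C2" "hom x \<theta> e" "e \<notin> C1" using gC by (auto simp: gap_def)
  have C12: "C1 \<subseteq> C2" using gC by (simp add: gap_def)
  have "\<exists>i<n. bas [i] \<in> C2 \<and> (bas [i] \<in> C1 \<or> C1 = scalars)"
  proof (cases "\<exists>j<n. bas [j] \<in> C1")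
    case True then show ?thesis using C12 by blast
  next
    case False
    then have "C1 = scalars" using rcs_no_letter[OF C1 ix] by blast
    moreover have "\<exists>j<n. bas [j] \<in> C2" using rcs_no_letter[OF C2 ix] e calculation by blast
    ultimately show ?thesis by blast
  qed
  then obtain i where i: "i < n" "bas [i] \<in> C2" "bas [i] \<in> C1 \<or> C1 = scalars" by blast
  obtain m where m: "refl X x n i m" "refl.x' x i m \<in> XX" using reflect[OF xX i(1)] by blast
  interpret refl X x n i m by (rule m(1))
  let ?b = "bas [i] :: nat list \<Rightarrow> 'k"
  have bne: "?b \<noteq> 0" by (auto simp: bas_def fun_eq_iff fun_pw)
  have bh: "hom x (x i) ?b" using hom_bas[of x "[i]"] by simp
  have ix': "indep n x'" by (rule indep_x'[OF ix])
  \<comment> \<open>As \<open>x i = - x' i\<close>, it is not a nonnegative combination of the new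
    simple roots.\<close>
  have pos': "wv x' w \<noteq> x i" if "set w \<subseteq> {..<n}" for w
  proof
    assume "wv x' w = x i"
    then have "wv x' (i # w) = wv x' []" by simp
    then have "mset (i # w) = mset []" using ix' that i(1) unfolding indep_def by (metis list.set(1,2) empty_subsetI insert_subset lessThan_iff)
    then show False by simp
  qed
  have "x i \<noteq> 0"
  proof
    assume "x i = 0"
    then have "wv x [i] = wv x []" by simp
    then have "mset [i] = mset []" using ix i(1) unfolding indep_def by (metis list.set(1,2) empty_subsetI insert_subset lessThan_iff)
    then show False by simp
  qed
  then have hi: "0 < h (x i)" using hC i(2) bne bh unfolding hpos_def by blast
  have wt: "\<exists>w. set w \<subseteq> {..<n} \<and> wv x' w = \<mu>" if y: "rcs n x' C" "y \<in> C" "y \<noteq> 0" "hom x' \<mu> y" for C y \<mu>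
  proof -
    obtain w where "y w \<noteq> 0" using y(3) by (auto simp: fun_eq_iff fun_pw)
    then show ?thesis using y U_letters[OF rcsD(1)[OF y(1,2)]] unfolding hom_def by blast
  qed
  \<comment> \<open>Splitting off powers of i lowers the height, so the coefficients belong to
    \<open>D1\<close> by the gap, and the products do because i is in \<open>D1\<close>.\<close>
  have inC1: "gap h x' (red D1) (red D2) \<eta>"
    if D: "rcs n x D1" "rcs n x D2" "?b \<in> D1" "gap h x D1 D2 \<eta>" for D1 D2 \<eta>
  proof (rule gap_red[OF D(1,2) _ D(4)])
    have D12: "D1 \<subseteq> D2" using D(4) by (simp add: gap_def)
    then show "?b \<in> D2" using D(3) by blast
    fix k y assume y: "y \<in> D2" "hom x (\<eta> - wv x (replicate (Suc k) i)) y"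
    show "y \<odot>\<^bsub>x\<^esub> pw x i (Suc k) \<in> D1"
    proof (cases "y = 0")
      case True then show ?thesis using rcs_zero[OF D(1)] by simp
    next
      case False
      have "h (\<eta> - wv x (replicate (Suc k) i)) < h \<eta>" unfolding h_diff h_wv using hi by simp
      then have "y \<in> D1" using D(4) y False unfolding gap_def by (metis less_irrefl less_imp_le)
      then show ?thesis using rcsD(6)[OF D(1) _ rcs_pow[OF D(1,3)]] by blast
    qed
  qed
  have iE: "?b \<in> E1 t" if "t \<in> T" for t using E[OF that] i(2) by blast
  have gE: "gap h x' (red (E1 t)) (red (E2 t)) (\<theta>' t)" if "t \<in> T" for t
    using inC1[of "E1 t" "E2 t"] E[OF that] iE[OF that] by blast
  have rE: "rcs n x' (red (E1 t))" "rcs n x' (red (E2 t))" if "t \<in> T" for t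
  proof -
    have "?b \<in> E2 t" using E[OF that] iE[OF that] by (auto simp: gap_def)
    then show "rcs n x' (red (E1 t))" "rcs n x' (red (E2 t))" using red_rcs E[OF that] iE[OF that] by blast+
  qed
  have rC2: "rcs n x' (red C2)" by (rule red_rcs[OF C2 i(2)])
  have rC1: "rcs n x' (red C1)" using i(3) red_rcs[OF C1] rcs_scalars red_scalars by auto
  show ?case
  proof (cases "\<theta> = x i")
    case True
    show ?thesis
    proof
      assume "\<theta> = (\<Sum>t\<in>T. \<theta>' t)"
      moreover have "\<exists>w. set w \<subseteq> {..<n} \<and> wv x' w = (\<Sum>t\<in>T'. \<theta>' t)" if "finite T'" "T' \<subseteq> T" for T'
        using that
      proof (induction T')
        case empty show ?case by (intro exI[of _ "[]"]) simp
      next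
        case (insert t T')
        then have t: "t \<in> T" by simp
        obtain e' where e': "e' \<in> red (E2 t)" "hom x' (\<theta>' t) e'" "e' \<notin> red (E1 t)" using gE[OF t] by (auto simp: gap_def)
        then have "e' \<noteq> 0" using rcs_zero[OF rE(1)[OF t]] by auto
        then obtain w where "set w \<subseteq> {..<n}" "wv x' w = \<theta>' t" using wt[OF rE(2)[OF t] e'(1)] e'(2) by blast
        moreover obtain w' where "set w' \<subseteq> {..<n}" "wv x' w' = (\<Sum>t\<in>T'. \<theta>' t)" using insert by auto
        ultimately show ?case using insert by (intro exI[of _ "w @ w'"]) auto
      qed
      ultimately show False using pos' True T by (metis order_refl)
    qed
  next
    case False
    have gC': "gap h x' (red C1) (red C2) \<theta>"
    proof (cases "?b \<in> C1")
      case True then show ?thesis using inC1[OF C1 C2 True gC] by blast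
    next
      case nb: False
      then have sc1: "C1 = scalars" using i(3) by blast
      \<comment> \<open>If \<open>x i\<close> were not higher than \<theta>, the gap would put i
        into \<open>C1\<close>. Being higher, it cannot be split off from an element of weight
        \<theta>, since heights in \<open>C2\<close> are nonnegative.\<close>
      have big: "h \<theta> < h (x i)"
      proof (rule ccontr)
        assume "\<not> ?thesis"
        then have "?b \<in> C1" using gC i(2) bne bh False unfolding gap_def by (metis not_less)
        then show False using nb by blast
      qed
      have pos: "0 \<le> h \<mu>" if "y \<in> C2" "y \<noteq> 0" "hom x \<mu> y" for y \<mu>
        using hC that h_zero unfolding hpos_def by force
      show ?thesis
      proof (rule gap_red[OF C1 C2 i(2) gC])
        fix k y assume y: "y \<in> C2" "hom x (\<theta> - wv x (replicate (Suc k) i)) y"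
        have "y = 0"
        proof (rule ccontr)
          assume "y \<noteq> 0"
          then have "0 \<le> h (\<theta> - wv x (replicate (Suc k) i))" using pos y by blast
          then have "int (Suc k) * h (x i) \<le> h \<theta>" unfolding h_diff h_wv by simp
          moreover have "h (x i) \<le> int (Suc k) * h (x i)" using hi by (simp add: algebra_simps)
          ultimately show False using big by linarith
        qed
        then show "y \<odot>\<^bsub>x\<^esub> pw x i (Suc k) \<in> C1" using rcs_zero[OF C1] by simp
      qed
    qed
    let ?S = "{\<beta>\<in>Phi. \<exists>y\<in>C2. y \<noteq> 0 \<and> hom x \<beta> y}"
    let ?S' = "{\<beta>\<in>Phi. \<exists>y\<in>red C2. y \<noteq> 0 \<and> hom x' \<beta> y}"
    \<comment> \<open>No new weights appear, and \<open>x i\<close> is lost; this is the decrease in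
      the induction.\<close>
    have "?S' \<subseteq> ?S" using red_homD[OF C2] by blast
    moreover have "x i \<in> ?S" using simple[OF xX i(1)] i(2) bne bh by blast
    moreover have "x i \<notin> ?S'" using wt[OF rC2] pos' by blast
    ultimately have "?S' \<subset> ?S" by blast
    then have "card ?S' < card ?S" using fin by (intro psubset_card_mono) auto
    then show ?thesis
    proof (rule less.hyps)
      show "rcs n x' (red (E1 t)) \<and> rcs n x' (red (E2 t)) \<and> red C2 \<subseteq> red (E1 t) \<and> gap h x' (red (E1 t)) (red (E2 t)) (\<theta>' t) \<and> hpos h x' (red (E2 t))"
        if "t \<in> T" for t
        using rE[OF that] gE[OF that] E[OF that] red_mono hpos_red by blast
    qed (use m(2) ix' rC1 rC2 gC' hpos_red[OF C2 hC] T in auto)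
  qed
qed

end

subsection \<open>Dominant words and Lyndon vectors\<close>

lemma map_shuffles: "z \<in> shuffles u v \<Longrightarrow> map g z \<in> shuffles (map g u) (map g v)"
  by (induction u v arbitrary: z rule: shuffles.induct) (auto intro: Cons_in_shuffles_leftI Cons_in_shuffles_rightI)

lemma concat_eq_map: "concat ks = map g w \<Longrightarrow> \<exists>ls. concat ls = w \<and> map (map g) ls = ks"
proof (induction ks arbitrary: w)
  case Nil then show ?case by (intro exI[of _ "[]"]) auto
next
  case (Cons k ks)
  then have "map g (take (length k) w) = k" "concat ks = map g (drop (length k) w)"
    by (auto simp: take_map[symmetric] drop_map[symmetric] simp flip: Cons.prems)
  then show ?case using Cons.IH[of "drop (length k) w"]
    by (metis append_take_drop_id concat.simps(2) list.simps(9))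
qed

definition DL :: "nat list \<Rightarrow> (nat list \<Rightarrow> 'k) \<Rightarrow> nat list \<Rightarrow> 'k" where
  "DL u f = (\<lambda>v. f (u @ v))"

lemma DL_simps [simp]: "DL [] f = f" "DL (j # u) f = DL u (Dl j f)"
  by (auto simp: DL_def Dl_def)

lemma DL_add: "DL u (f + g) = DL u f + DL u (g :: _ \<Rightarrow> 'k::comm_ring_1)"
  by (auto simp: DL_def fun_eq_iff fun_pw)

lemma DL_zero: "DL u 0 = (0 :: _ \<Rightarrow> 'k::zero)"
  by (auto simp: DL_def fun_eq_iff fun_pw)

lemma DL_sc: "DL u (sc c f) = sc c (DL u (f :: _ \<Rightarrow> 'k::comm_ring_1))"
  by (auto simp: DL_def fun_eq_iff fun_pw)

lemma DL_diff: "DL u (f - g) = DL u f - DL u (g :: _ \<Rightarrow> 'k::comm_ring_1)"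
  by (auto simp: DL_def fun_eq_iff fun_pw)

lemma hom_DL: "hom x \<mu> f \<Longrightarrow> hom x (\<mu> - wv x u) (DL u f)"
  by (auto simp: hom_def DL_def algebra_simps)

definition cmp :: "(nat \<Rightarrow> 'v::ab_group_add) \<Rightarrow> 'v \<Rightarrow> (nat list \<Rightarrow> 'k::comm_ring_1) \<Rightarrow> nat list \<Rightarrow> 'k" where
  "cmp x \<mu> f = (\<lambda>w. if wv x w = \<mu> then f w else 0)"

lemma hom_cmp: "hom x \<mu> (cmp x \<mu> f)" by (auto simp: hom_def cmp_def)

lemma cmp_hom: "hom x \<nu> f \<Longrightarrow> cmp x \<mu> f = (if \<nu> = \<mu> then f else 0)"
  by (auto simp: cmp_def fun_eq_iff hom_def fun_pw)

lemma lspan_cmp: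
  assumes "f \<in> lspan A" "\<And>a. a \<in> A \<Longrightarrow> \<exists>\<nu>. hom x \<nu> a"
  shows "cmp x \<mu> f \<in> lspan {a \<in> A. hom x \<mu> a}"
  using assms(1)
proof (rule lspan_linear)
  fix a assume "a \<in> A"
  then obtain \<nu> where "hom x \<nu> a" using assms(2) by blast
  then show "cmp x \<mu> a \<in> lspan {a \<in> A. hom x \<mu> a}" using \<open>a \<in> A\<close> by (auto simp: cmp_hom intro: lspan_base)
qed (auto simp: cmp_def fun_eq_iff fun_pw)

context bichar
begin

lemma U_Dl:
  assumes "f \<in> U n x" shows "Dl j f \<in> U n x"
  unfolding U_def
proof (rule lspan_linear[OF assms[unfolded U_def], where F = "Dl j"])
  have "set w \<subseteq> {..<n} \<Longrightarrow> Dl j (Xi x w) \<in> U n x" for w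
  proof (induction w)
    case Nil then show ?case by (simp add: U_zero)
  next
    case (Cons k w)
    have "Dl j (Xi x (k # w)) = (if k = j then tw x (x j) (Xi x w) else 0) + (bas [k] \<odot>\<^bsub>x\<^esub> Dl j (Xi x w))"
      by (simp add: Dl_bas_mul)
    moreover have "(if k = j then tw x (x j) (Xi x w) else 0) \<in> U n x" using Cons.prems by (auto intro: U_tw Xi_U U_zero)
    moreover have "bas [k] \<odot>\<^bsub>x\<^esub> Dl j (Xi x w) \<in> U n x"
      using Cons by (intro U_mul bas_U) auto
    ultimately show ?case by (simp only: U_add)
  qed
  then show "\<And>a. a \<in> Xi x ` lists {..<n} \<Longrightarrow> Dl j a \<in> lspan (Xi x ` lists {..<n})"
    by (auto simp: U_def)
qed simp_all

lemma U_DL: "f \<in> U n x \<Longrightarrow> DL u f \<in> U n x"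
  by (induction u arbitrary: f) (auto intro: U_Dl)

lemma U_suffix: "f \<in> U n x \<Longrightarrow> (\<lambda>v. f (v @ w)) \<in> U n x"
proof (induction w)
  case (Cons l w)
  then have "Dr l (\<lambda>v. f (v @ w)) \<in> U n x" by (intro U_Dr) auto
  then show ?case by (simp add: Dr_def)
qed simp

lemma U_cmp: "f \<in> U n x \<Longrightarrow> cmp x \<mu> f \<in> U n x"
  unfolding U_def using hom_Xi by (intro lspan_mono[OF _ lspan_cmp]) auto

lemma DL_mul:
  assumes "hom x \<nu> g"
  shows "DL u (f \<odot>\<^bsub>x\<^esub> g) \<in> lspan {DL a f \<odot>\<^bsub>x\<^esub> DL b g |a b. u \<in> shuffles a b}"
  using assms
proof (induction u arbitrary: f g \<nu>)
  case Nil then show ?case by (auto intro!: lspan_base exI[of _ "[]"])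
next
  case (Cons j u)
  have "DL u (Dl j f \<odot>\<^bsub>x\<^esub> g) \<in> lspan {DL a f \<odot>\<^bsub>x\<^esub> DL b g |a b. j # u \<in> shuffles a b}"
    using Cons.IH[OF Cons.prems] by (rule lspan_mono[rotated]) (force intro: Cons_in_shuffles_leftI exI[of _ "j # _"])
  moreover have "DL u (f \<odot>\<^bsub>x\<^esub> Dl j g) \<in> lspan {DL a f \<odot>\<^bsub>x\<^esub> DL b g |a b. j # u \<in> shuffles a b}"
    using Cons.IH[OF hom_Dl[OF Cons.prems]] by (rule lspan_mono[rotated]) (force intro: Cons_in_shuffles_rightI exI[of _ "j # _"])
  ultimately show ?case
    by (simp add: Dl_mul DL_add tw_hom[OF Cons.prems] DL_sc lspan_add lspan_sc)
qed

lemma DL_mul_right: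
  assumes "hom x \<nu> g"
  shows "DL u (f \<odot>\<^bsub>x\<^esub> g) - (f \<odot>\<^bsub>x\<^esub> DL u g) \<in> lspan {DL a f \<odot>\<^bsub>x\<^esub> DL b g |a b. u \<in> shuffles a b \<and> a \<noteq> []}"
  using assms
proof (induction u arbitrary: g \<nu>)
  case Nil then show ?case by simp
next
  case (Cons j u)
  let ?A = "{DL a f \<odot>\<^bsub>x\<^esub> DL b g |a b. j # u \<in> shuffles a b \<and> a \<noteq> []}"
  have 1: "DL u (Dl j f \<odot>\<^bsub>x\<^esub> g) \<in> lspan ?A"
    using DL_mul[OF Cons.prems] by (rule lspan_mono[rotated]) (force intro: Cons_in_shuffles_leftI exI[of _ "j # _"])
  have 2: "DL u (f \<odot>\<^bsub>x\<^esub> Dl j g) - (f \<odot>\<^bsub>x\<^esub> DL u (Dl j g)) \<in> lspan ?A"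
    using Cons.IH[OF hom_Dl[OF Cons.prems]] by (rule lspan_mono[rotated]) (force intro: Cons_in_shuffles_rightI exI[of _ "j # _"])
  have "DL (j # u) (f \<odot>\<^bsub>x\<^esub> g) - (f \<odot>\<^bsub>x\<^esub> DL (j # u) g) = sc (X (x j) \<nu>) (DL u (Dl j f \<odot>\<^bsub>x\<^esub> g)) + (DL u (f \<odot>\<^bsub>x\<^esub> Dl j g) - (f \<odot>\<^bsub>x\<^esub> DL u (Dl j g)))"
    by (simp add: Dl_mul DL_add tw_hom[OF Cons.prems] DL_sc)
  then show ?case by (simp only: lspan_add[OF lspan_sc[OF 1] 2])
qed

lemma DL_mul_left:
  assumes "hom x \<nu> g"
  shows "DL u (f \<odot>\<^bsub>x\<^esub> g) - sc (X (wv x u) \<nu>) (DL u f \<odot>\<^bsub>x\<^esub> g) \<in> lspan {DL a f \<odot>\<^bsub>x\<^esub> DL b g |a b. u \<in> shuffles a b \<and> b \<noteq> []}"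
  using assms
proof (induction u arbitrary: f)
  case Nil then show ?case by simp
next
  case (Cons j u)
  let ?A = "{DL a f \<odot>\<^bsub>x\<^esub> DL b g |a b. j # u \<in> shuffles a b \<and> b \<noteq> []}"
  have 1: "DL u (f \<odot>\<^bsub>x\<^esub> Dl j g) \<in> lspan ?A"
    using DL_mul[OF hom_Dl[OF Cons.prems]] by (rule lspan_mono[rotated]) (force intro: Cons_in_shuffles_rightI exI[of _ "j # _"])
  have 2: "DL u (Dl j f \<odot>\<^bsub>x\<^esub> g) - sc (X (wv x u) \<nu>) (DL u (Dl j f) \<odot>\<^bsub>x\<^esub> g) \<in> lspan ?A"
    using Cons.IH[OF Cons.prems] by (rule lspan_mono[rotated]) (force intro: Cons_in_shuffles_leftI exI[of _ "j # _"])
  have "DL (j # u) (f \<odot>\<^bsub>x\<^esub> g) - sc (X (wv x (j # u)) \<nu>) (DL (j # u) f \<odot>\<^bsub>x\<^esub> g) =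
      DL u (f \<odot>\<^bsub>x\<^esub> Dl j g) + sc (X (x j) \<nu>) (DL u (Dl j f \<odot>\<^bsub>x\<^esub> g) - sc (X (wv x u) \<nu>) (DL u (Dl j f) \<odot>\<^bsub>x\<^esub> g))"
    by (simp add: Dl_mul DL_add tw_hom[OF Cons.prems] DL_sc X_add_left sc_minus)
  then show ?case by (simp only: lspan_add[OF 1 lspan_sc[OF 2]])
qed

end

text \<open>All simple roots have the same height \<open>hx\<close>, so that the height of a word is
  proportional to its length (\<open>h_len\<close>). \<open>r_split\<close> keeps just what the
  co-standard recursion for Lyndon vectors provides.\<close>

locale lyn_sys = root_sys X n XX Phi h for X :: "'v::ab_group_add \<Rightarrow> 'v \<Rightarrow> 'k::field" and n XX Phi h +
  fixes x :: "nat \<Rightarrow> 'v" and hx :: int and rk :: "nat \<Rightarrow> nat" and r :: "nat list \<Rightarrow> nat list \<Rightarrow> 'k"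
  assumes x_XX: "x \<in> XX" and indep_x: "indep n x" and h_x: "0 < hx" "\<And>j. j < n \<Longrightarrow> h (x j) = hx"
    and rk: "inj_on rk {..<n}"
    and r_letter: "\<And>j. j < n \<Longrightarrow> r [j] = bas [j]"
    and r_split: "\<And>l. set l \<subseteq> {..<n} \<Longrightarrow> lyn (map rk l) \<Longrightarrow> 2 \<le> length l \<Longrightarrow>
      \<exists>l1 l2. l = l1 @ l2 \<and> lyn (map rk l1) \<and> lyn (map rk l2) \<and> map rk l1 < map rk l2 \<and>
        r l = (r l1 \<odot>\<^bsub>x\<^esub> r l2) - sc (inverse (X (wv x l1) (wv x l2))) (r l2 \<odot>\<^bsub>x\<^esub> r l1)"
begin

abbreviation key where "key w \<equiv> map rk w"
abbreviation W where "W \<equiv> {w. set w \<subseteq> {..<n}}"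
abbreviation mul_x (infixl "\<odot>" 70) where "f \<odot> g \<equiv> f \<odot>\<^bsub>x\<^esub> g"
abbreviation V where "V \<equiv> U n x"

definition Dom :: "nat list \<Rightarrow> bool" where
  "Dom w \<longleftrightarrow> (\<exists>f\<in>V. f w \<noteq> 0 \<and> (\<forall>u. f u \<noteq> 0 \<longrightarrow> key u \<le> key w))"

lemma key_inj: "u \<in> W \<Longrightarrow> w \<in> W \<Longrightarrow> key u = key w \<Longrightarrow> u = w"
  using rk by (metis (no_types, lifting) inj_on_map_eq_map inj_on_subset mem_Collect_eq Un_subset_iff)

lemma h_len: "w \<in> W \<Longrightarrow> h (wv x w) = hx * int (length w)"
  by (induction w) (auto simp: h_zero h_add h_x algebra_simps)

lemma wv_eq: "u \<in> W \<Longrightarrow> w \<in> W \<Longrightarrow> wv x u = wv x w \<Longrightarrow> mset u = mset w"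
  using indep_x unfolding indep_def mem_Collect_eq by blast

lemma V_W: "f \<in> V \<Longrightarrow> f w \<noteq> 0 \<Longrightarrow> w \<in> W" using U_letters by blast

lemma V_mset: "f \<in> V \<Longrightarrow> hom x (wv x k) f \<Longrightarrow> k \<in> W \<Longrightarrow> f w \<noteq> 0 \<Longrightarrow> mset w = mset k"
  using V_W wv_eq unfolding hom_def by blast

lemma Dom_hom:
  assumes "Dom w" shows "\<exists>f\<in>V. hom x (wv x w) f \<and> f w \<noteq> 0 \<and> (\<forall>u. f u \<noteq> 0 \<longrightarrow> key u \<le> key w)"
proof -
  obtain f where f: "f \<in> V" "f w \<noteq> 0" "\<forall>u. f u \<noteq> 0 \<longrightarrow> key u \<le> key w" using assms by (auto simp: Dom_def)
  show ?thesis
  proof (intro bexI[of _ "cmp x (wv x w) f"] conjI allI impI)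
    show "cmp x (wv x w) f w \<noteq> 0" using f by (simp add: cmp_def)
    show "key u \<le> key w" if "cmp x (wv x w) f u \<noteq> 0" for u
      using that f(3) unfolding cmp_def by presburger
  qed (simp_all add: hom_cmp U_cmp f)
qed

lemma Dom_W: "Dom w \<Longrightarrow> w \<in> W" unfolding Dom_def using V_W by blast

text \<open>Strip u, or v, from a homogeneous element with maximal word \<open>u @ v\<close>. In the
  second case all words have the same length, so comparing whole words compares the
  prefixes.\<close>

lemma Dom_factor:
  assumes "Dom (u @ v)" shows "Dom u" "Dom v"
proof -
  obtain f where f: "f \<in> V" "hom x (wv x (u @ v)) f" "f (u @ v) \<noteq> 0" "\<forall>w. f w \<noteq> 0 \<longrightarrow> key w \<le> key (u @ v)"
    using Dom_hom[OF assms] by blast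
  show "Dom v" unfolding Dom_def
  proof (intro bexI[of _ "DL u f"] conjI allI impI)
    show "key v' \<le> key v" if "DL u f v' \<noteq> 0" for v'
    proof -
      have "key (u @ v') \<le> key (u @ v)" using f(4)[rule_format, of "u @ v'"] that by (simp add: DL_def)
      then show ?thesis by simp
    qed
  qed (use f U_DL in \<open>simp_all add: DL_def\<close>)
  show "Dom u" unfolding Dom_def
  proof (intro bexI[of _ "\<lambda>w. f (w @ v)"] conjI allI impI)
    fix u' assume u': "f (u' @ v) \<noteq> 0"
    have "length (u' @ v) = length (u @ v)" by (rule mset_eq_length[OF V_mset[OF f(1,2) Dom_W[OF assms] u']])
    moreover have "key u' @ key v \<le> key u @ key v" using f(4) u' by force
    ultimately show "key u' \<le> key u"
      using less_same_length_append[of "key u" "key u'" "key v" "key v"] by (metis length_append length_map add_right_cancel leD not_le order_refl)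
  qed (use f U_suffix in auto)
qed

lemma finite_class: "finite {w. mset w = M}"
proof (cases "\<exists>v. mset v = M")
  case True
  then obtain v where "mset v = M" by blast
  then have "{w. mset w = M} \<subseteq> {w. set w \<subseteq> set v \<and> length w \<le> length v}"
    by (auto dest: mset_eq_setD mset_eq_length)
  then show ?thesis using finite_lists_length_le[of "set v"] finite_subset by blast
qed auto

section \<open>Leading monomials\<close>

definition GT where "GT v = Xi x ` {w. mset w = mset v \<and> key v < key w}"
definition GE where "GE v = Xi x ` {w. mset w = mset v \<and> key v \<le> key w}"

lemma GT_GE: "f \<in> lspan (GT v) \<Longrightarrow> f \<in> lspan (GE v)"
  by (rule lspan_mono[rotated]) (auto simp: GT_def GE_def)

lemma Xi_GE: "Xi x v \<in> lspan (GE v)" by (rule lspan_base) (auto simp: GE_def)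

lemma class_length: "mset w = mset v \<Longrightarrow> length (key w) = length (key v)" by (metis length_map mset_eq_length)

lemma GE_GE_mul: "f \<in> lspan (GE u) \<Longrightarrow> g \<in> lspan (GE v) \<Longrightarrow> f \<odot> g \<in> lspan (GE (u @ v))"
  by (erule lspan_mul, assumption)
     (auto simp: GE_def Xi_append[symmetric] intro!: lspan_base imageI le_same_length_append, metis mset_eq_length)

lemma GT_GE_mul: "f \<in> lspan (GT u) \<Longrightarrow> g \<in> lspan (GE v) \<Longrightarrow> f \<odot> g \<in> lspan (GT (u @ v))"
  by (erule lspan_mul, assumption)
     (auto simp: GE_def GT_def Xi_append[symmetric] intro!: lspan_base imageI less_same_length_append, metis mset_eq_length order_refl)

lemma GE_GT_mul: "f \<in> lspan (GE u) \<Longrightarrow> g \<in> lspan (GT v) \<Longrightarrow> f \<odot> g \<in> lspan (GT (u @ v))"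
proof (erule lspan_mul, assumption)
  fix a b assume "a \<in> GE u" "b \<in> GT v"
  then obtain u' v' where a: "a = Xi x u'" "mset u' = mset u" "key u \<le> key u'" and b: "b = Xi x v'" "mset v' = mset v" "key v < key v'"
    by (auto simp: GE_def GT_def)
  have "key (u @ v) < key (u' @ v')"
  proof (cases "key u = key u'")
    case False
    then have "key u < key u'" using a by simp
    then show ?thesis using less_same_length_append[of "key u" "key u'"] class_length[OF a(2)] by simp
  qed (use b in simp)
  then show "a \<odot> b \<in> lspan (GT (u @ v))" using a b by (auto simp: GT_def Xi_append[symmetric] intro!: lspan_base imageI)
qed

lemma leading_mul:
  assumes "f - Xi x u \<in> lspan (GT u)" "g - Xi x v \<in> lspan (GT v)"
  shows "(f \<odot> g) - Xi x (u @ v) \<in> lspan (GT (u @ v))"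
proof -
  have g: "g \<in> lspan (GE v)" using lspan_add[OF GT_GE[OF assms(2)] Xi_GE[of v]] by simp
  have "(f \<odot> g) - Xi x (u @ v) = ((f - Xi x u) \<odot> g) + (Xi x u \<odot> (g - Xi x v))"
    by (simp add: mul_diff Xi_append)
  then show ?thesis using GT_GE_mul[OF assms(1) g] GE_GT_mul[OF Xi_GE assms(2)] by (simp add: lspan_add)
qed

lemma lyndon_induct [consumes 2, case_names letter split]:
  assumes "l \<in> W" "lyn (key l)" "\<And>j. j < n \<Longrightarrow> P [j]"
    "\<And>l1 l2. l1 \<in> W \<Longrightarrow> l2 \<in> W \<Longrightarrow> lyn (key l1) \<Longrightarrow> lyn (key l2) \<Longrightarrow> key l1 < key l2 \<Longrightarrow> P l1 \<Longrightarrow> P l2 \<Longrightarrow>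
        r (l1 @ l2) = (r l1 \<odot> r l2) - sc (inverse (X (wv x l1) (wv x l2))) (r l2 \<odot> r l1) \<Longrightarrow> P (l1 @ l2)"
  shows "P l"
  using assms(1,2)
proof (induction "length l" arbitrary: l rule: less_induct)
  case less
  show ?case
  proof (cases "2 \<le> length l")
    case False
    moreover have "l \<noteq> []" using less.prems by auto
    ultimately have "length l = 1" by (cases l) (auto simp: Suc_le_eq)
    then obtain j where "l = [j]" by (auto simp: length_Suc_conv)
    then show ?thesis using assms(3) less.prems by auto
  next
    case True
    obtain l1 l2 where l: "l = l1 @ l2" "lyn (key l1)" "lyn (key l2)" "key l1 < key l2"
        "r l = (r l1 \<odot> r l2) - sc (inverse (X (wv x l1) (wv x l2))) (r l2 \<odot> r l1)"
      using r_split[OF _ less.prems(2) True] less.prems(1) by blast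
    then have "l1 \<noteq> []" "l2 \<noteq> []" by auto
    then have "P l1" "P l2" using less.hyps[of l1] less.hyps[of l2] l less.prems by auto
    then show ?thesis using assms(4)[of l1 l2] l less.prems by auto
  qed
qed

lemma r_V: "l \<in> W \<Longrightarrow> lyn (key l) \<Longrightarrow> r l \<in> V \<and> hom x (wv x l) (r l)"
proof (induction rule: lyndon_induct)
  case (letter j) then show ?case using hom_bas[of x "[j]"] by (simp add: r_letter bas_U)
next
  case (split l1 l2)
  have "hom x (wv x l1 + wv x l2) (r l2 \<odot> r l1)" using hom_mul[of x "wv x l2" "r l2" "wv x l1" "r l1"] split by (simp add: add.commute)
  then show ?case using split by (auto intro!: U_diff U_mul U_sc hom_diff hom_sc hom_mul)
qed

text \<open>In the subtracted product \<open>r l2 \<odot> r l1\<close> all monomials have words at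
  least \<open>l2 @ l1\<close>, hence at least \<open>l2\<close>, which exceeds the Lyndon word
  \<open>l1 @ l2\<close>.\<close>

lemma r_leading: "l \<in> W \<Longrightarrow> lyn (key l) \<Longrightarrow> r l - Xi x l \<in> lspan (GT l)"
proof (induction rule: lyndon_induct)
  case (letter j) then show ?case by (simp add: r_letter)
next
  case (split l1 l2)
  have ge: "r l1 \<in> lspan (GE l1)" "r l2 \<in> lspan (GE l2)"
    using lspan_add[OF GT_GE[OF split.IH(1)] Xi_GE[of l1]] lspan_add[OF GT_GE[OF split.IH(2)] Xi_GE[of l2]] by simp_all
  have "lyn (key (l1 @ l2))" using lyn_append[of "key l1" "key l2"] split by simp
  then have "key (l1 @ l2) < key l2" using lyn_suffix[of "key l1" "key l2"] split by (metis lyn_Nil map_append)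
  also have "\<dots> \<le> key (l2 @ l1)" by simp
  finally have lt: "key (l1 @ l2) < key (l2 @ l1)" .
  have "r l2 \<odot> r l1 \<in> lspan (GT (l1 @ l2))"
    using GE_GE_mul[OF ge(2,1)] by (rule lspan_mono[rotated]) (use lt in \<open>auto simp: GE_def GT_def\<close>)
  then have "((r l1 \<odot> r l2) - Xi x (l1 @ l2)) - sc (inverse (X (wv x l1) (wv x l2))) (r l2 \<odot> r l1) \<in> lspan (GT (l1 @ l2))"
    by (intro lspan_diff lspan_sc leading_mul split)
  then show ?case unfolding split.hyps(6) by (simp add: algebra_simps)
qed

text \<open>All proper right coefficients of a Lyndon vector lie in the right ideal spanned by the words
  \<open>\<ge> l\<close> (up to constants). The only terms of the bracket outside of it are multiples of \<open>r l1\<close>,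
  and the coefficient in the bracket is the one for which they cancel.\<close>

definition VG where "VG l = Xi x ` {w \<in> W. key l \<le> key w}"
definition VK where "VK l = insert (bas []) (VG l)"

lemma VG_VK: "f \<in> lspan (VG l) \<Longrightarrow> f \<in> lspan (VK l)"
  by (rule lspan_mono[rotated]) (auto simp: VK_def)

lemma VG_mono: "key l \<le> key m \<Longrightarrow> f \<in> lspan (VG m) \<Longrightarrow> f \<in> lspan (VG l)"
  by (rule lspan_mono[rotated]) (auto simp: VG_def)

lemma VK_mono: "key l \<le> key m \<Longrightarrow> f \<in> lspan (VK m) \<Longrightarrow> f \<in> lspan (VK l)"
  by (rule lspan_mono[rotated]) (auto simp: VG_def VK_def)

lemma VG_mul: "f \<in> lspan (VG l) \<Longrightarrow> g \<in> V \<Longrightarrow> f \<odot> g \<in> lspan (VG l)"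
  unfolding U_def
proof (erule lspan_mul, assumption)
  fix a b assume "a \<in> VG l" "b \<in> Xi x ` lists {..<n}"
  then obtain u v where a: "a = Xi x u" "u \<in> W" "key l \<le> key u" "b = Xi x v" "v \<in> W" by (auto simp: VG_def)
  have "key l \<le> key (u @ v)" using a(3) by (simp add: order_trans[OF _ le_append])
  then show "a \<odot> b \<in> lspan (VG l)" using a by (auto simp: VG_def Xi_append[symmetric] intro!: lspan_base imageI)
qed

lemma VK_V: "f \<in> lspan (VK l) \<Longrightarrow> f \<in> V"
  by (rule lspan_subset[of "VK l" "Xi x ` lists {..<n}", folded U_def, rotated])
     (auto simp: VK_def VG_def intro: Xi_U one_U)

lemma VK_mul: "f \<in> lspan (VK l) \<Longrightarrow> g \<in> lspan (VK l) \<Longrightarrow> f \<odot> g \<in> lspan (VK l)"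
proof (rule lspan_mul, assumption, assumption)
  fix a b assume ab: "a \<in> VK l" "b \<in> VK l"
  show "a \<odot> b \<in> lspan (VK l)"
  proof (cases "a = bas []")
    case True then show ?thesis using ab by (simp add: lspan_base)
  next
    case False
    then have "a \<in> lspan (VG l)" using ab by (auto simp: VK_def intro: lspan_base)
    then show ?thesis using VG_mul VG_VK VK_V lspan_base ab(2) by blast
  qed
qed

lemma VK_hom:
  assumes "f \<in> lspan (VK l)" "hom x \<mu> f"
  shows "f \<in> lspan {a \<in> VK l. hom x \<mu> a}"
proof -
  have "cmp x \<mu> f \<in> lspan {a \<in> VK l. hom x \<mu> a}"
    using assms(1) by (rule lspan_cmp) (auto simp: VK_def VG_def intro: hom_Xi hom_bas[of x "[]", simplified])
  then show ?thesis using assms(2) by (simp add: cmp_hom)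
qed

lemma Xi_hom: "w \<in> W \<Longrightarrow> hom x \<mu> (Xi x w) \<Longrightarrow> Xi x w \<noteq> 0 \<Longrightarrow> wv x w = \<mu>"
  using hom_unique hom_Xi by blast

lemma VK_class:
  assumes "f \<in> lspan (VK l)" "hom x (wv x v) f" "v \<in> W" "v \<noteq> []"
  shows "f \<in> lspan (Xi x ` {w. mset w = mset v \<and> key l \<le> key w})"
  using VK_hom[OF assms(1,2)]
proof (rule lspan_subset[rotated])
  fix a assume "a \<in> {a \<in> VK l. hom x (wv x v) a}"
  then have a: "a \<in> VK l" "hom x (wv x v) a" by auto
  show "a \<in> lspan (Xi x ` {w. mset w = mset v \<and> key l \<le> key w})"
  proof (cases "a = 0")
    case False
    obtain w where w: "w \<in> W" "a = Xi x w" "w = [] \<or> key l \<le> key w" using a(1) by (auto simp: VK_def VG_def intro: that[of "[]"])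
    then have "mset w = mset v" using Xi_hom a False wv_eq assms(3) by blast
    moreover have "w \<noteq> []" using calculation assms(4) by auto
    ultimately show ?thesis using w by (auto intro!: lspan_base)
  qed simp
qed

lemma r_VK: "l \<in> W \<Longrightarrow> lyn (key l) \<Longrightarrow> r l \<in> lspan (VG l)"
proof -
  assume l: "l \<in> W" "lyn (key l)"
  have "r l \<in> lspan (GE l)" using lspan_add[OF GT_GE[OF r_leading[OF l]] Xi_GE[of l]] by simp
  then show ?thesis by (rule lspan_mono[rotated]) (use l in \<open>auto simp: GE_def VG_def dest: mset_eq_setD\<close>)
qed

lemma r_right_parts: "l \<in> W \<Longrightarrow> lyn (key l) \<Longrightarrow> u \<noteq> [] \<Longrightarrow> DL u (r l) \<in> lspan (VK l)"
proof (induction arbitrary: u rule: lyndon_induct)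
  case (letter j)
  then obtain i u' where "u = i # u'" by (cases u) auto
  moreover have "DL u' (bas []) \<in> lspan (VK [j])" for u'
    by (cases u') (simp_all add: DL_zero lspan_base VK_def)
  moreover have "DL u' 0 \<in> lspan (VK [j])" for u' by (simp add: DL_zero)
  ultimately show ?case using letter by (cases "j = i") (simp_all add: r_letter Dl_bas)
next
  case (split l1 l2)
  define l where "l = l1 @ l2"
  define c where "c = inverse (X (wv x l1) (wv x l2))"
  have h1: "hom x (wv x l1) (r l1)" "r l1 \<in> V" and h2: "hom x (wv x l2) (r l2)" "r l2 \<in> V"
    using r_V split by blast+
  have lynl: "lyn (key l)" using lyn_append[of "key l1" "key l2"] split by (simp add: l_def)
  have l_l2: "key l \<le> key l2" using lyn_suffix_le[of "key l1" "key l2"] lynl split by (cases "l2 = []") (auto simp: l_def)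
  \<comment> \<open>Such a coefficient is constant or a combination of words at least
    \<open>l1\<close> but shorter than \<open>l1\<close>. These differ from \<open>l1\<close> at a
    letter and so exceed \<open>l1 @ l2\<close> as well.\<close>
  have A1: "DL a (r l1) \<in> lspan (VK l)" if a: "a \<noteq> []" for a
  proof (cases "DL a (r l1) = 0")
    case False
    then obtain v where v: "r l1 (a @ v) \<noteq> 0" by (auto simp: DL_def fun_eq_iff fun_pw)
    have mv: "mset (a @ v) = mset l1" using V_mset[OF h1(2,1) split.hyps(1) v] .
    have vW: "v \<in> W" using V_W[OF h1(2) v] by auto
    have wv: "wv x v = wv x l1 - wv x a" using h1(1) v unfolding hom_def by (metis add_diff_cancel_left' wv_simps(3))
    have hv: "hom x (wv x v) (DL a (r l1))" unfolding wv by (rule hom_DL[OF h1(1)])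
    have D: "DL a (r l1) \<in> lspan (VK l1)" by (rule split.IH(1)[OF a])
    show ?thesis
    proof (cases "v = []")
      case True
      then have "DL a (r l1) w = 0" if "w \<noteq> []" for w
        using hv V_mset[OF U_DL[OF h1(2)], of "[]" a w] that by (auto simp: hom_def)
      then have "DL a (r l1) = sc (DL a (r l1) []) (bas [])" by (auto simp: fun_eq_iff fun_pw bas_def)
      moreover have "sc (DL a (r l1) []) (bas []) \<in> lspan (VK l)" by (intro lspan_sc lspan_base) (simp add: VK_def)
      ultimately show ?thesis by simp
    next
      case False
      have lenv: "length v < length l1" using mset_eq_length[OF mv] a by (cases a) auto
      have "DL a (r l1) \<in> lspan (VG l)"
        using VK_class[OF D hv vW False]
      proof (rule lspan_mono[rotated], safe)
        fix w assume w: "mset w = mset v" "key l1 \<le> key w"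
        then have lw: "length w < length l1" using lenv mset_eq_length[OF w(1)] by simp
        have "key l1 < key w" using w(2) lw by (metis length_map less_irrefl order.order_iff_strict)
        moreover have "\<not> prefix (key l1) (key w)" using lw by (auto dest: prefix_length_le)
        ultimately have "key l1 @ key l2 < key w @ []" by (rule less_not_prefix_append)
        moreover have "w \<in> W" using vW w(1) by (auto dest: mset_eq_setD)
        ultimately show "Xi x w \<in> VG l" by (auto simp: VG_def l_def)
      qed
      then show ?thesis by (rule VG_VK)
    qed
  qed simp
  have A2: "DL b (r l2) \<in> lspan (VK l)" for b
  proof (cases "b = []")
    case True then show ?thesis using VG_VK[OF VG_mono[OF l_l2 r_VK]] split by simp
  next
    case False then show ?thesis using VK_mono[OF l_l2 split.IH(2)[OF False]] by simp
  qed
  \<comment> \<open>Modulo the span of \<open>VK l\<close>, in both products only the term remains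
    in which u is taken from \<open>r l2\<close> alone.\<close>
  have B1: "DL u (r l1 \<odot> r l2) - (r l1 \<odot> DL u (r l2)) \<in> lspan (VK l)"
    using DL_mul_right[OF h2(1)] by (rule lspan_subset[rotated]) (auto intro!: VK_mul A1 A2)
  have B2: "DL u (r l2 \<odot> r l1) - sc (X (wv x u) (wv x l1)) (DL u (r l2) \<odot> r l1) \<in> lspan (VK l)"
    using DL_mul_left[OF h1(1)] by (rule lspan_subset[rotated]) (auto intro!: VK_mul A1 A2)
  define M where "M = (r l1 \<odot> DL u (r l2)) - sc (c * X (wv x u) (wv x l1)) (DL u (r l2) \<odot> r l1)"
  have "M \<in> lspan (VK l)"
  proof (cases "DL u (r l2) = 0")
    case True then show ?thesis by (simp add: M_def)
  next
    case False
    then obtain v where v: "r l2 (u @ v) \<noteq> 0" by (auto simp: DL_def fun_eq_iff fun_pw)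
    have vW: "v \<in> W" using V_W[OF h2(2) v] by auto
    have wv: "wv x v = wv x l2 - wv x u" using h2(1) v unfolding hom_def by (metis add_diff_cancel_left' wv_simps(3))
    have hv: "hom x (wv x v) (DL u (r l2))" unfolding wv by (rule hom_DL[OF h2(1)])
    show ?thesis
    proof (cases "v = []")
      case True
      then have "DL u (r l2) w = 0" if "w \<noteq> []" for w
        using hv V_mset[OF U_DL[OF h2(2)], of "[]" u w] that by (auto simp: hom_def)
      then have e: "DL u (r l2) = sc (DL u (r l2) []) (bas [])" by (auto simp: fun_eq_iff fun_pw bas_def)
      have "wv x u = wv x l2" using wv True by simp
      then have "c * X (wv x u) (wv x l1) = 1" by (simp add: c_def X_sym[of "wv x l2"])
      then have "M = 0" unfolding M_def by (subst (1 2) e) simp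
      then show ?thesis by simp
    next
      case False
      have D: "DL u (r l2) \<in> lspan (Xi x ` {w. mset w = mset v \<and> key l2 \<le> key w})"
        by (rule VK_class[OF split.IH(2)[OF split.prems] hv vW False])
      then have D2: "DL u (r l2) \<in> lspan (VG l2)"
        by (rule lspan_mono[rotated]) (use vW in \<open>auto simp: VG_def dest: mset_eq_setD\<close>)
      have "DL u (r l2) \<odot> r l1 \<in> lspan (VG l)" by (rule VG_mul[OF VG_mono[OF l_l2 D2] h1(2)])
      moreover have "r l1 \<odot> DL u (r l2) \<in> lspan (VG l)"
      proof (rule lspan_mul[OF _ D2])
        show "r l1 \<in> lspan (GE l1)" using lspan_add[OF GT_GE[OF r_leading[OF split.hyps(1,3)]] Xi_GE[of l1]] by simp
        fix a b assume "a \<in> GE l1" "b \<in> VG l2"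
        then obtain w w' where w: "a = Xi x w" "mset w = mset l1" "key l1 \<le> key w" "b = Xi x w'" "w' \<in> W" "key l2 \<le> key w'"
          by (auto simp: GE_def VG_def)
        have "key l1 @ key l2 \<le> key w @ key w'" using w class_length[OF w(2)] by (intro le_same_length_append) auto
        moreover have "w \<in> W" using split.hyps(1) w(2) by (auto dest: mset_eq_setD)
        ultimately show "a \<odot> b \<in> lspan (VG l)" using w by (auto simp: VG_def Xi_append[symmetric] l_def intro!: lspan_base imageI)
      qed
      ultimately show ?thesis unfolding M_def by (intro VG_VK lspan_diff lspan_sc)
    qed
  qed
  then have "(DL u (r l1 \<odot> r l2) - (r l1 \<odot> DL u (r l2))) - sc c (DL u (r l2 \<odot> r l1) - sc (X (wv x u) (wv x l1)) (DL u (r l2) \<odot> r l1)) + M \<in> lspan (VK l)"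
    by (intro lspan_add lspan_diff lspan_sc B1 B2)
  moreover have "DL u (r l) = (DL u (r l1 \<odot> r l2) - (r l1 \<odot> DL u (r l2))) - sc c (DL u (r l2 \<odot> r l1) - sc (X (wv x u) (wv x l1)) (DL u (r l2) \<odot> r l1)) + M"
    unfolding M_def l_def split.hyps(6) c_def[symmetric] by (simp add: DL_diff DL_sc sc_minus)
  ultimately show ?case by (simp add: l_def)
qed

end

lemma sum_sc_apply: "finite S \<Longrightarrow> (\<Sum>k\<in>S. sc (c k) (F k)) w = (\<Sum>k\<in>S. c k * F k w)" for c :: "'a \<Rightarrow> 'k::comm_ring_1"
  by (induction S rule: finite_induct) (auto simp: fun_pw)

context lyn_sys
begin

text \<open>The matrix \<open>Xi x w v\<close> is symmetric, so a linear dependence of the coordinate functional \<open>v\<close>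
  on those of larger words is the same as a dependence of \<open>Xi x v\<close> on larger \<open>Xi x w\<close>.\<close>

lemma Xi_not_Dom:
  assumes "v \<in> W" "\<not> Dom v" shows "Xi x v \<in> lspan (GT v)"
proof -
  define A where "A = {w. mset w = mset v \<and> key v < key w}"
  define S where "S = {f \<in> V. hom x (wv x v) f}"
  have fA: "finite A" unfolding A_def by (rule finite_subset[OF _ finite_class[of "mset v"]]) auto
  have "\<exists>c. \<forall>f\<in>S. f v = (\<Sum>a\<in>A. c a * f a)"
  proof (rule functional_span[OF fA])
    fix f assume f: "f \<in> S" "\<And>a. a \<in> A \<Longrightarrow> f a = 0"
    show "f v = 0"
    proof (rule ccontr)
      assume "f v \<noteq> 0"
      moreover have "key u \<le> key v" if "f u \<noteq> 0" for u
      proof -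
        have "mset u = mset v" using V_mset[of f v u] f(1) that assms(1) by (simp add: S_def)
        then show ?thesis using f(2)[of u] that by (force simp: A_def)
      qed
      ultimately have "Dom v" using f(1) by (auto simp: Dom_def S_def)
      then show False using assms by simp
    qed
  qed (auto simp: S_def fun_pw intro: U_add U_sc hom_add hom_sc)
  then obtain c where c: "\<forall>f\<in>S. f v = (\<Sum>a\<in>A. c a * f a)" by blast
  have "Xi x v = (\<Sum>a\<in>A. sc (c a) (Xi x a))"
  proof
    fix u
    have sum_app: "(\<Sum>a\<in>A. sc (c a) (Xi x a)) u = (\<Sum>a\<in>A. c a * Xi x a u)"
      using fA by (induction A rule: finite_induct) (auto simp: fun_pw)
    show "Xi x v u = (\<Sum>a\<in>A. sc (c a) (Xi x a)) u"
    proof (cases "mset u = mset v")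
      case True
      then have "u \<in> W" using assms(1) by (auto dest: mset_eq_setD)
      then have "Xi x u \<in> S" using True hom_Xi[of x u] wv_mset[OF True, of x] by (auto simp: S_def Xi_U)
      then have "Xi x u v = (\<Sum>a\<in>A. c a * Xi x u a)" using c by blast
      then show ?thesis by (simp add: sum_app Xi_sym[of x v u] Xi_sym[of x _ u])
    next
      case False
      then have "Xi x a u = 0" if "a \<in> A" for a using Xi_support[of x a u] that by (auto simp: A_def)
      then show ?thesis using Xi_support[of x v u] False by (auto simp: sum_app)
    qed
  qed
  also have "\<dots> \<in> lspan (GT v)" by (intro lspan_sum lspan_sc lspan_base) (auto simp: A_def GT_def)
  finally show ?thesis .
qed

section \<open>Products of Lyndon vectors along canonical factorizations\<close>

definition facw :: "nat list \<Rightarrow> nat list list" where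
  "facw k = (SOME ls. concat ls = k \<and> map (map rk) ls = fac (key k))"

lemma facw: "concat (facw k) = k" "map (map rk) (facw k) = fac (key k)"
proof -
  have "\<exists>ls. concat ls = k \<and> map (map rk) ls = fac (key k)" by (rule concat_eq_map) (rule fac(2))
  then have "concat (facw k) = k \<and> map (map rk) (facw k) = fac (key k)" unfolding facw_def by (rule someI_ex)
  then show "concat (facw k) = k" "map (map rk) (facw k) = fac (key k)" by auto
qed

lemma facw_lyn: "l \<in> set (facw k) \<Longrightarrow> lyn (key l)"
  using facw(2)[of k] lyn_fac[of "key l" "key k"] by (metis image_eqI list.set_map)

lemma facw_W: "k \<in> W \<Longrightarrow> l \<in> set (facw k) \<Longrightarrow> l \<in> W"
  using facw(1)[of k] by (metis (no_types, lifting) UN_upper mem_Collect_eq order_trans set_concat)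

lemma facw_Dom: "Dom k \<Longrightarrow> l \<in> set (facw k) \<Longrightarrow> Dom l"
proof -
  assume "Dom k" "l \<in> set (facw k)"
  then obtain as bs where "facw k = as @ l # bs" by (meson split_list)
  then have "k = concat as @ l @ concat bs" using facw(1)[of k] by simp
  then show "Dom l" using \<open>Dom k\<close> Dom_factor by metis
qed

lemma facw_lyndon: "lyn (key l) \<Longrightarrow> facw l = [l]"
proof -
  assume "lyn (key l)"
  then have "map (map rk) (facw l) = [key l]" using facw(2)[of l] fac_lyn by simp
  then obtain m where "facw l = [m]" by auto
  then show ?thesis using facw(1)[of l] by simp
qed

definition pr :: "nat list list \<Rightarrow> nat list \<Rightarrow> 'k" where
  "pr ls = foldr (\<lambda>l acc. r l \<odot> acc) ls (bas [])"

definition RW :: "nat list \<Rightarrow> nat list \<Rightarrow> 'k" where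
  "RW k = pr (facw k)"

lemma pr_simps [simp]: "pr [] = bas []" "pr (l # ls) = r l \<odot> pr ls"
  by (simp_all add: pr_def)

lemma pr_props: "\<forall>l\<in>set ls. l \<in> W \<and> lyn (key l) \<Longrightarrow>
   pr ls \<in> V \<and> hom x (wv x (concat ls)) (pr ls) \<and> pr ls - Xi x (concat ls) \<in> lspan (GT (concat ls))"
proof (induction ls)
  case Nil then show ?case using hom_bas[of x "[]"] by (simp add: one_U)
next
  case (Cons l ls)
  then show ?case using r_V[of l] r_leading[of l] by (auto intro: U_mul hom_mul leading_mul)
qed

lemma RW_props: "k \<in> W \<Longrightarrow> RW k \<in> V \<and> hom x (wv x k) (RW k) \<and> RW k - Xi x k \<in> lspan (GT k)"
  using pr_props[of "facw k"] facw_W[of k] facw_lyn[of _ k] facw(1)[of k] by (simp add: RW_def)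

lemma RW_lyndon: "lyn (key l) \<Longrightarrow> RW l = r l"
  by (simp add: RW_def facw_lyndon)

definition sup_le :: "(nat list \<Rightarrow> 'k) \<Rightarrow> nat list \<Rightarrow> bool" where
  "sup_le f k \<longleftrightarrow> (\<forall>w. f w \<noteq> 0 \<longrightarrow> key w \<le> key k)"

lemma sup_le_mul:
  assumes "f \<in> V" "g \<in> V" "hom x (wv x u) f" "hom x (wv x v) g" "u \<in> W" "v \<in> W" "sup_le f u" "sup_le g v" "(f \<odot> g) w \<noteq> 0"
  shows "key w \<le> mg (fac (key u) @ fac (key v))"
proof -
  obtain a b where ab: "w \<in> shuffles a b" "f a \<noteq> 0" "g b \<noteq> 0" using mul_support[OF assms(9)] by blast
  show ?thesis
    by (rule shuffles_le_mg_mono[OF map_shuffles[OF ab(1)]])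
       (use ab assms V_mset[of f u a] V_mset[of g v b] in \<open>auto simp: sup_le_def dest: mset_eq_length\<close>)
qed

lemma pr_sup_le: "\<forall>l\<in>set ls. l \<in> W \<and> lyn (key l) \<and> sup_le (r l) l \<Longrightarrow> dsc (map (map rk) ls) \<Longrightarrow> sup_le (pr ls) (concat ls)"
proof (induction ls)
  case Nil then show ?case by (auto simp: sup_le_def bas_def)
next
  case (Cons l ls)
  have p: "pr ls \<in> V" "hom x (wv x (concat ls)) (pr ls)" "sup_le (pr ls) (concat ls)" "concat ls \<in> W"
    using pr_props[of ls] Cons by (auto simp: dsc_Cons)
  have l: "r l \<in> V" "hom x (wv x l) (r l)" using r_V Cons.prems by auto
  have f: "fac (key l) = [key l]" "fac (key (concat ls)) = map (map rk) ls"
    using Cons.prems by (auto intro!: fac_lyn fac_eqI simp: dsc_Cons map_concat)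
  show ?case unfolding sup_le_def
  proof (intro allI impI)
    fix w assume "pr (l # ls) w \<noteq> 0"
    then have "key w \<le> mg (fac (key l) @ fac (key (concat ls)))"
      using sup_le_mul[OF l(1) p(1) l(2) p(2) _ p(4) _ p(3)] Cons.prems by simp
    also have "\<dots> = concat (map (map rk) (l # ls))" unfolding f using Cons.prems(2) mg_dsc[of "map (map rk) (l # ls)"] by simp
    finally show "key w \<le> key (concat (l # ls))" by (simp add: map_concat)
  qed
qed

text \<open>Descending induction within a weight class: for dominant v the product
  \<open>RW v\<close> has leading monomial \<open>Xi x v\<close>, for other v this monomial is
  itself a combination of larger ones.\<close>

lemma RW_span:
  assumes "v \<in> W" shows "Xi x v \<in> lspan (RW ` {k. Dom k \<and> mset k = mset v \<and> key v \<le> key k})"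
  using assms
proof (induction "card {w. mset w = mset v \<and> key v < key w}" arbitrary: v rule: less_induct)
  case less
  have GT: "f \<in> lspan (RW ` {k. Dom k \<and> mset k = mset v \<and> key v \<le> key k})" if "f \<in> lspan (GT v)" for f
    using that
  proof (rule lspan_subset[rotated])
    fix a assume "a \<in> GT v"
    then obtain w where w: "a = Xi x w" "mset w = mset v" "key v < key w" by (auto simp: GT_def)
    have "{u. mset u = mset w \<and> key w < key u} \<subset> {u. mset u = mset v \<and> key v < key u}" using w by auto
    moreover have "finite {u. mset u = mset v \<and> key v < key u}" by (rule finite_subset[OF _ finite_class[of "mset v"]]) auto
    ultimately have "card {u. mset u = mset w \<and> key w < key u} < card {u. mset u = mset v \<and> key v < key u}"
      by (intro psubset_card_mono)
    moreover have "w \<in> W" using less.prems w(2) by (auto dest: mset_eq_setD)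
    ultimately have "a \<in> lspan (RW ` {k. Dom k \<and> mset k = mset w \<and> key w \<le> key k})" using less.hyps w(1) by blast
    then show "a \<in> lspan (RW ` {k. Dom k \<and> mset k = mset v \<and> key v \<le> key k})"
      by (rule lspan_mono[rotated]) (use w in auto)
  qed
  show ?case
  proof (cases "Dom v")
    case False then show ?thesis using GT Xi_not_Dom less.prems by blast
  next
    case True
    then have "RW v \<in> lspan (RW ` {k. Dom k \<and> mset k = mset v \<and> key v \<le> key k})" by (intro lspan_base) auto
    moreover have "RW v - Xi x v \<in> lspan (RW ` {k. Dom k \<and> mset k = mset v \<and> key v \<le> key k})" using GT RW_props less.prems by blast
    ultimately have "RW v - (RW v - Xi x v) \<in> lspan (RW ` {k. Dom k \<and> mset k = mset v \<and> key v \<le> key k})" by (rule lspan_diff)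
    then show ?thesis by simp
  qed
qed

text \<open>The largest index m with nonzero coefficient cannot be cancelled at the word m, since no
  other product contains a word that large. Hence the largest index that occurs is also a word of
  f.\<close>

lemma triangular:
  assumes f: "f \<in> lspan (RW ` A)" and A: "A \<subseteq> W" "\<And>k. k \<in> A \<Longrightarrow> sup_le (RW k) k" "\<And>k. k \<in> A \<Longrightarrow> RW k k \<noteq> 0" and "f \<noteq> 0"
  shows "\<exists>m\<in>A. f m \<noteq> 0 \<and> f \<in> lspan (RW ` {k \<in> A. key k \<le> key m})"
proof -
  obtain S0 c where S0: "finite S0" "S0 \<subseteq> A" "f = (\<Sum>k\<in>S0. sc (c k) (RW k))" using lspan_finite_sum[OF f] by blast
  define S where "S = {k \<in> S0. c k \<noteq> 0}"
  have S: "finite S" "S \<subseteq> A" using S0 by (auto simp: S_def)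
  have fS: "f = (\<Sum>k\<in>S. sc (c k) (RW k))" unfolding S0(3) using S0(1) by (intro sum.mono_neutral_right) (auto simp: S_def)
  have ne: "S \<noteq> {}" using fS \<open>f \<noteq> 0\<close> by auto
  have "Max (key ` S) \<in> key ` S" using S ne by (intro Max_in) auto
  then obtain m where m: "m \<in> S" "key m = Max (key ` S)" by force
  have le: "key k \<le> key m" if "k \<in> S" for k using m S that by simp
  have "f m = (\<Sum>k\<in>S. c k * RW k m)" unfolding fS by (rule sum_sc_apply[OF S(1)])
  also have "\<dots> = (\<Sum>k\<in>{m}. c k * RW k m)"
  proof (rule sum.mono_neutral_right)
    show "\<forall>k\<in>S - {m}. c k * RW k m = 0"
    proof
      fix k assume k: "k \<in> S - {m}"
      then have "key k \<noteq> key m" using key_inj A(1) S(2) m(1) by blast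
      then have "\<not> key m \<le> key k" using le k by force
      then show "c k * RW k m = 0" using A(2)[of k] S(2) k by (auto simp: sup_le_def)
    qed
  qed (use S m in auto)
  finally have "f m \<noteq> 0" using A(3) S(2) m(1) by (auto simp: S_def)
  moreover have "f \<in> lspan (RW ` {k \<in> A. key k \<le> key m})"
    unfolding fS using le S(2) by (intro lspan_sum lspan_sc lspan_base) auto
  ultimately show ?thesis using m S by blast
qed

text \<open>Descending induction on k. Expand an element f with maximal word k. The part g with
  indices above k vanishes: by \<open>triangular\<close> it would otherwise contribute a word above
  k, which the rest cannot cancel. Among indices up to k only \<open>RW k\<close> can contain k, and
  f does.\<close>

lemma RW_lead:
  assumes sup: "\<And>k. Dom k \<Longrightarrow> mset k = M \<Longrightarrow> sup_le (RW k) k"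
  shows "Dom k \<Longrightarrow> mset k = M \<Longrightarrow> RW k k \<noteq> 0"
proof (induction "card {w. mset w = M \<and> key k < key w}" arbitrary: k rule: less_induct)
  case less
  note kW = Dom_W[OF less.prems(1)]
  have IH: "RW k' k' \<noteq> 0" if k': "Dom k'" "mset k' = M" "key k < key k'" for k'
  proof -
    have "{w. mset w = M \<and> key k' < key w} \<subset> {w. mset w = M \<and> key k < key w}" using k' by auto
    moreover have "finite {w. mset w = M \<and> key k < key w}" by (rule finite_subset[OF _ finite_class[of M]]) auto
    ultimately have "card {w. mset w = M \<and> key k' < key w} < card {w. mset w = M \<and> key k < key w}" by (intro psubset_card_mono)
    then show ?thesis using less.hyps k' by blast
  qed
  obtain f where f: "f \<in> V" "hom x (wv x k) f" "f k \<noteq> 0" "\<forall>u. f u \<noteq> 0 \<longrightarrow> key u \<le> key k" using Dom_hom[OF less.prems(1)] by blast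
  let ?A = "{k. Dom k \<and> mset k = M}"
  have "f \<in> lspan {a \<in> Xi x ` lists {..<n}. hom x (wv x k) a}"
    using lspan_cmp[OF f(1)[unfolded U_def], of x "wv x k"] hom_Xi f(2) by (auto simp: cmp_hom)
  then have "f \<in> lspan (RW ` ?A)"
  proof (rule lspan_subset[rotated])
    fix a assume "a \<in> {a \<in> Xi x ` lists {..<n}. hom x (wv x k) a}"
    then obtain w where w: "a = Xi x w" "w \<in> W" "hom x (wv x k) a" by auto
    show "a \<in> lspan (RW ` ?A)"
    proof (cases "a = 0")
      case False
      then have "wv x w = wv x k" using Xi_hom[OF w(2)] w(1,3) by simp
      then have "mset w = mset k" by (rule wv_eq[OF w(2) kW])
      then show ?thesis unfolding w(1) by (intro lspan_mono[OF _ RW_span[OF w(2)]]) (simp add: less.prems(2) image_mono Collect_mono)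
    qed simp
  qed
  from lspan_finite_sum[OF this] obtain S c where S: "finite S" "S \<subseteq> ?A" "f = (\<Sum>k\<in>S. sc (c k) (RW k))"
    by (elim exE conjE)
  define S1 where "S1 = {k' \<in> S. key k < key k'}"
  define S2 where "S2 = {k' \<in> S. key k' \<le> key k}"
  have S12: "S = S1 \<union> S2" "S1 \<inter> S2 = {}" "finite S1" "finite S2" using S(1) by (auto simp: S1_def S2_def)
  define g where "g = (\<Sum>k\<in>S1. sc (c k) (RW k))"
  have fg: "f = g + (\<Sum>k\<in>S2. sc (c k) (RW k))" unfolding S(3) g_def S12(1) using S12 by (intro sum.union_disjoint) auto
  have S2_0: "(\<Sum>k\<in>S2. sc (c k) (RW k)) w = 0" if "key k < key w" for w
  proof -
    have "RW k' w = 0" if "k' \<in> S2" for k'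
    proof -
      have "Dom k'" "mset k' = M" "key k' < key w" using that S(2) \<open>key k < key w\<close> by (auto simp: S2_def)
      then show ?thesis using sup[of k'] unfolding sup_le_def by force
    qed
    then show ?thesis by (simp add: sum_sc_apply[OF S12(4)])
  qed
  have "g = 0"
  proof (rule ccontr)
    assume "g \<noteq> 0"
    moreover have "g \<in> lspan (RW ` S1)" unfolding g_def by (intro lspan_sum lspan_sc lspan_base) auto
    moreover have "S1 \<subseteq> W" using S(2) Dom_W by (auto simp: S1_def)
    moreover have "sup_le (RW k') k' \<and> RW k' k' \<noteq> 0" if "k' \<in> S1" for k'
      using sup[of k'] IH[of k'] S(2) that by (auto simp: S1_def)
    ultimately obtain m where m: "m \<in> S1" "g m \<noteq> 0" using triangular[of g S1] by blast
    then have "f m = g m" using S2_0[of m] by (simp add: fg fun_pw S1_def)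
    then show False using f(4)[rule_format, of m] m by (auto simp: S1_def)
  qed
  then have "f k = (\<Sum>k'\<in>S2. c k' * RW k' k)" by (simp add: fg sum_sc_apply[OF S12(4)])
  also have "\<dots> = (\<Sum>k'\<in>S2 \<inter> {k}. c k' * RW k' k)"
  proof (rule sum.mono_neutral_right)
    show "\<forall>k'\<in>S2 - S2 \<inter> {k}. c k' * RW k' k = 0"
    proof
      fix k' assume k': "k' \<in> S2 - S2 \<inter> {k}"
      then have D: "Dom k'" "mset k' = M" "key k' \<le> key k" using S(2) by (auto simp: S2_def)
      then have "key k' \<noteq> key k" using key_inj[OF Dom_W[OF D(1)] kW] k' by blast
      then show "c k' * RW k' k = 0" using sup[OF D(1,2)] D(3) unfolding sup_le_def by force
    qed
  qed (use S12 in auto)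
  finally show ?case using f(3) by (cases "k \<in> S2") auto
qed

subsubsection \<open>The coideal subalgebras cut out by the order\<close>

definition CQ :: "(nat list \<Rightarrow> bool) \<Rightarrow> (nat list \<Rightarrow> 'k) set" where
  "CQ P = {f \<in> V. (\<exists>\<mu>. hom x \<mu> f) \<and> (\<forall>w. f w \<noteq> 0 \<longrightarrow> (\<forall>y\<in>set (fac (key w)). P y))}"

lemma CQ_rcs:
  assumes P: "\<And>a b. P b \<Longrightarrow> a \<le> b \<Longrightarrow> P a" shows "rcs n x (CQ P)"
  unfolding rcs_def
proof (intro conjI ballI allI impI)
  have "fac (key w) = []" if "bas [] w \<noteq> (0 :: 'k)" for w using that by (simp add: bas_def split: if_splits)
  then show "bas [] \<in> CQ P" using hom_bas[of x "[]"] by (auto simp: CQ_def one_U)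
  fix f assume f: "f \<in> CQ P"
  show "f \<in> V" "\<exists>\<mu>. hom x \<mu> f" using f by (auto simp: CQ_def)
  show "sc c f \<in> CQ P" for c using f by (auto simp: CQ_def U_sc fun_pw intro: hom_sc)
  show "Dr j f \<in> CQ P" if "j < n" for j
  proof -
    have "\<forall>y\<in>set (fac (key w)). P y" if "Dr j f w \<noteq> 0" for w
    proof -
      have "\<forall>y\<in>set (fac (key w @ [rk j])). P y" using f that by (auto simp: CQ_def Dr_def)
      then show ?thesis using P by (rule fac_prefix_downclosed)
    qed
    then show ?thesis using f by (auto simp: CQ_def intro!: U_Dr intro: hom_Dr)
  qed
  fix g assume g: "g \<in> CQ P"
  have "\<forall>y\<in>set (fac (key w)). P y" if w: "(f \<odot> g) w \<noteq> 0" for w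
  proof -
    obtain u v where uv: "w \<in> shuffles u v" "f u \<noteq> 0" "g v \<noteq> 0" using mul_support[OF w] by blast
    have "\<forall>y\<in>set (fac (key u)). P y" "\<forall>y\<in>set (fac (key v)). P y" using f g uv(2,3) by (auto simp: CQ_def)
    from fac_shuffles_downclosed[OF map_shuffles[OF uv(1)] this] P show ?thesis by blast
  qed
  then show "f \<odot> g \<in> CQ P" using f g by (auto simp: CQ_def intro!: U_mul intro: hom_mul)
  fix \<mu> assume h: "hom x \<mu> f" "hom x \<mu> g"
  have "f w \<noteq> 0 \<or> g w \<noteq> 0" if "(f + g) w \<noteq> 0" for w using that by (auto simp: fun_pw)
  then show "f + g \<in> CQ P" using f g hom_add[OF h] by (auto simp: CQ_def intro!: U_add)
qed

lemma CQ_hpos: "hpos h x (CQ P)"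
  unfolding hpos_def
proof (intro ballI allI impI)
  fix f \<mu> assume f: "f \<in> CQ P" "f \<noteq> 0" "hom x \<mu> f"
  then obtain w where w: "f w \<noteq> 0" by (auto simp: fun_eq_iff fun_pw)
  then have "w \<in> W" "wv x w = \<mu>" using f V_W by (auto simp: CQ_def hom_def)
  then have "h \<mu> = hx * int (length w)" using h_len by auto
  then show "\<mu> = 0 \<or> 0 < h \<mu>" using \<open>wv x w = \<mu>\<close> by (cases w) (auto simp: h_x(1))
qed

text \<open>A word whose factors are at most l and include l is at least as long as l; when its
  height is bounded by that of l, it must be l.\<close>

lemma CQ_gap:
  assumes l: "Dom l" "lyn (key l)"
  shows "gap h x (CQ (\<lambda>y. y < key l)) (CQ (\<lambda>y. y \<le> key l)) (wv x l)"
  unfolding gap_def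
proof (intro conjI allI impI)
  note lW = Dom_W[OF l(1)]
  show "CQ (\<lambda>y. y < key l) \<subseteq> CQ (\<lambda>y. y \<le> key l)" unfolding CQ_def using less_imp_le by blast
  fix f \<mu> assume f: "f \<in> CQ (\<lambda>y. y \<le> key l)" "f \<noteq> 0" "hom x \<mu> f" "h \<mu> \<le> h (wv x l)" "\<mu> \<noteq> wv x l"
  have "y < key l" if w: "f w \<noteq> 0" and y: "y \<in> set (fac (key w))" for w y
  proof (rule ccontr)
    assume "\<not> y < key l"
    moreover have "y \<le> key l" using f(1) w y by (auto simp: CQ_def)
    ultimately have yl: "y = key l" by simp
    have wW: "w \<in> W" "wv x w = \<mu>" using f(1,3) w V_W by (auto simp: CQ_def hom_def)
    then have len: "length w \<le> length l" using f(4) h_len lW h_x(1) by auto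
    obtain as bs where as: "fac (key w) = as @ key l # bs" using y yl by (meson split_list)
    then have c: "key w = concat as @ key l @ concat bs" using fac(2)[of "key w"] by simp
    then have "length (key w) = length (concat as) + length (key l) + length (concat bs)" by (metis length_append add.assoc)
    then have "concat as = []" "concat bs = []" using len by auto
    then have "key w = key l" using c by (simp del: concat_eq_Nil_conv)
    then have "w = l" using key_inj wW lW by blast
    then show False using wW f(5) by simp
  qed
  then show "f \<in> CQ (\<lambda>y. y < key l)" using f(1) by (auto simp: CQ_def)
next
  obtain f where f: "f \<in> V" "hom x (wv x l) f" "f l \<noteq> 0" "\<forall>u. f u \<noteq> 0 \<longrightarrow> key u \<le> key l" using Dom_hom[OF l(1)] by blast
  have "y \<le> key l" if "f w \<noteq> 0" "y \<in> set (fac (key w))" for w y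
    by (rule fac_downclosed[where ls = "[key l]" and Q = "\<lambda>y. y \<le> key l"]) (use f that in auto)
  then have "f \<in> CQ (\<lambda>y. y \<le> key l)" using f by (auto simp: CQ_def)
  moreover have "f \<notin> CQ (\<lambda>y. y < key l)" using f(3) fac_lyn[OF l(2)] by (auto simp: CQ_def)
  ultimately show "\<exists>e\<in>CQ (\<lambda>y. y \<le> key l). hom x (wv x l) e \<and> e \<notin> CQ (\<lambda>y. y < key l)" using f by blast
qed

lemma wv_concat: "wv x (concat ls) = (\<Sum>t<length ls. wv x (ls ! t))"
  by (induction ls) (simp_all add: sum.lessThan_Suc_shift del: sum.lessThan_Suc)

text \<open>Each Lyndon word gives a step of a flag, cut out by \<open><\<close> and
  \<open>\<le>\<close>; since \<open>key l < key m\<close>, the step of l lies below that of every m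
  in \<open>ms\<close>.\<close>

lemma Lyndon_convex:
  assumes l: "Dom l" "lyn (key l)" and ms: "ms \<noteq> []" "\<And>m. m \<in> set ms \<Longrightarrow> Dom m \<and> lyn (key m) \<and> key l < key m"
  shows "wv x l \<noteq> wv x (concat ms)"
  unfolding wv_concat
proof (rule convexity[OF x_XX indep_x _ _ CQ_gap[OF l] CQ_hpos])
  let ?E1 = "\<lambda>t. CQ (\<lambda>y. y < key (ms ! t))" and ?E2 = "\<lambda>t. CQ (\<lambda>y. y \<le> key (ms ! t))"
  fix t assume t: "t \<in> {..<length ms}"
  then have m: "Dom (ms ! t)" "lyn (key (ms ! t))" "key l < key (ms ! t)" using ms(2)[of "ms ! t"] by auto
  show "rcs n x (?E1 t) \<and> rcs n x (?E2 t) \<and> CQ (\<lambda>y. y \<le> key l) \<subseteq> ?E1 t \<and> gap h x (?E1 t) (?E2 t) (wv x (ms ! t)) \<and> hpos h x (?E2 t)"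
  proof (intro conjI)
    show "CQ (\<lambda>y. y \<le> key l) \<subseteq> ?E1 t" unfolding CQ_def using m(3) le_less_trans by blast
  qed (use m in \<open>auto simp: CQ_gap CQ_hpos intro!: CQ_rcs\<close>)
qed (use ms in \<open>auto intro!: CQ_rcs\<close>)

section \<open>The maximal word of a Lyndon vector\<close>

lemma RW_sup_le: "Dom k \<Longrightarrow> sup_le (RW k) k"
proof (induction "length k" arbitrary: k rule: less_induct)
  case less
  note kW = Dom_W[OF less.prems]
  have IHr: "sup_le (r l) l" if "Dom l" "lyn (key l)" "length l < length k" for l
    using less.hyps[OF that(3,1)] RW_lyndon[OF that(2)] by simp
  show ?case
  proof (cases "lyn (key k)")
    case False
    have "sup_le (r l) l" if l: "l \<in> set (facw k)" for l
    proof (rule IHr)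
      show "Dom l" "lyn (key l)" using facw_Dom[OF less.prems l] facw_lyn[OF l] by auto
      obtain as bs where as: "facw k = as @ l # bs" using l by (meson split_list)
      have k: "k = concat as @ l @ concat bs" using facw(1)[of k] as by simp
      have "length l \<noteq> length k"
      proof
        assume "length l = length k"
        then have "concat as = []" "concat bs = []" using arg_cong[OF k, of length] by (simp_all del: concat_eq_Nil_conv)
        then have "k = l" using k by (simp del: concat_eq_Nil_conv)
        then show False using False facw_lyn[OF l] by simp
      qed
      then show "length l < length k" using arg_cong[OF k, of length] by simp
    qed
    then have "sup_le (pr (facw k)) (concat (facw k))"
      using facw_W[OF kW] facw_lyn fac(1)[of "key k"] facw(2)[of k] by (intro pr_sup_le) auto
    then show ?thesis by (simp add: RW_def facw(1))
  next
    case lk: True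
    show ?thesis
    proof (rule ccontr)
      assume "\<not> ?thesis"
      then obtain w0 where w0: "r k w0 \<noteq> 0" "key k < key w0" by (force simp: sup_le_def RW_lyndon[OF lk])
      have rk: "r k \<in> V" "hom x (wv x k) (r k)" using r_V[OF kW lk] by auto
      let ?S = "{w. r k w \<noteq> 0}"
      have "?S \<subseteq> {w. mset w = mset k}" using V_mset[OF rk kW] by blast
      then have fS: "finite ?S" using finite_class finite_subset by blast
      have "Max (key ` ?S) \<in> key ` ?S" using fS w0 by (intro Max_in) auto
      then obtain m where m: "r k m \<noteq> 0" "key m = Max (key ` ?S)" by force
      have le: "key w \<le> key m" if "r k w \<noteq> 0" for w using m fS that by simp
      have km: "key k < key m" using le[OF w0(1)] w0(2) by simp
      \<comment> \<open>The offending word m is dominant, as the maximal word of \<open>r k\<close>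
        itself, so its Lyndon factors are dominant as well.\<close>
      have Dm: "Dom m" unfolding Dom_def using rk m(1) le by blast
      have mm: "mset m = mset k" using V_mset[OF rk kW m(1)] .
      have fm: "facw m \<noteq> []" using facw(1)[of m] km by auto
      then obtain ms mr where ms: "facw m = ms @ [mr]" by (metis rev_exhaust)
      define u where "u = concat ms"
      have mu: "m = u @ mr" using facw(1)[of m] ms by (simp add: u_def)
      have mr: "Dom mr" "lyn (key mr)" using facw_Dom[OF Dm] facw_lyn[of _ m] ms by auto
      have mrW: "mr \<in> W" "mr \<noteq> []" using Dom_W[OF mr(1)] mr(2) by auto
      \<comment> \<open>It suffices to treat the last, smallest factor \<open>mr\<close> of
        \<open>m = u @ mr\<close>, by looking at the coefficient z that remains of
        \<open>r k\<close> after removing u.\<close>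
      have "key k < key mr"
      proof (cases "u = []")
        case True then show ?thesis using km mu by simp
      next
        case False
        define z where "z = DL u (r k)"
        have len: "length mr < length k" using mset_eq_length[OF mm] False mu by (cases u) auto
        have "wv x mr = wv x k - wv x u" using wv_mset[OF mm, of x] unfolding mu by (simp add: eq_diff_eq add.commute)
        then have hz: "hom x (wv x mr) z" using hom_DL[OF rk(2), of u] by (simp add: z_def)
        have "z \<in> lspan (VK k)" unfolding z_def by (rule r_right_parts[OF kW lk False])
        then have "z \<in> lspan (Xi x ` {w. mset w = mset mr \<and> key k \<le> key w})" using VK_class hz mrW by blast
        then have z: "z \<in> lspan (RW ` {k'. Dom k' \<and> mset k' = mset mr \<and> key k \<le> key k'})"
        proof (rule lspan_subset[rotated])
          fix a assume "a \<in> Xi x ` {w. mset w = mset mr \<and> key k \<le> key w}"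
          then obtain w where w: "a = Xi x w" "mset w = mset mr" "key k \<le> key w" by blast
          then have "w \<in> W" using mrW by (auto dest: mset_eq_setD)
          then show "a \<in> lspan (RW ` {k'. Dom k' \<and> mset k' = mset mr \<and> key k \<le> key k'})"
            unfolding w(1) by (intro lspan_mono[OF _ RW_span]) (use w(2,3) in auto)
        qed
        have sup: "sup_le (RW k') k'" if "Dom k'" "mset k' = mset mr" for k'
          using less.hyps[of k'] that mset_eq_length[OF that(2)] len by simp
        have zm: "z mr \<noteq> 0" using m(1) mu by (simp add: z_def DL_def)
        then have "z \<noteq> 0" by (auto simp: fun_pw)
        \<comment> \<open>z is a combination of products with indices at least k, for which
          triangularity is known by the induction on length. So z contains a word \<open>k''\<close>
          at least k, and \<open>u @ k''\<close> is a word of \<open>r k\<close>, hence at most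
          \<open>u @ mr\<close>.\<close>
        then obtain k'' where k'': "key k \<le> key k''" "z k'' \<noteq> 0"
          using triangular[OF z] sup RW_lead[of "mset mr", OF sup] Dom_W by blast
        have "key (u @ k'') \<le> key (u @ mr)" using le[of "u @ k''"] k''(2) mu by (simp add: z_def DL_def)
        then have "key k \<le> key mr" using k''(1) by simp
        moreover have "key k \<noteq> key mr" using len by (metis length_map less_irrefl)
        ultimately show ?thesis by simp
      qed
      moreover have "dsc (map key ms @ [key mr])" using fac(1)[of "key m"] facw(2)[of m] ms by simp
      ultimately have "Dom l \<and> lyn (key l) \<and> key k < key l" if "l \<in> set (facw m)" for l
        using that ms facw_Dom[OF Dm that] facw_lyn[OF that] by (auto simp: dsc_append)
      then have "wv x k \<noteq> wv x (concat (facw m))" using Lyndon_convex[OF less.prems lk fm] by blast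
      then show False using facw(1)[of m] wv_mset[OF mm, of x] by simp
    qed
  qed
qed

text \<open>\<open>triangular\<close> converts the bound on words into the bound on indices: the
  largest index m that occurs is itself a word of \<open>r i \<odot> r j\<close>, so the shuffle
  estimate applies to it.\<close>

theorem straightening:
  assumes i: "Dom i" "lyn (key i)" and j: "Dom j" "lyn (key j)" and ij: "key i < key j"
  shows "r i \<odot> r j \<in> lspan (RW ` {k. Dom k \<and> key (i @ j) \<le> key k \<and> key k \<le> key (j @ i)})"
proof (cases "r i \<odot> r j = 0")
  case False
  note iW = Dom_W[OF i(1)] and jW = Dom_W[OF j(1)]
  let ?f = "r i \<odot> r j" and ?A = "{k. Dom k \<and> mset k = mset (i @ j) \<and> key (i @ j) \<le> key k}"
  have "?f - Xi x (i @ j) \<in> lspan (GT (i @ j))" by (intro leading_mul r_leading iW jW i j)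
  from lspan_add[OF GT_GE[OF this] Xi_GE] have "?f \<in> lspan (GE (i @ j))" by simp
  then have "?f \<in> lspan (RW ` ?A)"
  proof (rule lspan_subset[rotated])
    fix a assume "a \<in> GE (i @ j)"
    then obtain w where w: "a = Xi x w" "mset w = mset (i @ j)" "key (i @ j) \<le> key w" by (auto simp: GE_def)
    moreover have "w \<in> W" using iW jW mset_eq_setD[OF w(2)] by auto
    ultimately show "a \<in> lspan (RW ` ?A)" using RW_span[of w] by (auto elim!: lspan_mono[rotated])
  qed
  then obtain m where m: "m \<in> ?A" "?f m \<noteq> 0" "?f \<in> lspan (RW ` {k \<in> ?A. key k \<le> key m})"
    using triangular[of ?f ?A] False RW_sup_le RW_lead[of "mset (i @ j)"] Dom_W by blast
  have "key m \<le> mg (fac (key i) @ fac (key j))"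
    using sup_le_mul[OF _ _ _ _ iW jW _ _ m(2)] r_V[OF iW i(2)] r_V[OF jW j(2)] RW_sup_le[OF i(1)] RW_sup_le[OF j(1)]
    by (simp add: RW_lyndon i j)
  also have "\<dots> = mg [key j, key i]" unfolding fac_lyn[OF i(2)] fac_lyn[OF j(2)] by (rule mg_mset) simp
  also have "\<dots> = key j @ key i" using mg_dsc[of "[key j, key i]"] i j ij by (simp add: dsc_Cons)
  finally have "key m \<le> key (j @ i)" by simp
  then have "{k \<in> ?A. key k \<le> key m} \<subseteq> {k. Dom k \<and> key (i @ j) \<le> key k \<and> key k \<le> key (j @ i)}" using order_trans by auto
  then show ?thesis using m(3) by (meson image_mono lspan_mono)
qed simp

end

subsection \<open>Simple systems of the basic Lie superalgebras\<close>

lemma qq_pow: "qq ^ k = to_fract (monom 1 k)"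
proof (induction k)
  case (Suc k)
  have "qq * to_fract (monom 1 k) = to_fract ([:0, 1:] * monom 1 k)" by (simp add: qq_def del: mult_pCons_left)
  then show ?case using Suc by (simp add: monom_Suc)
qed simp

lemma qq_nz [simp]: "qq \<noteq> 0" by (simp add: qq_def)

lemma qq_powi_eq_1: "qq powi k = 1 \<longleftrightarrow> k = 0"
proof -
  have *: "qq ^ t = 1 \<Longrightarrow> t = 0" for t
  proof -
    assume "qq ^ t = 1"
    then have "to_fract (monom 1 t) = to_fract (1 :: rat poly)" by (simp add: qq_pow)
    then have "monom 1 t = (1 :: rat poly)" unfolding to_fract_eq_iff .
    then have "degree (monom 1 t :: rat poly) = degree (1 :: rat poly)" by metis
    then show "t = 0" by (simp add: degree_monom_eq)
  qed
  show ?thesis using *[of "nat k"] *[of "nat (- k)"] by (auto simp: power_int_def power_inverse)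
qed

lemma qq_powi_add: "qq powi (a + b) = qq powi a * qq powi b"
  by (simp add: power_int_add)

section \<open>From integral forms with parity to reflections\<close>

locale lattice_form =
  fixes B :: "'v::ab_group_add \<Rightarrow> 'v \<Rightarrow> int" and P :: "'v \<Rightarrow> bool"
  assumes B_add: "B (a + b) c = B a c + B b c" and B_sym: "B a b = B b a" and P_add: "P (a + b) \<longleftrightarrow> P a \<noteq> P b"
begin

definition X :: "'v \<Rightarrow> 'v \<Rightarrow> K" where
  "X a b = (if P a \<and> P b then - 1 else 1) * qq powi (- B a b)"

sublocale bichar X
proof
  show "X a b = X b a" for a b by (simp add: X_def B_sym[of a b] conj_commute)
  show "X (a + b) c = X a c * X b c" for a b c
    using qq_powi_add[of "- B a c" "- B b c"] by (simp add: X_def B_add P_add)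
qed (simp add: X_def)

lemma B_add2: "B c (a + b) = B c a + B c b" using B_add B_sym by metis
lemma B_zero: "B 0 c = 0" "B c 0 = 0" using B_add[of 0 0 c] B_sym[of 0 c] by auto
lemma B_minus: "B (- a) c = - B a c" "B c (- a) = - B c a"
  using B_add[of "- a" a c] B_sym[of c] by (auto simp: B_zero)
lemma B_diff: "B (a - b) c = B a c - B b c" "B c (a - b) = B c a - B c b"
  using B_add[of a "- b" c] B_add2[of c a "- b"] by (auto simp: B_minus)
lemmas B_lin = B_add B_add2 B_zero B_minus B_diff

lemma P_zero: "\<not> P 0" using P_add[of 0 0] by simp
lemma P_minus: "P (- a) = P a" using P_add[of "- a" a] by (auto simp: P_zero)
lemma P_diff: "P (a - b) \<longleftrightarrow> P a \<noteq> P b" using P_add[of a "- b"] by (simp add: P_minus)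
lemmas P_lin = P_add P_zero P_minus P_diff

lemma X_square: "(X a b)\<^sup>2 = qq powi (- 2 * B a b)"
  by (simp add: X_def power2_eq_square power_int_add[symmetric] algebra_simps)

lemma X_self_pow: "X a a ^ t = (if P a \<and> odd t then - 1 else 1) * qq powi (- int t * B a a)"
  by (auto simp: X_def power_mult_distrib power_int_mult[symmetric] power_int_of_nat power_int_power mult.commute[of "int t"] simp flip: power_int_of_nat)

text \<open>\<open>RC u v v'\<close>: reflecting in the simple root \<open>u\<close> takes the simple root \<open>v\<close> to \<open>v'\<close>.\<close>

definition RC :: "'v \<Rightarrow> 'v \<Rightarrow> 'v \<Rightarrow> bool" where
  "RC u v v' \<longleftrightarrow> (\<exists>k. v' = v + sum_list (replicate k u) \<and>
     (B u u \<noteq> 0 \<and> 2 * B u v = - int k * B u u \<and> (P u \<longrightarrow> even k) \<or>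
      B u u = 0 \<and> P u \<and> k = (if B u v = 0 then 0 else 1)))"

lemma RC_0: "B u v = 0 \<Longrightarrow> B u u \<noteq> 0 \<or> P u \<Longrightarrow> v' = v \<Longrightarrow> RC u v v'"
  unfolding RC_def by (rule exI[of _ 0]) auto

lemma RC_1: "B u v \<noteq> 0 \<Longrightarrow> B u u = 0 \<and> P u \<or> B u u \<noteq> 0 \<and> \<not> P u \<and> 2 * B u v = - B u u \<Longrightarrow> v' = v + u \<Longrightarrow> RC u v v'"
  unfolding RC_def by (rule exI[of _ 1]) auto

lemma RC_2: "B u u \<noteq> 0 \<Longrightarrow> B u v = - B u u \<Longrightarrow> v' = v + u + u \<Longrightarrow> RC u v v'"
  unfolding RC_def by (rule exI[of _ 2]) (auto simp: numeral_2_eq_2 add.assoc)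

definition RF :: "nat \<Rightarrow> (nat \<Rightarrow> 'v) \<Rightarrow> nat \<Rightarrow> (nat \<Rightarrow> 'v) \<Rightarrow> bool" where
  "RF n x i x' \<longleftrightarrow> x' i = - x i \<and> (B (x i) (x i) \<noteq> 0 \<or> P (x i)) \<and> (\<forall>j<n. j \<noteq> i \<longrightarrow> RC (x i) (x j) (x' j))"

text \<open>The conditions on m become comparisons of exponents of q. If
  \<open>b \<noteq> 0\<close>, the product at t is a sign times q to the power
  \<open>(m j - t) * b\<close>, and 1 exactly at \<open>t = m j\<close>. If \<open>b = 0\<close>,
  then \<open>Q = - 1\<close>, so the quantum integer 2 vanishes and \<open>m j\<close> is 0 or
  1.\<close>

lemma RF_refl:
  assumes "RF n x i x'" "i < n"
  shows "\<exists>m. refl X x n i m \<and> (\<forall>j<n. refl.x' x i m j = x' j)"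
proof -
  define b where "b = B (x i) (x i)"
  define ok where "ok j k \<longleftrightarrow> x' j = x j + sum_list (replicate k (x i)) \<and>
     (b \<noteq> 0 \<and> 2 * B (x i) (x j) = - int k * b \<and> (P (x i) \<longrightarrow> even k) \<or>
      b = 0 \<and> P (x i) \<and> k = (if B (x i) (x j) = 0 then 0 else 1))" for j k
  have "\<forall>j. \<exists>k. j < n \<longrightarrow> j \<noteq> i \<longrightarrow> ok j k" using assms unfolding RF_def RC_def ok_def b_def by blast
  then obtain m where m: "\<And>j. j < n \<Longrightarrow> j \<noteq> i \<Longrightarrow> ok j (m j)" by metis
  have b: "b \<noteq> 0 \<or> P (x i)" using assms by (simp add: RF_def b_def)
  let ?Q = "X (x i) (x i)"
  have Q0: "?Q = - 1" if "b = 0" using that b by (simp add: X_def b_def)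
  have qn: "qn ?Q t \<noteq> 0" if "b \<noteq> 0" "t > 0" for t
  proof
    assume "qn ?Q t = 0"
    then have "?Q ^ t = 1" using power_diff_1_eq[of ?Q t] by (simp add: qn_def)
    then have "?Q ^ (2 * t) = 1" unfolding mult_2 power_add by simp
    then show False using that by (simp add: X_self_pow qq_powi_eq_1 b_def)
  qed
  have QX: "?Q ^ t * (X (x i) (x j))\<^sup>2 = (if P (x i) \<and> odd t then - 1 else 1) * qq powi (- int t * b - 2 * B (x i) (x j))" for t j
    by (simp add: X_self_pow X_square b_def power_int_add[symmetric] algebra_simps)
  \<comment> \<open>Squaring removes the sign.\<close>
  have sgn1: "e * qq powi k \<noteq> 1" if "e = 1 \<or> e = - 1" "k \<noteq> 0" for e k
  proof
    assume "e * qq powi k = 1"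
    then have "(e * qq powi k)\<^sup>2 = 1" by simp
    then have "(qq powi k)\<^sup>2 = 1" using that(1) by (auto simp: power_mult_distrib)
    then have "qq powi (k + k) = 1" unfolding qq_powi_add power2_eq_square .
    then show False using that(2) by (simp add: qq_powi_eq_1)
  qed
  have "refl X x n i m"
  proof
    show "?Q = - 1 \<or> (\<forall>t>0. qn ?Q t \<noteq> 0)" using Q0 qn by blast
    fix j assume j: "j < n" "j \<noteq> i"
    note mj = m[OF j, unfolded ok_def, THEN conjunct2]
    show "qn ?Q (Suc (m j)) = 0 \<or> ?Q ^ m j * (X (x i) (x j))\<^sup>2 = 1"
    proof (cases "b = 0")
      case True then show ?thesis using mj Q0 by (auto simp: X_square qn_Suc split: if_splits)
    next
      case False then show ?thesis using mj unfolding QX by auto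
    qed
    fix t assume t: "t < m j"
    show "qn ?Q (Suc t) \<noteq> 0 \<and> ?Q ^ t * (X (x i) (x j))\<^sup>2 \<noteq> 1"
    proof (cases "b = 0")
      case True then show ?thesis using mj t by (auto simp: X_square qq_powi_eq_1 split: if_splits)
    next
      case False
      then have "2 * B (x i) (x j) = - int (m j) * b" using mj by auto
      then have "- int t * b - 2 * B (x i) (x j) = (int (m j) - int t) * b" by (simp add: algebra_simps)
      then show ?thesis using False t qn unfolding QX by (intro conjI sgn1) auto
    qed
    show "?Q ^ (2 * m j - t) * (X (x i) (x j))\<^sup>2 \<noteq> 1"
    proof (cases "b = 0")
      case True then show ?thesis using mj t Q0 by (auto simp: X_square qq_powi_eq_1 split: if_splits)
    next
      case False
      then have "2 * B (x i) (x j) = - int (m j) * b" using mj by auto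
      moreover have "int (2 * m j - t) = 2 * int (m j) - int t" using t by auto
      ultimately have "- int (2 * m j - t) * b - 2 * B (x i) (x j) = (int t - int (m j)) * b" by (simp add: algebra_simps)
      then show ?thesis using False t unfolding QX by (intro sgn1) auto
    qed
  qed (use assms in auto)
  moreover have "refl.x' x i m j = x' j" if "j < n" for j
    using m[OF that] assms(1) calculation by (auto simp: refl.x'_def ok_def RF_def wv_def)
  ultimately show ?thesis by blast
qed

text \<open>\<open>RF\<close> describes the new system only at indices below n, whereas
  \<open>root_sys\<close> speaks of the function \<open>refl.x'\<close>; closure of
  \<open>XX\<close> under changes from n on bridges this.\<close>

lemma root_sysI:
  assumes "finite Phi" "\<And>x i. x \<in> XX \<Longrightarrow> i < n \<Longrightarrow> x i \<in> Phi"
    and "\<And>x i. x \<in> XX \<Longrightarrow> i < n \<Longrightarrow> \<exists>x'\<in>XX. RF n x i x'"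
    and "\<And>x y. x \<in> XX \<Longrightarrow> \<forall>j<n. y j = x j \<Longrightarrow> y \<in> XX"
    and "\<And>a b. h (a + b) = h a + h b"
  shows "root_sys X n XX Phi h"
proof
  fix x i assume "x \<in> XX" "i < n"
  then show "\<exists>m. refl X x n i m \<and> refl.x' x i m \<in> XX"
    by (metis assms(3,4) RF_refl)
qed (fact assms)+

end

text \<open>F is a multiple of a dual coordinate; the factor d avoids denominators where a simple
  root is twice a basis vector.\<close>

lemma indepI:
  fixes x :: "nat \<Rightarrow> 'v::ab_group_add"
  assumes "\<And>k. k < n \<Longrightarrow> \<exists>(F :: 'v \<Rightarrow> int) d. (\<forall>a b. F (a + b) = F a + F b) \<and> d \<noteq> 0 \<and> (\<forall>j<n. F (x j) = (if j = k then d else 0))"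
  shows "indep n x"
  unfolding indep_def
proof (intro allI impI multiset_eqI)
  fix u w k assume uw: "set u \<subseteq> {..<n}" "set w \<subseteq> {..<n}" "wv x u = wv x w"
  show "count (mset u) k = count (mset w) k"
  proof (cases "k < n")
    case True
    then obtain F :: "'v \<Rightarrow> int" and d where F: "\<And>a b. F (a + b) = F a + F b" "d \<noteq> 0" "\<And>j. j < n \<Longrightarrow> F (x j) = (if j = k then d else 0)"
      using assms by metis
    have "F 0 = 0" using F(1)[of 0 0] by simp
    then have "set v \<subseteq> {..<n} \<Longrightarrow> F (wv x v) = d * int (count (mset v) k)" for v
      by (induction v) (auto simp: F algebra_simps)
    then show ?thesis using uw F(2) by (metis mult_cancel_left of_nat_eq_iff)
  next
    case False then show ?thesis using uw(1,2) by (metis count_mset_0_iff lessThan_iff subsetD)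
  qed
qed

definition iu :: "nat \<Rightarrow> nat \<Rightarrow> int" where "iu a = (\<lambda>c. if c = a then 1 else 0)"

text \<open>The lattice spanned by m vectors \<epsilon> of norm c and M - m vectors \<delta> of norm
  -c, with parity the number of \<delta>'s. Type B uses \<open>c = 2\<close>, types A, C and D use
  \<open>c = 1\<close>.\<close>

locale frames =
  fixes m M :: nat and c :: int
  assumes c: "0 < c"
begin

definition B :: "(nat \<Rightarrow> int) \<Rightarrow> (nat \<Rightarrow> int) \<Rightarrow> int" where
  "B u v = (\<Sum>a<M. (if a < m then c else - c) * u a * v a)"

definition P :: "(nat \<Rightarrow> int) \<Rightarrow> bool" where
  "P u \<longleftrightarrow> odd (\<Sum>a=m..<M. u a)"

sublocale lattice_form B P
  by standard (auto simp: B_def P_def plus_fun_apply algebra_simps sum.distrib)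

lemma B_iu: "a < M \<Longrightarrow> B (iu a) v = (if a < m then c else - c) * v a"
  by (simp add: B_def iu_def if_distrib[of "\<lambda>z. _ * z"] if_distrib[of "\<lambda>z. z * _"] sum.delta cong: if_cong)

lemma P_iu: "a < M \<Longrightarrow> P (iu a) \<longleftrightarrow> m \<le> a"
  by (simp add: P_def iu_def sum.delta)

lemma two_simps [simp]: "B (2 * a) v = 2 * B a v" "B v (2 * a) = 2 * B v a" "\<not> P (2 * a)"
  by (simp_all only: mult_2 B_lin P_lin)

definition EE :: "(nat \<Rightarrow> int) set" where "EE = iu ` {..<M} \<union> (\<lambda>a. - iu a) ` {..<M}"

text \<open>A finite set that contains all roots of the classical types, and more; it serves only to
  bound the induction.\<close>

definition Phi :: "(nat \<Rightarrow> int) set" where "Phi = (\<lambda>(u, v). u + v) ` ((insert 0 EE) \<times> (insert 0 EE))"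

lemma finite_Phi: "finite Phi" by (simp add: Phi_def EE_def)

lemma EE_norm: "u \<in> EE \<Longrightarrow> B u u = (if P u then - c else c)"
  by (auto simp: EE_def B_minus P_minus B_iu P_iu) (auto simp: iu_def)

lemma EE_minus: "u \<in> EE \<Longrightarrow> - u \<in> EE" by (auto simp: EE_def)

lemma Phi_add: "u \<in> EE \<Longrightarrow> v \<in> EE \<Longrightarrow> u + v \<in> Phi" "u \<in> EE \<Longrightarrow> v \<in> EE \<Longrightarrow> u - v \<in> Phi" "u \<in> EE \<Longrightarrow> u \<in> Phi"
proof -
  have *: "u \<in> insert 0 EE \<Longrightarrow> v \<in> insert 0 EE \<Longrightarrow> u + v \<in> Phi" for u v unfolding Phi_def by auto
  show "u \<in> EE \<Longrightarrow> v \<in> EE \<Longrightarrow> u + v \<in> Phi" "u \<in> EE \<Longrightarrow> v \<in> EE \<Longrightarrow> u - v \<in> Phi" "u \<in> EE \<Longrightarrow> u \<in> Phi"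
    using *[of u v] *[of u "- v"] *[of u 0] EE_minus[of v] by auto
qed

lemma Phi_two: "u \<in> EE \<Longrightarrow> 2 * u \<in> Phi"
  unfolding mult_2 by (rule Phi_add(1))

text \<open>A signed permutation of the \<epsilon>'s and \<delta>'s. Simple systems are read off
  from frames, and reflections act on frames.\<close>

definition frame :: "(nat \<Rightarrow> nat \<Rightarrow> int) \<Rightarrow> bool" where
  "frame e \<longleftrightarrow> (\<forall>k<M. e k \<in> EE) \<and> (\<forall>k<M. \<forall>l<M. k \<noteq> l \<longrightarrow> B (e k) (e l) = 0)"

definition sw :: "nat \<Rightarrow> (nat \<Rightarrow> nat \<Rightarrow> int) \<Rightarrow> nat \<Rightarrow> nat \<Rightarrow> int" where
  "sw i e = e(i := e (Suc i), Suc i := e i)"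

definition ng :: "nat \<Rightarrow> (nat \<Rightarrow> nat \<Rightarrow> int) \<Rightarrow> nat \<Rightarrow> nat \<Rightarrow> int" where
  "ng i e = e(i := - e i)"

lemma sw_apply: "sw i e i = e (Suc i)" "sw i e (Suc i) = e i" "j \<noteq> i \<Longrightarrow> j \<noteq> Suc i \<Longrightarrow> sw i e j = e j"
  by (auto simp: sw_def)

lemma ng_apply: "ng i e i = - e i" "j \<noteq> i \<Longrightarrow> ng i e j = e j"
  by (auto simp: ng_def)

lemma frame_EE: "frame e \<Longrightarrow> k < M \<Longrightarrow> e k \<in> EE" by (simp add: frame_def)

lemma frame_B: "frame e \<Longrightarrow> k < M \<Longrightarrow> l < M \<Longrightarrow> B (e k) (e l) = (if k = l then if P (e k) then - c else c else 0)"
  by (simp add: frame_def EE_norm)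

lemma frame_sw: "frame e \<Longrightarrow> Suc i < M \<Longrightarrow> frame (sw i e)"
  unfolding frame_def sw_def by auto

lemma frame_ng: "frame e \<Longrightarrow> frame (ng i e)"
  unfolding frame_def ng_def by (auto simp: B_minus EE_minus)

text \<open>Reflecting in \<open>a - b\<close> interchanges a and b. For equal parities it is an
  ordinary even reflection, for different ones \<open>a - b\<close> is isotropic; the norms
  \<open>\<plusminus> c\<close> let both cases share the same formulas.\<close>

lemma RC_swap:
  assumes "a \<in> EE" "b \<in> EE" "B a b = 0"
  shows "B w a = 0 \<Longrightarrow> B w b = 0 \<Longrightarrow> w' = w \<Longrightarrow> RC (a - b) w w'"
    and "B w a = - B a a \<Longrightarrow> B w b = 0 \<Longrightarrow> w' = w + (a - b) \<Longrightarrow> RC (a - b) w w'"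
    and "B w a = 0 \<Longrightarrow> B w b = B b b \<Longrightarrow> w' = w + (a - b) \<Longrightarrow> RC (a - b) w w'"
proof -
  note [simp] = B_lin P_lin EE_norm[OF assms(1)] EE_norm[OF assms(2)] assms(3) B_sym[of b a] B_sym[of a w] B_sym[of b w]
  show "B w a = 0 \<Longrightarrow> B w b = 0 \<Longrightarrow> w' = w \<Longrightarrow> RC (a - b) w w'"
    using c by (intro RC_0) (simp_all split: if_splits)
  show "B w a = - B a a \<Longrightarrow> B w b = 0 \<Longrightarrow> w' = w + (a - b) \<Longrightarrow> RC (a - b) w w'"
    using c by (intro RC_1) (simp_all split: if_splits)
  show "B w a = 0 \<Longrightarrow> B w b = B b b \<Longrightarrow> w' = w + (a - b) \<Longrightarrow> RC (a - b) w w'"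
    using c by (intro RC_1) (simp_all split: if_splits)
qed

lemma swap_norm: "a \<in> EE \<Longrightarrow> b \<in> EE \<Longrightarrow> B a b = 0 \<Longrightarrow> B (a - b) (a - b) \<noteq> 0 \<or> P (a - b)"
  using c B_sym[of b a] by (simp add: B_lin P_lin EE_norm split: if_splits)

lemma chain_RC:
  assumes e: "frame e" and i: "Suc i < M" and j: "Suc j < M" "j \<noteq> i"
  shows "RC (e i - e (Suc i)) (e j - e (Suc j)) (sw i e j - sw i e (Suc j))"
proof -
  note S = RC_swap[OF frame_EE[OF e] frame_EE[OF e], of i "Suc i"]
  note F = frame_B[OF e]
  consider "j = Suc i" | "i = Suc j" | "j \<noteq> Suc i" "i \<noteq> Suc j" by blast
  then show ?thesis
  proof cases
    case 1 then show ?thesis using i j by (intro S(3)) (auto simp: F B_lin sw_apply)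
  next
    case 2 then show ?thesis using i j by (intro S(2)) (auto simp: F B_lin sw_apply)
  next
    case 3 then show ?thesis using i j by (intro S(1)) (auto simp: F B_lin sw_apply)
  qed
qed

lemma chain_self:
  assumes "frame e" "Suc i < M"
  shows "sw i e i - sw i e (Suc i) = - (e i - e (Suc i)) \<and> (B (e i - e (Suc i)) (e i - e (Suc i)) \<noteq> 0 \<or> P (e i - e (Suc i)))"
  using swap_norm[OF frame_EE frame_EE, of e i e "Suc i"] assms by (auto simp: frame_B sw_apply)

text \<open>The functional with value \<open>c * H k\<close> on \<open>e k\<close>; the sign
  compensates the negative norms of the \<delta>'s.\<close>

definition hh :: "(nat \<Rightarrow> nat \<Rightarrow> int) \<Rightarrow> (nat \<Rightarrow> int) \<Rightarrow> (nat \<Rightarrow> int) \<Rightarrow> int" where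
  "hh e H v = (\<Sum>l<M. H l * (if P (e l) then - 1 else 1) * B (e l) v)"

lemma hh_add: "hh e H (a + b) = hh e H a + hh e H b"
  by (simp add: hh_def B_lin sum.distrib algebra_simps)

lemma hh_minus: "hh e H (a - b) = hh e H a - hh e H b"
  using hh_add[of e H "a - b" b] by simp

lemma hh_two: "hh e H (2 * a) = 2 * hh e H a"
  by (simp only: mult_2 hh_add)

lemma hh_frame:
  assumes e: "frame e" and k: "k < M" shows "hh e H (e k) = c * H k"
proof -
  have "hh e H (e k) = (\<Sum>l<M. if l = k then c * H k else 0)"
    unfolding hh_def by (intro sum.cong refl) (auto simp: frame_B[OF e] k)
  then show ?thesis using k by simp
qed

end

context frames
begin

subsubsection \<open>Type A\<close>

definition XA :: "(nat \<Rightarrow> nat \<Rightarrow> int) set" where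
  "XA = {x. \<exists>e. frame e \<and> (\<forall>j<M - 1. x j = e j - e (Suc j))}"

lemma root_sys_A: "root_sys X (M - 1) XA Phi (hh e0 H)"
proof (rule root_sysI[OF finite_Phi])
  fix x i assume "x \<in> XA" and i: "i < M - 1"
  then obtain e where e: "frame e" "\<forall>j<M - 1. x j = e j - e (Suc j)" by (auto simp: XA_def)
  show "x i \<in> Phi" using e i frame_EE[OF e(1), of i] frame_EE[OF e(1), of "Suc i"] by (auto intro: Phi_add)
  have *: "RF (M - 1) x i (\<lambda>j. sw i e j - sw i e (Suc j))"
    using chain_self[OF e(1), of i] chain_RC[OF e(1), of i] i e(2) unfolding RF_def by auto
  show "\<exists>x'\<in>XA. RF (M - 1) x i x'"
    by (rule bexI, rule *) (use frame_sw[OF e(1), of i] i in \<open>auto simp: XA_def intro!: exI[of _ "sw i e"]\<close>)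
qed (auto simp: XA_def hh_add)

lemma indep_A:
  assumes "frame e" shows "indep (M - 1) (\<lambda>j. e j - e (Suc j))"
proof (rule indepI)
  fix k assume "k < M - 1"
  then show "\<exists>F d. (\<forall>a b. F (a + b) = F a + F b) \<and> d \<noteq> (0::int) \<and> (\<forall>j<M - 1. F (e j - e (Suc j)) = (if j = k then d else 0))"
    using c assms by (intro exI[of _ "hh e (\<lambda>l. if l \<le> k then 1 else 0)"] exI[of _ c])
      (auto simp: hh_add hh_minus hh_frame)
qed

subsubsection \<open>Type B\<close>

definition xB :: "(nat \<Rightarrow> nat \<Rightarrow> int) \<Rightarrow> nat \<Rightarrow> nat \<Rightarrow> int" where
  "xB e j = (if Suc j < M then e j - e (Suc j) else e j)"

definition XB :: "(nat \<Rightarrow> nat \<Rightarrow> int) set" where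
  "XB = {x. \<exists>e. frame e \<and> (\<forall>j<M. x j = xB e j)}"

lemma root_sys_B: "root_sys X M XB Phi (hh e0 H)"
proof (rule root_sysI[OF finite_Phi])
  fix x i assume "x \<in> XB" and i: "i < M"
  then obtain e where e: "frame e" "\<forall>j<M. x j = xB e j" by (auto simp: XB_def)
  note F = frame_B[OF e(1)] and E = frame_EE[OF e(1)]
  show "x i \<in> Phi" using e i E[of i] E[of "Suc i"] by (auto simp: xB_def intro: Phi_add)
  show "\<exists>x'\<in>XB. RF M x i x'"
  proof (cases "Suc i < M")
    case True
    note S = RC_swap[OF E E, of i "Suc i"]
    have "RC (e i - e (Suc i)) (xB e j) (xB (sw i e) j)" if j: "j < M" "j \<noteq> i" for j
    proof (cases "Suc j < M")
      case False
      then have jM: "j = M - 1" "M \<noteq> 0" using j by auto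
      show ?thesis
      proof (cases "j = Suc i")
        case Suc: True
        then show ?thesis using False j by (intro S(3)) (auto simp: xB_def F sw_apply)
      next
        case ne: False
        then show ?thesis using False j True by (intro S(1)) (auto simp: xB_def F sw_apply)
      qed
    qed (use chain_RC[OF e(1) True] j in \<open>simp add: xB_def\<close>)
    then have *: "RF M x i (xB (sw i e))"
      using chain_self[OF e(1) True] e(2) True unfolding RF_def by (auto simp: xB_def)
    show ?thesis by (rule bexI, rule *) (use frame_sw[OF e(1) True] in \<open>auto simp: XB_def\<close>)
  next
    case False
    have "RC (e i) (xB e j) (xB (ng i e) j)" if j: "j < M" "j \<noteq> i" for j
    proof (cases "Suc j = i")
      case True
      then show ?thesis using i c by (intro RC_2) (auto simp: xB_def F B_lin ng_apply)
    next
      case ne: False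
      then show ?thesis using i j c False by (intro RC_0) (auto simp: xB_def F B_lin ng_apply)
    qed
    then have *: "RF M x i (xB (ng i e))"
      using e(2) False i c unfolding RF_def by (auto simp: xB_def ng_apply F)
    show ?thesis by (rule bexI, rule *) (use frame_ng[OF e(1)] in \<open>auto simp: XB_def\<close>)
  qed
qed (auto simp: XB_def hh_add)

lemma indep_B:
  assumes "frame e" shows "indep M (xB e)"
proof (rule indepI)
  fix k assume "k < M"
  then show "\<exists>F d. (\<forall>a b. F (a + b) = F a + F b) \<and> d \<noteq> (0::int) \<and> (\<forall>j<M. F (xB e j) = (if j = k then d else 0))"
    using c assms by (intro exI[of _ "hh e (\<lambda>l. if l \<le> k then 1 else 0)"] exI[of _ c])
      (auto simp: hh_add hh_minus hh_frame xB_def)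
qed

subsubsection \<open>Types C and D\<close>

text \<open>The end of the diagram depends on the parity of the last frame vector, which reflections
  can change: both shapes belong to one family.\<close>

definition la :: "(nat \<Rightarrow> nat \<Rightarrow> int) \<Rightarrow> nat \<Rightarrow> int" where
  "la e = (if P (e (M - 1)) then e (M - 1) + e (M - 1) else e (M - 2) + e (M - 1))"

definition xD :: "(nat \<Rightarrow> nat \<Rightarrow> int) \<Rightarrow> nat \<Rightarrow> nat \<Rightarrow> int" where
  "xD e j = (if Suc j < M then e j - e (Suc j) else la e)"

definition tp :: "nat \<Rightarrow> nat" where
  "tp j = (if j = M - 2 then M - 1 else if j = M - 1 then M - 2 else j)"

text \<open>Reflecting in an isotropic last root \<open>\<delta> + \<epsilon>\<close> interchanges the labels of the last two nodes.\<close>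

definition XD :: "(nat \<Rightarrow> nat \<Rightarrow> int) set" where
  "XD = {x. \<exists>e p. frame e \<and> (p = id \<or> p = tp) \<and> (\<forall>j<M. x j = xD e (p j))}"

text \<open>Away from the last node the frame is changed by a transposition. At the last node
  2\<delta> negates one vector, \<epsilon>+\<epsilon>' exchanges and negates two, and the isotropic
  \<delta>+\<epsilon> turns the end of shape D into one of shape C.\<close>

lemma xD_reflect:
  assumes M: "2 \<le> M" and e: "frame e" and i: "i < M"
  shows "\<exists>e' p. frame e' \<and> (p = id \<or> p = tp) \<and> RF M (xD e) i (\<lambda>j. xD e' (p j))"
proof -
  note F = frame_B[OF e(1)] and E = frame_EE[OF e(1)]
  obtain k where kM: "M = Suc (Suc k)" using M by (metis add_2_eq_Suc le_Suc_ex)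
  have k: "k < M" "Suc k < M" "M - Suc 0 = Suc k" "M - 2 = k" "\<not> Suc (Suc k) < M" "\<And>j. j < k \<Longrightarrow> j < M" "\<And>j. j < k \<Longrightarrow> Suc j < M"
    using kM by auto
  define a where "a = e k"
  define b where "b = e (Suc k)"
  have ab: "a \<in> EE" "b \<in> EE" "B a b = 0" "B b a = 0" "B a a = (if P a then - c else c)" "B b b = (if P b then - c else c)"
    using E k by (auto simp: a_def b_def F)
  have la: "la e = (if P b then b + b else a + b)" by (simp add: la_def a_def b_def k)
  consider (chain) "i < k" | (pre) "i = k" | (last) "i = Suc k" using i kM by linarith
  then show ?thesis
  proof cases
    case chain
    then have iM: "Suc i < M" using kM by simp
    note S = RC_swap[OF E E, of i "Suc i"]
    have ni: "i \<noteq> k" "i \<noteq> Suc k" "Suc i \<noteq> Suc k" using chain by auto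
    have "RC (e i - e (Suc i)) (la e) (la (sw i e))"
    proof (cases "Suc i = k \<and> \<not> P b")
      case True
      then show ?thesis using iM Suc_lessD[OF iM]
        by (intro S(3)) (auto simp: k la_def F B_lin sw_def b_def)
    next
      case False
      then show ?thesis using ni iM Suc_lessD[OF iM]
        by (intro S(1)) (auto simp: k la_def F B_lin sw_apply b_def sw_def)
    qed
    then have "RF M (xD e) i (xD (sw i e))"
      using chain_self[OF e iM] chain_RC[OF e iM] iM unfolding RF_def by (auto simp: xD_def)
    then show ?thesis using frame_sw[OF e iM] by (intro exI[of _ "sw i e"] exI[of _ id]) auto
  next
    case pre
    then have iM: "Suc i < M" using kM by simp
    have la': "la (sw i e) = (if P a then a + a else a + b)"
      by (simp add: la_def a_def b_def k pre sw_apply add.commute)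
    have "RC (a - b) (la e) (la (sw i e))"
    proof (cases "P b")
      case True
      have "RC (a - b) (b + b) (if P a then a + a else a + b)" using True ab c
        by (cases "P a", intro RC_2) (auto intro!: RC_1 simp: B_lin P_lin)
      then show ?thesis unfolding la la' using True by simp
    next
      case False
      have "RC (a - b) (a + b) (if P a then a + a else a + b)" using False ab c
        by (cases "P a", intro RC_1) (auto intro!: RC_0 simp: B_lin P_lin)
      then show ?thesis unfolding la la' using False by simp
    qed
    then have "RF M (xD e) i (xD (sw i e))"
      using chain_self[OF e iM] chain_RC[OF e iM] iM unfolding RF_def by (auto simp: xD_def a_def b_def pre)
    then show ?thesis using frame_sw[OF e iM] by (intro exI[of _ "sw i e"] exI[of _ id]) auto
  next
    case last
    have lower: "xD e j = e j - e (Suc j)" "B (e j) a = 0" "B (e j) b = 0" "B a (e j) = 0" "B b (e j) = 0"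
      if "j < k" for j using that k by (auto simp: xD_def F a_def b_def)
    consider (d) "P b" | (ee) "\<not> P b" "\<not> P a" | (ed) "\<not> P b" "P a" by blast
    then show ?thesis
    proof cases
      case d
      have "RC (la e) (xD e j) (xD (ng (Suc k) e) j)" if j: "j < M" "j \<noteq> i" for j
      proof (cases "j = k")
        case True
        then show ?thesis using d ab c unfolding la by (intro RC_1) (auto simp: xD_def k a_def b_def ng_apply B_lin P_lin)
      next
        case False
        then have "j < k" using j kM last by simp
        moreover have "B b (e (Suc j)) = 0" using \<open>j < k\<close> k by (simp add: F b_def)
        ultimately show ?thesis using d ab c lower[OF \<open>j < k\<close>] k unfolding la
          by (intro RC_0) (auto simp: xD_def ng_apply B_lin P_lin)
      qed
      then have "RF M (xD e) i (xD (ng (Suc k) e))"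
        using d ab c last k unfolding RF_def by (auto simp: xD_def la_def b_def ng_apply B_lin P_lin)
      then show ?thesis using frame_ng[OF e] by (intro exI[of _ "ng (Suc k) e"] exI[of _ id]) auto
    next
      case ee
      \<comment> \<open>Reflection in \<open>a + b\<close> sends a to \<open>- b\<close> and b to
        \<open>- a\<close>.\<close>
      define e' where "e' = ng k (ng (Suc k) (sw k e))"
      have e': "frame e'" "e' k = - b" "e' (Suc k) = - a" "\<And>j. j < k \<Longrightarrow> e' j = e j"
        unfolding e'_def by (intro frame_ng frame_sw e k(2)) (auto simp: ng_def sw_def a_def b_def)
      note S = RC_swap[OF ab(1) EE_minus[OF ab(2)], unfolded diff_minus_eq_add]
      have "RC (la e) (xD e j) (xD e' j)" if j: "j < M" "j \<noteq> i" for j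
      proof -
        consider "j = k" | "Suc j = k" | "Suc j < k" using j kM last by linarith
        then show ?thesis
        proof cases
          case 1
          then show ?thesis using ee ab c e' k unfolding la by (intro RC_0) (auto simp: xD_def a_def b_def B_lin P_lin)
        next
          case 2
          then show ?thesis using ee ab c e' lower[of j] k unfolding la
            by (simp, intro S(2)) (auto simp: xD_def a_def[symmetric] B_lin P_lin)
        next
          case 3
          moreover have "B (e (Suc j)) a = 0" "B (e (Suc j)) b = 0" using 3 k by (auto simp: F a_def b_def)
          ultimately show ?thesis using ee ab c e' lower[of j] k unfolding la
            by (simp, intro S(1)) (auto simp: xD_def B_lin P_lin)
        qed
      qed
      moreover have "la e' = - la e" using ee e' k by (simp add: la_def P_minus a_def b_def)
      ultimately have "RF M (xD e) i (xD e')"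
        using ee ab c last k la unfolding RF_def by (auto simp: xD_def B_lin P_lin)
      then show ?thesis using e' by (intro exI[of _ e'] exI[of _ id]) auto
    next
      case ed
      \<comment> \<open>In the frame ending in \<open>- b, a\<close> the node before the last is
        \<open>- (a + b)\<close> and the last one is \<open>a + a\<close>, the image of
        \<open>a - b\<close>. So the two nodes have exchanged their labels.\<close>
      define e' where "e' = ng k (sw k e)"
      have e': "frame e'" "e' k = - b" "e' (Suc k) = a" "\<And>j. j < k \<Longrightarrow> e' j = e j"
        unfolding e'_def by (intro frame_ng frame_sw e k(2)) (auto simp: ng_def sw_def a_def b_def)
      let ?p = tp
      note S = RC_swap[OF ab(1) EE_minus[OF ab(2)], unfolded diff_minus_eq_add]
      have la': "la e' = a + a" using ed e' k by (simp add: la_def)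
      have "RC (la e) (xD e j) (xD e' (?p j))" if j: "j < M" "j \<noteq> i" for j
      proof -
        consider "j = k" | "Suc j = k" | "Suc j < k" using j kM last by linarith
        then show ?thesis
        proof cases
          case 1
          have "RC (a + b) (a - b) (a + a)" using ed ab c by (intro RC_1) (auto simp: B_lin P_lin)
          then show ?thesis using 1 ed e' la' k unfolding la by (simp add: xD_def a_def b_def tp_def)
        next
          case 2
          then show ?thesis using ed ab c e' lower[of j] k unfolding la
            by (simp, intro S(2)) (auto simp: xD_def a_def[symmetric] B_lin P_lin tp_def)
        next
          case 3
          moreover have "B (e (Suc j)) a = 0" "B (e (Suc j)) b = 0" using 3 k by (auto simp: F a_def b_def)
          ultimately show ?thesis using ed ab c e' lower[of j] k unfolding la
            by (simp, intro S(1)) (auto simp: xD_def B_lin P_lin tp_def)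
        qed
      qed
      then have "RF M (xD e) i (\<lambda>j. xD e' (?p j))"
        using ed ab c last k la e' unfolding RF_def by (auto simp: xD_def tp_def B_lin P_lin)
      then show ?thesis using e' by (intro exI[of _ e'] exI[of _ ?p]) auto
    qed
  qed
qed

lemma root_sys_D:
  assumes M: "2 \<le> M" shows "root_sys X M XD Phi (hh e0 H)"
proof (rule root_sysI[OF finite_Phi])
  let ?t = tp
  have t: "?t j < M \<longleftrightarrow> j < M" "?t (?t j) = j" "?t \<circ> ?t = id" "?t j = ?t j' \<longleftrightarrow> j = j'" for j j' using M by (auto simp: tp_def fun_eq_iff)
  fix x i assume "x \<in> XD" and i: "i < M"
  then obtain e p where e: "frame e" "p = id \<or> p = ?t" "\<forall>j<M. x j = xD e (p j)" unfolding XD_def by blast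
  have p: "p j < M \<longleftrightarrow> j < M" "p j = p j' \<longleftrightarrow> j = j'" for j j' using e(2) t by auto
  note E = frame_EE[OF e(1)]
  have "xD e j \<in> Phi" if "j < M" for j
    using that M E[of j] E[of "Suc j"] E[of "M - 1"] E[of "M - 2"] by (auto simp: xD_def la_def intro: Phi_add(1,2) Phi_two)
  then show "x i \<in> Phi" using e(3) i p by auto
  obtain e' p' where e': "frame e'" "p' = id \<or> p' = ?t" "RF M (xD e) (p i) (\<lambda>j. xD e' (p' j))"
    using xD_reflect[OF M e(1), of "p i"] i p by auto
  have "RF M x i (\<lambda>j. xD e' (p' (p j)))" using e'(3) e(3) i p unfolding RF_def by auto
  moreover have "p' \<circ> p = id \<or> p' \<circ> p = tp" using e(2) e'(2) t(3) by auto
  then have "(\<lambda>j. xD e' (p' (p j))) \<in> XD"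
    unfolding XD_def using e'(1) by (intro CollectI exI[of _ e'] exI[of _ "p' \<circ> p"] conjI) simp_all
  ultimately show "\<exists>x'\<in>XD. RF M x i x'" by (intro bexI)
next
  fix x y assume "x \<in> XD" "\<forall>j<M. y j = x j"
  then show "y \<in> XD" unfolding XD_def by fastforce
qed (simp add: hh_add)

lemma indep_D:
  assumes e: "frame e" and M: "2 \<le> M" shows "indep M (xD e)"
proof (rule indepI)
  fix k assume k: "k < M"
  show "\<exists>F d. (\<forall>a b. F (a + b) = F a + F b) \<and> d \<noteq> (0::int) \<and> (\<forall>j<M. F (xD e j) = (if j = k then d else 0))"
  proof (cases "P (e (M - 1))")
    case True
    then show ?thesis using c e k M
      by (intro exI[of _ "hh e (\<lambda>l. if l \<le> k then 1 else 0)"] exI[of _ "if k = M - 1 then 2 * c else c"])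
        (auto simp: hh_add hh_two hh_minus hh_frame xD_def la_def)
  next
    case False
    \<comment> \<open>For \<open>k = M - 2\<close> the value -1 at the last vector makes the
      functional vanish on the sum of the last two vectors; on their difference it is 2, whence the
      factor 2.\<close>
    define H where "H l = (if l \<le> k then 1 else if k = M - 2 \<and> l = M - 1 then - 1 else 0 :: int)" for l
    show ?thesis using False c e k M
      by (intro exI[of _ "hh e H"] exI[of _ "if k \<ge> M - 2 then 2 * c else c"])
        (auto simp: hh_add hh_two hh_minus hh_frame xD_def la_def H_def)
  qed
qed

end

definition chi :: "datum \<Rightarrow> nat \<Rightarrow> nat \<Rightarrow> K" where
  "chi D i j = (if par D i \<and> par D j then - 1 else 1) * qq powi (- Bf D i j)"

text \<open>Only the matrix \<open>chi D\<close> links the abstract system to the datum; lattice,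
  form and parity are hidden in \<open>X\<close>.\<close>

definition realizable :: "datum \<Rightarrow> bool" where
  "realizable D \<longleftrightarrow> (\<exists>(X :: wgt \<Rightarrow> wgt \<Rightarrow> K) XX Phi h x hx. root_sys X (nn D) XX Phi h \<and> x \<in> XX \<and> indep (nn D) x \<and>
     0 < hx \<and> (\<forall>j<nn D. h (x j) = hx) \<and> (\<forall>i<nn D. \<forall>j<nn D. X (x i) (x j) = chi D i j))"

text \<open>The first condition keeps quantum integers from vanishing; the last one is what makes \<open>q \<mapsto> - q\<inverse>\<close>
  invert \<open>chi\<close> in type \<open>B(0,n+1)\<close>.\<close>

definition even_form :: "datum \<Rightarrow> bool" where
  "even_form D \<longleftrightarrow> (\<forall>i<nn D. even (Bf D i i)) \<and> (\<forall>i<nn D. \<forall>j<nn D. Bf D i j = Bf D j i)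
     \<and> (bflag D \<longrightarrow> (\<forall>i<nn D. \<forall>j<nn D. even (Bf D i j)))"

definition rv :: "(nat \<Rightarrow> int) \<Rightarrow> vec" where "rv u = (\<lambda>a. of_int (u a))"

lemma rv_simps: "vsub (rv u) (rv v) = rv (u - v)" "vadd (rv u) (rv v) = rv (u + v)" "vsc 2 (rv u) = rv (2 * u)"
  "s \<in> sgns \<Longrightarrow> vsc s (ev a) = rv (if s = 1 then iu a else - iu a)" "ev a = rv (iu a)"
  by (auto simp: rv_def vsub_def vadd_def vsc_def ev_def iu_def sgns_def fun_eq_iff plus_fun_apply minus_apply)

context frames
begin

lemma gform_rv: "gform M (\<lambda>a b. if a = b then (if a < m then of_int c else - of_int c) else 0) (rv u) (rv v) = of_int (B u v)"
proof -
  have "(\<Sum>b<M. (if a = b then (if a < m then of_int c else - of_int c) else 0) * rv u a * rv v b) = of_int ((if a < m then c else - c) * u a * v a)"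
    if "a < M" for a
  proof -
    have "(\<Sum>b<M. (if a = b then (if a < m then of_int c else - of_int c) else 0) * rv u a * rv v b) =
      (\<Sum>b<M. if b = a then (if a < m then of_int c else - of_int c) * rv u a * rv v a else 0)"
      by (intro sum.cong) auto
    then show ?thesis using that by (simp add: rv_def)
  qed
  then show ?thesis unfolding gform_def B_def of_int_sum by (intro sum.cong) auto
qed

definition sframe :: "(nat \<Rightarrow> bool) \<Rightarrow> (nat \<Rightarrow> nat) \<Rightarrow> nat \<Rightarrow> nat \<Rightarrow> int" where
  "sframe sp s k = (if sp k then iu (s k) else - iu (s k))"

lemma frame_sframe:
  assumes "bij_betw s {..<M} {..<M}" shows "frame (sframe sp s)"
proof -
  have s: "s k < M" if "k < M" for k using assms that by (auto simp: bij_betw_def)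
  have "s k \<noteq> s l" if "k < M" "l < M" "k \<noteq> l" for k l using assms that by (auto simp: bij_betw_def inj_on_def)
  then have "iu (s l) (s k) = 0" if "k < M" "l < M" "k \<noteq> l" for k l using that by (simp add: iu_def)
  then show ?thesis using s by (auto simp: frame_def sframe_def EE_def B_minus B_iu)
qed

lemma P_sframe: "bij_betw s {..<M} {..<M} \<Longrightarrow> k < M \<Longrightarrow> P (sframe sp s k) \<longleftrightarrow> m \<le> s k"
  by (auto simp: sframe_def P_minus bij_betw_def intro!: P_iu)

lemma realizeI:
  assumes "nn D = n" "amb D = gform M (\<lambda>a b. if a = b then (if a < m then of_int c else - of_int c) else 0)"
    and sr: "\<And>j. j < n \<Longrightarrow> sr D j = rv (x j)" and par: "\<And>j. j < n \<Longrightarrow> par D j = P (x j)"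
    and "root_sys X n XX Phi h" "x \<in> XX" "indep n x" "0 < hx" "\<And>j. j < n \<Longrightarrow> h (x j) = hx"
    and ev: "\<And>j. j < n \<Longrightarrow> even (B (x j) (x j))" "bflag D \<Longrightarrow> even c"
  shows "realizable D \<and> even_form D"
proof
  have Bf: "Bf D i j = B (x i) (x j)" if "i < n" "j < n" for i j
    using that by (simp add: Bf_def assms(2) sr gform_rv)
  show "realizable D" unfolding realizable_def
    by (rule exI[of _ X], rule exI[of _ XX], rule exI[of _ Phi], rule exI[of _ h], rule exI[of _ x], rule exI[of _ hx])
      (use assms Bf in \<open>auto simp: chi_def X_def\<close>)
  have "even (B u v)" if "even c" for u v using that unfolding B_def by (intro dvd_sum) auto
  then show "even_form D" using ev by (auto simp: even_form_def assms(1) Bf B_sym)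
qed

end

lemma typeA_realizable:
  assumes "typeA m n D" shows "realizable D \<and> even_form D"
proof -
  define M where "M = m + n + 2"
  \<comment> \<open>The \<epsilon>'s have the coordinates 0,...,m, hence
    \<open>Suc m\<close>.\<close>
  interpret frames "Suc m" M 1 by standard simp
  obtain s where s: "bij_betw s {..<M} {..<M}"
    and D: "nn D = M - 1" "amb D = gform M (\<lambda>a b. if a = b then (if a \<le> m then 1 else -1) else 0)"
      "sr D = (\<lambda>k. vsub (ev (s k)) (ev (s (Suc k))))" "par D = (\<lambda>k. (m < s k) \<noteq> (m < s (Suc k)))" "\<not> bflag D"
    using assms by (auto simp: typeA_def Let_def M_def)
  define e where "e = sframe (\<lambda>_. True) s"
  note e = frame_sframe[OF s, of "\<lambda>_. True", folded e_def]
  have P: "P (e k) \<longleftrightarrow> m < s k" if "k < M" for k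
    using P_sframe[OF s that, of "\<lambda>_. True"] by (simp add: e_def Suc_le_eq)
  have sr: "sr D j = rv (e j - e (Suc j))" for j by (simp add: D rv_simps e_def sframe_def)
  show ?thesis
  proof (rule realizeI[where x = "\<lambda>j. e j - e (Suc j)" and n = "M - 1" and h = "hh e (\<lambda>l. - int l)" and XX = XA and hx = 1])
    show "root_sys X (M - 1) XA Phi (hh e (\<lambda>l. - int l))" by (rule root_sys_A)
    show "indep (M - 1) (\<lambda>j. e j - e (Suc j))" by (rule indep_A[OF e])
    show "(\<lambda>j. e j - e (Suc j)) \<in> XA" unfolding XA_def using e by blast
    show "amb D = gform M (\<lambda>a b. if a = b then (if a < Suc m then of_int 1 else - of_int 1) else 0)"
      by (simp only: D of_int_1 less_Suc_eq_le)
  qed (use D(1,4,5) sr P in \<open>auto simp: P_diff hh_minus hh_frame[OF e] B_lin frame_B[OF e]\<close>)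
qed

lemma typeB_realizable:
  assumes "typeB m k D" shows "realizable D \<and> even_form D"
proof -
  interpret frames m "m + k" 2 by standard simp
  obtain s sg where s: "bij_betw s {..<m + k} {..<m + k}" and sg: "\<forall>j<m + k. sg j \<in> sgns"
    and D: "nn D = m + k" "amb D = gform (m + k) (\<lambda>a b. if a = b then (if a < m then 2 else -2) else 0)"
      "sr D = (\<lambda>j. if Suc j < m + k then vsub (vsc (sg j) (ev (s j))) (vsc (sg (Suc j)) (ev (s (Suc j)))) else vsc (sg j) (ev (s j)))"
      "par D = (\<lambda>j. if Suc j < m + k then (m \<le> s j) \<noteq> (m \<le> s (Suc j)) else m \<le> s j)"
    using assms by (auto simp: typeB_def Let_def)
  define e where "e = sframe (\<lambda>j. sg j = 1) s"
  note e = frame_sframe[OF s, of "\<lambda>j. sg j = 1", folded e_def]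
  have P: "P (e j) \<longleftrightarrow> m \<le> s j" if "j < m + k" for j
    using P_sframe[OF s that, of "\<lambda>j. sg j = 1"] by (simp add: e_def)
  have v: "vsc (sg j) (ev (s j)) = rv (e j)" if "j < m + k" for j
    using sg that by (simp add: rv_simps(4) e_def sframe_def)
  show ?thesis
  \<comment> \<open>The values \<open>M - l\<close> drop by 1 at each step and end with 1, so that
    after scaling by c all simple roots, including the short last one, have height 2.\<close>
  proof (rule realizeI[where x = "xB e" and n = "m + k" and h = "hh e (\<lambda>l. int (m + k) - int l)" and XX = XB and hx = 2])
    show "root_sys X (m + k) XB Phi (hh e (\<lambda>l. int (m + k) - int l))" by (rule root_sys_B)
    show "indep (m + k) (xB e)" by (rule indep_B[OF e])
    show "xB e \<in> XB" unfolding XB_def using e by blast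
    show "amb D = gform (m + k) (\<lambda>a b. if a = b then (if a < m then of_int 2 else - of_int 2) else 0)"
      by (simp only: D of_int_numeral)
  next
    fix j assume "j < m + k"
    then show "hh e (\<lambda>l. int (m + k) - int l) (xB e j) = 2"
      by (cases "Suc j < m + k") (auto simp: xB_def hh_minus hh_frame[OF e])
  qed (use D P v in \<open>auto simp: rv_simps(1) xB_def P_diff B_lin frame_B[OF e]\<close>)
qed

lemma typeDC_realizable:
  assumes "typeDC m k D" and mk: "1 \<le> m" "1 \<le> k" shows "realizable D \<and> even_form D"
proof -
  let ?M = "m + k"
  interpret frames m ?M 1 by standard simp
  have M: "2 \<le> ?M" using mk by simp
  obtain s sg where s: "bij_betw s {..<?M} {..<?M}" and sg: "\<forall>j<?M. sg j \<in> sgns"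
    and D: "nn D = ?M" "amb D = gform ?M (\<lambda>a b. if a = b then (if a < m then 1 else -1) else 0)"
      "sr D = (\<lambda>j. if Suc j < ?M then vsub (vsc (sg j) (ev (s j))) (vsc (sg (Suc j)) (ev (s (Suc j))))
           else if m \<le> s j then vsc 2 (vsc (sg j) (ev (s j))) else vadd (vsc (sg (j - 1)) (ev (s (j - 1)))) (vsc (sg j) (ev (s j))))"
      "par D = (\<lambda>j. if Suc j < ?M then (m \<le> s j) \<noteq> (m \<le> s (Suc j)) else \<not> m \<le> s j \<and> m \<le> s (j - 1))" "\<not> bflag D"
    using assms by (auto simp: typeDC_def Let_def)
  define e where "e = sframe (\<lambda>j. sg j = 1) s"
  note e = frame_sframe[OF s, of "\<lambda>j. sg j = 1", folded e_def]
  have P: "P (e j) \<longleftrightarrow> m \<le> s j" if "j < ?M" for j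
    using P_sframe[OF s that, of "\<lambda>j. sg j = 1"] by (simp add: e_def)
  have v: "vsc (sg j) (ev (s j)) = rv (e j)" if "j < ?M" for j
    using sg that by (simp add: rv_simps(4) e_def sframe_def)
  obtain k' where k': "?M = Suc (Suc k')" using M by (metis add_2_eq_Suc le_Suc_ex)
  have last: "xD e (Suc k') = la e" "la e = (if m \<le> s (Suc k') then 2 * e (Suc k') else e k' + e (Suc k'))"
  proof -
    have "?M - Suc 0 = Suc k'" "?M - 2 = k'" "\<not> Suc (Suc k') < ?M" "Suc k' < ?M" using k' by auto
    then show "xD e (Suc k') = la e" "la e = (if m \<le> s (Suc k') then 2 * e (Suc k') else e k' + e (Suc k'))"
      using P[of "Suc k'"] by (simp_all add: xD_def la_def)
  qed

  \<comment> \<open>For a last root 2\<delta> the values are odd numbers down to 1 and all simple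
    roots get height 2; for a last root that is a sum of two vectors they are 1 and 0 at the end and
    the height is 1.\<close>
  let ?H = "if P (e (Suc k')) then (\<lambda>l. 2 * (int ?M - int l) - 1) else (\<lambda>l. int ?M - 1 - int l)"
  show ?thesis
  proof (rule realizeI[where x = "xD e" and n = ?M and h = "hh e ?H" and XX = XD and hx = "if P (e (Suc k')) then 2 else 1"])
    show "root_sys X ?M XD Phi (hh e ?H)" by (rule root_sys_D[OF M])
    show "indep ?M (xD e)" by (rule indep_D[OF e M])
    show "xD e \<in> XD" unfolding XD_def using e by (intro CollectI exI[of _ e] exI[of _ id]) simp
    show "amb D = gform ?M (\<lambda>a b. if a = b then (if a < m then of_int 1 else - of_int 1) else 0)"
      by (simp only: D of_int_1)
  next
    fix j assume j: "j < ?M"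
    have M1: "Suc k' < ?M" "k' < ?M" using k' by auto
    have kM: "int m + int k = int k' + 2" using arg_cong[OF k', of int] by simp
    have "sr D j = rv (xD e j) \<and> par D j = P (xD e j) \<and> hh e ?H (xD e j) = (if P (e (Suc k')) then 2 else 1) \<and> even (B (xD e j) (xD e j))"
    proof (cases "Suc j < ?M")
      case True
      then show ?thesis
        using P[of j] P[of "Suc j"] v[of j] v[of "Suc j"]
        by (simp add: D rv_simps(1) xD_def P_diff hh_minus hh_frame[OF e] B_lin frame_B[OF e])
    next
      case False
      then have j': "j = Suc k'" using j k' by linarith
      have "\<not> Suc (Suc k') < ?M" using k' by simp
      then show ?thesis
        using P[OF M1(1)] P[OF M1(2)] v[OF M1(1)] v[OF M1(2)] M1 kM
        by (simp add: j' D last rv_simps(2,3) P_lin hh_add hh_two hh_frame[OF e] B_lin frame_B[OF e])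
    qed
    then show "sr D j = rv (xD e j)" "par D j = P (xD e j)" "hh e ?H (xD e j) = (if P (e (Suc k')) then 2 else 1)" "even (B (xD e j) (xD e j))"
      by auto
  qed (use D in auto)
qed

subsubsection \<open>The exceptional types\<close>

text \<open>For a finite system, the simple systems are given by a Gram matrix and parities from a finite list \<open>TL\<close>
  of types closed under reflections, and by the list \<open>Ph\<close> of all roots in coordinates with respect to the
  distinguished simple roots; \<open>gd\<close> lists the pairs \<open>((\<beta>, \<gamma>), (\<gamma>, \<gamma>))\<close> with \<open>\<beta>\<close> isotropic that occur in \<open>TL\<close>.\<close>

definition dot :: "int list \<Rightarrow> int list \<Rightarrow> int" where "dot u v = sum_list (map2 (*) u v)"

text \<open>The multiple of the reflecting root that is added: the Cartan integer up to sign, or 0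
  or 1 for an isotropic root.\<close>

definition rr :: "int \<Rightarrow> int \<Rightarrow> int" where
  "rr b c = (if b \<noteq> 0 then (- 2 * c) div b else if c = 0 then 0 else 1)"

text \<open>For isotropic u with nonzero pairing \<open>v + u\<close> may fail to be a root, with
  \<open>v - u\<close> being one instead; therefore closure is demanded only for the pairs of values
  recorded in \<open>gd\<close>.\<close>

definition pair_ok :: "(int \<times> int) list \<Rightarrow> int list list \<Rightarrow> int list \<Rightarrow> int list \<Rightarrow> int \<Rightarrow> int \<Rightarrow> int \<Rightarrow> bool" where
  "pair_ok gd Ph u v b c d \<longleftrightarrow> (b \<noteq> 0 \<or> c = 0 \<or> (c, d) \<in> set gd) \<longrightarrow> map2 (\<lambda>x y. y + rr b c * x) u v \<in> set Ph"

definition form_vec :: "int list list \<Rightarrow> int list \<Rightarrow> int list" where "form_vec A u = map (dot u) A"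

definition pairs_ok :: "int list list \<Rightarrow> (int \<times> int) list \<Rightarrow> int list list \<Rightarrow> bool" where
  "pairs_ok A gd Ph \<longleftrightarrow> list_all (\<lambda>(u, w). list_all (\<lambda>(v, z). pair_ok gd Ph u v (dot u w) (dot v w) (dot v z)) (map (\<lambda>v. (v, form_vec A v)) Ph)) (map (\<lambda>v. (v, form_vec A v)) Ph)"

text \<open>The value -2 at i makes the formula \<open>x j + rf M i j * x i\<close> valid for
  \<open>j = i\<close> as well, where it gives \<open>- x i\<close>.\<close>

definition rf :: "int list list \<Rightarrow> nat \<Rightarrow> nat \<Rightarrow> int" where
  "rf M i j = (if j = i then - 2 else rr (M ! i ! i) (M ! i ! j))"

definition tref :: "nat \<Rightarrow> nat \<Rightarrow> int list list \<Rightarrow> bool list \<Rightarrow> int list list \<times> bool list" where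
  "tref n i M p = (map (\<lambda>j. map (\<lambda>k. M ! j ! k + rf M i j * M ! i ! k + rf M i k * M ! j ! i + rf M i j * rf M i k * M ! i ! i) [0..<n]) [0..<n],
     map (\<lambda>j. (p ! j) \<noteq> (odd (rf M i j) \<and> p ! i)) [0..<n])"

definition type_ok :: "nat \<Rightarrow> (int \<times> int) list \<Rightarrow> (int list list \<times> bool list) list \<Rightarrow> bool" where
  "type_ok n gd TL \<longleftrightarrow> list_all (\<lambda>(M, p). list_all (\<lambda>i. (M ! i ! i \<noteq> 0 \<or> p ! i) \<and> tref n i M p \<in> set TL \<and>
     list_all (\<lambda>j. j = i \<or> (if M ! i ! i \<noteq> 0 then 2 * M ! i ! j = - rf M i j * M ! i ! i \<and> 0 \<le> rf M i j \<and> (p ! i \<longrightarrow> even (rf M i j))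
       else M ! i ! j = 0 \<or> (M ! i ! j, M ! j ! j) \<in> set gd)) [0..<n]) [0..<n]) TL"

definition AF :: "int list list" where "AF = [[4, - 2, 0, 0], [- 2, 4, - 2, 0], [0, - 2, 2, - 1], [0, 0, - 1, 0]]"
definition PF :: "int list list" where
  "PF = (let P = [[0, 0, 0, 1], [0, 0, 1, 0], [0, 0, 1, 1], [0, 1, 0, 0], [0, 1, 1, 0], [0, 1, 1, 1], [0, 1, 2, 0], [0, 1, 2, 1], [1, 0,
     0, 0], [1, 1, 0, 0], [1, 1, 1, 0], [1, 1, 1, 1], [1, 1, 2, 0], [1, 1, 2, 1], [1, 2, 2, 0], [1, 2, 2, 1], [1, 2, 3, 1],
     [1, 2, 3, 2]] in P @ map (map uminus) P)"
definition TF :: "(int list list \<times> bool list) list" where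
  "TF = [([[- 6, 0, 0, 3], [0, 2, - 2, - 1], [0, - 2, 4, 0], [3, - 1, 0, 0]], [False, False, False, True]), ([[0, - 2, 0, 3], [-
     2, 4, - 2, 0], [0, - 2, 4, 0], [3, 0, 0, - 6]], [True, False, False, False]), ([[0, 2, 0, - 3], [2, 0, - 2, 1], [0, - 2,
     4, 0], [- 3, 1, 0, 0]], [True, True, False, True]), ([[4, - 2, 0, 0], [- 2, 0, 2, - 1], [0, 2, 0, - 1], [0, - 1, - 1,
     2]], [False, True, True, False]), ([[4, - 2, 0, 0], [- 2, 4, - 2, 0], [0, - 2, 0, 1], [0, 0, 1, 0]], [False, False,
     True, True]), ([[4, - 2, 0, 0], [- 2, 4, - 2, 0], [0, - 2, 2, - 1], [0, 0, - 1, 0]], [False, False, False, True])]"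
definition GF :: "(int \<times> int) list" where "GF = [(- 3, 0), (- 2, 4), (- 1, 2), (1, 0), (2, 0), (3, - 6)]"

definition AG :: "int list list" where "AG = [[0, - 1, 0], [- 1, 2, - 3], [0, - 3, 6]]"
definition PG :: "int list list" where
  "PG = (let P = [[0, 0, 1], [0, 1, 0], [0, 1, 1], [0, 2, 1], [0, 3, 1], [0, 3, 2], [1, 0, 0], [1, 1, 0], [1, 1, 1], [1, 2, 1], [1, 3,
     1], [1, 3, 2], [1, 4, 2]] in P @ map (map uminus) P)"
definition TG :: "(int list list \<times> bool list) list" where
  "TG = [([[- 2, 0, 2], [0, 6, - 3], [2, - 3, 0]], [True, False, True]), ([[0, - 1, 0], [- 1, 2, - 3], [0, - 3, 6]], [True,
     False, False]), ([[0, 1, 0], [1, 0, - 3], [0, - 3, 6]], [True, True, False]), ([[2, - 1, - 2], [- 1, 0, 3], [- 2, 3,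
     0]], [False, True, True])]"
definition GG :: "(int \<times> int) list" where "GG = [(- 3, 6), (- 2, 2), (- 1, 2), (1, 0), (2, - 2), (3, 0)]"

lemma type_ok_F: "type_ok 4 GF TF" by code_simp
lemma type_ok_G: "type_ok 3 GG TG" by code_simp
lemma pairs_ok_G: "pairs_ok AG GG PG" by code_simp
lemma pairs_ok_F: "pairs_ok AF GF PF" by code_simp

lemma dot_sum: "length u = n \<Longrightarrow> length v = n \<Longrightarrow> dot u v = (\<Sum>i<n. u ! i * v ! i)"
  by (simp add: dot_def sum_list_sum_nth atLeast0LessThan)

locale gram_sys =
  fixes n :: nat and A :: "int list list" and p0 :: "bool list" and Ph :: "int list list"
    and TL :: "(int list list \<times> bool list) list" and gd :: "(int \<times> int) list"
  assumes len: "length A = n" "\<forall>r\<in>set A. length r = n" "\<forall>u\<in>set Ph. length u = n"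
    and sym: "\<forall>i<n. \<forall>j<n. A ! i ! j = A ! j ! i"
    and neg: "\<forall>u\<in>set Ph. map uminus u \<in> set Ph"
    and simple: "\<forall>i<n. map (\<lambda>j. if j = i then 1 else 0) [0..<n] \<in> set Ph"
    and init: "(A, p0) \<in> set TL"
    and pairs_ok: "pairs_ok A gd Ph" and type_ok: "type_ok n gd TL"
begin

definition B :: "(nat \<Rightarrow> int) \<Rightarrow> (nat \<Rightarrow> int) \<Rightarrow> int" where
  "B u v = (\<Sum>i<n. \<Sum>j<n. u i * v j * A ! i ! j)"

definition P :: "(nat \<Rightarrow> int) \<Rightarrow> bool" where
  "P u \<longleftrightarrow> odd (\<Sum>i<n. if p0 ! i then u i else 0)"

sublocale lattice_form B P
proof
  show "B (a + b) c = B a c + B b c" for a b c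
    by (simp add: B_def plus_fun_apply algebra_simps sum.distrib)
  show "B a b = B b a" for a b
    unfolding B_def by (subst sum.swap) (auto intro!: sum.cong simp: sym)
  show "P (a + b) \<longleftrightarrow> P a \<noteq> P b" for a b
  proof -
    have "(\<Sum>i<n. if p0 ! i then (a + b) i else 0) = (\<Sum>i<n. if p0 ! i then a i else 0) + (\<Sum>i<n. if p0 ! i then b i else 0)"
      unfolding sum.distrib[symmetric] by (intro sum.cong) (auto simp: plus_fun_apply)
    then show ?thesis by (simp add: P_def)
  qed
qed

definition lv :: "int list \<Rightarrow> nat \<Rightarrow> int" where "lv l = (\<lambda>i. if i < n then l ! i else 0)"

lemma B_lv:
  assumes "length u = n" "length v = n" shows "B (lv u) (lv v) = dot u (form_vec A v)"
proof -
  have "dot u (form_vec A v) = (\<Sum>i<n. u ! i * (\<Sum>j<n. A ! i ! j * v ! j))"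
    using assms len by (auto simp: dot_sum[of _ n] form_vec_def intro!: sum.cong)
  then show ?thesis by (simp add: B_def lv_def sum_distrib_left mult_ac)
qed

definition Phi :: "(nat \<Rightarrow> int) set" where "Phi = lv ` set Ph"

lemma Phi_minus: "u \<in> Phi \<Longrightarrow> - u \<in> Phi"
proof -
  assume "u \<in> Phi"
  then obtain l where l: "u = lv l" "l \<in> set Ph" by (auto simp: Phi_def)
  then have "- u = lv (map uminus l)" using len by (auto simp: lv_def)
  then show ?thesis using neg l by (auto simp: Phi_def)
qed

lemma Phi_refl:
  assumes u: "u \<in> Phi" and v: "v \<in> Phi" and g: "B u u \<noteq> 0 \<or> B u v = 0 \<or> (B u v, B v v) \<in> set gd"
    and k: "int k = rr (B u u) (B u v)"
  shows "v + sum_list (replicate k u) \<in> Phi"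
proof -
  obtain lu lw where l: "u = lv lu" "lu \<in> set Ph" "v = lv lw" "lw \<in> set Ph" using u v by (auto simp: Phi_def)
  have len': "length lu = n" "length lw = n" using l len by auto
  have "pair_ok gd Ph lu lw (B u u) (B v u) (B v v)"
    using pairs_ok l(2,4) unfolding pairs_ok_def list_all_iff by (force simp: l(1,3) B_lv len')
  then have m: "map2 (\<lambda>x y. y + rr (B u u) (B u v) * x) lu lw \<in> set Ph"
    using g by (simp add: pair_ok_def B_sym[of v u])
  have s: "sum_list (replicate k u) i = int k * u i" for i
    by (induction k) (auto simp: plus_fun_apply zero_fun_apply algebra_simps)
  have "v + sum_list (replicate k u) = lv (map2 (\<lambda>x y. y + rr (B u u) (B u v) * x) lu lw)"
    unfolding fun_eq_iff plus_fun_apply s using len' by (auto simp: l(1,3) lv_def k)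
  then show ?thesis using m by (auto simp: Phi_def)
qed

definition XX :: "(nat \<Rightarrow> nat \<Rightarrow> int) set" where
  "XX = {x. (\<forall>j<n. x j \<in> Phi) \<and> (\<exists>(M, p)\<in>set TL. \<forall>j<n. P (x j) = p ! j \<and> (\<forall>k<n. B (x j) (x k) = M ! j ! k))}"

text \<open>Membership in \<open>XX\<close> is decided by Gram matrix and parities alone; these
  transform bilinearly as computed by \<open>tref\<close>, and \<open>type_ok\<close> says that the
  result is in the list again.\<close>

lemma reflect:
  assumes x: "x \<in> XX" and i: "i < n" shows "\<exists>x'\<in>XX. RF n x i x'"
proof -
  obtain M p where M: "(M, p) \<in> set TL" "\<And>j. j < n \<Longrightarrow> P (x j) = p ! j" "\<And>j k. j < n \<Longrightarrow> k < n \<Longrightarrow> B (x j) (x k) = M ! j ! k"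
    and xP: "\<And>j. j < n \<Longrightarrow> x j \<in> Phi" using x by (auto simp: XX_def)
  let ?r = "rf M i"
  have T: "(M ! i ! i \<noteq> 0 \<or> p ! i) \<and> tref n i M p \<in> set TL \<and> (\<forall>j\<in>{0..<n}. j = i \<or> (if M ! i ! i \<noteq> 0
      then 2 * M ! i ! j = - ?r j * M ! i ! i \<and> 0 \<le> ?r j \<and> (p ! i \<longrightarrow> even (?r j))
      else M ! i ! j = 0 \<or> (M ! i ! j, M ! j ! j) \<in> set gd))"
    using bspec[OF type_ok[unfolded type_ok_def list_all_iff] M(1)] i by simp
  have t: "M ! i ! i \<noteq> 0 \<or> p ! i" "tref n i M p \<in> set TL"
    "\<And>j. j < n \<Longrightarrow> j \<noteq> i \<Longrightarrow> (if M ! i ! i \<noteq> 0 then 2 * M ! i ! j = - ?r j * M ! i ! i \<and> 0 \<le> ?r j \<and> (p ! i \<longrightarrow> even (?r j))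
       else M ! i ! j = 0 \<or> (M ! i ! j, M ! j ! j) \<in> set gd)"
    using T by auto
  define x' where "x' j = (if j = i then - x i else x j + sum_list (replicate (nat (?r j)) (x i)))" for j
  have r0: "?r j = (if M ! i ! j = 0 then 0 else 1)" if "j \<noteq> i" "M ! i ! i = 0" for j
    using that by (simp add: rf_def rr_def)
  have ri: "?r i = - 2" by (simp add: rf_def)
  have r: "0 \<le> ?r j" if "j < n" "j \<noteq> i" for j using t(3)[OF that] that(2) by (cases "M ! i ! i = 0") (simp_all add: r0)
  have s: "B (sum_list (replicate k u)) v = int k * B u v" "P (sum_list (replicate k u)) \<longleftrightarrow> odd k \<and> P u" for k u v
    by (induction k) (auto simp: B_lin P_lin algebra_simps)
  have Bx: "B (x' j) v = B (x j) v + ?r j * B (x i) v" if "j < n" for j v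
    using that r by (auto simp: x'_def B_lin s ri)
  have Px: "P (x' j) \<longleftrightarrow> p ! j \<noteq> (odd (?r j) \<and> p ! i)" if "j < n" for j
    using that r[OF that] i M(2) by (auto simp: x'_def P_lin s ri even_nat_iff)
  have "RF n x i x'" unfolding RF_def
  proof (intro conjI allI impI)
    show "x' i = - x i" "B (x i) (x i) \<noteq> 0 \<or> P (x i)" using t(1) i M by (auto simp: x'_def)
    fix j assume j: "j < n" "j \<noteq> i"
    show "RC (x i) (x j) (x' j)"
    proof (cases "M ! i ! i = 0")
      case True
      then show ?thesis unfolding RC_def using r0[OF j(2)] i j M(2,3) t(1)
        by (intro exI[of _ "nat (?r j)"]) (simp add: x'_def)
    next
      case False
      then show ?thesis unfolding RC_def using t(3)[OF j] r[OF j] i j M(2,3)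
        by (intro exI[of _ "nat (?r j)"]) (simp add: x'_def even_nat_iff)
    qed
  qed
  moreover have "x' \<in> XX" unfolding XX_def
  proof (intro CollectI conjI allI impI bexI[OF _ t(2)])
    fix j assume j: "j < n"
    show "x' j \<in> Phi"
    proof (cases "j = i")
      case True then show ?thesis using xP i Phi_minus by (simp add: x'_def)
    next
      case False
      then have "B (x i) (x i) \<noteq> 0 \<or> B (x i) (x j) = 0 \<or> (B (x i) (x j), B (x j) (x j)) \<in> set gd"
        using t(3)[OF j False] M(3) i j by (simp split: if_splits)
      then have "x j + sum_list (replicate (nat (?r j)) (x i)) \<in> Phi"
        using r[OF j False] M(3) i j False by (intro Phi_refl xP) (simp_all add: rf_def)
      then show ?thesis using False by (simp add: x'_def)
    qed
  next
    have "B (x' j) (x' k) = M ! j ! k + ?r j * M ! i ! k + ?r k * M ! j ! i + ?r j * ?r k * M ! i ! i"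
      if "j < n" "k < n" for j k
    proof -
      have s: "M ! k ! j = M ! j ! k" "M ! k ! i = M ! i ! k" "M ! j ! i = M ! i ! j" using M(3) that i B_sym by metis+
      have "B (x' j) (x' k) = B (x' k) (x j) + ?r j * B (x' k) (x i)"
        using Bx[OF that(1), of "x' k"] by (simp add: B_sym[of _ "x' k"])
      then show ?thesis using that i M(3) by (simp add: Bx[OF that(2)] s algebra_simps)
    qed
    then show "case tref n i M p of (M, p) \<Rightarrow> \<forall>j<n. P (x' j) = p ! j \<and> (\<forall>k<n. B (x' j) (x' k) = M ! j ! k)"
      using Px by (simp add: tref_def)
  qed
  ultimately show ?thesis by blast
qed

definition hs :: "(nat \<Rightarrow> int) \<Rightarrow> int" where "hs u = (\<Sum>i<n. u i)"

lemma root_sys_gram: "root_sys X n XX Phi hs"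
proof (rule root_sysI)
  show "\<exists>x'\<in>XX. RF n x i x'" if "x \<in> XX" "i < n" for x i using reflect that by blast
  show "y \<in> XX" if "x \<in> XX" "\<forall>j<n. y j = x j" for x y
  proof -
    have "(\<forall>j<n. y j \<in> Phi) \<longleftrightarrow> (\<forall>j<n. x j \<in> Phi)" using that by auto
    moreover have "(\<forall>j<n. P (y j) = p ! j \<and> (\<forall>k<n. B (y j) (y k) = M ! j ! k)) \<longleftrightarrow>
      (\<forall>j<n. P (x j) = p ! j \<and> (\<forall>k<n. B (x j) (x k) = M ! j ! k))" for M p using that(2) by auto
    ultimately show ?thesis using that(1) by (simp add: XX_def)
  qed
qed (auto simp: XX_def Phi_def hs_def plus_fun_apply sum.distrib)

lemma realizable_gram:
  assumes "nn D = n" "\<And>i j. i < n \<Longrightarrow> j < n \<Longrightarrow> Bf D i j = A ! i ! j" "\<And>i. i < n \<Longrightarrow> par D i = p0 ! i"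
    "\<And>i. i < n \<Longrightarrow> even (A ! i ! i)" "\<not> bflag D"
  shows "realizable D \<and> even_form D"
proof
  have Bu: "B (iu i) (iu j) = A ! i ! j" if "i < n" "j < n" for i j
  proof -
    have "B (iu i) (iu j) = (\<Sum>a<n. \<Sum>b<n. if b = j then if a = i then A ! i ! j else 0 else 0)"
      unfolding B_def by (intro sum.cong) (auto simp: iu_def)
    then show ?thesis using that by simp
  qed
  have Pu: "P (iu i) \<longleftrightarrow> p0 ! i" if "i < n" for i
  proof -
    have "(\<Sum>a<n. if p0 ! a then iu i a else 0) = (\<Sum>a<n. if a = i then if p0 ! i then 1 else 0 else 0)"
      by (intro sum.cong) (auto simp: iu_def)
    then show ?thesis using that by (simp add: P_def)
  qed
  have "iu i = lv (map (\<lambda>j. if j = i then 1 else 0) [0..<n])" if "i < n" for i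
    using that by (auto simp: lv_def iu_def)
  then have iu: "iu \<in> XX" unfolding XX_def using init Bu Pu simple by (auto simp: Phi_def intro!: bexI[OF _ init])
  have ind: "indep n iu"
  proof (rule indepI)
    fix k assume "k < n"
    then show "\<exists>F d. (\<forall>a b. F (a + b) = F a + F b) \<and> d \<noteq> (0::int) \<and> (\<forall>j<n. F (iu j) = (if j = k then d else 0))"
      by (intro exI[of _ "\<lambda>u. u k"] exI[of _ 1]) (auto simp: plus_fun_apply iu_def)
  qed
  have hu: "hs (iu j) = 1" if "j < n" for j using that by (simp add: hs_def iu_def)
  show "realizable D" unfolding realizable_def
    by (rule exI[of _ X], rule exI[of _ XX], rule exI[of _ Phi], rule exI[of _ hs], rule exI[of _ iu], rule exI[of _ 1])
      (use assms root_sys_gram iu ind hu Bu Pu in \<open>auto simp: chi_def X_def\<close>)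
  show "even_form D" using assms sym by (auto simp: even_form_def)
qed

end

lemma floor_minus_one: "\<lfloor>- 1 :: rat\<rfloor> = - 1"
  by (metis floor_of_int of_int_minus of_int_1)

lemma less4: "i < (4::nat) \<longleftrightarrow> i = 0 \<or> i = 1 \<or> i = 2 \<or> i = 3" by auto
lemma less3: "i < (3::nat) \<longleftrightarrow> i = 0 \<or> i = 1 \<or> i = 2" by auto

lemma typeF_realizable: "realizable typeF \<and> even_form typeF"
proof -
  interpret gram_sys 4 AF "[False, False, False, True]" PF TF GF
  proof
    show "pairs_ok AF GF PF" "type_ok 4 GF TF" by (fact pairs_ok_F type_ok_F)+
    show "\<forall>i<4. \<forall>j<4. AF ! i ! j = AF ! j ! i" by (simp add: less4 AF_def)
    show "\<forall>i<4. map (\<lambda>j. if j = i then 1 else 0) [0..<4] \<in> set PF" by (simp add: less4 PF_def upt_rec)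
  qed (auto simp: AF_def PF_def TF_def)
  show ?thesis
  proof (rule realizable_gram)
    fix i j :: nat assume "i < 4" "j < 4"
    then show "Bf typeF i j = AF ! i ! j"
      by (auto simp: less4 Bf_def typeF_def gform_def AF_def vsub_def vsc_def ev_def floor_minus_one lessThan_nat_numeral lessThan_Suc)
  qed (auto simp: typeF_def AF_def less4)
qed

lemma typeG_realizable: "realizable typeG \<and> even_form typeG"
proof -
  interpret gram_sys 3 AG "[True, False, False]" PG TG GG
  proof
    show "pairs_ok AG GG PG" "type_ok 3 GG TG" by (fact pairs_ok_G type_ok_G)+
    show "\<forall>i<3. \<forall>j<3. AG ! i ! j = AG ! j ! i" by (simp add: less3 AG_def)
    show "\<forall>i<3. map (\<lambda>j. if j = i then 1 else 0) [0..<3] \<in> set PG" by (simp add: less3 PG_def upt_rec)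
  qed (auto simp: AG_def PG_def TG_def)
  show ?thesis
  proof (rule realizable_gram)
    fix i j :: nat assume "i < 3" "j < 3"
    then show "Bf typeG i j = AG ! i ! j"
      by (auto simp: less3 Bf_def typeG_def gform_def AG_def vsub_def vadd_def vsc_def ev_def floor_minus_one eval_nat_numeral lessThan_Suc)
  qed (auto simp: typeG_def AG_def less3)
qed

theorem basic_realizable: "basic_datum D \<Longrightarrow> realizable D \<and> even_form D"
  unfolding basic_datum_def
  using typeA_realizable typeB_realizable typeDC_realizable typeF_realizable typeG_realizable
  by (meson le_numeral_extra(4) one_le_numeral order_trans)

subsection \<open>The bar involution\<close>

lemma evalK_pCons: "evalK (pCons a p) x = to_fract [:a:] + x * evalK p x"
  by (simp add: evalK_def map_poly_pCons)

lemma evalK_0 [simp]: "evalK 0 x = 0" by (simp add: evalK_def)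

lemma evalK_1 [simp]: "evalK 1 x = 1"
  using evalK_pCons[of 1 0 x] by (simp flip: one_pCons)

lemma evalK_add: "evalK (p + q) x = evalK p x + evalK q x"
  by (induction p q rule: poly_induct2) (simp_all add: evalK_pCons algebra_simps flip: to_fract_add)

lemma evalK_smult: "evalK (smult a p) x = to_fract [:a:] * evalK p x"
  by (induction p) (simp_all add: evalK_pCons algebra_simps flip: to_fract_mult)

lemma evalK_mult: "evalK (p * q) x = evalK p x * evalK q x"
  by (induction p) (simp_all add: evalK_pCons evalK_add evalK_smult algebra_simps)

lemma barq_eq: obtains s :: rat where "s \<noteq> 0" "barq D = to_fract [:s:] * inverse qq"
proof -
  have "barq D = to_fract [:if bflag D then - 1 else 1:] * inverse qq"
    by (simp add: barq_def flip: one_pCons) (metis minus_pCons minus_zero mult_minus1 one_pCons to_fract_1 to_fract_uminus)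
  then show ?thesis using that by (metis one_neq_zero zero_neq_neg_one)
qed

lemma to_fract_const_power: "to_fract [:a:] ^ i = to_fract [:a ^ i:]" for a :: rat
  by (induction i) (simp_all flip: to_fract_mult one_pCons)

text \<open>Multiplied by the right power of q, the value becomes a polynomial whose constant term
  is the leading coefficient of p up to a nonzero factor.\<close>

lemma evalK_barq_nz: assumes "p \<noteq> 0" shows "evalK p (barq D) \<noteq> 0"
proof
  assume 0: "evalK p (barq D) = 0"
  obtain s :: rat where s: "s \<noteq> 0" "barq D = to_fract [:s:] * inverse qq" by (rule barq_eq)
  let ?d = "degree p"
  have "evalK p (barq D) = (\<Sum>i\<le>?d. to_fract [:coeff p i:] * barq D ^ i)"
    by (simp add: evalK_def poly_altdef degree_map_poly coeff_map_poly)
  then have "0 = qq ^ ?d * (\<Sum>i\<le>?d. to_fract [:coeff p i:] * barq D ^ i)" using 0 by simp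
  also have "\<dots> = (\<Sum>i\<le>?d. to_fract (monom (coeff p i * s ^ i) (?d - i)))"
    unfolding sum_distrib_left
  proof (rule sum.cong[OF refl])
    fix i assume "i \<in> {..?d}"
    then have "qq ^ ?d = qq ^ (?d - i) * qq ^ i" by (simp add: power_add[symmetric])
    then have "qq ^ ?d * (to_fract [:coeff p i:] * barq D ^ i) = to_fract [:coeff p i * s ^ i:] * qq ^ (?d - i)"
      using to_fract_mult[of "[:coeff p i:]" "[:s ^ i:]"]
      by (simp add: s(2) power_mult_distrib to_fract_const_power power_inverse mult.commute del: to_fract_mult)
    also have "\<dots> = to_fract ([:coeff p i * s ^ i:] * monom 1 (?d - i))" unfolding qq_pow to_fract_mult ..
    also have "[:coeff p i * s ^ i:] * monom 1 (?d - i) = monom (coeff p i * s ^ i) (?d - i)" by (simp add: smult_monom)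
    finally show "qq ^ ?d * (to_fract [:coeff p i:] * barq D ^ i) = to_fract (monom (coeff p i * s ^ i) (?d - i))" .
  qed
  finally have "to_fract (\<Sum>i\<le>?d. monom (coeff p i * s ^ i) (?d - i)) = 0" by (simp only: to_fract_sum)
  then have "(\<Sum>i\<le>?d. monom (coeff p i * s ^ i) (?d - i)) = 0" unfolding to_fract_eq_0_iff .
  then have "coeff (\<Sum>i\<le>?d. monom (coeff p i * s ^ i) (?d - i)) 0 = 0" by simp
  moreover have "coeff (\<Sum>i\<le>?d. monom (coeff p i * s ^ i) (?d - i)) 0 = (\<Sum>i\<le>?d. if i = ?d then coeff p ?d * s ^ ?d else 0)"
    unfolding coeff_sum by (intro sum.cong) auto
  ultimately show False using s(1) assms by simp
qed

text \<open>\<open>barK\<close> is defined through the normalized fraction; independence of the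
  representation makes it a field homomorphism.\<close>

lemma barK_frac: assumes "b \<noteq> 0" shows "barK D (to_fract a / to_fract b) = evalK a (barq D) / evalK b (barq D)"
proof -
  let ?f = "to_fract a / to_fract b"
  define a' where "a' = fst (quot_of_fract ?f)"
  define b' where "b' = snd (quot_of_fract ?f)"
  have b': "b' \<noteq> 0" by (simp add: b'_def)
  have "?f = to_fract a' / to_fract b'" unfolding a'_def b'_def Fract_conv_to_fract[symmetric] by simp
  then have "to_fract (a * b') = to_fract (a' * b)" using assms b' by (simp add: field_simps)
  then have "a * b' = a' * b" unfolding to_fract_eq_iff .
  then have "evalK a (barq D) * evalK b' (barq D) = evalK a' (barq D) * evalK b (barq D)" by (metis evalK_mult)
  then show ?thesis using evalK_barq_nz[OF b'] evalK_barq_nz[OF assms]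
    unfolding barK_def a'_def[symmetric] b'_def[symmetric] by (simp add: field_simps)
qed

lemma fract_cases: obtains a b :: "rat poly" where "b \<noteq> 0" "f = to_fract a / to_fract b"
  using Fract_quot_of_fract[of f] snd_quot_of_fract_nonzero[of f] unfolding Fract_conv_to_fract by metis

lemma barK_add: "barK D (f + g) = barK D f + barK D g"
proof -
  obtain a b where f: "b \<noteq> 0" "f = to_fract a / to_fract b" by (rule fract_cases)
  obtain c d where g: "d \<noteq> 0" "g = to_fract c / to_fract d" by (rule fract_cases)
  have "f + g = to_fract (a * d + c * b) / to_fract (b * d)" using f g by (simp add: add_frac_eq)
  then have "barK D (f + g) = evalK (a * d + c * b) (barq D) / evalK (b * d) (barq D)"
    using f(1) g(1) barK_frac[of "b * d" D "a * d + c * b"] by (simp del: to_fract_add to_fract_mult)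
  then show ?thesis using f g evalK_barq_nz
    by (simp add: barK_frac evalK_add evalK_mult add_frac_eq)
qed

lemma barK_mult: "barK D (f * g) = barK D f * barK D g"
proof -
  obtain a b where f: "b \<noteq> 0" "f = to_fract a / to_fract b" by (rule fract_cases)
  obtain c d where g: "d \<noteq> 0" "g = to_fract c / to_fract d" by (rule fract_cases)
  have "f * g = to_fract (a * c) / to_fract (b * d)" using f g by (simp add: field_simps)
  then show ?thesis using barK_frac[of "b * d" D "a * c"] f g by (simp add: barK_frac evalK_mult)
qed

lemma barK_1 [simp]: "barK D 1 = 1" using barK_frac[of 1 D 1] by simp
lemma barK_0 [simp]: "barK D 0 = 0" using barK_add[of D 0 0] by simp

lemma barK_minus: "barK D (- f) = - barK D f"
  using barK_add[of D f "- f"] by (simp add: eq_neg_iff_add_eq_0 add.commute)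

lemma barK_inverse: "barK D (inverse f) = inverse (barK D f)"
proof (cases "f = 0")
  case False
  then have "barK D f * barK D (inverse f) = 1" by (simp flip: barK_mult)
  then show ?thesis by (metis inverse_unique)
qed simp

lemma barK_eq_0: "barK D f = 0 \<longleftrightarrow> f = 0"
  using barK_inverse[of D f] barK_mult[of D f "inverse f"] by (cases "f = 0") auto

lemma barK_pow: "barK D (f ^ k) = barK D f ^ k"
  by (induction k) (simp_all add: barK_mult)

lemma barK_qq: "barK D qq = barq D"
  using barK_frac[of 1 D "[:0, 1:]"] by (simp add: qq_def evalK_pCons flip: one_pCons)

lemma barK_powi: "barK D (f powi k) = barK D f powi k"
  by (auto simp: power_int_def barK_pow barK_inverse)

text \<open>In type B(0,n+1) the sign in \<open>barq D\<close> disappears because all exponents are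
  even there.\<close>

lemma barK_chi:
  assumes "even_form D" "i < nn D" "j < nn D" shows "barK D (chi D i j) = inverse (chi D i j)"
proof -
  have "barq D powi (- Bf D i j) = inverse qq powi (- Bf D i j)"
  proof (cases "bflag D")
    case True
    then have "even (Bf D i j)" using assms by (simp add: even_form_def)
    then show ?thesis using True by (simp add: barq_def power_int_minus_left_even)
  qed (simp add: barq_def)
  then show ?thesis by (simp add: chi_def barK_minus barK_powi barK_inverse barK_qq power_int_inverse power_int_minus)
qed

lemma qnum_nz:
  assumes "even (bfw D \<beta> \<beta>)" "0 < k" shows "qnum D \<beta> k \<noteq> 0"
proof -
  define b where "b = bfw D \<beta> \<beta>"
  define d where "d = (if b = 0 then 1 else b div 2)"
  define q where "q = qq powi d"
  have d: "d \<noteq> 0" using assms(1) by (auto simp: d_def b_def)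
  have q0: "q \<noteq> 0" by (simp add: q_def)
  have q: "q ^ t \<noteq> 1" if "0 < t" for t
    using qq_powi_eq_1[of "d * int t"] d that by (simp add: q_def power_int_mult)
  \<comment> \<open>Squaring removes the sign e and leaves a positive power of q equal to 1.\<close>
  have ne: "e * q ^ t \<noteq> inverse q ^ t" if "0 < t" "e = 1 \<or> e = - 1" for e t
  proof
    assume "e * q ^ t = inverse q ^ t"
    then have "e * (q ^ t * q ^ t) = 1" using q0 by (simp add: power_inverse field_simps)
    then have "(e * (q ^ t * q ^ t))\<^sup>2 = 1" by simp
    then have "q ^ (t + t + (t + t)) = 1" using that(2) by (auto simp: power2_eq_square power_add)
    then show False using q[of "t + t + (t + t)"] that(1) by simp
  qed
  have e: "(- 1 :: K) ^ k = 1 \<or> (- 1 :: K) ^ k = - 1" by (cases "even k") auto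
  have "(- 1) ^ k * q ^ k - inverse q ^ k \<noteq> 0" "- q - inverse q \<noteq> 0" "q ^ k - inverse q ^ k \<noteq> 0" "q - inverse q \<noteq> 0"
    using ne[OF assms(2) e] ne[of 1 "- 1"] ne[OF assms(2), of 1] ne[of 1 1] by auto
  then show ?thesis unfolding qnum_def b_def[symmetric] Let_def d_def[symmetric] q_def[symmetric] by simp
qed

text \<open>Off-diagonal terms occur twice. Evenness ensures that halving a nonzero norm in
  \<open>qnum\<close> does not give 0.\<close>

lemma even_bfw: assumes "even_form D" shows "even (bfw D \<beta> \<beta>)"
proof -
  have "even (\<Sum>i<n. \<Sum>j<n. f i * f j * b i j)"
    if "\<forall>i<n. even (b i i)" "\<forall>i<n. \<forall>j<n. b i j = b j i" for n and f :: "nat \<Rightarrow> int" and b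
    using that
  proof (induction n)
    case (Suc n)
    have "(\<Sum>i<Suc n. \<Sum>j<Suc n. f i * f j * b i j) = (\<Sum>i<n. \<Sum>j<n. f i * f j * b i j) + (\<Sum>i<n. f i * f n * b i n)
        + (\<Sum>j<n. f n * f j * b n j) + f n * f n * b n n" by (simp add: sum.distrib)
    also have "(\<Sum>j<n. f n * f j * b n j) = (\<Sum>i<n. f i * f n * b i n)" using Suc.prems by (intro sum.cong) auto
    finally have "(\<Sum>i<Suc n. \<Sum>j<Suc n. f i * f j * b i j) = (\<Sum>i<n. \<Sum>j<n. f i * f j * b i j) + 2 * (\<Sum>i<n. f i * f n * b i n)
        + f n * f n * b n n" by simp
    moreover have "even (\<Sum>i<n. \<Sum>j<n. f i * f j * b i j)" using Suc by simp
    ultimately show ?case using Suc.prems by (simp only: even_add even_mult_iff) simp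
  qed simp
  then show ?thesis using assms unfolding bfw_def even_form_def by blast
qed

subsection \<open>The quantum shuffle product of a datum\<close>

lemma basis_bas: "basis = bas" by (simp add: basis_def bas_def fun_eq_iff)

lemma shr_Nil: "shr D v u [] = basis (rev u)" by (cases u) simp_all

lemma wt_Cons: "wt (k # w) = (\<lambda>i. wt [k] i + wt w i)" by (auto simp: wt_def)

lemma bfw_add: "bfw D (\<lambda>i. \<beta> i + \<gamma> i) \<delta> = bfw D \<beta> \<delta> + bfw D \<gamma> \<delta>"
  by (simp add: bfw_def algebra_simps sum.distrib)

lemma bfw_letter:
  assumes "k < nn D" "j < nn D" shows "bfw D (wt [k]) (wt [j]) = Bf D k j"
proof -
  have "bfw D (wt [k]) (wt [j]) = (\<Sum>a<nn D. \<Sum>b<nn D. if b = j then if a = k then Bf D k j else 0 else 0)"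
    unfolding bfw_def by (intro sum.cong) (auto simp: wt_def)
  then show ?thesis using assms by simp
qed

locale datum_sys = root_sys X "nn D" XX Phi h
  for D :: datum and X :: "wgt \<Rightarrow> wgt \<Rightarrow> K" and XX Phi h +
  fixes x :: "nat \<Rightarrow> wgt" and hx :: int and rk :: "nat \<Rightarrow> nat"
  assumes x_XX: "x \<in> XX" and indep_x: "indep (nn D) x" and h_x: "0 < hx" "\<And>j. j < nn D \<Longrightarrow> h (x j) = hx"
    and rk: "inj_on rk {..<nn D}" and ev: "even_form D"
    and X_chi: "\<And>i j. i < nn D \<Longrightarrow> j < nn D \<Longrightarrow> X (x i) (x j) = chi D i j"
begin

abbreviation key where "key w \<equiv> map rk w"
abbreviation W where "W \<equiv> {w. set w \<subseteq> {..<nn D}}"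
abbreviation V where "V \<equiv> U (nn D) x"

lemma X_word:
  "w \<in> W \<Longrightarrow> j < nn D \<Longrightarrow>
   X (wv x w) (x j) = (- 1) ^ (if parw D w \<and> par D j then 1 else 0) * qq powi (- bfw D (wt w) (wt [j]))"
proof (induction w)
  case Nil then show ?case by (simp add: parw_def wt_def bfw_def)
next
  case (Cons k w)
  have "parw D (k # w) \<longleftrightarrow> par D k \<noteq> parw D w" by (auto simp: parw_def)
  moreover have "bfw D (wt (k # w)) (wt [j]) = Bf D k j + bfw D (wt w) (wt [j])"
    using Cons.prems bfw_letter[of k D j] unfolding wt_Cons[of k w] bfw_add by simp
  moreover have "qq powi (- (Bf D k j + bfw D (wt w) (wt [j]))) = qq powi (- Bf D k j) * qq powi (- bfw D (wt w) (wt [j]))"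
    using qq_powi_add[of "- Bf D k j" "- bfw D (wt w) (wt [j])"] by simp
  ultimately show ?case using Cons by (simp add: X_add_left X_chi chi_def)
qed

lemma Dr_app_letter: "Dr k (\<lambda>u. app_letter i F u + c * app_letter j G u) = (if k = i then F else 0) + sc c (if k = j then G else 0)"
  by (auto simp: Dr_def app_letter_def fun_eq_iff fun_pw)

text \<open>The recursion of \<open>shr\<close> on reversed words removes last letters, so both
  sides are compared by their right derivatives.\<close>

lemma shr_qq: "u \<in> W \<Longrightarrow> w \<in> W \<Longrightarrow> shr D qq u w = bas (rev u) \<odot>\<^bsub>x\<^esub> bas (rev w)"
proof (induction u w rule: shuffles.induct)
  case (3 i u j w)
  show ?case
  proof (rule ext_Dr)
    fix k
    have "X (x k) (wv x (rev (i # u))) = (- 1) ^ (if parw D (i # u) \<and> par D k then 1 else 0) * qq powi (- bfw D (wt (i # u)) (wt [k]))" if "k = j"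
      using X_word[of "i # u" j] wv_mset[of "rev (i # u)" "i # u" x] X_sym[of "x j" "wv x (i # u)"] 3 that by (simp del: wv_simps)
    then show "Dr k (shr D qq (i # u) (j # w)) = Dr k (bas (rev (i # u)) \<odot>\<^bsub>x\<^esub> bas (rev (j # w)))"
      using 3 by (auto simp: Dr_app_letter Dr_mul Dr_bas)
  qed (simp add: app_letter_def bas_def)
qed (simp_all add: basis_bas shr_Nil)

text \<open>The sign is its own inverse, so inverting q inverts \<open>X\<close>; this gives the
  opposite product up to a scalar, and hence \<open>starqq\<close> becomes a braided commutator
  (\<open>starqq_mul\<close>).\<close>

lemma shr_inverse_qq: "u \<in> W \<Longrightarrow> w \<in> W \<Longrightarrow>
   shr D (inverse qq) u w = sc (inverse (X (wv x u) (wv x w))) (bas (rev w) \<odot>\<^bsub>x\<^esub> bas (rev u))"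
proof (induction u w rule: shuffles.induct)
  case (3 i u j w)
  show ?case
  proof (rule ext_Dr)
    fix k
    have 1: "X (x i) (wv x (rev (j # w))) = X (x i) (wv x (j # w))"
      using wv_mset[of "rev (j # w)" "j # w" x] by (simp del: wv_simps)
    have "(- 1) ^ (if parw D (i # u) \<and> par D j then 1 else 0) * inverse qq powi (- bfw D (wt (i # u)) (wt [j])) = inverse (X (wv x (i # u)) (x j))"
      using X_word[of "i # u" j] 3 by (simp add: power_int_inverse)
    then show "Dr k (shr D (inverse qq) (i # u) (j # w)) = Dr k (sc (inverse (X (wv x (i # u)) (wv x (j # w)))) (bas (rev (j # w)) \<odot>\<^bsub>x\<^esub> bas (rev (i # u))))"
      using 3 1 by (simp add: Dr_app_letter Dr_mul Dr_bas X_add_left X_add_right)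
        (auto intro!: arg_cong2[of _ _ _ _ sc] simp: field_simps)
  qed (simp add: app_letter_def bas_def sc_def)
qed (simp_all add: basis_bas shr_Nil)

text \<open>\<open>diamond\<close> sums over supports and agrees with the recursive product only
  when these are finite and consist of words over \<open>I\<close>.\<close>

definition FV :: "elt \<Rightarrow> bool" where "FV f \<longleftrightarrow> finite {w. f w \<noteq> 0} \<and> (\<forall>w. f w \<noteq> 0 \<longrightarrow> w \<in> W)"

lemma FV_V: "f \<in> V \<Longrightarrow> FV f"
proof -
  assume f: "f \<in> V"
  then obtain N where N: "\<forall>w. f w \<noteq> 0 \<longrightarrow> length w \<le> N" using U_bounded by blast
  then have "{w. f w \<noteq> 0} \<subseteq> {w. set w \<subseteq> {..<nn D} \<and> length w \<le> N}" using U_letters[OF f] by blast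
  then have "finite {w. f w \<noteq> 0}" by (rule finite_subset) (rule finite_lists_length_le, simp)
  then show ?thesis using U_letters[OF f] by (simp add: FV_def)
qed

lemma FV_sc: "FV f \<Longrightarrow> FV (sc c f)"
  unfolding FV_def by (auto simp: fun_pw intro: finite_subset[of _ "{w. f w \<noteq> 0}"])

lemma FV_mul: assumes "FV f" "FV g" shows "FV (f \<odot>\<^bsub>x\<^esub> g)"
proof -
  have "{w. (f \<odot>\<^bsub>x\<^esub> g) w \<noteq> 0} \<subseteq> (\<Union>u\<in>{u. f u \<noteq> 0}. \<Union>v\<in>{v. g v \<noteq> 0}. shuffles u v)"
    using mul_support[of f x g] by fastforce
  moreover have "finite \<dots>" using assms by (auto simp: FV_def)
  ultimately have "finite {w. (f \<odot>\<^bsub>x\<^esub> g) w \<noteq> 0}" by (rule finite_subset)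
  moreover have "w \<in> W" if w: "(f \<odot>\<^bsub>x\<^esub> g) w \<noteq> 0" for w
  proof -
    obtain u v where "w \<in> shuffles u v" "f u \<noteq> 0" "g v \<noteq> 0" using mul_support[OF w] by blast
    then show ?thesis using assms set_shuffles[of w u v] by (auto simp: FV_def)
  qed
  ultimately show ?thesis by (auto simp: FV_def)
qed

lemma FV_one: "FV (bas [])" by (auto simp: FV_def bas_def)

lemma mul_expand:
  assumes "FV f" "FV g" shows "(f \<odot>\<^bsub>x\<^esub> g) w = (\<Sum>u\<in>supp f. \<Sum>v\<in>supp g. f u * g v * (bas u \<odot>\<^bsub>x\<^esub> bas v) w)"
proof -
  have fin: "finite (supp f)" "finite (supp g)" using assms by (auto simp: FV_def supp_def)
  have ex: "f = (\<Sum>u\<in>supp f. sc (f u) (bas u))" if "finite (supp f)" for f :: elt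
  proof
    fix w
    have "(\<Sum>u\<in>supp f. sc (f u) (bas u)) w = (\<Sum>u\<in>supp f. f u * bas u w)" by (rule sum_sc_apply[OF that])
    also have "\<dots> = (\<Sum>u\<in>supp f. if u = w then f w else 0)" by (intro sum.cong) (auto simp: bas_def)
    also have "\<dots> = f w" using that by (simp add: supp_def)
    finally show "f w = (\<Sum>u\<in>supp f. sc (f u) (bas u)) w" by simp
  qed
  have l: "(\<Sum>u\<in>S. F u) \<odot>\<^bsub>x\<^esub> k = (\<Sum>u\<in>S. F u \<odot>\<^bsub>x\<^esub> k)" if "finite S" for S k and F :: "word \<Rightarrow> elt"
    using that by (induction S rule: finite_induct) (auto simp: mul_add_left)
  have r: "k \<odot>\<^bsub>x\<^esub> (\<Sum>u\<in>S. F u) = (\<Sum>u\<in>S. k \<odot>\<^bsub>x\<^esub> F u)" if "finite S" for S k and F :: "word \<Rightarrow> elt"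
    using that by (induction S rule: finite_induct) (auto simp: mul_add_right)
  have "(f \<odot>\<^bsub>x\<^esub> g) w = ((\<Sum>u\<in>supp f. sc (f u) (bas u)) \<odot>\<^bsub>x\<^esub> g) w" using ex[OF fin(1)] by simp
  also have "\<dots> = (\<Sum>u\<in>supp f. sc (f u) (bas u \<odot>\<^bsub>x\<^esub> g)) w" by (simp add: l[OF fin(1)])
  also have "\<dots> = (\<Sum>u\<in>supp f. f u * (bas u \<odot>\<^bsub>x\<^esub> g) w)" by (rule sum_sc_apply[OF fin(1)])
  also have "\<dots> = (\<Sum>u\<in>supp f. f u * (\<Sum>v\<in>supp g. g v * (bas u \<odot>\<^bsub>x\<^esub> bas v) w))"
  proof (intro sum.cong refl)
    fix u
    have "(bas u \<odot>\<^bsub>x\<^esub> g) w = (bas u \<odot>\<^bsub>x\<^esub> (\<Sum>v\<in>supp g. sc (g v) (bas v))) w" using ex[OF fin(2)] by simp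
    also have "\<dots> = (\<Sum>v\<in>supp g. sc (g v) (bas u \<odot>\<^bsub>x\<^esub> bas v)) w" by (simp add: r[OF fin(2)])
    also have "\<dots> = (\<Sum>v\<in>supp g. g v * (bas u \<odot>\<^bsub>x\<^esub> bas v) w)" by (rule sum_sc_apply[OF fin(2)])
    finally show "f u * (bas u \<odot>\<^bsub>x\<^esub> g) w = f u * (\<Sum>v\<in>supp g. g v * (bas u \<odot>\<^bsub>x\<^esub> bas v) w)" by simp
  qed
  finally show ?thesis by (simp add: sum_distrib_left mult.assoc)
qed

lemma star_mul: assumes "FV f" "FV g" shows "star D f g = f \<odot>\<^bsub>x\<^esub> g"
proof
  fix w
  have "shuffle D qq u v w = (bas u \<odot>\<^bsub>x\<^esub> bas v) w" if "u \<in> supp f" "v \<in> supp g" for u v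
    using that assms by (subst shuffle_def, subst shr_qq) (auto simp: FV_def supp_def)
  then show "star D f g w = (f \<odot>\<^bsub>x\<^esub> g) w"
    unfolding star_def diamond_def mul_expand[OF assms] by (intro sum.cong refl) simp
qed

lemma starqq_mul:
  assumes "FV f" "FV g" "hom x \<mu> f" "hom x \<nu> g"
  shows "starqq D f g = (f \<odot>\<^bsub>x\<^esub> g) - sc (inverse (X \<mu> \<nu>)) (g \<odot>\<^bsub>x\<^esub> f)"
proof
  fix w
  have "shuffle D (inverse qq) u v w = inverse (X \<mu> \<nu>) * (bas v \<odot>\<^bsub>x\<^esub> bas u) w" if "u \<in> supp f" "v \<in> supp g" for u v
  proof -
    have "wv x (rev u) = \<mu>" "wv x (rev v) = \<nu>" "rev u \<in> W" "rev v \<in> W"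
      using that assms wv_mset[of "rev u" u x] wv_mset[of "rev v" v x] by (auto simp: FV_def supp_def hom_def)
    then show ?thesis by (subst shuffle_def, subst shr_inverse_qq) (simp_all add: fun_pw)
  qed
  then have "diamond D (inverse qq) f g w = (\<Sum>u\<in>supp f. \<Sum>v\<in>supp g. f u * g v * (inverse (X \<mu> \<nu>) * (bas v \<odot>\<^bsub>x\<^esub> bas u) w))"
    unfolding diamond_def by (intro sum.cong refl) simp
  also have "\<dots> = inverse (X \<mu> \<nu>) * (g \<odot>\<^bsub>x\<^esub> f) w"
    unfolding mul_expand[OF assms(2,1)] sum_distrib_left by (subst sum.swap) (simp add: mult_ac)
  finally have "diamond D (inverse qq) f g w = inverse (X \<mu> \<nu>) * (g \<odot>\<^bsub>x\<^esub> f) w" .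
  then show "starqq D f g w = ((f \<odot>\<^bsub>x\<^esub> g) - sc (inverse (X \<mu> \<nu>)) (g \<odot>\<^bsub>x\<^esub> f)) w"
    unfolding starqq_def star_mul[OF assms(1,2), unfolded star_def] by (simp add: fun_pw)
qed

lemma UU_V: "UU D = V"
proof
  show "UU D \<subseteq> V"
  proof
    fix f assume "f \<in> UU D"
    then show "f \<in> V"
    proof induction
      case (add f g)
      then show ?case using U_add[of f "nn D" x g] by (simp add: plus_fun_def)
    next
      case (smul f c)
      then show ?case using U_sc[of f "nn D" x c] by (simp add: sc_def)
    next
      case (mult f g)
      then show ?case by (simp add: star_mul FV_V U_mul)
    qed (simp_all add: basis_bas one_U bas_U)
  qed
  show "V \<subseteq> UU D"
  proof
    fix f assume "f \<in> V"
    then show "f \<in> UU D" unfolding U_def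
    proof (rule lspan_induct)
      show "0 \<in> UU D" using UU.smul[OF UU.one, of 0] by (simp add: zero_fun_def)
      fix a f c assume a: "a \<in> Xi x ` lists {..<nn D}" and "f \<in> UU D"
      have "Xi x w \<in> UU D" if "w \<in> W" for w using that
      proof (induction w)
        case Nil then show ?case using UU.one by (simp add: basis_bas)
      next
        case (Cons j w)
        then have "star D (basis [j]) (Xi x w) \<in> UU D" by (intro UU.mult UU.gen) auto
        then show ?case using Cons by (simp add: basis_bas star_mul FV_V bas_U Xi_U)
      qed
      then have "a \<in> UU D" using a by auto
      then show "sc c a + f \<in> UU D" using UU.add[OF UU.smul] \<open>f \<in> UU D\<close> by (simp add: plus_fun_def sc_def)
    qed
  qed
qed

end

section \<open>Identifying the recursive definitions with the abstract Lyndon system\<close>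

lemma cs_len:
  assumes "2 \<le> length w"
  shows "0 < cs_len rk w" "cs_len rk w < length w" "lyndon rk (take (cs_len rk w) w)"
    and "0 < k \<Longrightarrow> k < length w \<Longrightarrow> lyndon rk (take k w) \<Longrightarrow> k \<le> cs_len rk w"
proof -
  let ?Q = "\<lambda>k. 0 < k \<and> k < length w \<and> lyndon rk (take k w)"
  have "?Q 1" using assms by (auto simp: lyndon_def)
  then have "?Q (cs_len rk w)" unfolding cs_len_def by (rule GreatestI_nat[where b = "length w"]) auto
  then show "0 < cs_len rk w" "cs_len rk w < length w" "lyndon rk (take (cs_len rk w) w)" by auto
  show "0 < k \<Longrightarrow> k < length w \<Longrightarrow> lyndon rk (take k w) \<Longrightarrow> k \<le> cs_len rk w"
    unfolding cs_len_def by (rule Greatest_le_nat[where b = "length w"]) auto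
qed

lemma r_aux_fuel: "length w \<le> m \<Longrightarrow> length w \<le> m' \<Longrightarrow> r_aux D rk m w = r_aux D rk m' w"
proof (induction m arbitrary: m' w)
  case 0 then show ?case by (cases m') auto
next
  case (Suc m)
  show ?case
  proof (cases m')
    case 0 then show ?thesis using Suc by simp
  next
    case (Suc k)
    show ?thesis
    proof (cases "length w \<le> 1")
      case False
      then have "length (take (cs_len rk w) w) \<le> m" "length (take (cs_len rk w) w) \<le> k"
        "length (drop (cs_len rk w) w) \<le> m" "length (drop (cs_len rk w) w) \<le> k"
        using cs_len(1,2)[of w rk] Suc.prems Suc by auto
      then have "r_aux D rk m (take (cs_len rk w) w) = r_aux D rk k (take (cs_len rk w) w)"
        "r_aux D rk m (drop (cs_len rk w) w) = r_aux D rk k (drop (cs_len rk w) w)" by (auto intro: Suc.IH)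
      then show ?thesis using False Suc by simp
    qed (simp add: Suc)
  qed
qed

lemma rvec_split:
  assumes "2 \<le> length w"
  shows "rvec D rk w = starqq D (rvec D rk (take (cs_len rk w) w)) (rvec D rk (drop (cs_len rk w) w))"
proof -
  obtain m where m: "length w = Suc m" using assms by (cases "length w") auto
  have "length (take (cs_len rk w) w) \<le> m" "length (drop (cs_len rk w) w) \<le> m"
    using cs_len(1,2)[OF assms, of rk] m by auto
  then have "r_aux D rk m (take (cs_len rk w) w) = rvec D rk (take (cs_len rk w) w)"
    "r_aux D rk m (drop (cs_len rk w) w) = rvec D rk (drop (cs_len rk w) w)"
    unfolding rvec_def using r_aux_fuel order_refl by metis+
  then show ?thesis using assms by (simp add: rvec_def[of D rk w] m)
qed

context datum_sys
begin

lemma lexless_key: "u \<in> W \<Longrightarrow> w \<in> W \<Longrightarrow> lexless rk u w \<longleftrightarrow> key u < key w"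
proof
  assume "lexless rk u w"
  then show "key u < key w" unfolding lexless_def
  proof (elim disjE exE conjE)
    fix t assume "t \<noteq> []" "w = u @ t"
    then show ?thesis using append_less_iff[of "key u" "[]" "key t"] by (cases t) auto
  qed simp
next
  assume "u \<in> W" "w \<in> W" "key u < key w"
  then show "lexless rk u w"
  proof (induction u arbitrary: w)
    case Nil then show ?case by (auto simp: lexless_def)
  next
    case (Cons a u)
    then obtain b v where w: "w = b # v" by (cases w) auto
    show ?case
    proof (cases "rk a < rk b")
      case True
      then show ?thesis unfolding lexless_def w
        by (intro disjI2 exI[of _ "[]"] exI[of _ a] exI[of _ b] exI[of _ u] exI[of _ v]) simp
    next
      case False
      then have ab: "rk a = rk b" and "key u < key v" using Cons.prems(3) by (auto simp: w)
      then have "lexless rk u v" using Cons by (auto simp: w)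
      moreover have "a = b" using rk ab Cons.prems(1,2) by (auto simp: w inj_on_def)
      ultimately show ?thesis unfolding lexless_def w
        by (elim disjE exE conjE) (simp, metis append_Cons)
    qed
  qed
qed

lemma key_eq: "u \<in> W \<Longrightarrow> w \<in> W \<Longrightarrow> key u = key w \<Longrightarrow> u = w"
  using inj_on_map_eq_map[of rk u w] inj_on_subset[OF rk] by blast

lemma lexle_key: "u \<in> W \<Longrightarrow> w \<in> W \<Longrightarrow> lexle rk u w \<longleftrightarrow> key u \<le> key w"
  using key_eq[of u w] by (auto simp: lexle_def lexless_key order.order_iff_strict)

lemma drop_W: "w \<in> W \<Longrightarrow> drop k w \<in> W" using set_drop_subset[of k w] by auto
lemma take_W: "w \<in> W \<Longrightarrow> take k w \<in> W" using set_take_subset[of k w] by auto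

lemma lyndon_key:
  assumes "w \<in> W" shows "lyndon rk w \<longleftrightarrow> lyn (key w)"
proof
  assume l: "lyndon rk w"
  show "lyn (key w)" unfolding lyn_def
  proof (intro conjI allI impI)
    fix p s assume ps: "key w = p @ s" "p \<noteq> []" "s \<noteq> []"
    have "length w = length p + length s" using arg_cong[OF ps(1), of length] by simp
    then have "lexless rk w (drop (length p) w)" using l ps(2,3) by (simp add: lyndon_def)
    moreover have "key (drop (length p) w) = s" using ps(1) by (simp add: drop_map[symmetric])
    ultimately show "key w < s" using lexless_key[OF assms drop_W[OF assms]] by metis
  qed (use l in \<open>simp add: lyndon_def\<close>)
next
  assume l: "lyn (key w)"
  have "lexless rk w (drop k w)" if "0 < k" "k < length w" for k
  proof -
    have "key w = take k (key w) @ drop k (key w)" by simp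
    then have "key w < drop k (key w)" using l that unfolding lyn_def by (metis append_take_drop_id drop_eq_Nil length_map not_less take_eq_Nil less_numeral_extra(3))
    then show ?thesis unfolding lexless_key[OF assms drop_W[OF assms]] by (simp add: drop_map)
  qed
  then show "lyndon rk w" using l by (auto simp: lyndon_def)
qed

lemma rvec_props: "w \<in> W \<Longrightarrow> w \<noteq> [] \<Longrightarrow> rvec D rk w \<in> V \<and> hom x (wv x w) (rvec D rk w)"
proof (induction "length w" arbitrary: w rule: less_induct)
  case less
  show ?case
  proof (cases "2 \<le> length w")
    case True
    let ?k = "cs_len rk w"
    let ?f = "rvec D rk (take ?k w)" and ?g = "rvec D rk (drop ?k w)"
    note k = cs_len(1,2)[OF True, of rk]
    have f: "?f \<in> V" "hom x (wv x (take ?k w)) ?f" using less.hyps[of "take ?k w"] take_W[OF less.prems(1)] k less.prems(2) by auto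
    have g: "?g \<in> V" "hom x (wv x (drop ?k w)) ?g" using less.hyps[of "drop ?k w"] drop_W[OF less.prems(1)] k by auto
    have wv: "wv x w = wv x (take ?k w) + wv x (drop ?k w)" by (metis append_take_drop_id wv_simps(3))
    show ?thesis unfolding rvec_split[OF True] starqq_mul[OF FV_V[OF f(1)] FV_V[OF g(1)] f(2) g(2)]
      using f g hom_mul[OF f(2) g(2)] hom_mul[OF g(2) f(2)] unfolding wv
      by (auto intro!: U_diff U_mul U_sc hom_diff hom_sc simp: add.commute)
  next
    case False
    then obtain j where "w = [j]" using less.prems(2) by (cases w; cases "tl w") auto
    then show ?thesis using less.prems hom_bas[of x "[j]"] by (auto simp: rvec_def basis_bas bas_U)
  qed
qed

sublocale L: lyn_sys X "nn D" XX Phi h x hx rk "rvec D rk"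
proof
  show "rvec D rk [j] = bas [j]" for j by (simp add: rvec_def basis_bas)
  fix l assume l: "set l \<subseteq> {..<nn D}" "lyn (key l)" "2 \<le> length l"
  let ?k = "cs_len rk l"
  let ?l1 = "take ?k l" and ?l2 = "drop ?k l"
  note k = cs_len[OF l(3), where rk = rk]
  have W: "l \<in> W" "?l1 \<in> W" "?l2 \<in> W" and ne: "?l1 \<noteq> []" "?l2 \<noteq> []" using l take_W drop_W k by auto
  have l1: "lyn (key ?l1)" using lyndon_key[OF W(2)] k(3) by simp
  have kl: "key l = key ?l1 @ key ?l2" by (metis append_take_drop_id map_append)
  have l2: "lyn (key ?l2)"
  proof (rule lyn_costandard)
    show "lyn (key ?l1 @ key ?l2)" "lyn (key ?l1)" "key ?l2 \<noteq> []" using l(2) kl l1 ne by auto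
    fix p q assume pq: "key ?l2 = p @ q" "p \<noteq> []" "q \<noteq> []"
    show "\<not> lyn (key ?l1 @ p)"
    proof
      assume a: "lyn (key ?l1 @ p)"
      \<comment> \<open>A Lyndon prefix of this length would be longer than the one chosen by
        \<open>cs_len\<close>.\<close>
      let ?m = "?k + length p"
      have "length l = ?k + length p + length q" using arg_cong[OF pq(1), of length] k(2) by simp
      moreover have "key (take ?m l) = key ?l1 @ p"
        using pq(1) by (simp add: take_add take_map[symmetric] drop_map[symmetric])
      ultimately have "?m \<le> ?k" using a k lyndon_key[OF take_W[OF W(1)]] pq by (intro k(4)) auto
      then show False using pq(2) by simp
    qed
  qed
  have "key ?l1 < key ?l2"
  proof -
    have "key ?l1 \<le> key l" unfolding kl by simp
    also have "key l < key ?l2" using lyn_suffix[of "key ?l1" "key ?l2"] l(2) kl ne by simp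
    finally show ?thesis .
  qed
  moreover have "rvec D rk l = (rvec D rk ?l1 \<odot>\<^bsub>x\<^esub> rvec D rk ?l2) - sc (inverse (X (wv x ?l1) (wv x ?l2))) (rvec D rk ?l2 \<odot>\<^bsub>x\<^esub> rvec D rk ?l1)"
    unfolding rvec_split[OF l(3)] using rvec_props[OF W(2) ne(1)] rvec_props[OF W(3) ne(2)] by (simp add: starqq_mul FV_V)
  ultimately show "\<exists>l1 l2. l = l1 @ l2 \<and> lyn (key l1) \<and> lyn (key l2) \<and> key l1 < key l2 \<and>
        rvec D rk l = (rvec D rk l1 \<odot>\<^bsub>x\<^esub> rvec D rk l2) - sc (inverse (X (wv x l1) (wv x l2))) (rvec D rk l2 \<odot>\<^bsub>x\<^esub> rvec D rk l1)"
    using l1 l2 by (intro exI[of _ ?l1] exI[of _ ?l2]) simp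
qed (use x_XX indep_x h_x rk in auto)

lemma dominant_Dom: "dominant D rk w \<longleftrightarrow> L.Dom w"
proof -
  have "is_max rk f w \<longleftrightarrow> f w \<noteq> 0 \<and> (\<forall>u. f u \<noteq> 0 \<longrightarrow> key u \<le> key w)" if f: "f \<in> V" for f
    unfolding is_max_def using lexle_key[of _ w] U_letters[OF f] by blast
  then show ?thesis unfolding dominant_def L.Dom_def UU_V by blast
qed

lemma lynfact_facw:
  assumes "k \<in> W" shows "lynfact rk k = L.facw k"
  unfolding lynfact_def
proof (rule the_equality)
  have sub: "l \<in> W" if "concat ls = k" "l \<in> set ls" for l and ls :: "word list"
    using that assms by (metis UN_upper mem_Collect_eq order_trans set_concat)
  have dsc: "dsc (map key ls) \<longleftrightarrow> (\<forall>l\<in>set ls. lyndon rk l) \<and> sorted_wrt (\<lambda>a b. lexle rk b a) ls" if "concat ls = k" for ls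
  proof -
    have e: "lexle rk b a \<longleftrightarrow> key b \<le> key a" if "a \<in> set ls" "b \<in> set ls" for a b
      using lexle_key[OF sub sub] \<open>concat ls = k\<close> that by blast
    have "(\<forall>l\<in>set ls. lyndon rk l) \<longleftrightarrow> (\<forall>l\<in>set ls. lyn (key l))" by (intro ball_cong refl lyndon_key sub[OF that])
    moreover have "sorted_wrt (\<lambda>a b. lexle rk b a) ls \<longleftrightarrow> sorted_wrt (\<lambda>a b. key b \<le> key a) ls"
      by (rule iffI; erule sorted_wrt_mono_rel[rotated]; simp add: e)
    ultimately show ?thesis by (auto simp: dsc_def sorted_wrt_map)
  qed
  show "concat (L.facw k) = k \<and> (\<forall>l\<in>set (L.facw k). lyndon rk l) \<and> sorted_wrt (\<lambda>a b. lexle rk b a) (L.facw k)"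
    using dsc[OF L.facw(1)] fac(1)[of "key k"] L.facw[of k] by simp
  fix ls assume ls: "concat ls = k \<and> (\<forall>l\<in>set ls. lyndon rk l) \<and> sorted_wrt (\<lambda>a b. lexle rk b a) ls"
  then have "dsc (map key ls)" using dsc by blast
  moreover have "concat (map key ls) = key k" using ls by (auto simp: map_concat)
  ultimately have "map key ls = map key (L.facw k)" using fac_eqI L.facw(2)[of k] by metis
  moreover have "inj_on key (set ls \<union> set (L.facw k))"
    using sub[of ls] sub[OF L.facw(1)] ls key_eq by (intro inj_onI) blast
  ultimately show "ls = L.facw k" using inj_on_map_eq_map by blast
qed

end

section \<open>The semilinear anti-automorphism\<close>

lemma pcount_snoc: "pcount D (u @ [j]) = pcount D u + (if par D j then length (filter (par D) u) else 0)"
proof -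
  let ?A = "{(s, t). s < t \<and> t < length u \<and> par D (u ! s) \<and> par D (u ! t)}"
  let ?B = "if par D j then {s. s < length u \<and> par D (u ! s)} else {}"
  have "{(s, t). s < t \<and> t < length (u @ [j]) \<and> par D ((u @ [j]) ! s) \<and> par D ((u @ [j]) ! t)} = ?A \<union> (\<lambda>s. (s, length u)) ` ?B"
    by (auto simp: nth_append less_Suc_eq)
  moreover have "finite ?A" by (rule finite_subset[of _ "{..<length u} \<times> {..<length u}"]) auto
  moreover have "?A \<inter> (\<lambda>s. (s, length u)) ` ?B = {}" by auto
  ultimately have "pcount D (u @ [j]) = card ?A + card ((\<lambda>s. (s, length u)) ` ?B)"
    unfolding pcount_def by (simp add: card_Un_disjoint)
  also have "card ((\<lambda>s. (s, length u)) ` ?B) = card ?B" by (intro card_image) (auto simp: inj_on_def)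
  finally show ?thesis by (simp add: pcount_def length_filter_conv_card)
qed

lemma Ssum_snoc: "Ssum D (u @ [j]) = Ssum D u + (\<Sum>s<length u. Bf D (u ! s) j)"
  by (simp add: Ssum_def nth_append)

context datum_sys
begin

text \<open>The two word reversals in \<sigma> cancel, so \<sigma> fixes every word up to this
  scalar, the product of \<open>X\<close> over all pairs of its letters.\<close>

definition gg :: "word \<Rightarrow> K" where
  "gg w = (- 1) ^ pcount D (rev w) * qq powi (- Ssum D (rev w))"

lemma sigma_apply: "sigma D f w = barK D (f w) * gg w"
  by (simp add: sigma_def barE_def tau_def gg_def mult.assoc)

lemma X_letters:
  "u \<in> W \<Longrightarrow> j < nn D \<Longrightarrow>
   X (wv x u) (x j) = (if par D j then (- 1) ^ length (filter (par D) u) else 1) * qq powi (- (\<Sum>s<length u. Bf D (u ! s) j))"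
proof (induction u)
  case (Cons k u)
  have "qq powi (- (Bf D k j + (\<Sum>s<length u. Bf D (u ! s) j))) = qq powi (- Bf D k j) * qq powi (- (\<Sum>s<length u. Bf D (u ! s) j))"
    using qq_powi_add[of "- Bf D k j" "- (\<Sum>s<length u. Bf D (u ! s) j)"] by simp
  then show ?case using Cons by (simp add: X_add_left X_chi chi_def sum.lessThan_Suc_shift del: sum.lessThan_Suc)
qed simp

lemma gg_Cons: assumes "w \<in> W" "j < nn D" shows "gg (j # w) = X (x j) (wv x w) * gg w"
proof -
  have "X (x j) (wv x w) = X (wv x (rev w)) (x j)" using wv_mset[of "rev w" w x] by (simp add: X_sym[of "x j"])
  also have "\<dots> = (if par D j then (- 1) ^ length (filter (par D) (rev w)) else 1) * qq powi (- (\<Sum>s<length w. Bf D (rev w ! s) j))"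
    using X_letters[of "rev w" j] assms by simp
  finally show ?thesis
    using qq_powi_add[of "- Ssum D (rev w)" "- (\<Sum>s<length w. Bf D (rev w ! s) j)"]
    by (simp add: gg_def pcount_snoc Ssum_snoc power_add)
qed

lemma gg_Nil [simp]: "gg [] = 1"
proof -
  have "pcount D [] = 0" by (simp add: pcount_def)
  then show ?thesis by (simp add: gg_def Ssum_def)
qed

lemma bar_X: "w \<in> W \<Longrightarrow> j < nn D \<Longrightarrow> barK D (X (x j) (wv x w)) = inverse (X (x j) (wv x w))"
  by (induction w) (auto simp: X_add_right barK_mult X_chi barK_chi[OF ev])

lemma sigma_sc: "sigma D (sc c f) = sc (barK D c) (sigma D f)"
  by (auto simp: sigma_apply fun_pw barK_mult fun_eq_iff)

lemma sigma_add: "sigma D (f + g) = sigma D f + sigma D g"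
  by (auto simp: sigma_apply fun_pw barK_add fun_eq_iff algebra_simps)

lemma sigma_zero: "sigma D 0 = 0" by (auto simp: sigma_apply fun_pw fun_eq_iff)

lemma sigma_one: "sigma D (bas []) = bas []" by (auto simp: sigma_apply bas_def fun_eq_iff)

lemma sigma_sum: "sigma D (\<Sum>k\<in>S. sc (c k) (F k)) = (\<Sum>k\<in>S. sc (barK D (c k)) (sigma D (F k)))"
  by (induction S rule: infinite_finite_induct) (simp_all add: sigma_zero sigma_add sigma_sc)

lemma sigma_support: "sigma D f w \<noteq> 0 \<longleftrightarrow> f w \<noteq> 0"
  by (simp add: sigma_apply barK_eq_0 gg_def)

lemma FV_sigma: "FV f \<Longrightarrow> FV (sigma D f)"
  unfolding FV_def sigma_support .

lemma sigma_tw: assumes "\<forall>w. g w \<noteq> 0 \<longrightarrow> w \<in> W" "j < nn D" shows "sigma D (tw x (x j) g) = tw x (- x j) (sigma D g)"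
proof
  fix w show "sigma D (tw x (x j) g) w = tw x (- x j) (sigma D g) w"
    using assms bar_X[of w j] by (cases "g w = 0") (auto simp: sigma_apply tw_def barK_mult X_uminus)
qed

lemma Dl_sigma: assumes "\<forall>w. g w \<noteq> 0 \<longrightarrow> w \<in> W" "j < nn D" shows "Dl j (sigma D g) = tw x (x j) (sigma D (Dl j g))"
proof
  fix w show "Dl j (sigma D g) w = tw x (x j) (sigma D (Dl j g)) w"
    using assms(1)[rule_format, of "j # w"] gg_Cons[of w j] assms(2) by (cases "g (j # w) = 0") (auto simp: Dl_def sigma_apply tw_def)
qed

text \<open>Compare \<open>Dl j\<close> of both sides. Passing \<sigma> through a derivation
  produces a twist, passing it through a twist inverts the twist; the two effects exchange the roles
  of the factors in the Leibniz rule.\<close>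

lemma sigma_mul_word:
  "w \<in> W \<Longrightarrow> \<forall>w. f w \<noteq> 0 \<longrightarrow> w \<in> W \<Longrightarrow> \<forall>w. g w \<noteq> 0 \<longrightarrow> w \<in> W \<Longrightarrow> sigma D (f \<odot> g) w = (sigma D g \<odot> sigma D f) w"
proof (induction w arbitrary: f g)
  case Nil then show ?case by (simp add: sigma_apply barK_mult mult.commute)
next
  case (Cons j w)
  have j: "j < nn D" and w: "w \<in> W" using Cons.prems by auto
  have sup: "\<forall>w. Dl j f w \<noteq> 0 \<longrightarrow> w \<in> W" "\<forall>w. Dl j g w \<noteq> 0 \<longrightarrow> w \<in> W" "\<forall>w. tw x (x j) g w \<noteq> 0 \<longrightarrow> w \<in> W"
    using Cons.prems(2,3) by (fastforce simp: Dl_def tw_def)+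
  have "sigma D (f \<odot> g) (j # w) = X (x j) (wv x w) * sigma D (Dl j (f \<odot> g)) w"
    by (simp add: sigma_apply gg_Cons[OF w j] Dl_def)
  also have "\<dots> = X (x j) (wv x w) * ((sigma D (tw x (x j) g) \<odot> sigma D (Dl j f)) w + (sigma D (Dl j g) \<odot> sigma D f) w)"
    unfolding Dl_mul sigma_add plus_fun_apply using Cons.IH[OF w] sup Cons.prems(2,3) by simp
  also have "\<dots> = (tw x (x j) (tw x (- x j) (sigma D g) \<odot> sigma D (Dl j f)) + tw x (x j) (sigma D (Dl j g) \<odot> sigma D f)) w"
    using sigma_tw[OF Cons.prems(3) j] by (simp add: plus_fun_apply tw_def[of x "x j" "_ \<odot> _"] algebra_simps)
  also have "\<dots> = ((sigma D g \<odot> Dl j (sigma D f)) + (Dl j (sigma D g) \<odot> tw x (x j) (sigma D f))) w"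
    using Dl_sigma[OF Cons.prems(2) j] Dl_sigma[OF Cons.prems(3) j] by (simp add: tw_mul)
  also have "\<dots> = (sigma D g \<odot> sigma D f) (j # w)"
    using fun_cong[OF Dl_mul[of j "sigma D g" x "sigma D f"], of w] by (simp add: add.commute Dl_def[of j "_ \<odot> _"])
  finally show ?case .
qed

lemma sigma_mul: assumes "FV f" "FV g" shows "sigma D (f \<odot> g) = sigma D g \<odot> sigma D f"
proof
  fix w show "sigma D (f \<odot> g) w = (sigma D g \<odot> sigma D f) w"
  proof (cases "w \<in> W")
    case True then show ?thesis using sigma_mul_word assms by (simp add: FV_def)
  next
    case False
    have "(f \<odot> g) w = 0" "(sigma D g \<odot> sigma D f) w = 0"
      using FV_mul[OF assms] FV_mul[OF FV_sigma[OF assms(2)] FV_sigma[OF assms(1)]] False by (auto simp: FV_def)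
    then show ?thesis by (simp add: sigma_apply)
  qed
qed

lemma qn_nz: "0 < k \<Longrightarrow> qnum D \<beta> k \<noteq> 0" by (intro qnum_nz even_bfw ev)

lemma kappa_nz: "kappa D rk w \<noteq> 0"
proof -
  have "kappa_aux D rk m w \<noteq> 0" for m
    by (induction m arbitrary: w) (simp_all add: qn_nz Let_def)
  then show ?thesis by (simp add: kappa_def)
qed

lemma EL_eq: "EL D rk w = sc (inverse (kappa D rk w)) (sigma D (rvec D rk w))"
  by (simp add: EL_def sc_def)

abbreviation LW where "LW ls \<equiv> \<forall>l\<in>set ls. l \<in> W \<and> l \<noteq> []"

lemma FV_rvec: "l \<in> W \<Longrightarrow> l \<noteq> [] \<Longrightarrow> FV (rvec D rk l)" using rvec_props by (intro FV_V) blast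

lemma FV_pr: "LW ls \<Longrightarrow> FV (L.pr ls)"
  by (induction ls) (auto simp: FV_one intro!: FV_mul FV_rvec)

lemma pr_append: "L.pr (as @ bs) = L.pr as \<odot> L.pr bs"
  by (induction as) (simp_all add: mul_assoc)

lemma sigma_pr_append: "LW (as @ bs) \<Longrightarrow> sigma D (L.pr (as @ bs)) = sigma D (L.pr bs) \<odot> sigma D (L.pr as)"
  unfolding pr_append by (intro sigma_mul FV_pr) auto

lemma Edp_eq:
  assumes "l \<in> W" "l \<noteq> []"
  shows "\<exists>c. c \<noteq> 0 \<and> Edp D rk l t = sc c (sigma D (L.pr (replicate t l)))"
proof -
  have "\<exists>c. c \<noteq> 0 \<and> starpow D (EL D rk l) t = sc c (sigma D (L.pr (replicate t l)))"
  proof (induction t)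
    case 0 show ?case by (rule exI[of _ 1]) (simp add: sigma_one basis_bas)
  next
    case (Suc t)
    then obtain c where c: "c \<noteq> 0" "starpow D (EL D rk l) t = sc c (sigma D (L.pr (replicate t l)))" by blast
    have FV: "FV (L.pr (replicate t l))" using assms by (intro FV_pr) auto
    have "starpow D (EL D rk l) (Suc t) = sc (inverse (kappa D rk l)) (sigma D (rvec D rk l)) \<odot> sc c (sigma D (L.pr (replicate t l)))"
      unfolding starpow.simps c(2) unfolding EL_eq by (intro star_mul FV_sc FV_sigma FV_rvec assms FV)
    also have "\<dots> = sc (inverse (kappa D rk l) * c) (sigma D (rvec D rk l) \<odot> sigma D (L.pr (replicate t l)))"
      by (simp add: mult.commute)
    also have "sigma D (rvec D rk l) \<odot> sigma D (L.pr (replicate t l)) = sigma D (L.pr (replicate t l @ [l]))"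
      using assms by (subst sigma_pr_append) auto
    finally show ?case using c(1) kappa_nz by (intro exI[of _ "inverse (kappa D rk l) * c"]) (simp add: replicate_append_same)
  qed
  then obtain c where c: "c \<noteq> 0" "starpow D (EL D rk l) t = sc c (sigma D (L.pr (replicate t l)))" by blast
  have "qfact D (wt l) t \<noteq> 0" by (simp add: qfact_def qn_nz)
  then show ?thesis using c by (intro exI[of _ "inverse (qfact D (wt l) t) * c"]) (auto simp: Edp_def sc_def mult.assoc)
qed

lemma concat_rle: "concat (map (\<lambda>(l, t). replicate t l) (rle ls)) = ls"
  by (induction ls) (auto split: list.splits)

text \<open>Factors are multiplied from the smallest to the largest Lyndon word. As \<sigma>
  reverses products, the result is \<sigma> of the decreasing product, up to the nonzero
  normalizations.\<close>

lemma Edp_prod: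
  "\<forall>(l, t)\<in>set ps. l \<in> W \<and> l \<noteq> [] \<Longrightarrow> FV f \<Longrightarrow>
   \<exists>c. c \<noteq> 0 \<and> foldr (\<lambda>(l, t) acc. star D (Edp D rk l t) acc) (rev ps) f =
     sc c (sigma D (L.pr (concat (map (\<lambda>(l, t). replicate t l) ps))) \<odot> f)"
proof (induction ps arbitrary: f)
  case Nil then show ?case by (intro exI[of _ 1]) (simp add: sigma_one)
next
  case (Cons p ps)
  obtain l t where p: "p = (l, t)" by (cases p) auto
  have l: "l \<in> W" "l \<noteq> []" using Cons.prems by (auto simp: p)
  obtain d where d: "d \<noteq> 0" "Edp D rk l t = sc d (sigma D (L.pr (replicate t l)))" using Edp_eq[OF l] by blast
  let ?r = "replicate t l" and ?q = "concat (map (\<lambda>(l, t). replicate t l) ps)"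
  have LW: "LW (?r @ ?q)" using Cons.prems(1) l by (auto split: prod.splits)
  have FVr: "FV (sigma D (L.pr ?r))" using l by (intro FV_sigma FV_pr) auto
  have FVd: "FV (Edp D rk l t)" unfolding d(2) by (intro FV_sc FVr)
  then have "FV (star D (Edp D rk l t) f)" using Cons.prems(2) by (simp add: star_mul FV_mul)
  then obtain c where c: "c \<noteq> 0" "foldr (\<lambda>(l, t) acc. star D (Edp D rk l t) acc) (rev ps) (star D (Edp D rk l t) f) =
     sc c (sigma D (L.pr ?q) \<odot> star D (Edp D rk l t) f)" using Cons.IH[of "star D (Edp D rk l t) f"] Cons.prems by auto
  have "sigma D (L.pr ?q) \<odot> star D (Edp D rk l t) f = sc d (sigma D (L.pr (?r @ ?q)) \<odot> f)"
    using star_mul[OF FVd Cons.prems(2)] by (simp add: d(2) sigma_pr_append[OF LW] mul_assoc)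
  then show ?case using c d(1) by (intro exI[of _ "c * d"]) (simp add: p)
qed

lemma EW_eq:
  assumes "L.Dom k" shows "\<exists>c. c \<noteq> 0 \<and> EW D rk k = sc c (sigma D (L.RW k))"
proof -
  have k: "k \<in> W" by (rule L.Dom_W[OF assms])
  have "LW (L.facw k)" using L.facw_W[OF k] L.facw_lyn[of _ k] by fastforce
  moreover have "l \<in> set ls" if "(l, t) \<in> set (rle ls)" for l t and ls :: "word list"
    using that by (induction ls arbitrary: t) (auto split: list.splits if_splits)
  ultimately have "\<forall>(l, t)\<in>set (rle (L.facw k)). l \<in> W \<and> l \<noteq> []" by blast
  from Edp_prod[OF this FV_one] show ?thesis
    unfolding EW_def lynfact_facw[OF k] concat_rle basis_bas L.RW_def by simp
qed

theorem Levendorskii_Soibelman: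
  assumes "Lplus D rk i" "Lplus D rk j" "lexless rk i j"
  shows "\<exists>S c. finite S \<and> S \<subseteq> {k. dominant D rk k \<and> lexle rk (i @ j) k \<and> lexle rk k (j @ i)}
    \<and> star D (EL D rk j) (EL D rk i) = (\<lambda>w. \<Sum>k\<in>S. c k * EW D rk k w)"
proof -
  have D: "L.Dom i" "L.Dom j" using assms dominant_Dom by (auto simp: Lplus_def)
  have W: "i \<in> W" "j \<in> W" using L.Dom_W D by blast+
  have l: "lyn (key i)" "lyn (key j)" using assms lyndon_key W by (auto simp: Lplus_def)
  have ij: "key i < key j" using assms(3) lexless_key W by blast
  let ?A = "{k. L.Dom k \<and> key (i @ j) \<le> key k \<and> key k \<le> key (j @ i)}"
  have "rvec D rk i \<odot> rvec D rk j \<in> lspan (L.RW ` ?A)" by (rule L.straightening[OF D(1) l(1) D(2) l(2) ij])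
  from lspan_finite_sum[OF this] obtain S c where S: "finite S" "S \<subseteq> ?A"
    "rvec D rk i \<odot> rvec D rk j = (\<Sum>k\<in>S. sc (c k) (L.RW k))" by (elim exE conjE)
  have ne: "i \<noteq> []" "j \<noteq> []" using l by auto
  have "\<forall>k. \<exists>d. k \<in> S \<longrightarrow> d \<noteq> 0 \<and> EW D rk k = sc d (sigma D (L.RW k))" using EW_eq S(2) by blast
  then obtain d where d: "\<And>k. k \<in> S \<Longrightarrow> d k \<noteq> 0" "\<And>k. k \<in> S \<Longrightarrow> EW D rk k = sc (d k) (sigma D (L.RW k))" by metis
  let ?e = "inverse (kappa D rk j) * inverse (kappa D rk i)"
  have "star D (EL D rk j) (EL D rk i) = sc ?e (sigma D (rvec D rk j) \<odot> sigma D (rvec D rk i))"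
    unfolding EL_eq using ne W by (simp add: star_mul FV_sc FV_sigma FV_rvec mult.commute)
  \<comment> \<open>Reversal by \<sigma> is the reason for straightening the product in the order i,
    j rather than j, i.\<close>
  also have "\<dots> = sc ?e (sigma D (rvec D rk i \<odot> rvec D rk j))" using ne W by (simp add: sigma_mul FV_rvec)
  also have "\<dots> = sc ?e (\<Sum>k\<in>S. sc (barK D (c k)) (sigma D (L.RW k)))" unfolding S(3) sigma_sum ..
  also have "\<dots> = (\<lambda>w. \<Sum>k\<in>S. ?e * barK D (c k) * inverse (d k) * EW D rk k w)"
  proof
    fix w
    have "sc ?e (\<Sum>k\<in>S. sc (barK D (c k)) (sigma D (L.RW k))) w = (\<Sum>k\<in>S. ?e * (barK D (c k) * sigma D (L.RW k) w))"
      unfolding sc_apply[of ?e] sum_sc_apply[OF S(1)] sum_distrib_left ..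
    also have "\<dots> = (\<Sum>k\<in>S. ?e * barK D (c k) * inverse (d k) * EW D rk k w)"
      using d by (intro sum.cong refl) (simp add: fun_pw)
    finally show "sc ?e (\<Sum>k\<in>S. sc (barK D (c k)) (sigma D (L.RW k))) w = (\<Sum>k\<in>S. ?e * barK D (c k) * inverse (d k) * EW D rk k w)" .
  qed
  finally have "star D (EL D rk j) (EL D rk i) = (\<lambda>w. \<Sum>k\<in>S. ?e * barK D (c k) * inverse (d k) * EW D rk k w)" .
  moreover have "S \<subseteq> {k. dominant D rk k \<and> lexle rk (i @ j) k \<and> lexle rk k (j @ i)}"
  proof
    fix k assume "k \<in> S"
    then have k: "L.Dom k" "key (i @ j) \<le> key k" "key k \<le> key (j @ i)" using S(2) by auto
    then show "k \<in> {k. dominant D rk k \<and> lexle rk (i @ j) k \<and> lexle rk k (j @ i)}"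
      using lexle_key[of "i @ j" k] lexle_key[of k "j @ i"] L.Dom_W[OF k(1)] W dominant_Dom by simp
  qed
  ultimately show ?thesis using S(1)
    by (intro exI[of _ S] exI[of _ "\<lambda>k. ?e * barK D (c k) * inverse (d k)"]) simp
qed

end

theorem mainTheorem14:
  fixes D :: datum and rk :: "nat \<Rightarrow> nat" and i j :: word
  assumes "basic_datum D"
    and "inj_on rk {..<nn D}"
    and "Lplus D rk i" and "Lplus D rk j"
    and "lexless rk i j"
  shows "\<exists>S c. finite S
           \<and> S \<subseteq> {k. dominant D rk k \<and> lexle rk (i @ j) k \<and> lexle rk k (j @ i)}
           \<and> star D (EL D rk j) (EL D rk i) = (\<lambda>w. \<Sum>k\<in>S. c k * EW D rk k w)"
proof -
  obtain X :: "wgt \<Rightarrow> wgt \<Rightarrow> K" and XX Phi h x hx where "root_sys X (nn D) XX Phi h" "x \<in> XX" "indep (nn D) x"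
    "0 < hx" "\<forall>j<nn D. h (x j) = hx" "\<forall>i<nn D. \<forall>j<nn D. X (x i) (x j) = chi D i j" and ev: "even_form D"
    using basic_realizable[OF assms(1)] unfolding realizable_def by blast
  then interpret datum_sys D X XX Phi h x hx rk
    using assms(2) by (intro datum_sys.intro datum_sys_axioms.intro) auto
  show ?thesis by (rule Levendorskii_Soibelman[OF assms(3-5)])
qed

end
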